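(* Let $A=\{A_i\}_{i\in\mathbb Z}$ be a graded commutative noetherian ring concentrated in even degrees. Then there is a bijection of lattices $$\{\text{thick tensor ideals of } \operatorname{perf}(A,0)\}\ \longleftrightarrow\ \{\text{specialization closed subsets of } \operatorname{Spec}(A)\}$$ given by the mutually inverse maps $\sigma(\mathsf T)=\bigcup_{P\in\mathsf T}\operatorname{supp}_{(A,0)}(P)$ and $\tau(\mathcal V)=\{P\in\operatorname{perf}(A,0)\mid \operatorname{supp}_{(A,0)}(P)\subseteq\mathcal V\}$.
   Context: $\operatorname{perf}(A,0)$ is the homotopy category of dg $A$-modules ($A$ regarded as a dg algebra with zero differential) whose underlying graded $A$-module is finitely generated graded projective: morphisms are degree $0$ $A$-linear chain maps, modulo maps of the form $\partial h+h\partial$ with $h$ of degree $1$ and $h(ax)=(-1)^{|a|}a\,h(x)$. (Acyclic objects are not necessarily zero a priori; no quasi-isomorphisms are inverted.) It is a tensor triangulated category under $\otimes_A$ with $\partial(x\otimes y)=\partial x\otimes y+(-1)^{|x|}x\otimes\partial y$ and unit $A$. A thick tensor ideal is a full triangulated subcategory closed under direct summands and under tensoring with arbitrary objects of $\operatorname{perf}(A,0)$. $\operatorname{Spec}(A)$ is the set of homogeneous prime ideals of $A$ with the Zariski topology; a subset is specialization closed if it is a union of closed subsets. With $(-)_\mathfrak p$ denoting homogeneous localization, $\operatorname{supp}_{(A,0)}(P)=\{\mathfrak p\in\operatorname{Spec}(A): P_\mathfrak p\neq 0\text{ in }\operatorname{perf}(A_\mathfrak p,0)\}$. *)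

theory Defs
  imports "HOL-Algebra.Module" "HOL-Algebra.Ring_Divisibility" "HOL-Algebra.Complete_Lattice"
    "HOL-Algebra.Free_Abelian_Groups" "HOL-Library.Equipollence"
begin

text \<open>
  Graded objects are internal direct sums: a ring or module on an explicit carrier together with
  a \<open>\<int>\<close>-indexed family of additive subgroups whose direct sum is the carrier.
\<close>

record 'a gr_ring = "'a ring" +
  rgrad :: "int \<Rightarrow> 'a set"

record ('a, 'm) gr_module = "('a, 'm) module" +
  mgrad :: "int \<Rightarrow> 'm set"

record ('a, 'm) dg_module = "('a, 'm) gr_module" +
  diff :: "'m \<Rightarrow> 'm" (\<open>\<partial>\<index>\<close>)

definition decomposes :: "('m, 'z) ring_scheme \<Rightarrow> (int \<Rightarrow> 'm set) \<Rightarrow> 'm \<Rightarrow> (int \<Rightarrow> 'm) \<Rightarrow> bool" where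
  "decomposes M G x f \<longleftrightarrow>
     (\<forall>i. f i \<in> G i) \<and> finite {i. f i \<noteq> \<zero>\<^bsub>M\<^esub>} \<and> x = finsum M f {i. f i \<noteq> \<zero>\<^bsub>M\<^esub>}"

definition grading :: "('m, 'z) ring_scheme \<Rightarrow> (int \<Rightarrow> 'm set) \<Rightarrow> bool" where
  "grading M G \<longleftrightarrow>
     (\<forall>i. additive_subgroup (G i) M) \<and> (\<forall>x \<in> carrier M. \<exists>!f. decomposes M G x f)"

definition component :: "('m, 'z) ring_scheme \<Rightarrow> (int \<Rightarrow> 'm set) \<Rightarrow> 'm \<Rightarrow> int \<Rightarrow> 'm" where
  "component M G x = (THE f. decomposes M G x f)"

text \<open>The sign \<open>(-1)\<^sup>i x\<close>.\<close>

definition koszul :: "int \<Rightarrow> ('m, 'z) ring_scheme \<Rightarrow> 'm \<Rightarrow> 'm" where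
  "koszul i M x = (if even i then x else \<ominus>\<^bsub>M\<^esub> x)"

definition graded_comm_ring :: "('a, 'z) gr_ring_scheme \<Rightarrow> bool" where
  "graded_comm_ring A \<longleftrightarrow>
     ring A \<and> grading A (rgrad A) \<and> \<one>\<^bsub>A\<^esub> \<in> rgrad A 0 \<and>
     (\<forall>i j. \<forall>a \<in> rgrad A i. \<forall>b \<in> rgrad A j.
        a \<otimes>\<^bsub>A\<^esub> b \<in> rgrad A (i + j) \<and> a \<otimes>\<^bsub>A\<^esub> b = koszul (i * j) A (b \<otimes>\<^bsub>A\<^esub> a))"

definition even_degrees :: "('a, 'z) gr_ring_scheme \<Rightarrow> bool" where
  "even_degrees A \<longleftrightarrow> (\<forall>i. odd i \<longrightarrow> rgrad A i = {\<zero>\<^bsub>A\<^esub>})"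

definition homogeneous_ideal :: "('a, 'z) gr_ring_scheme \<Rightarrow> 'a set \<Rightarrow> bool" where
  "homogeneous_ideal A I \<longleftrightarrow> ideal I A \<and> (\<forall>x \<in> I. \<forall>i. component A (rgrad A) x i \<in> I)"

text \<open>
  Noetherian in the graded sense. It is implied by \<^locale>\<open>noetherian_ring\<close> (and, for
  \<open>\<int>\<close>-gradings, equivalent to it).
\<close>

definition graded_noetherian :: "('a, 'z) gr_ring_scheme \<Rightarrow> bool" where
  "graded_noetherian A \<longleftrightarrow>
     (\<forall>I. homogeneous_ideal A I \<longrightarrow> (\<exists>S \<subseteq> carrier A. finite S \<and> I = genideal A S))"

definition graded_module :: "('a, 'y) gr_ring_scheme \<Rightarrow> ('a, 'm, 'z) gr_module_scheme \<Rightarrow> bool" where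
  "graded_module A M \<longleftrightarrow>
     module A M \<and> grading M (mgrad M) \<and>
     (\<forall>i j. \<forall>a \<in> rgrad A i. \<forall>x \<in> mgrad M j. a \<odot>\<^bsub>M\<^esub> x \<in> mgrad M (i + j))"

text \<open>Degree \<open>n\<close> maps, with \<open>f (a x) = (-1)\<^sup>n\<^sup>|\<^sup>a\<^sup>| a f x\<close>.\<close>

definition graded_linear ::
  "('a, 'y) gr_ring_scheme \<Rightarrow> int \<Rightarrow> ('a, 'm, 'u) gr_module_scheme \<Rightarrow> ('a, 'n, 'v) gr_module_scheme
    \<Rightarrow> ('m \<Rightarrow> 'n) \<Rightarrow> bool" where
  "graded_linear A n M N f \<longleftrightarrow>
     f \<in> hom (add_monoid M) (add_monoid N) \<and>
     (\<forall>i. f ` mgrad M i \<subseteq> mgrad N (i + n)) \<and>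
     (\<forall>i. \<forall>a \<in> rgrad A i. \<forall>x \<in> carrier M. f (a \<odot>\<^bsub>M\<^esub> x) = koszul (n * i) N (a \<odot>\<^bsub>N\<^esub> f x))"

definition finitely_generated :: "('a, 'y) gr_ring_scheme \<Rightarrow> ('a, 'm, 'z) gr_module_scheme \<Rightarrow> bool" where
  "finitely_generated A M \<longleftrightarrow>
     (\<exists>S \<subseteq> carrier M. finite S \<and> (\<forall>N. submodule N A M \<and> S \<subseteq> N \<longrightarrow> N = carrier M))"

text \<open>
  The lifting property in the category of graded modules. It suffices to test it on these two
  carrier types: \<open>'m \<Rightarrow> 'a\<close> accommodates a free module mapping onto \<open>P\<close>, and
  a splitting of that surjection makes \<open>P\<close> a direct summand of a free module.
\<close>

definition graded_projective :: "('a, 'y) gr_ring_scheme \<Rightarrow> ('a, 'm, 'z) gr_module_scheme \<Rightarrow> bool" where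
  "graded_projective A P \<longleftrightarrow>
     (\<forall>(X :: ('a, 'm \<Rightarrow> 'a) gr_module) (Y :: ('a, 'm) gr_module) g f.
        graded_module A X \<and> graded_module A Y \<and>
        graded_linear A 0 X Y g \<and> g ` carrier X = carrier Y \<and> graded_linear A 0 P Y f \<longrightarrow>
        (\<exists>l. graded_linear A 0 P X l \<and> (\<forall>x \<in> carrier P. g (l x) = f x)))"

text \<open>
  Dg modules over \<open>(A, 0)\<close>, graded homologically: the differential has degree \<open>-1\<close>, so that
  homotopies have degree \<open>1\<close>.
\<close>

definition dg_module :: "('a, 'y) gr_ring_scheme \<Rightarrow> ('a, 'm) dg_module \<Rightarrow> bool" where
  "dg_module A M \<longleftrightarrow>
     graded_module A M \<and> graded_linear A (-1) M M \<partial>\<^bsub>M\<^esub> \<and>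
     (\<forall>x \<in> carrier M. \<partial>\<^bsub>M\<^esub> (\<partial>\<^bsub>M\<^esub> x) = \<zero>\<^bsub>M\<^esub>)"

definition chain_map ::
  "('a, 'y) gr_ring_scheme \<Rightarrow> ('a, 'm) dg_module \<Rightarrow> ('a, 'n) dg_module \<Rightarrow> ('m \<Rightarrow> 'n) \<Rightarrow> bool" where
  "chain_map A M N f \<longleftrightarrow>
     graded_linear A 0 M N f \<and> (\<forall>x \<in> carrier M. f (\<partial>\<^bsub>M\<^esub> x) = \<partial>\<^bsub>N\<^esub> (f x))"

definition homotopic ::
  "('a, 'y) gr_ring_scheme \<Rightarrow> ('a, 'm) dg_module \<Rightarrow> ('a, 'n) dg_module
    \<Rightarrow> ('m \<Rightarrow> 'n) \<Rightarrow> ('m \<Rightarrow> 'n) \<Rightarrow> bool" where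
  "homotopic A M N f g \<longleftrightarrow>
     (\<exists>h. graded_linear A 1 M N h \<and>
        (\<forall>x \<in> carrier M. f x \<ominus>\<^bsub>N\<^esub> g x = \<partial>\<^bsub>N\<^esub> (h x) \<oplus>\<^bsub>N\<^esub> h (\<partial>\<^bsub>M\<^esub> x)))"

text \<open>Isomorphism in the homotopy category. The two objects may have different carrier types.\<close>

definition ho_iso :: "('a, 'y) gr_ring_scheme \<Rightarrow> ('a, 'm) dg_module \<Rightarrow> ('a, 'n) dg_module \<Rightarrow> bool" where
  "ho_iso A M N \<longleftrightarrow>
     (\<exists>f g. chain_map A M N f \<and> chain_map A N M g \<and>
        homotopic A M M (g \<circ> f) id \<and> homotopic A N N (f \<circ> g) id)"

text \<open>The objects of \<open>perf(A, 0)\<close> whose carrier is a subset of the type \<open>'m\<close>.\<close>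

definition perf :: "('a, 'y) gr_ring_scheme \<Rightarrow> ('a, 'm) dg_module set" where
  "perf A = {P. dg_module A P \<and> finitely_generated A P \<and> graded_projective A P}"

text \<open>
  Constructions on dg modules. In all of them, signs depending on the degree of a scalar are
  omitted, since all scalars have even degree; in particular scalars act on
  \<open>shift k M\<close> as they do on \<open>M\<close>, and left and right scalar actions agree. The fields
  \<^const>\<open>mult\<close> and \<^const>\<open>one\<close> of a module record carry no meaning.
\<close>

definition zero_dg :: "('a, unit) dg_module" where
  "zero_dg = \<lparr>carrier = {()}, mult = \<lambda>_ _. (), one = (), ring.zero = (), add = \<lambda>_ _. (),
     smult = \<lambda>_ _. (), mgrad = \<lambda>_. {()}, diff = \<lambda>_. ()\<rparr>"

definition unit_dg :: "('a, 'y) gr_ring_scheme \<Rightarrow> ('a, 'a) dg_module" where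
  "unit_dg A = \<lparr>carrier = carrier A, mult = mult A, one = \<one>\<^bsub>A\<^esub>, ring.zero = \<zero>\<^bsub>A\<^esub>, add = add A,
     smult = mult A, mgrad = rgrad A, diff = \<lambda>_. \<zero>\<^bsub>A\<^esub>\<rparr>"

definition shift :: "int \<Rightarrow> ('a, 'm) dg_module \<Rightarrow> ('a, 'm) dg_module" where
  "shift k M = M\<lparr>mgrad := \<lambda>i. mgrad M (i - k), diff := \<lambda>x. koszul k M (\<partial>\<^bsub>M\<^esub> x)\<rparr>"

definition dg_sum :: "('a, 'm) dg_module \<Rightarrow> ('a, 'n) dg_module \<Rightarrow> ('a, 'm \<times> 'n) dg_module" where
  "dg_sum M N = \<lparr>carrier = carrier M \<times> carrier N, mult = undefined, one = undefined,
     ring.zero = (\<zero>\<^bsub>M\<^esub>, \<zero>\<^bsub>N\<^esub>),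
     add = \<lambda>(x, y) (x', y'). (x \<oplus>\<^bsub>M\<^esub> x', y \<oplus>\<^bsub>N\<^esub> y'),
     smult = \<lambda>a (x, y). (a \<odot>\<^bsub>M\<^esub> x, a \<odot>\<^bsub>N\<^esub> y),
     mgrad = \<lambda>i. mgrad M i \<times> mgrad N i,
     diff = \<lambda>(x, y). (\<partial>\<^bsub>M\<^esub> x, \<partial>\<^bsub>N\<^esub> y)\<rparr>"

definition cone ::
  "('a, 'm) dg_module \<Rightarrow> ('a, 'n) dg_module \<Rightarrow> ('m \<Rightarrow> 'n) \<Rightarrow> ('a, 'n \<times> 'm) dg_module" where
  "cone M N f = (dg_sum N (shift 1 M))
     \<lparr>diff := \<lambda>(y, x). (\<partial>\<^bsub>N\<^esub> y \<oplus>\<^bsub>N\<^esub> f x, \<partial>\<^bsub>shift 1 M\<^esub> x)\<rparr>"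

text \<open>
  The tensor product is the free abelian group on pairs modulo the subgroup generated by
  biadditivity and balancedness; its elements are cosets. The additive map \<open>parity\<close> is
  \<open>x \<mapsto> (-1)\<^sup>|\<^sup>x\<^sup>| x\<close> on homogeneous elements.
\<close>

definition parity :: "('a, 'm) dg_module \<Rightarrow> 'm \<Rightarrow> 'm" where
  "parity M x = finsum M (\<lambda>i. koszul i M (component M (mgrad M) x i))
     {i. component M (mgrad M) x i \<noteq> \<zero>\<^bsub>M\<^esub>}"

definition tensor_relations ::
  "('a, 'y) gr_ring_scheme \<Rightarrow> ('a, 'm) dg_module \<Rightarrow> ('a, 'n) dg_module \<Rightarrow> ('m \<times> 'n \<Rightarrow>\<^sub>0 int) set" where
  "tensor_relations A M N =
     {frag_of (x \<oplus>\<^bsub>M\<^esub> x', y) - frag_of (x, y) - frag_of (x', y) | x x' y.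
        x \<in> carrier M \<and> x' \<in> carrier M \<and> y \<in> carrier N} \<union>
     {frag_of (x, y \<oplus>\<^bsub>N\<^esub> y') - frag_of (x, y) - frag_of (x, y') | x y y'.
        x \<in> carrier M \<and> y \<in> carrier N \<and> y' \<in> carrier N} \<union>
     {frag_of (a \<odot>\<^bsub>M\<^esub> x, y) - frag_of (x, a \<odot>\<^bsub>N\<^esub> y) | a x y.
        a \<in> carrier A \<and> x \<in> carrier M \<and> y \<in> carrier N}"

definition tensor_group ::
  "('a, 'm) dg_module \<Rightarrow> ('a, 'n) dg_module \<Rightarrow> ('m \<times> 'n \<Rightarrow>\<^sub>0 int) monoid" where
  "tensor_group M N = free_Abelian_group (carrier M \<times> carrier N)"

definition tensor_null ::
  "('a, 'y) gr_ring_scheme \<Rightarrow> ('a, 'm) dg_module \<Rightarrow> ('a, 'n) dg_module \<Rightarrow> ('m \<times> 'n \<Rightarrow>\<^sub>0 int) set" where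
  "tensor_null A M N = generate (tensor_group M N) (tensor_relations A M N)"

definition tensor_class ::
  "('a, 'y) gr_ring_scheme \<Rightarrow> ('a, 'm) dg_module \<Rightarrow> ('a, 'n) dg_module
    \<Rightarrow> ('m \<times> 'n \<Rightarrow>\<^sub>0 int) \<Rightarrow> ('m \<times> 'n \<Rightarrow>\<^sub>0 int) set" where
  "tensor_class A M N u = tensor_null A M N #>\<^bsub>tensor_group M N\<^esub> u"

text \<open>
  Maps on the quotient are given by formulas on representatives \<open>u\<close>. The formulas do not depend
  on the representative, so each of the unions below is a single coset.
\<close>

definition tensor ::
  "('a, 'y) gr_ring_scheme \<Rightarrow> ('a, 'm) dg_module \<Rightarrow> ('a, 'n) dg_module
    \<Rightarrow> ('a, ('m \<times> 'n \<Rightarrow>\<^sub>0 int) set) dg_module" where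
  "tensor A M N =
     \<lparr>carrier = carrier (tensor_group M N Mod tensor_null A M N),
      mult = undefined, one = undefined,
      ring.zero = \<one>\<^bsub>tensor_group M N Mod tensor_null A M N\<^esub>,
      add = mult (tensor_group M N Mod tensor_null A M N),
      smult = \<lambda>a C. \<Union>u \<in> C. tensor_class A M N
        (frag_extend (\<lambda>(x, y). frag_of (a \<odot>\<^bsub>M\<^esub> x, y)) u),
      mgrad = \<lambda>k. {tensor_class A M N u | u.
        Poly_Mapping.keys u \<subseteq> (\<Union>i. mgrad M i \<times> mgrad N (k - i))},
      diff = \<lambda>C. \<Union>u \<in> C. tensor_class A M N
        (frag_extend (\<lambda>(x, y). frag_of (\<partial>\<^bsub>M\<^esub> x, y) + frag_of (parity M x, \<partial>\<^bsub>N\<^esub> y)) u)\<rparr>"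

text \<open>
  A full subcategory is given by its set of objects. The distinguished triangles are those
  isomorphic to \<open>X \<rightarrow> Y \<rightarrow> cone f \<rightarrow> shift 1 X\<close>. A cone, and likewise a tensor product, has a carrier
  type other than \<open>'m\<close>; closure therefore refers to all objects of \<^term>\<open>perf A\<close> isomorphic to it.
\<close>

definition triangulated_subcategory :: "('a, 'y) gr_ring_scheme \<Rightarrow> ('a, 'm) dg_module set \<Rightarrow> bool" where
  "triangulated_subcategory A T \<longleftrightarrow>
     T \<subseteq> perf A \<and>
     (\<forall>Z \<in> perf A. ho_iso A Z zero_dg \<longrightarrow> Z \<in> T) \<and>
     (\<forall>X \<in> T. \<forall>Y \<in> perf A. ho_iso A X Y \<longrightarrow> Y \<in> T) \<and>
     (\<forall>X \<in> T. \<forall>k. shift k X \<in> T) \<and>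
     (\<forall>X \<in> T. \<forall>Y \<in> T. \<forall>f. chain_map A X Y f \<longrightarrow>
        (\<forall>Z \<in> perf A. ho_iso A Z (cone X Y f) \<longrightarrow> Z \<in> T))"

definition thick_tensor_ideal :: "('a, 'y) gr_ring_scheme \<Rightarrow> ('a, 'm) dg_module set \<Rightarrow> bool" where
  "thick_tensor_ideal A T \<longleftrightarrow>
     triangulated_subcategory A T \<and>
     (\<forall>X \<in> T. \<forall>Y \<in> perf A. \<forall>Z \<in> (perf A :: ('a, 'm) dg_module set).
        ho_iso A X (dg_sum Y Z) \<longrightarrow> Y \<in> T) \<and>
     (\<forall>X \<in> T. \<forall>Y \<in> (perf A :: ('a, 'm) dg_module set). \<forall>Z \<in> perf A.
        ho_iso A Z (tensor A X Y) \<longrightarrow> Z \<in> T)"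

definition Spec :: "('a, 'y) gr_ring_scheme \<Rightarrow> 'a set set" where
  "Spec A = {p. primeideal p A \<and> homogeneous_ideal A p}"

definition zariski_closed :: "('a, 'y) gr_ring_scheme \<Rightarrow> 'a set set \<Rightarrow> bool" where
  "zariski_closed A C \<longleftrightarrow> (\<exists>I. homogeneous_ideal A I \<and> C = {p \<in> Spec A. I \<subseteq> p})"

definition specialization_closed :: "('a, 'y) gr_ring_scheme \<Rightarrow> 'a set set \<Rightarrow> bool" where
  "specialization_closed A V \<longleftrightarrow> (\<exists>F. (\<forall>C \<in> F. zariski_closed A C) \<and> V = \<Union>F)"

text \<open>
  Homogeneous localization inverts the homogeneous elements outside of \<open>p\<close>. The fraction
  \<open>m/s\<close> is the equivalence class of the pair \<open>(m, s)\<close>, and as above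
  the unions over representatives are single equivalence classes.
\<close>

definition denominators :: "('a, 'y) gr_ring_scheme \<Rightarrow> 'a set \<Rightarrow> 'a set" where
  "denominators A p = (\<Union>i. rgrad A i) - p"

definition fraction ::
  "'a set \<Rightarrow> ('a, 'm) dg_module \<Rightarrow> 'm \<Rightarrow> 'a \<Rightarrow> ('m \<times> 'a) set" where
  "fraction S M m s = {(n, t). n \<in> carrier M \<and> t \<in> S \<and>
     (\<exists>u \<in> S. u \<odot>\<^bsub>M\<^esub> (t \<odot>\<^bsub>M\<^esub> m) = u \<odot>\<^bsub>M\<^esub> (s \<odot>\<^bsub>M\<^esub> n))}"

definition localized_module ::
  "('a, 'y) gr_ring_scheme \<Rightarrow> 'a set \<Rightarrow> ('a, 'm) dg_module
    \<Rightarrow> (('a \<times> 'a) set, ('m \<times> 'a) set) dg_module" where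
  "localized_module A p M = (let S = denominators A p in
     \<lparr>carrier = {fraction S M m s | m s. m \<in> carrier M \<and> s \<in> S},
      mult = undefined, one = undefined,
      ring.zero = fraction S M \<zero>\<^bsub>M\<^esub> \<one>\<^bsub>A\<^esub>,
      add = \<lambda>X Y. \<Union>(m, s) \<in> X. \<Union>(n, t) \<in> Y. fraction S M (t \<odot>\<^bsub>M\<^esub> m \<oplus>\<^bsub>M\<^esub> s \<odot>\<^bsub>M\<^esub> n) (s \<otimes>\<^bsub>A\<^esub> t),
      smult = \<lambda>Q X. \<Union>(a, s) \<in> Q. \<Union>(m, t) \<in> X. fraction S M (a \<odot>\<^bsub>M\<^esub> m) (s \<otimes>\<^bsub>A\<^esub> t),
      mgrad = \<lambda>i. {fraction S M m s | m s j. s \<in> S \<inter> rgrad A j \<and> m \<in> mgrad M (i + j)},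
      diff = \<lambda>X. \<Union>(m, s) \<in> X. fraction S M (\<partial>\<^bsub>M\<^esub> m) s\<rparr>)"

definition localized_ring :: "('a, 'y) gr_ring_scheme \<Rightarrow> 'a set \<Rightarrow> ('a \<times> 'a) set gr_ring" where
  "localized_ring A p = (let U = localized_module A p (unit_dg A) in
     \<lparr>carrier = carrier U, mult = smult U,
      one = fraction (denominators A p) (unit_dg A) \<one>\<^bsub>A\<^esub> \<one>\<^bsub>A\<^esub>,
      ring.zero = \<zero>\<^bsub>U\<^esub>, add = add U, rgrad = mgrad U\<rparr>)"

definition supp :: "('a, 'y) gr_ring_scheme \<Rightarrow> ('a, 'm) dg_module \<Rightarrow> 'a set set" where
  "supp A P = {p \<in> Spec A. \<not> ho_iso (localized_ring A p) (localized_module A p P) zero_dg}"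

definition \<sigma> :: "('a, 'y) gr_ring_scheme \<Rightarrow> ('a, 'm) dg_module set \<Rightarrow> 'a set set" where
  "\<sigma> A T = (\<Union>P \<in> T. supp A P)"

definition \<tau> :: "('a, 'y) gr_ring_scheme \<Rightarrow> 'a set set \<Rightarrow> ('a, 'm) dg_module set" where
  "\<tau> A V = {P \<in> perf A. supp A P \<subseteq> V}"

definition inclusion_order :: "'b set set \<Rightarrow> 'b set gorder" where
  "inclusion_order \<C> = \<lparr>carrier = \<C>, eq = (=), le = (\<subseteq>)\<rparr>"

definition thick_ideals :: "('a, 'y) gr_ring_scheme \<Rightarrow> ('a, 'm) dg_module set gorder" where
  "thick_ideals A = inclusion_order {T. thick_tensor_ideal A T}"

definition spcl_subsets :: "('a, 'y) gr_ring_scheme \<Rightarrow> 'a set set gorder" where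
  "spcl_subsets A = inclusion_order {V. specialization_closed A V}"

end

(*
  Everything is reduced to matrices: an object of perf(A,0) is a dg module with a finite homogeneous
  dual basis, and p lies outside supp P iff some homogeneous s outside p is null-homotopic on P.
  A thick tensor ideal T contains every P with supp P inside the union of the supports of T:
  consider functorial enlargements P -> G P, built from cones of evaluations Q (x) Q* (x) P -> P
  with Q in T, such that maps factoring through T after enlarging already do so before. A homogeneous
  ideal I maximal among those modulo which no enlargement of P is null-homotopic would be prime.
  At a prime p, either p is not in supp P or p is in supp Q for some Q in T, and in both cases some
  t outside p kills an enlargement of P modulo p; combined with an enlargement null modulo p + (t)
  this yields one null modulo p. So I = 0 is reached, and P is a retract of an object of T.
  Conversely Koszul objects realize every closed subset as a support.
*)
theory Submission
  imports Defs
begin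

text \<open>They become available at a prime, because over a graded field an acyclic complex is
  contractible. Neither residue fields nor quotients by ideals are formed: fractions are cleared by
  homogeneous scalars outside \<open>p\<close>, and equations hold modulo the submodule
  \<open>I M\<close>. The price is that maps constructed on the way commute with differentials only
  modulo an ideal. This is why an enlargement has to act on graded linear maps of every degree and
  to respect congruences modulo every ideal, instead of being a functor on chain maps alone.
  Composing enlargements is a nilpotence argument: if they are null modulo \<open>J\<close> and
  modulo \<open>K\<close>, the composite is null modulo any ideal containing the products. At a
  prime of the support, a homology class of \<open>Q\<close> over the residue field and a functional
  detecting it give a section of the evaluation, up to a scalar outside \<open>p\<close>. Even
  degrees enter in one way throughout: a nonzero homogeneous scalar has even degree, so signs
  attached to matrix entries agree.\<close>

lemmas (in abelian_group) group_rearrange =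
 a_assoc a_comm a_lcomm

lemma (in abelian_group) shows
 gr_add_minus: "[|x : carrier G; y : carrier G|] ==> x \<oplus> \<ominus> y = x \<ominus> y" and
 gr_minus_add: "[|x : carrier G; y : carrier G|] ==> \<ominus> x \<oplus> y = y \<ominus> x" and
 gr_diff_minus: "[|x : carrier G; y : carrier G|] ==> x \<ominus> \<ominus> y = x \<oplus> y" and
 gr_minus_diff: "[|x : carrier G; y : carrier G|] ==> \<ominus> x \<ominus> y = \<ominus> (x \<oplus> y)" and
 gr_minus_of_diff: "[|x : carrier G; y : carrier G|] ==> \<ominus> (x \<ominus> y) = y \<ominus> x" and
 gr_diff_add: "[|x : carrier G; y : carrier G; z : carrier G|] ==> (x \<ominus> y) \<oplus> z = (x \<oplus> z) \<ominus> y" and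
 gr_add_diff: "[|x : carrier G; y : carrier G; z : carrier G|] ==> x \<oplus> (y \<ominus> z) = (x \<oplus> y) \<ominus> z" and
 gr_diff_diff: "[|x : carrier G; y : carrier G; z : carrier G|] ==> x \<ominus> (y \<ominus> z) = (x \<oplus> z) \<ominus> y" and
 gr_diff_diff2: "[|x : carrier G; y : carrier G; z : carrier G|] ==> (x \<ominus> y) \<ominus> z = x \<ominus> (y \<oplus> z)"
 by (simp_all add: minus_eq minus_add group_rearrange)

lemma (in abelian_group) shows
 gr_diff_eq: "[|x : carrier G; y : carrier G; z : carrier G|] ==> (x \<ominus> y = z) = (x = z \<oplus> y)" and
 gr_eq_diff: "[|x : carrier G; y : carrier G; z : carrier G|] ==> (z = x \<ominus> y) = (z \<oplus> y = x)" and
 gr_minus_eq: "[|x : carrier G; z : carrier G|] ==> (\<ominus> x = z) = (\<zero> = z \<oplus> x)" and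
 gr_eq_minus: "[|x : carrier G; z : carrier G|] ==> (z = \<ominus> x) = (z \<oplus> x = \<zero>)" and
 gr_diff_self: "x : carrier G ==> x \<ominus> x = \<zero>" and
 gr_diff_zero: "x : carrier G ==> x \<ominus> \<zero> = x" and
 gr_zero_diff: "x : carrier G ==> \<zero> \<ominus> x = \<ominus> x"
   apply (metis add.inv_solve_right minus_eq)
   apply (metis add.inv_solve_right' minus_eq)
  apply (metis l_neg minus_equality minus_minus r_neg)
  apply (metis l_neg minus_equality minus_minus r_neg)
 by (simp_all add: minus_eq r_neg)

text \<open>All subtrahends are moved to the other side of an equation, so that an identity between
 signed sums becomes one between sums and is decided by associativity and commutativity.\<close>

lemmas group_arith =
 abelian_group.gr_add_minus abelian_group.gr_minus_add abelian_group.gr_diff_minus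
 abelian_group.gr_minus_diff abelian_group.gr_minus_of_diff abelian_group.gr_diff_add
 abelian_group.gr_add_diff abelian_group.gr_diff_diff abelian_group.gr_diff_diff2
 abelian_group.gr_diff_eq abelian_group.gr_eq_diff abelian_group.gr_minus_eq
 abelian_group.gr_eq_minus abelian_group.gr_diff_self abelian_group.gr_diff_zero
 abelian_group.gr_zero_diff abelian_group.group_rearrange abelian_group.minus_minus

lemmas group_closed =
 abelian_monoid.a_closed[OF abelian_group.axioms(1)] abelian_group.a_inv_closed
 abelian_group.minus_closed abelian_monoid.zero_closed[OF abelian_group.axioms(1)]
 abelian_monoid.l_zero[OF abelian_group.axioms(1)]
 abelian_monoid.r_zero[OF abelian_group.axioms(1)]

section \<open>Graded abelian groups and homogeneous components\<close>

locale graded_group = abelian_group M for M (structure) +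
 fixes G :: "int => 'a set"
 assumes grading: "grading M G"
begin

lemma G_subgroup: "additive_subgroup (G i) M"
 using grading by (simp add: grading_def)

lemma G_carrier [simp]: "x : G i ==> x : carrier M"
 using additive_subgroup.a_subset[OF G_subgroup] by blast

lemma G_zero [simp]: "\<zero> : G i"
 using additive_subgroup.zero_closed[OF G_subgroup] .

lemma G_add [simp]: "x : G i ==> y : G i ==> x \<oplus> y : G i"
 using additive_subgroup.a_closed[OF G_subgroup] .

lemma G_minus [simp]: "x : G i ==> \<ominus> x : G i"
 using additive_subgroup.a_inv_closed[OF G_subgroup] abelian_group_axioms by blast

lemma G_diff [simp]: "x : G i ==> y : G i ==> x \<ominus> y : G i"
 by (simp add: minus_eq)

lemma G_finsum: "f : F \<rightarrow> G i ==> finsum M f F : G i"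
proof (induction F rule: infinite_finite_induct)
 case (insert x F)
 then have "f : F \<rightarrow> carrier M" "f x : carrier M" using G_carrier by blast+
 with insert show ?case by (simp add: Pi_iff)
qed simp_all

abbreviation cmp where "cmp \<equiv> component M G"

lemma decomposes_cmp: "x : carrier M ==> decomposes M G x (cmp x)"
 unfolding component_def using grading theI'[of "decomposes M G x"] by (simp add: grading_def)

lemma cmp_in [simp]: "x : carrier M ==> cmp x i : G i"
 and cmp_finite: "x : carrier M ==> finite {i. cmp x i ~= \<zero>}"
 and cmp_sum: "x : carrier M ==> x = finsum M (cmp x) {i. cmp x i ~= \<zero>}"
 using decomposes_cmp by (auto simp: decomposes_def)

lemma cmp_carrier [simp]: "x : carrier M ==> cmp x i : carrier M"
 using cmp_in G_carrier by blast

lemma cmp_eqI: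
 assumes "!!i. f i : G i" "finite F" "!!i. i ~: F ==> f i = \<zero>" "x = finsum M f F"
 shows "cmp x = f"
proof -
 have fc: "!!i. f i : carrier M" using assms(1) G_carrier by blast
 have x: "x : carrier M" using assms fc by auto
 have sub: "{i. f i ~= \<zero>} \<subseteq> F" using assms(3) by auto
 have "finsum M f F = finsum M f {i. f i ~= \<zero>}"
  using fc sub by (intro add.finprod_mono_neutral_cong_right) (auto simp: assms(2))
 then have "decomposes M G x f"
  using assms sub by (auto simp: decomposes_def intro: finite_subset)
 with decomposes_cmp[OF x] grading x show ?thesis unfolding grading_def by blast
qed

lemma cmp_sum_superset:
 assumes "x : carrier M" "finite F" "!!i. i ~: F ==> cmp x i = \<zero>"
 shows "x = finsum M (cmp x) F"
proof -
 have "finsum M (cmp x) F = finsum M (cmp x) {i. cmp x i ~= \<zero>}"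
  using assms cmp_carrier by (intro add.finprod_mono_neutral_cong_right) auto
 with cmp_sum[OF assms(1)] show ?thesis by simp
qed

lemma cmp_add:
 assumes "x : carrier M" "y : carrier M"
 shows "cmp (x \<oplus> y) i = cmp x i \<oplus> cmp y i"
proof -
 let ?F = "{i. cmp x i ~= \<zero>} \<union> {i. cmp y i ~= \<zero>}"
 have F: "finite ?F" using assms cmp_finite by auto
 have "x = finsum M (cmp x) ?F" "y = finsum M (cmp y) ?F"
  using assms F by (auto intro!: cmp_sum_superset)
 then have "x \<oplus> y = finsum M (%i. cmp x i \<oplus> cmp y i) ?F"
  using assms by (subst finsum_addf) (auto simp: Pi_iff)
 then have "cmp (x \<oplus> y) = (%i. cmp x i \<oplus> cmp y i)"
  using assms F by (intro cmp_eqI[of _ ?F]) auto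
 then show ?thesis by simp
qed

lemma cmp_hom:
 assumes "x : G i"
 shows "cmp x j = (if j = i then x else \<zero>)"
proof -
 have "cmp x = (%j. if j = i then x else \<zero>)"
  using assms by (intro cmp_eqI[of _ "{i}"]) (auto simp: finsum_insert)
 then show ?thesis by simp
qed

lemma cmp_zero [simp]: "cmp \<zero> j = \<zero>"
 using cmp_hom[of \<zero> 0 j] by simp

lemma cmp_minus:
 assumes "x : carrier M" shows "cmp (\<ominus> x) i = \<ominus> cmp x i"
proof -
 have "cmp (\<ominus> x) i \<oplus> cmp x i = \<zero>"
  using assms by (simp add: l_neg flip: cmp_add)
 with assms show ?thesis by (simp add: minus_equality)
qed

lemma cmp_diff:
 assumes "x : carrier M" "y : carrier M" shows "cmp (x \<ominus> y) i = cmp x i \<ominus> cmp y i"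
 using assms by (simp add: minus_eq cmp_add cmp_minus)

lemma finsum_induct:
 assumes "finite F" "f : F \<rightarrow> carrier M" "P \<zero>"
  "!!x y. x : carrier M ==> y : carrier M ==> P x ==> P y ==> P (x \<oplus> y)"
  "!!i. i : F ==> P (f i)"
 shows "P (finsum M f F)"
 using assms(1,2,5)
proof (induction F)
 case (insert x F)
 then have "f x : carrier M" "finsum M f F : carrier M" "P (f x)" "P (finsum M f F)"
  by (auto intro!: finsum_closed)
 moreover have "finsum M f (insert x F) = f x \<oplus> finsum M f F"
  using insert by (intro finsum_insert) auto
 ultimately show ?case by (simp add: assms(4))
qed (simp add: assms(3))

lemma hom_induct [consumes 1, case_names zero add hom]:
 assumes "x : carrier M" "P \<zero>"
  "!!x y. x : carrier M ==> y : carrier M ==> P x ==> P y ==> P (x \<oplus> y)"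
  "!!x i. x : G i ==> P x"
 shows "P x"
proof -
 have "P (finsum M (cmp x) {i. cmp x i ~= \<zero>})"
 proof (rule finsum_induct)
  show "finite {i. cmp x i ~= \<zero>}" by (rule cmp_finite[OF assms(1)])
  show "cmp x : {i. cmp x i ~= \<zero>} \<rightarrow> carrier M" using cmp_carrier[OF assms(1)] by blast
  show "P (cmp x i)" for i by (rule assms(4)[OF cmp_in[OF assms(1)]])
 qed (fact assms)+
 with cmp_sum[OF assms(1)] show ?thesis by simp
qed

end

text \<open>A candidate \<open>c\<close> for the components that is additive and correct on
  homogeneous elements forces uniqueness: applying \<open>c\<close> to the sum of any other
  decomposition \<open>f\<close> returns \<open>f\<close>. Existence is then the only thing to check
  in a concrete construction.\<close>

lemma (in abelian_group) gradingI:
 assumes sub: "!!i. additive_subgroup (H i) G"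
  and c: "!!x i. x : carrier G ==> c x i : H i"
  and fin: "!!x. x : carrier G ==> finite {i. c x i ~= \<zero>}"
  and sum: "!!x. x : carrier G ==> x = finsum G (c x) {i. c x i ~= \<zero>}"
  and add: "!!x y i. x : carrier G ==> y : carrier G ==> c (x \<oplus> y) i = c x i \<oplus> c y i"
  and hom: "!!x i j. x : H i ==> c x j = (if j = i then x else \<zero>)"
 shows "grading G H"
 unfolding grading_def
proof (intro conjI allI ballI ex1I)
 fix x assume x: "x : carrier G"
 show "decomposes G H x (c x)" using c fin sum x by (auto simp: decomposes_def)
 fix f assume f: "decomposes G H x f"
 have carr: "!!i y. y : H i ==> y : carrier G"
  using additive_subgroup.a_subset[OF sub] by blast
 have H0: "!!i. \<zero> : H i" using additive_subgroup.zero_closed[OF sub] .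
 have f': "!!i. f i : H i" and ff: "finite {i. f i ~= \<zero>}"
  and fs: "x = finsum G f {i. f i ~= \<zero>}" using f by (auto simp: decomposes_def)
 have *: "c (finsum G f F) j = (if j : F then f j else \<zero>)" if "finite F" for F j
  using that
 proof (induction F)
  case empty
  show ?case using hom[OF H0] by simp
 next
  case (insert i F)
  have fc: "!!i. f i : carrier G" using f' carr by blast
  then have "finsum G f (insert i F) = f i \<oplus> finsum G f F"
   using insert by (intro finsum_insert) auto
  moreover have "finsum G f F : carrier G" using fc by simp
  ultimately show ?case using insert fc by (auto simp: add hom[OF f'])
 qed
 show "f = c x"
 proof
  fix j
  show "f j = c x j" using *[OF ff, of j] fs[symmetric] by simp
 qed
qed (fact sub)

lemma (in abelian_group) minus_zero: "\<ominus> \<zero> = \<zero>"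
 by (simp add: minus_equality)

section \<open>Rings in even degrees, graded modules and linear maps\<close>

locale even_graded_ring =
 fixes A :: "'a gr_ring" (structure)
 assumes graded_comm: "graded_comm_ring A" and even_deg: "even_degrees A"
begin

lemma A_ring: "ring A" and A_grading: "grading A (rgrad A)" and A_one [simp]: "\<one> : rgrad A 0"
 and A_mult: "a : rgrad A i ==> b : rgrad A j ==> a \<otimes> b : rgrad A (i + j)"
 and A_koszul: "a : rgrad A i ==> b : rgrad A j ==> a \<otimes> b = koszul (i * j) A (b \<otimes> a)"
 using graded_comm unfolding graded_comm_ring_def by blast+

lemma A_odd: "a : rgrad A i ==> odd i ==> a = \<zero>"
 using even_deg by (auto simp: even_degrees_def)

lemma A_graded: "graded_group A (rgrad A)"
 by (simp add: graded_group.intro graded_group_axioms.intro ring.is_abelian_group A_ring A_grading)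

end

sublocale even_graded_ring \<subseteq> GA: graded_group A "rgrad A"
 by (rule A_graded)

text \<open>The Koszul sign is nontrivial only if both degrees are odd, and then both factors are
  zero. So homogeneous elements commute, and additivity extends this to all elements, one argument
  at a time.\<close>

sublocale even_graded_ring \<subseteq> R?: cring A
proof -
 interpret ring A by (rule A_ring)
 have hom: "a \<otimes> b = b \<otimes> a" if "a : rgrad A i" "b : rgrad A j" for a b i j
 proof (cases "odd i & odd j")
  case True
  then have "a = \<zero>" using that A_odd by blast
  then show ?thesis using that by simp
 next
  case False
  then show ?thesis using A_koszul[OF that] by (auto simp: koszul_def)
 qed
 have hom2: "a \<otimes> b = b \<otimes> a" if a: "a : rgrad A i" and "b : carrier A" for a b i
  using that(2)
 proof (induction b rule: GA.hom_induct)
  case (add x y)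
  then show ?case using a by (simp add: l_distr r_distr)
 qed (use a hom in auto)
 have "a \<otimes> b = b \<otimes> a" if "a : carrier A" and b: "b : carrier A" for a b
  using that(1)
 proof (induction a rule: GA.hom_induct)
  case (add x y)
  then show ?case using b by (simp add: l_distr r_distr)
 qed (use b hom2 in auto)
 then show "cring A"
  by (intro cring.intro A_ring comm_monoid.intro comm_monoid_axioms.intro monoid_axioms)
qed

context even_graded_ring
begin

abbreviation gm where "gm \<equiv> graded_module A"

lemma gm_module: "gm M ==> module A M"
 and gm_smult_deg: "gm M ==> a : rgrad A i ==> x : mgrad M j ==> a \<odot>\<^bsub>M\<^esub> x : mgrad M (i + j)"
 by (auto simp: graded_module_def)

lemma gm_group [simp]: "gm M ==> abelian_group M"
 using gm_module module.axioms(2) by blast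

lemma gm_graded: "gm M ==> graded_group M (mgrad M)"
 by (rule graded_group.intro[OF gm_group graded_group_axioms.intro]) (simp_all add: graded_module_def)

lemma gm_carrier: "gm M ==> x : mgrad M i ==> x : carrier M"
 using graded_group.G_carrier[OF gm_graded] .

lemma gm_smult [simp]:
 assumes "gm M" "x : carrier M"
 shows "a : carrier A ==> a \<odot>\<^bsub>M\<^esub> x : carrier M"
  and "\<one> \<odot>\<^bsub>M\<^esub> x = x" and "\<zero> \<odot>\<^bsub>M\<^esub> x = \<zero>\<^bsub>M\<^esub>"
 using module.smult_closed[OF gm_module[OF assms(1)] _ assms(2)]
  module.smult_one[OF gm_module[OF assms(1)] assms(2)]
  module.smult_l_null[OF gm_module[OF assms(1)] assms(2)] by auto

lemma gm_smult_zero [simp]: "gm M ==> a : carrier A ==> a \<odot>\<^bsub>M\<^esub> \<zero>\<^bsub>M\<^esub> = \<zero>\<^bsub>M\<^esub>"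
 using module.smult_r_null[OF gm_module] .

lemma smult_smult:
 "[|gm M; a : carrier A; b : carrier A; x : carrier M|] ==> a \<odot>\<^bsub>M\<^esub> (b \<odot>\<^bsub>M\<^esub> x) = (a \<otimes> b) \<odot>\<^bsub>M\<^esub> x"
 using module.smult_assoc1[OF gm_module] by metis

lemma smult_add_l:
 "[|gm M; a : carrier A; b : carrier A; x : carrier M|] ==> (a \<oplus> b) \<odot>\<^bsub>M\<^esub> x = a \<odot>\<^bsub>M\<^esub> x \<oplus>\<^bsub>M\<^esub> b \<odot>\<^bsub>M\<^esub> x"
 using module.smult_l_distr[OF gm_module] .

lemma smult_add_r:
 "[|gm M; a : carrier A; x : carrier M; y : carrier M|] ==> a \<odot>\<^bsub>M\<^esub> (x \<oplus>\<^bsub>M\<^esub> y) = a \<odot>\<^bsub>M\<^esub> x \<oplus>\<^bsub>M\<^esub> a \<odot>\<^bsub>M\<^esub> y"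
 using module.smult_r_distr[OF gm_module] .

lemma smult_minus_l:
 "[|gm M; a : carrier A; x : carrier M|] ==> (\<ominus> a) \<odot>\<^bsub>M\<^esub> x = \<ominus>\<^bsub>M\<^esub> (a \<odot>\<^bsub>M\<^esub> x)"
 using module.smult_l_minus[OF gm_module] .

lemma smult_minus_r:
 "[|gm M; a : carrier A; x : carrier M|] ==> a \<odot>\<^bsub>M\<^esub> (\<ominus>\<^bsub>M\<^esub> x) = \<ominus>\<^bsub>M\<^esub> (a \<odot>\<^bsub>M\<^esub> x)"
 using module.smult_r_minus[OF gm_module] .

lemma smult_diff_l:
 "[|gm M; a : carrier A; b : carrier A; x : carrier M|] ==> (a \<ominus> b) \<odot>\<^bsub>M\<^esub> x = a \<odot>\<^bsub>M\<^esub> x \<ominus>\<^bsub>M\<^esub> b \<odot>\<^bsub>M\<^esub> x"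
 by (simp add: a_minus_def smult_add_l smult_minus_l)

lemma smult_diff_r:
 "[|gm M; a : carrier A; x : carrier M; y : carrier M|] ==> a \<odot>\<^bsub>M\<^esub> (x \<ominus>\<^bsub>M\<^esub> y) = a \<odot>\<^bsub>M\<^esub> x \<ominus>\<^bsub>M\<^esub> a \<odot>\<^bsub>M\<^esub> y"
 by (simp add: a_minus_def smult_add_r smult_minus_r group_closed)

lemmas smult_arith = smult_smult smult_add_l smult_add_r smult_minus_l smult_minus_r
 smult_diff_l smult_diff_r

lemma smult_finsum:
 "[|gm M; a : carrier A; f : F \<rightarrow> carrier M|] ==>
  a \<odot>\<^bsub>M\<^esub> finsum M f F = finsum M (%i. a \<odot>\<^bsub>M\<^esub> f i) F"
 using module.finsum_smult_ldistr[OF gm_module] by (cases "finite F")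
  (auto simp: abelian_monoid.finsum_infinite abelian_group.axioms(1))

text \<open>The sign-free form of \<open>graded_linear\<close>, in which a map of degree
  \<open>k\<close> is an ordinary linear map; all later arguments use this form.\<close>

definition lmap :: "int => ('a, 'm, 'u) gr_module_scheme => ('a, 'n, 'v) gr_module_scheme => ('m => 'n) => bool" where
 "lmap k M N f \<longleftrightarrow>
  (ALL x : carrier M. f x : carrier N) &
  (ALL x : carrier M. ALL y : carrier M. f (x \<oplus>\<^bsub>M\<^esub> y) = f x \<oplus>\<^bsub>N\<^esub> f y) &
  (ALL a : carrier A. ALL x : carrier M. f (a \<odot>\<^bsub>M\<^esub> x) = a \<odot>\<^bsub>N\<^esub> f x) &
  (ALL i. ALL x : mgrad M i. f x : mgrad N (i + k))"

lemma lmap_closed: "lmap k M N f ==> x : carrier M ==> f x : carrier N"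
 and lmap_plus: "lmap k M N f ==> x : carrier M ==> y : carrier M ==> f (x \<oplus>\<^bsub>M\<^esub> y) = f x \<oplus>\<^bsub>N\<^esub> f y"
 and lmap_smult: "lmap k M N f ==> a : carrier A ==> x : carrier M ==> f (a \<odot>\<^bsub>M\<^esub> x) = a \<odot>\<^bsub>N\<^esub> f x"
 and lmap_deg: "lmap k M N f ==> x : mgrad M i ==> f x : mgrad N (i + k)"
 by (auto simp: lmap_def)

lemma koszul_even_zero:
 assumes "gm M" "a : rgrad A i" "x : carrier M"
 shows "koszul (n * i) M (a \<odot>\<^bsub>M\<^esub> x) = a \<odot>\<^bsub>M\<^esub> x"
proof (cases "even i")
 case False
 then have "a = \<zero>" using A_odd assms(2) by blast
 then show ?thesis using assms by (simp add: koszul_def abelian_group.minus_zero)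
qed (simp add: koszul_def)

text \<open>The sign differs from 1 only for a scalar of odd degree, and such a scalar is zero.
  Linearity over arbitrary scalars follows from homogeneous ones by additivity.\<close>

lemma graded_linear_iff:
 assumes M: "gm M" and N: "gm N"
 shows "graded_linear A k M N f \<longleftrightarrow> lmap k M N f"
proof
 assume f: "graded_linear A k M N f"
 have cl: "!!x. x : carrier M ==> f x : carrier N"
  and ad: "!!x y. x : carrier M ==> y : carrier M ==> f (x \<oplus>\<^bsub>M\<^esub> y) = f x \<oplus>\<^bsub>N\<^esub> f y"
  and dg: "!!i x. x : mgrad M i ==> f x : mgrad N (i + k)"
  and sm: "!!i a x. a : rgrad A i ==> x : carrier M ==> f (a \<odot>\<^bsub>M\<^esub> x) = koszul (k * i) N (a \<odot>\<^bsub>N\<^esub> f x)"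
  using f unfolding graded_linear_def hom_def by (simp_all add: Pi_iff image_subset_iff)
 have "f (a \<odot>\<^bsub>M\<^esub> x) = a \<odot>\<^bsub>N\<^esub> f x" if "a : carrier A" and x: "x : carrier M" for a x
  using that(1)
 proof (induction a rule: GA.hom_induct)
  case zero
  then show ?case using sm[of \<zero> 0 x] x M N cl by (simp add: koszul_def)
 next
  case (add a b)
  then show ?case using M N x cl by (simp add: smult_add_l ad)
 next
  case (hom a i)
  then show ?case using sm[OF hom x] koszul_even_zero[OF N hom cl[OF x]] by simp
 qed
 then show "lmap k M N f" using cl ad dg by (simp add: lmap_def)
next
 assume f: "lmap k M N f"
 have "f (a \<odot>\<^bsub>M\<^esub> x) = koszul (k * i) N (a \<odot>\<^bsub>N\<^esub> f x)" if "a : rgrad A i" "x : carrier M" for a i x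
  using koszul_even_zero[OF N that(1) lmap_closed[OF f that(2)]] lmap_smult[OF f] that by simp
 then show "graded_linear A k M N f"
  using f by (auto simp: graded_linear_def hom_def lmap_def)
qed

lemma lmap_zero: "gm M ==> gm N ==> lmap k M N f ==> f \<zero>\<^bsub>M\<^esub> = \<zero>\<^bsub>N\<^esub>"
 using lmap_smult[of k M N f \<zero> "\<zero>\<^bsub>M\<^esub>"] lmap_closed[of k M N f "\<zero>\<^bsub>M\<^esub>"]
 by (simp add: group_closed)

lemma lmap_minus:
 assumes "gm M" "gm N" "lmap k M N f" "x : carrier M"
 shows "f (\<ominus>\<^bsub>M\<^esub> x) = \<ominus>\<^bsub>N\<^esub> f x"
proof -
 have "\<ominus>\<^bsub>M\<^esub> x = (\<ominus> \<one>) \<odot>\<^bsub>M\<^esub> x" using assms by (simp add: smult_minus_l)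
 moreover have "\<ominus>\<^bsub>N\<^esub> f x = (\<ominus> \<one>) \<odot>\<^bsub>N\<^esub> f x"
  using assms lmap_closed[OF assms(3,4)] by (simp add: smult_minus_l)
 ultimately show ?thesis using lmap_smult[OF assms(3) _ assms(4), of "\<ominus> \<one>"] by simp
qed

lemma lmap_diff:
 assumes "gm M" "gm N" "lmap k M N f" "x : carrier M" "y : carrier M"
 shows "f (x \<ominus>\<^bsub>M\<^esub> y) = f x \<ominus>\<^bsub>N\<^esub> f y"
 using assms lmap_plus[OF assms(3,4), of "\<ominus>\<^bsub>M\<^esub> y"] lmap_minus[OF assms(1-3,5)]
 by (simp add: a_minus_def group_closed)

lemmas lmapD = lmap_closed lmap_plus lmap_smult lmap_deg
lemmas lmapD0 = lmap_zero lmap_minus lmap_diff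

lemma lmap_finsum:
 assumes "gm M" "gm N" "lmap k M N f" "g : F \<rightarrow> carrier M"
 shows "f (finsum M g F) = finsum N (%i. f (g i)) F"
proof -
 interpret M: abelian_group M using assms by simp
 interpret N: abelian_group N using assms by simp
 show ?thesis using assms(4)
 proof (induction F rule: infinite_finite_induct)
  case (insert x F)
  then have "f (finsum M g (insert x F)) = f (g x \<oplus>\<^bsub>M\<^esub> finsum M g F)"
   by (subst M.finsum_insert) auto
  also have "\<dots> = f (g x) \<oplus>\<^bsub>N\<^esub> f (finsum M g F)"
   using insert by (intro lmap_plus[OF assms(3)]) auto
  also have "\<dots> = finsum N (%i. f (g i)) (insert x F)"
   using insert lmap_closed[OF assms(3)] by (subst N.finsum_insert) (auto simp: Pi_iff)
  finally show ?case .
 qed (use lmap_zero[OF assms(1-3)] in auto)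
qed

lemma lmapI_hom:
 assumes "gm M" "gm N"
  "!!x. x : carrier M ==> f x : carrier N"
  "!!x y. x : carrier M ==> y : carrier M ==> f (x \<oplus>\<^bsub>M\<^esub> y) = f x \<oplus>\<^bsub>N\<^esub> f y"
  "!!a x. a : carrier A ==> x : carrier M ==> f (a \<odot>\<^bsub>M\<^esub> x) = a \<odot>\<^bsub>N\<^esub> f x"
  "!!i x. x : mgrad M i ==> f x : mgrad N (i + k)"
 shows "lmap k M N f"
 using assms by (simp add: lmap_def)

lemma lmap_cong: "lmap k M N f ==> gm M ==> k = l ==> (!!x. x : carrier M ==> f x = g x) ==> lmap l M N g"
proof -
 assume f: "lmap k M N f" and M: "gm M" and "k = l" and eq: "!!x. x : carrier M ==> f x = g x"
 have eq': "g x = f x" if "x : carrier M" for x using eq[OF that] by simp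
 have "g x : mgrad N (i + k)" if "x : mgrad M i" for i x
  using lmap_deg[OF f that] eq'[OF gm_carrier[OF M that]] by simp
 then show ?thesis
  using lmapD[OF f] M \<open>k = l\<close> unfolding lmap_def by (simp add: eq' group_closed)
qed

lemma lmap_id: "lmap 0 M M (%x. x)"
 by (simp add: lmap_def)

lemma lmap_0: "gm N ==> lmap k M N (%_. \<zero>\<^bsub>N\<^esub>)"
 using graded_group.G_zero[OF gm_graded] by (auto simp: lmap_def group_closed)

lemma lmap_comp: "lmap k M N f ==> lmap l N P g ==> lmap (k + l) M P (%x. g (f x))"
 by (simp add: lmap_def add.assoc[symmetric])

lemma lmap_add:
 assumes "gm M" "gm N" "lmap k M N f" "lmap k M N g"
 shows "lmap k M N (%x. f x \<oplus>\<^bsub>N\<^esub> g x)"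
 using assms(1,2) lmapD[OF assms(3)] lmapD[OF assms(4)] graded_group.G_add[OF gm_graded[OF assms(2)]]
 by (intro lmapI_hom) (auto simp: group_closed smult_arith group_arith)

lemma lmap_uminus:
 assumes "gm M" "gm N" "lmap k M N f"
 shows "lmap k M N (%x. \<ominus>\<^bsub>N\<^esub> f x)"
 using assms(1,2) lmapD[OF assms(3)] graded_group.G_minus[OF gm_graded[OF assms(2)]]
 by (intro lmapI_hom) (auto simp: group_closed smult_arith abelian_group.minus_add)

lemma lmap_subtract:
 assumes "gm M" "gm N" "lmap k M N f" "lmap k M N g"
 shows "lmap k M N (%x. f x \<ominus>\<^bsub>N\<^esub> g x)"
 using lmap_add[OF assms(1,2,3) lmap_uminus[OF assms(1,2,4)]] by (simp add: a_minus_def)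

lemma lmap_smult_left:
 assumes "gm M" "gm N" "lmap k M N f" "a : rgrad A j"
 shows "lmap (k + j) M N (%x. a \<odot>\<^bsub>N\<^esub> f x)"
 using assms(1,2) lmapD[OF assms(3)] gm_smult_deg[OF assms(2,4), of _ "_ + k"] GA.G_carrier[OF assms(4)]
 by (intro lmapI_hom) (auto simp: group_closed smult_arith m_comm add.commute add.left_commute)

lemma lmap_sum:
 assumes "gm M" "gm N" "finite F" "!!i. i : F ==> lmap k M N (f i)"
 shows "lmap k M N (%x. finsum N (%i. f i x) F)"
 using assms(3,4)
proof (induction F)
 case empty
 interpret N: abelian_group N using assms by simp
 show ?case using lmap_0[OF assms(2)] by simp
next
 case (insert i F)
 interpret N: abelian_group N using assms by simp
 have "lmap k M N (%x. f i x \<oplus>\<^bsub>N\<^esub> finsum N (%i. f i x) F)"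
  using insert(4)[OF insertI1] insert(3)[OF insert(4)[OF insertI2]] by (rule lmap_add[OF assms(1,2)])
 then show ?case
 proof (rule lmap_cong[OF _ assms(1) refl])
  fix x assume x: "x : carrier M"
  have "f j x : carrier N" if "j : insert i F" for j
   using lmap_closed[OF insert(4)[OF that] x] .
  then have "finsum N (%i. f i x) (insert i F) = f i x \<oplus>\<^bsub>N\<^esub> finsum N (%i. f i x) F"
   using insert(1,2) by (intro N.finsum_insert) auto
  then show "f i x \<oplus>\<^bsub>N\<^esub> finsum N (%i. f i x) F = finsum N (%i. f i x) (insert i F)"
   by simp
 qed
qed

abbreviation "U \<equiv> unit_dg A"

lemma unit_simps [simp]: "carrier U = carrier A" "add U = add A" "smult U = mult A"
 "\<zero>\<^bsub>U\<^esub> = \<zero>" "mgrad U = rgrad A" "diff U = (%_. \<zero>)" "mult U = mult A" "\<one>\<^bsub>U\<^esub> = \<one>"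
 by (simp_all add: unit_dg_def)

lemma unit_finsum: "finsum U = finsum A"
 by (simp add: finsum_def finprod_def[abs_def] fun_eq_iff)

lemma unit_a_inv [simp]: "a_inv U = a_inv A" "a_minus U = a_minus A"
 by (simp_all add: a_inv_def m_inv_def[abs_def] a_minus_def[abs_def] fun_eq_iff)

lemma unit_gm [simp]: "gm U"
proof -
 have "abelian_group U"
  proof (rule abelian_groupI)
  show "EX y:carrier U. y \<oplus>\<^bsub>U\<^esub> x = \<zero>\<^bsub>U\<^esub>" if "x : carrier U" for x
   using that GA.l_neg[of x] by (intro bexI[of _ "\<ominus> x"]) simp_all
 qed (simp_all add: GA.group_rearrange)
 then have "module A U"
  by (intro module.intro is_cring module_axioms.intro) (auto simp: l_distr r_distr m_assoc)
 moreover have "grading U (rgrad A)"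
  using A_grading unfolding grading_def decomposes_def unit_finsum
  by (simp add: additive_subgroup_def subgroup_def m_inv_def)
 ultimately show ?thesis by (simp add: graded_module_def A_mult)
qed

lemma lmap_scale:
 assumes "gm M" "gm N" "lmap k M U \<phi>" "y : mgrad N j"
 shows "lmap (k + j) M N (%x. \<phi> x \<odot>\<^bsub>N\<^esub> y)"
proof -
 have y: "y : carrier N" by (rule gm_carrier[OF assms(2,4)])
 show ?thesis
  using assms(1,2) y lmapD[OF assms(3)] gm_smult_deg[OF assms(2) _ assms(4)]
  by (intro lmapI_hom) (simp_all add: group_closed smult_arith add.assoc[symmetric])
qed

end

section \<open>Dual bases, the submodules I M, and homogeneous primes\<close>

context even_graded_ring
begin

lemma finsum_lmap_closed:
 assumes "gm M" "!!i. i : F ==> f i : carrier M"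
 shows "finsum M f F : carrier M"
proof -
 interpret M: abelian_group M using assms by simp
 show ?thesis using assms by (intro M.finsum_closed) auto
qed

lemma finsum_congr:
 assumes "gm M" "!!i. i : F ==> f i : carrier M" "!!i. i : F ==> f i = g i"
 shows "finsum M f F = finsum M g F"
proof -
 interpret M: abelian_group M using assms by simp
 show ?thesis using assms by (intro M.finsum_cong') auto
qed

lemma finsum_plus:
 assumes "gm M" "!!i. i : F ==> f i : carrier M" "!!i. i : F ==> g i : carrier M"
 shows "finsum M (%i. f i \<oplus>\<^bsub>M\<^esub> g i) F = finsum M f F \<oplus>\<^bsub>M\<^esub> finsum M g F"
proof -
 interpret M: abelian_group M using assms by simp
 show ?thesis using assms by (intro M.finsum_addf) auto
qed

lemma finsum_Suc':
 assumes "gm M" "!!i. i \<le> m ==> f i : carrier M"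
 shows "finsum M f {..<Suc m} = finsum M f {..<m} \<oplus>\<^bsub>M\<^esub> f m"
proof -
 interpret M: abelian_group M using assms by simp
 have "finsum M f (insert m {..<m}) = f m \<oplus>\<^bsub>M\<^esub> finsum M f {..<m}"
  using assms by (intro M.finsum_insert) auto
 moreover have "f m : carrier M" "finsum M f {..<m} : carrier M"
  using assms by (auto intro!: M.finsum_closed)
 ultimately show ?thesis by (simp add: lessThan_Suc M.a_comm)
qed

lemma finsum_diff:
 assumes "gm M" "!!i. i : F ==> f i : carrier M" "!!i. i : F ==> g i : carrier M"
 shows "finsum M (%i. f i \<ominus>\<^bsub>M\<^esub> g i) F = finsum M f F \<ominus>\<^bsub>M\<^esub> finsum M g F"
proof -
 have "finsum M f F = finsum M (%i. (f i \<ominus>\<^bsub>M\<^esub> g i) \<oplus>\<^bsub>M\<^esub> g i) F"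
  using assms by (intro finsum_congr) (auto simp: group_closed group_arith)
 also have "\<dots> = finsum M (%i. f i \<ominus>\<^bsub>M\<^esub> g i) F \<oplus>\<^bsub>M\<^esub> finsum M g F"
  using assms by (intro finsum_plus) (auto simp: group_closed)
 finally show ?thesis
  using assms by (simp add: group_arith group_closed finsum_lmap_closed)
qed

lemma lmap_cmp:
 assumes "gm M" "gm N" "lmap k M N f" "x : carrier M"
 shows "component N (mgrad N) (f x) (i + k) = f (component M (mgrad M) x i)"
proof -
 interpret M: graded_group M "mgrad M" by (rule gm_graded[OF assms(1)])
 interpret N: graded_group N "mgrad N" by (rule gm_graded[OF assms(2)])
 note f0 = lmap_zero[OF assms(1-3)]
 show ?thesis using assms(4)
 proof (induction x rule: M.hom_induct)
  case zero
  show ?case by (simp add: f0)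
 next
  case (add x y)
  then show ?case by (simp add: M.cmp_add N.cmp_add lmapD[OF assms(3)])
 next
  case (hom x j)
  then show ?case using f0 by (simp add: M.cmp_hom N.cmp_hom[OF lmap_deg[OF assms(3) hom]])
 qed
qed

text \<open>By the dual basis lemma (see \<open>perf_iff\<close>) this characterizes finitely
  generated graded projective modules. Unlike a lifting property it does not quantify over other
  modules, so it makes sense on every carrier type, and it turns statements about \<open>M\<close>
  into finite sums.\<close>

definition dual_basis :: "('a, 'm, 'u) gr_module_scheme => nat => (nat => 'm) => (nat => int)
  => (nat => 'm => 'a) => bool" where
 "dual_basis M n q d \<phi> \<longleftrightarrow>
  (ALL i<n. q i : mgrad M (d i) & lmap (- d i) M U (\<phi> i)) &
  (ALL x : carrier M. x = finsum M (%i. \<phi> i x \<odot>\<^bsub>M\<^esub> q i) {..<n})"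

lemma dbD:
 assumes "dual_basis M n q d \<phi>"
 shows "i < n ==> q i : mgrad M (d i)" "i < n ==> lmap (- d i) M U (\<phi> i)"
  "x : carrier M ==> finsum M (%i. \<phi> i x \<odot>\<^bsub>M\<^esub> q i) {..<n} = x"
 using assms unfolding dual_basis_def by metis+

lemma db_closed:
 assumes "gm M" "dual_basis M n q d \<phi>" "i < n"
 shows "q i : carrier M" "x : carrier M ==> \<phi> i x : carrier A"
  "x : mgrad M j ==> \<phi> i x : rgrad A (j - d i)"
 using gm_carrier[OF assms(1) dbD(1)[OF assms(2,3)]] lmap_closed[OF dbD(2)[OF assms(2,3)]]
  lmap_deg[OF dbD(2)[OF assms(2,3)]] by auto

lemma db_expand:
 assumes "gm M" "gm N" "dual_basis M n q d \<phi>" "lmap k M N f" "x : carrier M"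
 shows "f x = finsum N (%i. \<phi> i x \<odot>\<^bsub>N\<^esub> f (q i)) {..<n}"
proof -
 note c = db_closed[OF assms(1,3)]
 have "f x = f (finsum M (%i. \<phi> i x \<odot>\<^bsub>M\<^esub> q i) {..<n})"
  using dbD(3)[OF assms(3,5)] by simp
 also have "\<dots> = finsum N (%i. f (\<phi> i x \<odot>\<^bsub>M\<^esub> q i)) {..<n}"
  using assms c by (intro lmap_finsum) auto
 also have "\<dots> = finsum N (%i. \<phi> i x \<odot>\<^bsub>N\<^esub> f (q i)) {..<n}"
  using assms c lmapD(1,3)[OF assms(4)] by (intro finsum_congr) auto
 finally show ?thesis .
qed

lemma db_lmap:
 assumes "gm M" "gm N" "dual_basis M n q d \<phi>" "!!i. i < n ==> y i : mgrad N (d i + k)"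
 shows "lmap k M N (%x. finsum N (%i. \<phi> i x \<odot>\<^bsub>N\<^esub> y i) {..<n})"
proof (intro lmap_sum assms)
 fix i assume "i : {..<n}"
 then have "lmap (- d i + (d i + k)) M N (%x. \<phi> i x \<odot>\<^bsub>N\<^esub> y i)"
  using assms dbD(2)[OF assms(3)] by (intro lmap_scale) auto
 then show "lmap k M N (%x. \<phi> i x \<odot>\<^bsub>N\<^esub> y i)" by simp
qed simp

lemma ideal_simps:
 assumes "ideal I A"
 shows "x : I ==> x : carrier A" "\<zero> : I" "x : I ==> y : I ==> x \<oplus> y : I"
  "x : I ==> \<ominus> x : I" "x : I ==> y : I ==> x \<ominus> y : I"
  "x : I ==> a : carrier A ==> a \<otimes> x : I" "x : I ==> a : carrier A ==> x \<otimes> a : I"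
proof -
 interpret I: ideal I A by fact
 show "x : I ==> x : carrier A" by (rule I.Icarr)
 show "\<zero> : I" by simp
 show "x : I ==> y : I ==> x \<oplus> y : I" by simp
 show m: "x : I ==> \<ominus> x : I" for x by simp
 show "x : I ==> y : I ==> x \<ominus> y : I" by (simp add: a_minus_def)
 show "x : I ==> a : carrier A ==> a \<otimes> x : I" by (rule I.I_l_closed)
 show "x : I ==> a : carrier A ==> x \<otimes> a : I" by (rule I.I_r_closed)
qed

lemma ideal_finsum:
 assumes "ideal I A" "finite F" "!!i. i : F ==> f i : I"
 shows "finsum A f F : I"
 using assms(2,3)
proof (induction F)
 case (insert i F)
 have "finsum A f (insert i F) = f i \<oplus> finsum A f F"
  using insert ideal_simps(1)[OF assms(1)] by (intro GA.finsum_insert) auto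
 then show ?case using insert ideal_simps(3)[OF assms(1)] by simp
qed (simp add: ideal_simps(2)[OF assms(1)])

text \<open>The submodule \<open>I M\<close>, for finitely generated projective \<open>M\<close>.\<close>

definition IM :: "'a set => ('a, 'm, 'u) gr_module_scheme => 'm set" where
 "IM I M = {x : carrier M. ALL k \<phi>. lmap k M U \<phi> --> \<phi> x : I}"

lemma IM_carrier: "x : IM I M ==> x : carrier M"
 by (simp add: IM_def)

lemma IMD: "x : IM I M ==> lmap k M U \<phi> ==> \<phi> x : I"
 by (auto simp: IM_def)

lemma IM_zero: "gm M ==> ideal I A ==> \<zero>\<^bsub>M\<^esub> : IM I M"
 by (simp add: IM_def group_closed lmap_zero[OF _ unit_gm] ideal_simps)

lemma IM_add: "gm M ==> ideal I A ==> x : IM I M ==> y : IM I M ==> x \<oplus>\<^bsub>M\<^esub> y : IM I M"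
 by (simp add: IM_def group_closed lmap_plus ideal_simps)

lemma IM_minus: "gm M ==> ideal I A ==> x : IM I M ==> \<ominus>\<^bsub>M\<^esub> x : IM I M"
 by (simp add: IM_def group_closed lmap_minus[OF _ unit_gm] ideal_simps)

lemma IM_diff: "gm M ==> ideal I A ==> x : IM I M ==> y : IM I M ==> x \<ominus>\<^bsub>M\<^esub> y : IM I M"
 by (simp add: a_minus_def IM_add IM_minus)

lemma IM_smult: "gm M ==> ideal I A ==> x : IM I M ==> a : carrier A ==> a \<odot>\<^bsub>M\<^esub> x : IM I M"
 by (simp add: IM_def lmap_smult ideal_simps)

lemma IM_lmap:
 assumes "lmap k M N f" "x : IM I M" shows "f x : IM I N"
 using IMD[OF assms(2) lmap_comp[OF assms(1)]] lmap_closed[OF assms(1) IM_carrier[OF assms(2)]]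
 by (auto simp: IM_def)

lemma IM_ideal_smult: "gm M ==> ideal I A ==> x : carrier M ==> a : I ==> a \<odot>\<^bsub>M\<^esub> x : IM I M"
 by (simp add: IM_def lmap_smult ideal_simps lmap_closed[where N = U, simplified])

lemma IM_mono: "I \<subseteq> J ==> IM I M \<subseteq> IM J M"
 by (auto simp: IM_def)

lemma IM_finsum:
 assumes "gm M" "ideal I A" "finite F" "!!i. i : F ==> f i : IM I M"
 shows "finsum M f F : IM I M"
proof -
 interpret M: abelian_group M using assms by simp
 show ?thesis using assms(3,4)
 proof (induction F)
  case (insert i F)
  have "finsum M f (insert i F) = f i \<oplus>\<^bsub>M\<^esub> finsum M f F"
   using insert IM_carrier[OF insert(4)] by (intro M.finsum_insert) auto
  then show ?case using insert assms(1,2) by (simp add: IM_add)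
 qed (simp add: IM_zero[OF assms(1,2)])
qed

text \<open>It suffices to test the functionals of one dual basis: the expansion of \<open>x\<close>
  then has coefficients in \<open>I\<close>.\<close>

lemma IM_dual:
 assumes "gm M" "ideal I A" "dual_basis M n q d \<phi>" "x : carrier M" "!!i. i < n ==> \<phi> i x : I"
 shows "x : IM I M"
proof -
 have "finsum M (%i. \<phi> i x \<odot>\<^bsub>M\<^esub> q i) {..<n} : IM I M"
  using assms db_closed[OF assms(1,3)] by (intro IM_finsum IM_ideal_smult) auto
 then show ?thesis by (simp add: dbD(3)[OF assms(3,4)])
qed

lemma IM_zero_ideal:
 assumes "gm M" "dual_basis M n q d \<phi>" "x : IM {\<zero>} M"
 shows "x = \<zero>\<^bsub>M\<^esub>"
proof -
 interpret M: abelian_group M using assms by simp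
 have x: "x : carrier M" using IM_carrier assms(3) .
 have "x = finsum M (%i. \<phi> i x \<odot>\<^bsub>M\<^esub> q i) {..<n}" using dbD(3)[OF assms(2) x] by simp
 also have "\<dots> = finsum M (%i. \<zero>\<^bsub>M\<^esub>) {..<n}"
 proof (rule finsum_congr[OF assms(1)])
  fix i assume "i : {..<n}"
  then have i: "i < n" by simp
  then have "\<phi> i x = \<zero>" using IMD[OF assms(3) dbD(2)[OF assms(2) i]] by simp
  then show "\<phi> i x \<odot>\<^bsub>M\<^esub> q i = \<zero>\<^bsub>M\<^esub>" using db_closed[OF assms(1,2) i] assms(1) by simp
  then show "\<phi> i x \<odot>\<^bsub>M\<^esub> q i : carrier M" by simp
 qed
 finally show ?thesis by simp
qed

lemma IM_cmp:
 assumes "gm M" "homogeneous_ideal A I" "x : IM I M"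
 shows "component M (mgrad M) x i : IM I M"
proof -
 interpret M: graded_group M "mgrad M" by (rule gm_graded[OF assms(1)])
 have x: "x : carrier M" using IM_carrier assms(3) .
 have "\<phi> (M.cmp x i) : I" if "lmap k M U \<phi>" for k \<phi>
 proof -
  have "\<phi> (M.cmp x i) = component U (mgrad U) (\<phi> x) (i + k)"
   using lmap_cmp[OF assms(1) unit_gm that x] by simp
  also have "\<dots> = component A (rgrad A) (\<phi> x) (i + k)"
   by (simp add: component_def decomposes_def unit_finsum)
  finally show ?thesis using IMD[OF assms(3) that] assms(2) by (simp add: homogeneous_ideal_def)
 qed
 then show ?thesis using x by (simp add: IM_def)
qed

lemma IM_hom_all:
 assumes "gm M" "gm N" "ideal I A" "lmap k M N f" "!!i x. x : mgrad M i ==> f x : IM I N"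
  "x : carrier M"
 shows "f x : IM I N"
proof -
 interpret M: graded_group M "mgrad M" by (rule gm_graded[OF assms(1)])
 show ?thesis using assms(6)
 proof (induction x rule: M.hom_induct)
  case zero
  then show ?case using lmap_zero[OF assms(1,2,4)] IM_zero[OF assms(2,3)] by simp
 next
  case (add x y)
  then show ?case using lmap_plus[OF assms(4)] IM_add[OF assms(2,3)] by simp
 qed (rule assms(5))
qed

text \<open>Stands in for equality in the quotient of \<open>M\<close> by \<open>I M\<close>, which
  is never formed. Membership of both sides in the carrier is built in, so that chains of
  congruences carry their own side conditions.\<close>

definition eqm :: "'a set => ('a, 'm, 'u) gr_module_scheme => 'm => 'm => bool" where
 "eqm I M x y \<longleftrightarrow> x : carrier M & y : carrier M & x \<ominus>\<^bsub>M\<^esub> y : IM I M"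

lemma eqmD: "eqm I M x y ==> x : carrier M" "eqm I M x y ==> y : carrier M"
 "eqm I M x y ==> x \<ominus>\<^bsub>M\<^esub> y : IM I M"
 by (auto simp: eqm_def)

context
 fixes I and M :: "('a, 'm, 'u) gr_module_scheme"
 assumes M: "gm M" and I: "ideal I A"
begin

lemma eqm_refl: "x : carrier M ==> eqm I M x x"
 using IM_zero[OF M I] by (simp add: eqm_def group_arith M)

lemma eqm_sym: "eqm I M x y ==> eqm I M y x"
 using IM_minus[OF M I, of "x \<ominus>\<^bsub>M\<^esub> y"] by (simp add: eqm_def group_arith M)

lemma eqm_trans:
 assumes "eqm I M x y" "eqm I M y z" shows "eqm I M x z"
proof -
 note c = assms[unfolded eqm_def]
 have "x \<ominus>\<^bsub>M\<^esub> z = (x \<ominus>\<^bsub>M\<^esub> y) \<oplus>\<^bsub>M\<^esub> (y \<ominus>\<^bsub>M\<^esub> z)"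
  using c by (simp add: group_arith group_closed M)
 then show ?thesis using c IM_add[OF M I] by (simp add: eqm_def)
qed

lemma eqm_add:
 assumes "eqm I M x y" "eqm I M x' y'" shows "eqm I M (x \<oplus>\<^bsub>M\<^esub> x') (y \<oplus>\<^bsub>M\<^esub> y')"
proof -
 note c = assms[unfolded eqm_def]
 have "(x \<oplus>\<^bsub>M\<^esub> x') \<ominus>\<^bsub>M\<^esub> (y \<oplus>\<^bsub>M\<^esub> y') = (x \<ominus>\<^bsub>M\<^esub> y) \<oplus>\<^bsub>M\<^esub> (x' \<ominus>\<^bsub>M\<^esub> y')"
  using c by (simp add: group_arith group_closed M)
 then show ?thesis using c IM_add[OF M I] by (simp add: eqm_def group_closed M)
qed

lemma eqm_diff:
 assumes "eqm I M x y" "eqm I M x' y'" shows "eqm I M (x \<ominus>\<^bsub>M\<^esub> x') (y \<ominus>\<^bsub>M\<^esub> y')"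
proof -
 note c = assms[unfolded eqm_def]
 have "(x \<ominus>\<^bsub>M\<^esub> x') \<ominus>\<^bsub>M\<^esub> (y \<ominus>\<^bsub>M\<^esub> y') = (x \<ominus>\<^bsub>M\<^esub> y) \<ominus>\<^bsub>M\<^esub> (x' \<ominus>\<^bsub>M\<^esub> y')"
  using c by (simp add: group_arith group_closed M)
 then show ?thesis using c IM_diff[OF M I] by (simp add: eqm_def group_closed M)
qed

lemma eqm_minus:
 assumes "eqm I M x y" shows "eqm I M (\<ominus>\<^bsub>M\<^esub> x) (\<ominus>\<^bsub>M\<^esub> y)"
proof -
 note c = assms[unfolded eqm_def]
 have "(\<ominus>\<^bsub>M\<^esub> x) \<ominus>\<^bsub>M\<^esub> (\<ominus>\<^bsub>M\<^esub> y) = \<ominus>\<^bsub>M\<^esub> (x \<ominus>\<^bsub>M\<^esub> y)"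
  using c by (simp add: group_arith group_closed M)
 then show ?thesis using c IM_minus[OF M I] by (simp add: eqm_def group_closed M)
qed

lemma eqm_smult:
 assumes "a : carrier A" "eqm I M x y" shows "eqm I M (a \<odot>\<^bsub>M\<^esub> x) (a \<odot>\<^bsub>M\<^esub> y)"
 using assms IM_smult[OF M I, of "x \<ominus>\<^bsub>M\<^esub> y" a] by (simp add: eqm_def smult_diff_r M)

lemma eqm_lmap:
 assumes "gm N" "lmap k M N f" "eqm I M x y" shows "eqm I N (f x) (f y)"
 using assms(3) IM_lmap[OF assms(2), of "x \<ominus>\<^bsub>M\<^esub> y"] lmap_diff[OF M assms(1,2)] lmap_closed[OF assms(2)]
 by (auto simp: eqm_def)

lemma eqm_zero_iff: "eqm I M x \<zero>\<^bsub>M\<^esub> \<longleftrightarrow> x : IM I M"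
 using IM_carrier[of x I M] by (auto simp: eqm_def group_closed M abelian_group.gr_diff_zero[OF gm_group[OF M]])

lemma eqm_finsum:
 assumes "finite F" "!!i. i : F ==> eqm I M (f i) (g i)"
 shows "eqm I M (finsum M f F) (finsum M g F)"
 using assms finsum_diff[OF M, of F f g] IM_finsum[OF M I, of F "%i. f i \<ominus>\<^bsub>M\<^esub> g i"]
 by (simp add: eqm_def finsum_lmap_closed[OF M])

end

lemma SpecD:
 assumes "p : Spec A"
 shows "homogeneous_ideal A p" "ideal p A" "\<one> ~: p"
  "a : carrier A ==> b : carrier A ==> a \<otimes> b : p ==> a : p \<or> b : p"
proof -
 interpret P: primeideal p A using assms by (simp add: Spec_def)
 show "homogeneous_ideal A p" using assms by (simp add: Spec_def)
 show "ideal p A" by (rule P.is_ideal)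
 show "\<one> ~: p" using P.one_imp_carrier P.I_notcarr by blast
 show "a : carrier A ==> b : carrier A ==> a \<otimes> b : p ==> a : p \<or> b : p"
  by (rule P.I_prime)
qed

lemma den_mult:
 assumes "p : Spec A" "s : rgrad A i" "s ~: p" "t : rgrad A j" "t ~: p"
 shows "s \<otimes> t ~: p"
 using SpecD(4)[OF assms(1), of s t] assms GA.G_carrier by blast

text \<open>Reduction to a common denominator. Each condition survives multiplication by homogeneous
  elements outside \<open>p\<close>, so the product of the individual denominators serves all of
  them; it stays outside \<open>p\<close> by primality.\<close>

lemma common_den:
 assumes p: "p : Spec A" and "finite F" "!!i. i : F ==> EX l s. s : rgrad A l & s ~: p & P i l s"
  and "!!i l s m u. [|i : F; s : rgrad A l; u : rgrad A m; u ~: p; P i l s|] ==> P i (m + l) (u \<otimes> s)"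
 shows "EX l s. s : rgrad A l & s ~: p & (ALL i:F. P i l s)"
 using assms(2-)
proof (induction F)
 case empty
 show ?case using A_one SpecD(3)[OF p] by blast
next
 case (insert i F)
 have "EX l s. s : rgrad A l & s ~: p & (ALL i:F. P i l s)"
  by (rule insert.IH) (use insert.prems in blast)+
 then obtain l s where s: "s : rgrad A l" "s ~: p" "ALL i:F. P i l s" by blast
 obtain l' s' where s': "s' : rgrad A l'" "s' ~: p" "P i l' s'" using insert.prems(1) by blast
 have comm: "s \<otimes> s' = s' \<otimes> s" using s s' m_comm by simp
 have 1: "P i (l + l') (s \<otimes> s')"
  using insert.prems(2)[OF insertI1 s'(1) s(1,2) s'(3)] .
 have 2: "P j (l' + l) (s' \<otimes> s)" if "j : F" for j
  using insert.prems(2)[OF insertI2[OF that] s(1) s'(1,2)] s(3) that by blast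
 have "s \<otimes> s' : rgrad A (l + l')" "s \<otimes> s' ~: p"
  using A_mult s(1) s'(1) den_mult[OF p s(1,2) s'(1,2)] by auto
 moreover have "P j (l + l') (s \<otimes> s')" if "j : F" for j
  using 2[OF that] by (simp add: comm add.commute)
 ultimately show ?case using 1 by blast
qed

end

section \<open>Linear algebra over graded residue fields and Nakayama's lemma\<close>

context even_graded_ring
begin

text \<open>Gaussian elimination over the graded residue field of \<open>p\<close>: among all \<open>\<pi>\<close> agreeing modulo \<open>B\<close>
 with a scalar outside \<open>p\<close>, one that kills as many coordinates as possible maps \<open>B\<close> into \<open>p Q\<close>.\<close>

lemma elimination:
 assumes Q: "gm Q" and db: "dual_basis Q n q d \<phi>" and p: "p : Spec A"
  and Bc: "B \<subseteq> carrier Q"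
  and Badd: "!!x y. x : B ==> y : B ==> x \<oplus>\<^bsub>Q\<^esub> y : B"
  and Bsm: "!!a x. a : carrier A ==> x : B ==> a \<odot>\<^bsub>Q\<^esub> x : B"
  and Bzero: "\<zero>\<^bsub>Q\<^esub> : B"
 shows "EX t k \<pi>. t : rgrad A k & t ~: p & lmap k Q Q \<pi> &
  (ALL x:carrier Q. t \<odot>\<^bsub>Q\<^esub> x \<ominus>\<^bsub>Q\<^esub> \<pi> x : B) & (ALL i. ALL x : B \<inter> mgrad Q i. \<pi> x : IM p Q)"
proof -
 let ?ok = "%t k \<pi>. t : rgrad A k & t ~: p & lmap k Q Q \<pi> & (ALL x:carrier Q. t \<odot>\<^bsub>Q\<^esub> x \<ominus>\<^bsub>Q\<^esub> \<pi> x : B)"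
 let ?Z = "%\<pi>. {i. i < n & (ALL x:carrier Q. \<phi> i (\<pi> x) = \<zero>)}"
 note pI = SpecD(2)[OF p]
 have "EX t k \<pi>. ?ok t k \<pi> & (ALL i. ALL x : B \<inter> mgrad Q i. \<pi> x : IM p Q)" if "?ok t k \<pi>" for t k \<pi>
  using that
 proof (induction "n - card (?Z \<pi>)" arbitrary: t k \<pi> rule: less_induct)
  case less
  note t = less.prems
  have tc: "t : carrier A" using t by auto
  note \<pi>D = lmapD[OF conjunct1[OF conjunct2[OF conjunct2[OF t]]]]
  show ?case
  proof (cases "ALL i. ALL x : B \<inter> mgrad Q i. \<pi> x : IM p Q")
   case False
   then obtain j b where b: "b : B" "b : mgrad Q j" "\<pi> b ~: IM p Q" by blast
   have bc: "b : carrier Q" using b Bc by blast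
   obtain i where i: "i < n" "\<phi> i (\<pi> b) ~: p"
    using IM_dual[OF Q pI db \<pi>D(1)[OF bc]] b(3) by blast
   define u where "u = \<phi> i (\<pi> b)"
   define b' where "b' = \<pi> b"
   have b'c: "b' : carrier Q" and b'd: "b' : mgrad Q (j + k)"
    using \<pi>D(1)[OF bc] \<pi>D(4)[OF b(2)] by (auto simp: b'_def)
   have ud: "u : rgrad A (j + k - d i)" using db_closed(3)[OF Q db i(1) b'd] by (simp add: u_def b'_def)
   then have uc: "u : carrier A" by simp
   \<comment> \<open>A pivot step without division: \<open>u\<close> is an entry of
     \<open>\<pi> b\<close> outside \<open>p\<close>. Multiplying by \<open>u\<close> and
     subtracting a multiple of \<open>b'\<close> clears coordinate \<open>i\<close> and keeps the
     coordinates already cleared, since \<open>b'\<close> vanishes there. As \<open>b'\<close> lies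
     in \<open>B\<close>, the new map still agrees with a scalar modulo \<open>B\<close>.\<close>
   define \<pi>' where "\<pi>' x = u \<odot>\<^bsub>Q\<^esub> \<pi> x \<ominus>\<^bsub>Q\<^esub> \<phi> i (\<pi> x) \<odot>\<^bsub>Q\<^esub> b'" for x
   have phl: "lmap (k + - d i) Q U (%x. \<phi> i (\<pi> x))"
    using lmap_comp[OF _ dbD(2)[OF db i(1)]] t by blast
   have 1: "lmap (k + (j + k - d i)) Q Q (%x. u \<odot>\<^bsub>Q\<^esub> \<pi> x)"
    using lmap_smult_left[OF Q Q _ ud] t by blast
   have 2: "lmap (k + (j + k - d i)) Q Q (%x. \<phi> i (\<pi> x) \<odot>\<^bsub>Q\<^esub> b')"
    using lmap_cong[OF lmap_scale[OF Q Q phl b'd] Q] by (simp add: algebra_simps)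
   have \<pi>': "lmap (k + (j + k - d i)) Q Q \<pi>'"
    unfolding \<pi>'_def by (rule lmap_subtract[OF Q Q 1 2])
   have Bdiff: "x \<ominus>\<^bsub>Q\<^esub> y : B" if "x : B" "y : B" for x y
   proof -
    have "x \<ominus>\<^bsub>Q\<^esub> y = x \<oplus>\<^bsub>Q\<^esub> (\<ominus> \<one>) \<odot>\<^bsub>Q\<^esub> y"
     using that Bc Q by (auto simp: a_minus_def smult_minus_l)
    then show ?thesis using that Badd Bsm by simp
   qed
   have b'B: "b' : B"
   proof -
    have "b' = t \<odot>\<^bsub>Q\<^esub> b \<ominus>\<^bsub>Q\<^esub> (t \<odot>\<^bsub>Q\<^esub> b \<ominus>\<^bsub>Q\<^esub> \<pi> b)"
     using bc tc \<pi>D(1)[OF bc] Q by (simp add: b'_def group_arith group_closed)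
    then show ?thesis using Bdiff t bc Bsm[OF tc b(1)] by simp
   qed
   have phc: "\<phi> i (\<pi> x) : carrier A" if "x : carrier Q" for x
    using db_closed(2)[OF Q db i(1) \<pi>D(1)[OF that]] .
   have B': "(u \<otimes> t) \<odot>\<^bsub>Q\<^esub> x \<ominus>\<^bsub>Q\<^esub> \<pi>' x : B" if x: "x : carrier Q" for x
   proof -
    have "(u \<otimes> t) \<odot>\<^bsub>Q\<^esub> x \<ominus>\<^bsub>Q\<^esub> \<pi>' x = u \<odot>\<^bsub>Q\<^esub> (t \<odot>\<^bsub>Q\<^esub> x \<ominus>\<^bsub>Q\<^esub> \<pi> x) \<oplus>\<^bsub>Q\<^esub> \<phi> i (\<pi> x) \<odot>\<^bsub>Q\<^esub> b'"
     using x uc tc Q \<pi>D(1)[OF x] phc[OF x] b'c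
     by (simp add: \<pi>'_def group_arith group_closed smult_arith)
    then show ?thesis using t x uc phc[OF x] b'B by (simp add: Badd Bsm)
   qed
   have ok': "?ok (u \<otimes> t) (k + (j + k - d i)) \<pi>'"
    using \<pi>' B' A_mult[OF ud, of t k] t den_mult[OF p ud _ conjunct1[OF t], of] i(2)
    by (simp add: u_def algebra_simps)
   have "?Z \<pi> \<subset> ?Z \<pi>'"
   proof
    have key: "\<phi> l (\<pi>' x) = u \<otimes> \<phi> l (\<pi> x) \<ominus> \<phi> i (\<pi> x) \<otimes> \<phi> l b'"
     if "l < n" "x : carrier Q" for l x
     using lmap_diff[OF Q unit_gm dbD(2)[OF db that(1)]] lmap_smult[OF dbD(2)[OF db that(1)]]
      that uc Q \<pi>D(1) phc b'c by (simp add: \<pi>'_def)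
    show "?Z \<pi> \<subseteq> ?Z \<pi>'"
    proof clarsimp
     fix l x assume l: "l < n" "ALL x:carrier Q. \<phi> l (\<pi> x) = \<zero>" and x: "x : carrier Q"
     have "\<phi> l b' = \<zero>" using l(2) bc by (simp add: b'_def)
     then show "\<phi> l (\<pi>' x) = \<zero>" using key[OF l(1) x] l(2) x uc phc[OF x] by (simp add: GA.gr_diff_self)
    qed
    have "i : ?Z \<pi>'"
     using i(1) key[OF i(1)] phc uc by (simp add: m_comm GA.gr_diff_self flip: u_def b'_def) (simp add: u_def b'_def m_comm GA.gr_diff_self)
    moreover have "\<phi> i (\<pi> b) ~= \<zero>" using i(2) ideal_simps(2)[OF pI] by metis
    then have "i ~: ?Z \<pi>" using bc by blast
    ultimately show "?Z \<pi> ~= ?Z \<pi>'" by blast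
   qed
   moreover have "finite (?Z \<pi>')" by simp
   ultimately have "card (?Z \<pi>) < card (?Z \<pi>')" by (rule psubset_card_mono[rotated])
   moreover have "card (?Z \<pi>') \<le> card {..<n}" by (rule card_mono) auto
   ultimately have "n - card (?Z \<pi>') < n - card (?Z \<pi>)" by simp
   from less.hyps[OF this ok'] show ?thesis .
  qed (use t in blast)
 qed
 moreover have "?ok \<one> 0 (%x. x)"
  using SpecD(3)[OF p] lmap_id Bzero Q by (simp add: group_arith)
 ultimately show ?thesis by (metis (no_types, lifting))
qed

text \<open>For \<open>I = p\<close> and \<open>s\<close> outside \<open>p\<close> this says that
  the reduction of \<open>Q\<close> to the residue field at \<open>p\<close> is contractible, with
  the denominator \<open>s\<close> cleared. A scalar of degree \<open>l\<close> raises the degree of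
  the homotopy to \<open>l + 1\<close>.\<close>

definition null_mod :: "'a set => ('a, 'm) dg_module => 'a => int => ('m => 'm) => bool" where
 "null_mod I Q s l h \<longleftrightarrow> s : rgrad A l & lmap (l + 1) Q Q h &
  (ALL x:carrier Q. eqm I Q (s \<odot>\<^bsub>Q\<^esub> x) (\<partial>\<^bsub>Q\<^esub> (h x) \<oplus>\<^bsub>Q\<^esub> h (\<partial>\<^bsub>Q\<^esub> x)))"

text \<open>The version of \<open>null_mod\<close> with equality in place of congruence. Vanishing
  of the localization at \<open>p\<close> amounts to such an \<open>s\<close> outside
  \<open>p\<close>, see \<open>not_in_supp_iff\<close>.\<close>

definition null :: "('a, 'm) dg_module => 'a => int => ('m => 'm) => bool" where
 "null Q s l h \<longleftrightarrow> s : rgrad A l & lmap (l + 1) Q Q h &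
  (ALL x:carrier Q. s \<odot>\<^bsub>Q\<^esub> x = \<partial>\<^bsub>Q\<^esub> (h x) \<oplus>\<^bsub>Q\<^esub> h (\<partial>\<^bsub>Q\<^esub> x))"

lemma dg_gm [simp]: "dg_module A M ==> gm M"
 and dg_lmap: "dg_module A M ==> lmap (-1) M M \<partial>\<^bsub>M\<^esub>"
 and dg_dd: "dg_module A M ==> x : carrier M ==> \<partial>\<^bsub>M\<^esub> (\<partial>\<^bsub>M\<^esub> x) = \<zero>\<^bsub>M\<^esub>"
 using graded_linear_iff[of M M "-1"] by (auto simp: dg_module_def)

lemma dgD:
 assumes "dg_module A M"
 shows "x : carrier M ==> \<partial>\<^bsub>M\<^esub> x : carrier M"
  "x : carrier M ==> y : carrier M ==> \<partial>\<^bsub>M\<^esub> (x \<oplus>\<^bsub>M\<^esub> y) = \<partial>\<^bsub>M\<^esub> x \<oplus>\<^bsub>M\<^esub> \<partial>\<^bsub>M\<^esub> y"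
  "a : carrier A ==> x : carrier M ==> \<partial>\<^bsub>M\<^esub> (a \<odot>\<^bsub>M\<^esub> x) = a \<odot>\<^bsub>M\<^esub> \<partial>\<^bsub>M\<^esub> x"
  "x : mgrad M i ==> \<partial>\<^bsub>M\<^esub> x : mgrad M (i - 1)"
  "x : carrier M ==> y : carrier M ==> \<partial>\<^bsub>M\<^esub> (x \<ominus>\<^bsub>M\<^esub> y) = \<partial>\<^bsub>M\<^esub> x \<ominus>\<^bsub>M\<^esub> \<partial>\<^bsub>M\<^esub> y"
  "x : carrier M ==> \<partial>\<^bsub>M\<^esub> (\<ominus>\<^bsub>M\<^esub> x) = \<ominus>\<^bsub>M\<^esub> \<partial>\<^bsub>M\<^esub> x"
  "\<partial>\<^bsub>M\<^esub> \<zero>\<^bsub>M\<^esub> = \<zero>\<^bsub>M\<^esub>"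
  "x : carrier M ==> \<partial>\<^bsub>M\<^esub> (\<partial>\<^bsub>M\<^esub> x) = \<zero>\<^bsub>M\<^esub>"
 using lmapD[OF dg_lmap[OF assms]] lmapD0[OF _ _ dg_lmap[OF assms]] assms dg_dd by auto

end

context even_graded_ring
begin

lemma spec_notin:
 assumes "p : Spec A" "s : carrier A" "s ~: p" "t : carrier A" "t ~: p"
 shows "s \<otimes> t ~: p"
 using SpecD(4)[OF assms(1,2,4)] assms by blast

text \<open>An acyclic complex over a field is contractible; here denominators are cleared and
  equations hold modulo \<open>p\<close>. Elimination applied to the cycles \<open>B\<close> gives
  \<open>\<pi>\<close>, a scaled projection that kills \<open>B\<close>, and
  \<open>w = t - \<pi>\<close> with values in \<open>B\<close>. Lifting \<open>w\<close> through the
  differential on a dual basis gives \<open>h0\<close>. The contraction is \<open>\<pi> h0\<close>: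
  the map \<open>v = h0 \<partial> - s t\<close> takes values in cycles, so
  \<open>\<pi> h0 \<partial>\<close> is congruent to \<open>s t \<pi>\<close>, while
  \<open>\<partial> \<pi> h0\<close> is congruent to \<open>t s w\<close>.\<close>

lemma contraction:
 assumes Q: "dg_module A Q" and db: "dual_basis Q n q d \<phi>" and p: "p : Spec A"
  and cyc: "!!x j. x : mgrad Q j ==> \<partial>\<^bsub>Q\<^esub> x : IM p Q ==>
   EX l s. s : rgrad A l & s ~: p & (EX y : mgrad Q (j + l + 1). s \<odot>\<^bsub>Q\<^esub> x \<ominus>\<^bsub>Q\<^esub> \<partial>\<^bsub>Q\<^esub> y : IM p Q)"
 shows "EX s l h. s ~: p & null_mod p Q s l h"
proof -
 note g [simp] = dg_gm[OF Q]
 note pI = SpecD(2)[OF p]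
 note dD = dgD[OF Q]
 note e_trans = eqm_trans[OF g pI] and e_sym = eqm_sym[OF g pI] and e_refl = eqm_refl[OF g pI]
  and e_sm = eqm_smult[OF g pI] and e_diff = eqm_diff[OF g pI] and e_add = eqm_add[OF g pI]
  and e_z = eqm_zero_iff[OF g pI]
 define B where "B = {x : carrier Q. \<partial>\<^bsub>Q\<^esub> x : IM p Q}"
 have "EX t k \<pi>. t : rgrad A k & t ~: p & lmap k Q Q \<pi> &
  (ALL x:carrier Q. t \<odot>\<^bsub>Q\<^esub> x \<ominus>\<^bsub>Q\<^esub> \<pi> x : B) & (ALL i. ALL x : B \<inter> mgrad Q i. \<pi> x : IM p Q)"
  by (rule elimination[OF g db p])
   (auto simp: B_def dD IM_add[OF g pI] IM_smult[OF g pI] IM_zero[OF g pI] group_closed)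
 then obtain t k \<pi> where t: "t : rgrad A k" "t ~: p" and \<pi>: "lmap k Q Q \<pi>"
  and tB: "!!x. x : carrier Q ==> t \<odot>\<^bsub>Q\<^esub> x \<ominus>\<^bsub>Q\<^esub> \<pi> x : B"
  and \<pi>B: "!!i x. x : B ==> x : mgrad Q i ==> \<pi> x : IM p Q" by blast
 note \<pi>D = lmapD[OF \<pi>] lmapD0[OF g g \<pi>]
 have tc [simp]: "t : carrier A" using t by auto
 define w where "w x = t \<odot>\<^bsub>Q\<^esub> x \<ominus>\<^bsub>Q\<^esub> \<pi> x" for x
 have wl: "lmap k Q Q w"
  using lmap_subtract[OF g g _ \<pi>] lmap_smult_left[OF g g lmap_id t(1)] by (simp add: w_def[abs_def])
 let ?P = "%i l s. EX y : mgrad Q (d i + k + l + 1). s \<odot>\<^bsub>Q\<^esub> w (q i) \<ominus>\<^bsub>Q\<^esub> \<partial>\<^bsub>Q\<^esub> y : IM p Q"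
 have "EX l s. s : rgrad A l & s ~: p & (ALL i:{..<n}. ?P i l s)"
 proof (rule common_den[OF p])
  fix i assume "i : {..<n}"
  then have i: "i < n" by simp
  have "w (q i) : mgrad Q (d i + k)" using lmap_deg[OF wl dbD(1)[OF db i]] .
  moreover have "\<partial>\<^bsub>Q\<^esub> (w (q i)) : IM p Q"
   using tB[OF db_closed(1)[OF g db i]] by (simp add: B_def w_def)
  ultimately show "EX l s. s : rgrad A l & s ~: p & ?P i l s" by (rule cyc)
 next
  fix i l s m u assume i: "i : {..<n}" and s: "s : rgrad A l" and u: "u : rgrad A m" and P: "?P i l s"
  then obtain y where y: "y : mgrad Q (d i + k + l + 1)" "s \<odot>\<^bsub>Q\<^esub> w (q i) \<ominus>\<^bsub>Q\<^esub> \<partial>\<^bsub>Q\<^esub> y : IM p Q" by blast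
  have c: "y : carrier Q" "w (q i) : carrier Q" "u : carrier A" "s : carrier A"
   using y gm_carrier[OF g] lmap_closed[OF wl] db_closed(1)[OF g db] i s u by auto
  have "(u \<otimes> s) \<odot>\<^bsub>Q\<^esub> w (q i) \<ominus>\<^bsub>Q\<^esub> \<partial>\<^bsub>Q\<^esub> (u \<odot>\<^bsub>Q\<^esub> y) = u \<odot>\<^bsub>Q\<^esub> (s \<odot>\<^bsub>Q\<^esub> w (q i) \<ominus>\<^bsub>Q\<^esub> \<partial>\<^bsub>Q\<^esub> y)"
   using c by (simp add: dD smult_arith)
  moreover have "u \<odot>\<^bsub>Q\<^esub> y : mgrad Q (d i + k + (m + l) + 1)"
   using gm_smult_deg[OF g u y(1)] by (simp add: algebra_simps)
  ultimately show "?P i (m + l) (u \<otimes> s)"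
   using IM_smult[OF g pI y(2) c(3)] by (metis (no_types, lifting))
 qed simp
 then obtain l s where s: "s : rgrad A l" "s ~: p" and "ALL i:{..<n}. ?P i l s" by blast
 then obtain y where y: "!!i. i < n ==> y i : mgrad Q (d i + (k + l + 1))"
  and yw: "!!i. i < n ==> s \<odot>\<^bsub>Q\<^esub> w (q i) \<ominus>\<^bsub>Q\<^esub> \<partial>\<^bsub>Q\<^esub> (y i) : IM p Q"
  unfolding Ball_def Bex_def lessThan_iff by (metis (no_types, lifting) add.assoc)
 have sc [simp]: "s : carrier A" using s by auto
 define h0 where "h0 x = finsum Q (%i. \<phi> i x \<odot>\<^bsub>Q\<^esub> y i) {..<n}" for x
 have h0: "lmap (k + l + 1) Q Q h0"
  unfolding h0_def[abs_def] by (rule db_lmap[OF g g db y])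
 note hD = lmapD[OF h0] lmapD0[OF g g h0]
 have wc: "w x : carrier Q" if "x : carrier Q" for x using lmap_closed[OF wl that] .
 have yc: "y i : carrier Q" if "i < n" for i using gm_carrier[OF g y[OF that]] .
 note qc = db_closed[OF g db]
 have dh0: "eqm p Q (\<partial>\<^bsub>Q\<^esub> (h0 x)) (s \<odot>\<^bsub>Q\<^esub> w x)" if x: "x : carrier Q" for x
 proof -
  have "\<partial>\<^bsub>Q\<^esub> (h0 x) = finsum Q (%i. \<partial>\<^bsub>Q\<^esub> (\<phi> i x \<odot>\<^bsub>Q\<^esub> y i)) {..<n}"
   unfolding h0_def using x yc qc by (intro lmap_finsum[OF g g dg_lmap[OF Q]]) auto
  also have "\<dots> = finsum Q (%i. \<phi> i x \<odot>\<^bsub>Q\<^esub> \<partial>\<^bsub>Q\<^esub> (y i)) {..<n}"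
   using x yc qc by (intro finsum_congr) (auto simp: dD)
  finally have 1: "\<partial>\<^bsub>Q\<^esub> (h0 x) = finsum Q (%i. \<phi> i x \<odot>\<^bsub>Q\<^esub> \<partial>\<^bsub>Q\<^esub> (y i)) {..<n}" .
  have swl: "lmap (k + l) Q Q (%x. s \<odot>\<^bsub>Q\<^esub> w x)" by (rule lmap_smult_left[OF g g wl s(1)])
  have 2: "s \<odot>\<^bsub>Q\<^esub> w x = finsum Q (%i. \<phi> i x \<odot>\<^bsub>Q\<^esub> (s \<odot>\<^bsub>Q\<^esub> w (q i))) {..<n}"
   by (rule db_expand[OF g g db swl x])
  show ?thesis unfolding 1 2
  proof (rule eqm_finsum[OF g pI])
   fix i assume "i : {..<n}"
   then have i: "i < n" by simp
   have "eqm p Q (s \<odot>\<^bsub>Q\<^esub> w (q i)) (\<partial>\<^bsub>Q\<^esub> (y i))"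
    using yw[OF i] wc[OF qc(1)[OF i]] yc[OF i] by (simp add: eqm_def dD)
   then show "eqm p Q (\<phi> i x \<odot>\<^bsub>Q\<^esub> \<partial>\<^bsub>Q\<^esub> (y i)) (\<phi> i x \<odot>\<^bsub>Q\<^esub> (s \<odot>\<^bsub>Q\<^esub> w (q i)))"
    by (rule e_sm[OF qc(2)[OF i x] e_sym])
  qed simp
 qed
 have dpi: "eqm p Q (\<partial>\<^bsub>Q\<^esub> (\<pi> z)) (t \<odot>\<^bsub>Q\<^esub> \<partial>\<^bsub>Q\<^esub> z)" if z: "z : carrier Q" for z
 proof (rule e_sym)
  have "\<partial>\<^bsub>Q\<^esub> (t \<odot>\<^bsub>Q\<^esub> z \<ominus>\<^bsub>Q\<^esub> \<pi> z) : IM p Q" using tB[OF z] by (simp add: B_def)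
  then show "eqm p Q (t \<odot>\<^bsub>Q\<^esub> \<partial>\<^bsub>Q\<^esub> z) (\<partial>\<^bsub>Q\<^esub> (\<pi> z))"
   using z by (simp add: eqm_def dD \<pi>D)
 qed
 have pid: "\<pi> (\<partial>\<^bsub>Q\<^esub> x) : IM p Q" if x: "x : carrier Q" for x
 proof (rule IM_hom_all[OF g g pI lmap_comp[OF dg_lmap[OF Q] \<pi>] _ x])
  fix i x assume x: "x : mgrad Q i"
  note xc = gm_carrier[OF g x]
  have "\<partial>\<^bsub>Q\<^esub> x : B" using xc by (simp add: B_def dD IM_zero[OF g pI])
  then show "\<pi> (\<partial>\<^bsub>Q\<^esub> x) : IM p Q" using dD(4)[OF x] by (rule \<pi>B)
 qed
 define v where "v x = h0 (\<partial>\<^bsub>Q\<^esub> x) \<ominus>\<^bsub>Q\<^esub> (s \<otimes> t) \<odot>\<^bsub>Q\<^esub> x" for x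
 have st: "s \<otimes> t : rgrad A (l + k)" by (rule A_mult[OF s(1) t(1)])
 have vl: "lmap (k + l) Q Q v"
  unfolding v_def[abs_def]
 proof (rule lmap_subtract[OF g g])
  show "lmap (k + l) Q Q (%x. h0 (\<partial>\<^bsub>Q\<^esub> x))"
   by (rule lmap_cong[OF lmap_comp[OF dg_lmap[OF Q] h0] g]) auto
  show "lmap (k + l) Q Q (%x. (s \<otimes> t) \<odot>\<^bsub>Q\<^esub> x)"
   by (rule lmap_cong[OF lmap_smult_left[OF g g lmap_id st] g]) auto
 qed
 have vB: "v x : B" if x: "x : carrier Q" for x
 proof -
  have 1: "eqm p Q (\<partial>\<^bsub>Q\<^esub> (h0 (\<partial>\<^bsub>Q\<^esub> x))) (s \<odot>\<^bsub>Q\<^esub> w (\<partial>\<^bsub>Q\<^esub> x))" by (rule dh0) (simp add: dD x)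
  have 2: "eqm p Q (s \<odot>\<^bsub>Q\<^esub> w (\<partial>\<^bsub>Q\<^esub> x)) (s \<odot>\<^bsub>Q\<^esub> (t \<odot>\<^bsub>Q\<^esub> \<partial>\<^bsub>Q\<^esub> x))"
  proof (rule e_sm)
   have "w (\<partial>\<^bsub>Q\<^esub> x) \<ominus>\<^bsub>Q\<^esub> t \<odot>\<^bsub>Q\<^esub> \<partial>\<^bsub>Q\<^esub> x = \<ominus>\<^bsub>Q\<^esub> \<pi> (\<partial>\<^bsub>Q\<^esub> x)"
    using x by (simp add: w_def dD \<pi>D group_arith group_closed)
   then show "eqm p Q (w (\<partial>\<^bsub>Q\<^esub> x)) (t \<odot>\<^bsub>Q\<^esub> \<partial>\<^bsub>Q\<^esub> x)"
    using x IM_minus[OF g pI pid[OF x]] by (simp add: eqm_def wc dD)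
  qed simp
  have 3: "eqm p Q (s \<odot>\<^bsub>Q\<^esub> (t \<odot>\<^bsub>Q\<^esub> \<partial>\<^bsub>Q\<^esub> x)) (\<partial>\<^bsub>Q\<^esub> ((s \<otimes> t) \<odot>\<^bsub>Q\<^esub> x))"
   using x e_refl by (simp add: dD smult_arith)
  show ?thesis
   using e_trans[OF e_trans[OF 1 2] 3] x by (simp add: eqm_def B_def v_def dD hD group_closed)
 qed
 have piv: "\<pi> (v x) : IM p Q" if x: "x : carrier Q" for x
 proof (rule IM_hom_all[OF g g pI lmap_comp[OF vl \<pi>] _ x])
  fix i x assume x: "x : mgrad Q i"
  show "\<pi> (v x) : IM p Q" by (rule \<pi>B[OF vB[OF gm_carrier[OF g x]] lmap_deg[OF vl x]])
 qed
 \<comment> \<open>One factor \<open>t\<close> comes from moving the differential past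
   \<open>\<pi>\<close>, the factor \<open>s\<close> from lifting cycles to chains, and the other
   \<open>t\<close> from \<open>w x + \<pi> x = t x\<close>.\<close>
 define c where "c = t \<otimes> (s \<otimes> t)"
 have cd: "c : rgrad A (k + (l + k))" unfolding c_def by (rule A_mult[OF t(1) st])
 have cp: "c ~: p" unfolding c_def by (intro spec_notin[OF p] tc sc s t m_closed)
 have hl: "lmap (k + (l + k) + 1) Q Q (%x. \<pi> (h0 x))"
  by (rule lmap_cong[OF lmap_comp[OF h0 \<pi>] g]) auto
 have "eqm p Q (c \<odot>\<^bsub>Q\<^esub> x) (\<partial>\<^bsub>Q\<^esub> (\<pi> (h0 x)) \<oplus>\<^bsub>Q\<^esub> \<pi> (h0 (\<partial>\<^bsub>Q\<^esub> x)))" if x: "x : carrier Q" for x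
 proof -
  have 1: "eqm p Q (\<partial>\<^bsub>Q\<^esub> (\<pi> (h0 x))) (t \<odot>\<^bsub>Q\<^esub> (s \<odot>\<^bsub>Q\<^esub> w x))"
   by (rule e_trans[OF dpi e_sm[OF _ dh0]]) (simp_all add: x hD)
  have "\<pi> (h0 (\<partial>\<^bsub>Q\<^esub> x)) \<ominus>\<^bsub>Q\<^esub> (s \<otimes> t) \<odot>\<^bsub>Q\<^esub> \<pi> x = \<pi> (v x)"
   using x by (simp add: v_def \<pi>D hD dD)
  then have 2: "eqm p Q (\<pi> (h0 (\<partial>\<^bsub>Q\<^esub> x))) ((s \<otimes> t) \<odot>\<^bsub>Q\<^esub> \<pi> x)"
   using piv[OF x] x by (simp add: eqm_def \<pi>D hD dD)
  have "t \<odot>\<^bsub>Q\<^esub> (s \<odot>\<^bsub>Q\<^esub> w x) \<oplus>\<^bsub>Q\<^esub> (s \<otimes> t) \<odot>\<^bsub>Q\<^esub> \<pi> x = c \<odot>\<^bsub>Q\<^esub> x"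
   using x by (simp add: w_def c_def \<pi>D smult_arith group_arith group_closed m_ac)
  then show ?thesis using e_sym[OF e_add[OF 1 2]] by simp
 qed
 then have "null_mod p Q c (k + (l + k)) (%x. \<pi> (h0 x))"
  using cd hl by (simp add: null_mod_def)
 then show ?thesis using cp by blast
qed

text \<open>Nakayama's lemma by eliminating generators one at a time. The invariant
  \<open>?S\<close> says that \<open>t Q\<close> lies in the span of the first \<open>m\<close>
  generators plus the image of \<open>g\<close>, with coefficients that depend linearly on the
  element. It holds for \<open>m = n\<close> by the dual basis, with \<open>t = 1\<close> and
  \<open>f = 0\<close>; at \<open>m = 0\<close> the map \<open>f\<close> is an inverse of
  \<open>g\<close> up to \<open>t\<close>.\<close>

lemma nakayama_inverse:
 assumes Q: "gm Q" and db: "dual_basis Q n q d \<phi>" and p: "p : Spec A"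
  and g: "lmap k Q Q g" and s: "s : rgrad A k" "s ~: p"
  and gs: "!!x. x : carrier Q ==> eqm p Q (s \<odot>\<^bsub>Q\<^esub> x) (g x)"
 shows "EX t l f. t : rgrad A l & t ~: p & lmap (l - k) Q Q f & (ALL x:carrier Q. g (f x) = t \<odot>\<^bsub>Q\<^esub> x)"
proof -
 note pI = SpecD(2)[OF p]
 note gD = lmapD[OF g] lmapD0[OF Q Q g]
 have sc [simp]: "s : carrier A" using s by auto
 note [simp] = Q
 note qc = db_closed[OF Q db]
 interpret Q: abelian_group Q using Q by simp
 let ?S = "%m t l c f. t : rgrad A l & t ~: p & lmap (l - k) Q Q f & (ALL j<m. lmap (l - d j) Q U (c j)) &
  (ALL x:carrier Q. t \<odot>\<^bsub>Q\<^esub> x = finsum Q (%j. c j x \<odot>\<^bsub>Q\<^esub> q j) {..<m} \<oplus>\<^bsub>Q\<^esub> g (f x))"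
 have "EX t l f. t : rgrad A l & t ~: p & lmap (l - k) Q Q f & (ALL x:carrier Q. g (f x) = t \<odot>\<^bsub>Q\<^esub> x)"
  if "?S m t l c f" "m \<le> n" for m t l c f
  using that
 proof (induction m arbitrary: t l c f)
  case 0
  then have "g (f x) = t \<odot>\<^bsub>Q\<^esub> x" if "x : carrier Q" for x
   using that gD(1) lmap_closed[of "l - k" Q Q f x] by simp
  then show ?case using 0 by blast
 next
  case (Suc m)
  have m: "m < n" using Suc.prems by simp
  have t: "t : rgrad A l" "t ~: p" and f: "lmap (l - k) Q Q f"
   and c: "!!j. j \<le> m ==> lmap (l - d j) Q U (c j)"
   and eq: "!!x. x : carrier Q ==>
    t \<odot>\<^bsub>Q\<^esub> x = finsum Q (%j. c j x \<odot>\<^bsub>Q\<^esub> q j) {..<Suc m} \<oplus>\<^bsub>Q\<^esub> g (f x)"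
   using Suc.prems by (auto simp: less_Suc_eq_le)
  have tc [simp]: "t : carrier A" using t by auto
  note fD = lmapD[OF f] lmapD0[OF Q Q f]
  have cc: "c j x : carrier A" if "j \<le> m" "x : carrier Q" for j x
   using lmap_closed[OF c[OF that(1)] that(2)] by simp
  have qcm: "q j : carrier Q" if "j \<le> m" for j using qc(1)[of j] m that by simp
  define F where "F x = finsum Q (%j. c j x \<odot>\<^bsub>Q\<^esub> q j) {..<m}" for x
  have Fc: "F x : carrier Q" if "x : carrier Q" for x
   unfolding F_def using that cc qcm by (intro finsum_lmap_closed) auto
  have eq': "t \<odot>\<^bsub>Q\<^esub> x = (F x \<oplus>\<^bsub>Q\<^esub> c m x \<odot>\<^bsub>Q\<^esub> q m) \<oplus>\<^bsub>Q\<^esub> g (f x)" if "x : carrier Q" for x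
   unfolding F_def eq[OF that] using that cc qcm by (subst finsum_Suc') auto
  define e where "e = s \<odot>\<^bsub>Q\<^esub> q m \<ominus>\<^bsub>Q\<^esub> g (q m)"
  have qm: "q m : carrier Q" and qmd: "q m : mgrad Q (d m)" using qc(1)[OF m] dbD(1)[OF db m] .
  have ec: "e : carrier Q" using qm by (simp add: e_def gD)
  have ed: "e : mgrad Q (k + d m)"
   unfolding e_def using gm_smult_deg[OF Q s(1) qmd] gD(4)[OF qmd]
   by (intro graded_group.G_diff[OF gm_graded[OF Q]]) (simp_all add: add.commute)
  have ep: "e : IM p Q" using gs[OF qm] by (simp add: e_def eqm_def)
  \<comment> \<open>The error \<open>e\<close> lies in \<open>p Q\<close>, so \<open>c m e\<close>
    lies in \<open>p\<close> and \<open>u\<close> stays outside \<open>p\<close>. Expanding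
    \<open>t e\<close> by the current relation and moving the term \<open>c m e q_m\<close> to the
    other side expresses \<open>u q_m\<close> by the earlier generators and the image of
    \<open>g\<close>.\<close>
  define u where "u = t \<otimes> s \<ominus> c m e"
  have ce: "c m e : carrier A" using cc[OF _ ec] by simp
  have uc: "u : carrier A" using ce by (simp add: u_def)
  have up: "u ~: p"
  proof
   assume "u : p"
   moreover have "c m e : p" using IMD[OF ep c[of m]] by simp
   ultimately have "u \<oplus> c m e : p" by (rule ideal_simps(3)[OF pI])
   moreover have "u \<oplus> c m e = t \<otimes> s" using ce by (simp add: u_def GA.gr_diff_add GA.gr_diff_eq GA.minus_closed)
   ultimately show False using spec_notin[OF p tc t(2) sc s(2)] by simp
  qed
  have ud: "u : rgrad A (l + k)"
   unfolding u_def using A_mult[OF t(1) s(1)] lmap_deg[OF c[of m] ed]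
   by (intro GA.G_diff) (simp_all add: algebra_simps)
  define z where "z = t \<odot>\<^bsub>Q\<^esub> q m \<oplus>\<^bsub>Q\<^esub> f e"
  have zc: "z : carrier Q" using qm ec by (simp add: z_def fD group_closed)
  have zd: "z : mgrad Q (l + d m)"
   unfolding z_def using gm_smult_deg[OF Q t(1) qmd] fD(4)[OF ed]
   by (intro graded_group.G_add[OF gm_graded[OF Q]]) (simp_all add: algebra_simps)
  have uq: "u \<odot>\<^bsub>Q\<^esub> q m = F e \<oplus>\<^bsub>Q\<^esub> g z"
  proof -
   have "t \<odot>\<^bsub>Q\<^esub> e = (t \<otimes> s) \<odot>\<^bsub>Q\<^esub> q m \<ominus>\<^bsub>Q\<^esub> g (t \<odot>\<^bsub>Q\<^esub> q m)"
    using qm by (simp add: e_def smult_arith gD)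
   then have "(t \<otimes> s) \<odot>\<^bsub>Q\<^esub> q m \<ominus>\<^bsub>Q\<^esub> g (t \<odot>\<^bsub>Q\<^esub> q m) = (F e \<oplus>\<^bsub>Q\<^esub> c m e \<odot>\<^bsub>Q\<^esub> q m) \<oplus>\<^bsub>Q\<^esub> g (f e)"
    using eq'[OF ec] by simp
   then show ?thesis using qm ec ce Fc[OF ec]
    by (simp add: u_def z_def smult_arith gD fD group_arith group_closed)
  qed
  define c' where "c' j x = u \<otimes> c j x \<oplus> c m x \<otimes> c j e" for j x
  define f' where "f' x = u \<odot>\<^bsub>Q\<^esub> f x \<oplus>\<^bsub>Q\<^esub> c m x \<odot>\<^bsub>Q\<^esub> z" for x
  have f': "lmap (l + (l + k) - k) Q Q f'"
   unfolding f'_def[abs_def]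
  proof (rule lmap_add[OF Q Q])
   show "lmap (l + (l + k) - k) Q Q (%x. u \<odot>\<^bsub>Q\<^esub> f x)"
    by (rule lmap_cong[OF lmap_smult_left[OF Q Q f ud] Q]) auto
   show "lmap (l + (l + k) - k) Q Q (%x. c m x \<odot>\<^bsub>Q\<^esub> z)"
    by (rule lmap_cong[OF lmap_scale[OF Q Q c[of m] zd] Q]) auto
  qed
  have c': "lmap (l + (l + k) - d j) Q U (c' j)" if j: "j < m" for j
   unfolding c'_def[abs_def]
  proof (rule lmap_add[OF Q unit_gm, simplified])
   show "lmap (l + (l + k) - d j) Q U (%x. u \<otimes> c j x)"
    by (rule lmap_cong[OF lmap_smult_left[OF Q unit_gm c[of j] ud, simplified] Q]) (use j in auto)
   have cj: "c j e : mgrad U (k + d m + (l - d j))" using lmap_deg[OF c[of j] ed] j by simp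
   show "lmap (l + (l + k) - d j) Q U (%x. c m x \<otimes> c j e)"
    by (rule lmap_cong[OF lmap_scale[OF Q unit_gm c[of m] cj, simplified] Q]) auto
  qed
  have eqn: "(t \<otimes> u) \<odot>\<^bsub>Q\<^esub> x = finsum Q (%j. c' j x \<odot>\<^bsub>Q\<^esub> q j) {..<m} \<oplus>\<^bsub>Q\<^esub> g (f' x)"
   if x: "x : carrier Q" for x
  proof -
   have cmx: "c m x : carrier A" using cc[OF _ x] by simp
   have "finsum Q (%j. c' j x \<odot>\<^bsub>Q\<^esub> q j) {..<m} =
     finsum Q (%j. u \<odot>\<^bsub>Q\<^esub> (c j x \<odot>\<^bsub>Q\<^esub> q j) \<oplus>\<^bsub>Q\<^esub> c m x \<odot>\<^bsub>Q\<^esub> (c j e \<odot>\<^bsub>Q\<^esub> q j)) {..<m}"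
    using x ec cc qcm uc cmx by (intro finsum_congr) (auto simp: c'_def smult_arith group_closed)
   also have "\<dots> = u \<odot>\<^bsub>Q\<^esub> F x \<oplus>\<^bsub>Q\<^esub> c m x \<odot>\<^bsub>Q\<^esub> F e"
    unfolding F_def using x ec cc qcm uc cmx
    by (subst finsum_plus) (auto simp: smult_finsum Pi_iff)
   finally have 1: "finsum Q (%j. c' j x \<odot>\<^bsub>Q\<^esub> q j) {..<m} = u \<odot>\<^bsub>Q\<^esub> F x \<oplus>\<^bsub>Q\<^esub> c m x \<odot>\<^bsub>Q\<^esub> F e" .
   have 2: "g (f' x) = u \<odot>\<^bsub>Q\<^esub> g (f x) \<oplus>\<^bsub>Q\<^esub> c m x \<odot>\<^bsub>Q\<^esub> g z"
    using x uc cmx zc by (simp add: f'_def gD fD group_closed)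
   have "(t \<otimes> u) \<odot>\<^bsub>Q\<^esub> x = u \<odot>\<^bsub>Q\<^esub> (t \<odot>\<^bsub>Q\<^esub> x)" using x uc by (simp add: smult_arith m_comm)
   also have "\<dots> = u \<odot>\<^bsub>Q\<^esub> F x \<oplus>\<^bsub>Q\<^esub> c m x \<odot>\<^bsub>Q\<^esub> (u \<odot>\<^bsub>Q\<^esub> q m) \<oplus>\<^bsub>Q\<^esub> u \<odot>\<^bsub>Q\<^esub> g (f x)"
    unfolding eq'[OF x] using x uc cmx Fc[OF x] qm by (simp add: smult_arith gD fD m_comm group_closed)
   also have "\<dots> = u \<odot>\<^bsub>Q\<^esub> F x \<oplus>\<^bsub>Q\<^esub> c m x \<odot>\<^bsub>Q\<^esub> F e \<oplus>\<^bsub>Q\<^esub> g (f' x)"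
    unfolding uq 2 using x uc cmx Fc[OF x] Fc[OF ec] zc
    by (simp add: smult_add_r gD fD group_closed group_arith)
   finally show ?thesis unfolding 1 .
  qed
  have "t \<otimes> u : rgrad A (l + (l + k))" "t \<otimes> u ~: p"
   using A_mult[OF t(1) ud] spec_notin[OF p tc t(2) uc up] by auto
  then have "?S m (t \<otimes> u) (l + (l + k)) c' f'" using f' c' eqn by blast
  moreover have "m \<le> n" using m by simp
  ultimately show ?case by (rule Suc.IH)
 qed
 moreover have "?S n \<one> 0 \<phi> (%_. \<zero>\<^bsub>Q\<^esub>)"
  using SpecD(3)[OF p] lmap_0[OF Q] dbD(2,3)[OF db] gD(5) by simp
 ultimately show ?thesis by blast
qed

end

context even_graded_ring
begin

text \<open>The map \<open>G = \<partial> h + h \<partial>\<close> is congruent to \<open>s\<close>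
  modulo \<open>p\<close> and commutes with the differential. Inverting it up to a scalar and
  composing the inverse with \<open>h\<close> gives an honest null-homotopy, provided the inverse is
  two-sided and commutes with the differential as well.\<close>

lemma nakayama_null:
 assumes Q: "dg_module A Q" and db: "dual_basis Q n q d \<phi>" and p: "p : Spec A"
  and nm: "null_mod p Q s k h" and sp: "s ~: p"
 shows "EX t l h'. t ~: p & null Q t l h'"
proof -
 note g [simp] = dg_gm[OF Q]
 note pI = SpecD(2)[OF p]
 note dD = dgD[OF Q]
 have s: "s : rgrad A k" and h: "lmap (k + 1) Q Q h" and eq: "!!x. x : carrier Q ==>
   eqm p Q (s \<odot>\<^bsub>Q\<^esub> x) (\<partial>\<^bsub>Q\<^esub> (h x) \<oplus>\<^bsub>Q\<^esub> h (\<partial>\<^bsub>Q\<^esub> x))"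
  using nm by (auto simp: null_mod_def)
 have sc [simp]: "s : carrier A" using s by auto
 note hD = lmapD[OF h] lmapD0[OF g g h]
 define G where "G x = \<partial>\<^bsub>Q\<^esub> (h x) \<oplus>\<^bsub>Q\<^esub> h (\<partial>\<^bsub>Q\<^esub> x)" for x
 have G: "lmap k Q Q G" unfolding G_def[abs_def]
  using lmap_comp[OF h dg_lmap[OF Q]] lmap_comp[OF dg_lmap[OF Q] h] by (intro lmap_add) auto
 note GD = lmapD[OF G] lmapD0[OF g g G]
 have Gd: "G (\<partial>\<^bsub>Q\<^esub> x) = \<partial>\<^bsub>Q\<^esub> (G x)" if "x : carrier Q" for x
  using that by (simp add: G_def dD hD group_closed)
 obtain t l f where t: "t : rgrad A l" "t ~: p" and f: "lmap (l - k) Q Q f"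
  and gf: "!!x. x : carrier Q ==> G (f x) = t \<odot>\<^bsub>Q\<^esub> x"
  using nakayama_inverse[OF g db p G s sp] eq unfolding G_def by blast
 have tc [simp]: "t : carrier A" using t by auto
 note fD = lmapD[OF f] lmapD0[OF g g f]
 \<comment> \<open>Since \<open>G y\<close> is congruent to \<open>s y\<close>, the map
   \<open>s f\<close> is congruent to \<open>t\<close>. So it has a one-sided inverse in turn, which
   makes \<open>f\<close> a two-sided inverse of \<open>G\<close> up to scalars.\<close>
 define f1 where "f1 x = s \<odot>\<^bsub>Q\<^esub> f x" for x
 have f1: "lmap l Q Q f1" unfolding f1_def[abs_def]
  by (rule lmap_cong[OF lmap_smult_left[OF g g f s] g]) auto
 note f1D = lmapD[OF f1] lmapD0[OF g g f1]
 have "eqm p Q (t \<odot>\<^bsub>Q\<^esub> x) (f1 x)" if x: "x : carrier Q" for x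
  using eqm_sym[OF g pI eq[OF fD(1)[OF x]]] gf[OF x] by (simp add: G_def f1_def)
 then obtain t2 l2 f2 where t2: "t2 : rgrad A l2" "t2 ~: p" and f2: "lmap (l2 - l) Q Q f2"
  and ff2: "!!x. x : carrier Q ==> f1 (f2 x) = t2 \<odot>\<^bsub>Q\<^esub> x"
  using nakayama_inverse[OF g db p f1 t] by blast
 have t2c [simp]: "t2 : carrier A" using t2 by auto
 note f2D = lmapD[OF f2] lmapD0[OF g g f2]
 define c where "c = s \<otimes> t2"
 have cc [simp]: "c : carrier A" and cd: "c : rgrad A (k + l2)"
  using A_mult[OF s t2(1)] by (auto simp: c_def)
 have cp: "c ~: p" unfolding c_def by (rule spec_notin[OF p sc sp t2c t2(2)])
 have *: "(s \<otimes> t) \<odot>\<^bsub>Q\<^esub> f2 x = t2 \<odot>\<^bsub>Q\<^esub> G x" if x: "x : carrier Q" for x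
 proof -
  have "G (f1 (f2 x)) = t2 \<odot>\<^bsub>Q\<^esub> G x" using x by (simp add: ff2 GD)
  moreover have "G (f1 (f2 x)) = s \<odot>\<^bsub>Q\<^esub> (t \<odot>\<^bsub>Q\<^esub> f2 x)" using x by (simp add: f1_def GD gf fD f2D)
  ultimately show ?thesis using x by (simp add: smult_arith f2D)
 qed
 define F where "F x = c \<odot>\<^bsub>Q\<^esub> f x" for x
 have F: "lmap (l + l2) Q Q F" unfolding F_def[abs_def]
  by (rule lmap_cong[OF lmap_smult_left[OF g g f cd] g]) auto
 note FD = lmapD[OF F] lmapD0[OF g g F]
 have FG: "F (G x) = (c \<otimes> t) \<odot>\<^bsub>Q\<^esub> x" if x: "x : carrier Q" for x
 proof -
  have "F (G x) = t2 \<odot>\<^bsub>Q\<^esub> f1 (G x)" using x by (simp add: F_def c_def f1_def smult_arith fD GD m_comm)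
  also have "\<dots> = f1 ((s \<otimes> t) \<odot>\<^bsub>Q\<^esub> f2 x)" using x by (simp add: * f1D GD)
  also have "\<dots> = (s \<otimes> t) \<odot>\<^bsub>Q\<^esub> (t2 \<odot>\<^bsub>Q\<^esub> x)" using x by (simp add: f1D f2D ff2)
  also have "\<dots> = (c \<otimes> t) \<odot>\<^bsub>Q\<^esub> x" using x by (simp add: smult_arith c_def m_ac)
  finally show ?thesis .
 qed
 have GF: "G (F x) = (c \<otimes> t) \<odot>\<^bsub>Q\<^esub> x" if x: "x : carrier Q" for x
  using x by (simp add: F_def GD fD gf smult_arith)
 \<comment> \<open>Writing \<open>c t\<close> as \<open>F G\<close> or as \<open>G F\<close> moves
   the differential past \<open>F\<close>, but only after multiplication by \<open>c t\<close>;
   hence the additional factor.\<close>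
 define F' where "F' x = (c \<otimes> t) \<odot>\<^bsub>Q\<^esub> F x" for x
 have ctd: "c \<otimes> t : rgrad A (k + l2 + l)" by (rule A_mult[OF cd t(1)])
 have F': "lmap (l + l2 + (k + l2 + l)) Q Q F'" unfolding F'_def[abs_def]
  by (rule lmap_smult_left[OF g g F ctd])
 note F'D = lmapD[OF F'] lmapD0[OF g g F']
 have F'd: "F' (\<partial>\<^bsub>Q\<^esub> x) = \<partial>\<^bsub>Q\<^esub> (F' x)" if x: "x : carrier Q" for x
 proof -
  have "\<partial>\<^bsub>Q\<^esub> (F' x) = (c \<otimes> t) \<odot>\<^bsub>Q\<^esub> \<partial>\<^bsub>Q\<^esub> (F x)" using x by (simp add: F'_def dD FD)
  also have "\<dots> = F (G (\<partial>\<^bsub>Q\<^esub> (F x)))" using x by (simp add: FG dD FD)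
  also have "\<dots> = F (\<partial>\<^bsub>Q\<^esub> ((c \<otimes> t) \<odot>\<^bsub>Q\<^esub> x))" using x by (simp add: Gd FD GF)
  also have "\<dots> = F' (\<partial>\<^bsub>Q\<^esub> x)" using x by (simp add: F'_def dD FD)
  finally show ?thesis by simp
 qed
 define T where "T = (c \<otimes> t) \<otimes> (c \<otimes> t)"
 have "T ~: p" unfolding T_def by (intro spec_notin[OF p] cc tc cp t m_closed)
 moreover have "null Q T (k + l2 + l + (k + l2 + l)) (%x. F' (h x))"
  unfolding null_def
 proof (intro conjI ballI)
  show "T : rgrad A (k + l2 + l + (k + l2 + l))" unfolding T_def by (rule A_mult[OF ctd ctd])
  show "lmap (k + l2 + l + (k + l2 + l) + 1) Q Q (%x. F' (h x))"
   by (rule lmap_cong[OF lmap_comp[OF h F'] g]) auto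
  fix x assume x: "x : carrier Q"
  have "T \<odot>\<^bsub>Q\<^esub> x = F' (G x)" using x by (simp add: F'_def FG T_def smult_arith GD)
  then show "T \<odot>\<^bsub>Q\<^esub> x = \<partial>\<^bsub>Q\<^esub> (F' (h x)) \<oplus>\<^bsub>Q\<^esub> F' (h (\<partial>\<^bsub>Q\<^esub> x))"
   using x by (simp add: G_def F'D F'd dD hD)
 qed
 ultimately show ?thesis by blast
qed

text \<open>If \<open>Q\<close> does not vanish at \<open>p\<close>, it has homology over the
  residue field: a cycle \<open>x\<close> modulo \<open>p\<close>, and a functional that kills
  boundaries but not \<open>x\<close>. For the proof, elimination is applied to boundaries plus
  \<open>p Q\<close>. Without a witness every coordinate of \<open>\<pi> x\<close> would lie in
  \<open>p\<close> for every cycle \<open>x\<close>, so \<open>t x\<close> would be a boundary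
  modulo \<open>p\<close>, and \<open>contraction\<close> and Nakayama would produce a
  null-homotopic scalar.\<close>

lemma support_witness:
 assumes Q: "dg_module A Q" and db: "dual_basis Q n q d \<phi>" and p: "p : Spec A"
  and nn: "\<nexists>s l h. s ~: p & null Q s l h"
 shows "EX x j \<psi> m. x : mgrad Q j & \<partial>\<^bsub>Q\<^esub> x : IM p Q & lmap m Q U \<psi> &
  (ALL y:carrier Q. \<psi> (\<partial>\<^bsub>Q\<^esub> y) : p) & \<psi> x ~: p"
proof (rule ccontr)
 assume neg: "\<not> ?thesis"
 note g [simp] = dg_gm[OF Q]
 note pI = SpecD(2)[OF p]
 note dD = dgD[OF Q]
 interpret QG: graded_group Q "mgrad Q" by (rule gm_graded[OF g])
 have "EX s l h. s ~: p & null_mod p Q s l h"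
 proof (rule contraction[OF Q db p])
  fix x j assume x: "x : mgrad Q j" and dx: "\<partial>\<^bsub>Q\<^esub> x : IM p Q"
  have xc: "x : carrier Q" using x by simp
  define B where "B = {\<partial>\<^bsub>Q\<^esub> y \<oplus>\<^bsub>Q\<^esub> z | y z. y : carrier Q & z : IM p Q}"
  have "EX t k \<pi>. t : rgrad A k & t ~: p & lmap k Q Q \<pi> &
   (ALL x:carrier Q. t \<odot>\<^bsub>Q\<^esub> x \<ominus>\<^bsub>Q\<^esub> \<pi> x : B) & (ALL i. ALL x : B \<inter> mgrad Q i. \<pi> x : IM p Q)"
  proof (rule elimination[OF g db p])
   show "B \<subseteq> carrier Q" using IM_carrier[of _ p Q] by (auto simp: B_def dD)
   show "\<zero>\<^bsub>Q\<^esub> : B" unfolding B_def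
    using dD(7) IM_zero[OF g pI] by (intro CollectI exI[of _ "\<zero>\<^bsub>Q\<^esub>"]) simp
   fix a u v assume a: "a : carrier A" and "u : B"
   then obtain y z where y: "y : carrier Q" "z : IM p Q" "u = \<partial>\<^bsub>Q\<^esub> y \<oplus>\<^bsub>Q\<^esub> z" by (auto simp: B_def)
   have zc: "z : carrier Q" by (rule IM_carrier[OF y(2)])
   show "a \<odot>\<^bsub>Q\<^esub> u : B" unfolding B_def
    using y zc a IM_smult[OF g pI y(2) a]
    by (intro CollectI exI[of _ "a \<odot>\<^bsub>Q\<^esub> y"] exI[of _ "a \<odot>\<^bsub>Q\<^esub> z"]) (simp add: dD smult_arith)
  next
   fix u v assume "u : B" "v : B"
   then obtain y z y' z' where y: "y : carrier Q" "z : IM p Q" "u = \<partial>\<^bsub>Q\<^esub> y \<oplus>\<^bsub>Q\<^esub> z"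
    and y': "y' : carrier Q" "z' : IM p Q" "v = \<partial>\<^bsub>Q\<^esub> y' \<oplus>\<^bsub>Q\<^esub> z'" by (auto simp: B_def)
   have zc: "z : carrier Q" "z' : carrier Q" using IM_carrier[OF y(2)] IM_carrier[OF y'(2)] by auto
   show "u \<oplus>\<^bsub>Q\<^esub> v : B" unfolding B_def
    using y y' zc IM_add[OF g pI y(2) y'(2)]
    by (intro CollectI exI[of _ "y \<oplus>\<^bsub>Q\<^esub> y'"] exI[of _ "z \<oplus>\<^bsub>Q\<^esub> z'"]) (simp add: dD QG.group_rearrange)
  qed
  then obtain t k \<pi> where t: "t : rgrad A k" "t ~: p" and \<pi>: "lmap k Q Q \<pi>"
   and tB: "!!x. x : carrier Q ==> t \<odot>\<^bsub>Q\<^esub> x \<ominus>\<^bsub>Q\<^esub> \<pi> x : B"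
   and \<pi>B: "!!i x. x : B ==> x : mgrad Q i ==> \<pi> x : IM p Q" by blast
  have tc [simp]: "t : carrier A" using t by auto
  note \<pi>D = lmapD[OF \<pi>] lmapD0[OF g g \<pi>]
  have pid: "\<pi> (\<partial>\<^bsub>Q\<^esub> y) : IM p Q" if y: "y : carrier Q" for y
  proof (rule IM_hom_all[OF g g pI lmap_comp[OF dg_lmap[OF Q] \<pi>] _ y])
   fix i y assume y: "y : mgrad Q i"
   then have "\<partial>\<^bsub>Q\<^esub> y : B" unfolding B_def
    using IM_zero[OF g pI] by (intro CollectI exI[of _ y] exI[of _ "\<zero>\<^bsub>Q\<^esub>"]) (simp add: dD group_closed)
   then show "\<pi> (\<partial>\<^bsub>Q\<^esub> y) : IM p Q" using dD(4)[OF y] by (rule \<pi>B)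
  qed
  have "\<phi> i (\<pi> x) : p" if i: "i < n" for i
  proof (rule ccontr)
   assume no: "\<phi> i (\<pi> x) ~: p"
   have "ALL y:carrier Q. \<phi> i (\<pi> (\<partial>\<^bsub>Q\<^esub> y)) : p" using IMD[OF pid dbD(2)[OF db i]] by blast
   with neg x dx no lmap_comp[OF \<pi> dbD(2)[OF db i]] show False by blast
  qed
  then have pix: "\<pi> x : IM p Q" by (intro IM_dual[OF g pI db]) (simp_all add: \<pi>D xc)
  from tB[OF xc] obtain y z where y: "y : carrier Q" "z : IM p Q"
   "t \<odot>\<^bsub>Q\<^esub> x \<ominus>\<^bsub>Q\<^esub> \<pi> x = \<partial>\<^bsub>Q\<^esub> y \<oplus>\<^bsub>Q\<^esub> z" by (auto simp: B_def)
  have zc: "z : carrier Q" by (rule IM_carrier[OF y(2)])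
  have "t \<odot>\<^bsub>Q\<^esub> x \<ominus>\<^bsub>Q\<^esub> \<partial>\<^bsub>Q\<^esub> y = \<pi> x \<oplus>\<^bsub>Q\<^esub> z"
   using y zc xc by (simp add: dD \<pi>D group_arith group_closed)
  then have 1: "t \<odot>\<^bsub>Q\<^esub> x \<ominus>\<^bsub>Q\<^esub> \<partial>\<^bsub>Q\<^esub> y : IM p Q" using IM_add[OF g pI pix y(2)] by simp
  \<comment> \<open>The preimage \<open>y\<close> need not be homogeneous. Its component of the
    right degree serves as well, because \<open>p Q\<close> contains the components of its
    elements.\<close>
  define y' where "y' = QG.cmp y (j + k + 1)"
  have "t \<odot>\<^bsub>Q\<^esub> x : mgrad Q (j + k)" using gm_smult_deg[OF g t(1) x] by (simp add: add.commute)
  then have "QG.cmp (t \<odot>\<^bsub>Q\<^esub> x \<ominus>\<^bsub>Q\<^esub> \<partial>\<^bsub>Q\<^esub> y) (j + k) = t \<odot>\<^bsub>Q\<^esub> x \<ominus>\<^bsub>Q\<^esub> \<partial>\<^bsub>Q\<^esub> y'"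
   using lmap_cmp[OF g g dg_lmap[OF Q] y(1), of "j + k + 1"] y(1) xc
   by (simp add: QG.cmp_diff QG.cmp_hom y'_def dD)
  then have "t \<odot>\<^bsub>Q\<^esub> x \<ominus>\<^bsub>Q\<^esub> \<partial>\<^bsub>Q\<^esub> y' : IM p Q"
   using IM_cmp[OF g SpecD(1)[OF p] 1, of "j + k"] by simp
  then show "EX l s. s : rgrad A l & s ~: p & (EX y : mgrad Q (j + l + 1). s \<odot>\<^bsub>Q\<^esub> x \<ominus>\<^bsub>Q\<^esub> \<partial>\<^bsub>Q\<^esub> y : IM p Q)"
   using t y(1) by (intro exI[of _ k] exI[of _ t] conjI bexI[of _ y']) (simp_all add: y'_def)
 qed
 then show False using nakayama_null[OF Q db p] nn by blast
qed

end

section \<open>Arithmetic of homogeneous fractions\<close>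

context even_graded_ring
begin

context
 fixes p assumes p: "p : Spec A"
begin

abbreviation "S \<equiv> denominators A p"

lemma SI: "s : rgrad A i ==> s ~: p ==> s : S"
 by (auto simp: denominators_def)

lemma S_carrier [simp]: "s : S ==> s : carrier A"
 by (auto simp: denominators_def)

lemma S_notin: "s : S ==> s ~: p"
 by (auto simp: denominators_def)

lemma S_mult [simp]: "s : S ==> t : S ==> s \<otimes> t : S"
 using A_mult den_mult[OF p] unfolding denominators_def by blast

lemma S_one [simp]: "\<one> : S"
 using SI[OF A_one SpecD(3)[OF p]] .

lemma S_even: "s : S ==> s : rgrad A i ==> even i"
 using A_odd S_notin ideal_simps(2)[OF SpecD(2)[OF p]] by metis

lemma fraction_subset:
 assumes M: "gm M" and c: "m : carrier M" "n : carrier M" "s : S" "t : S"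
  and u: "u : S" "(u \<otimes> t) \<odot>\<^bsub>M\<^esub> m = (u \<otimes> s) \<odot>\<^bsub>M\<^esub> n"
 shows "fraction S M m s \<subseteq> fraction S M n t"
proof (clarsimp simp: fraction_def)
 fix x v w assume x: "x : carrier M" "v : S" "w : S" and e: "w \<odot>\<^bsub>M\<^esub> (v \<odot>\<^bsub>M\<^esub> m) = w \<odot>\<^bsub>M\<^esub> (s \<odot>\<^bsub>M\<^esub> x)"
 let ?w = "w \<otimes> u \<otimes> s"
 have "?w \<odot>\<^bsub>M\<^esub> (v \<odot>\<^bsub>M\<^esub> n) = (w \<otimes> v) \<odot>\<^bsub>M\<^esub> ((u \<otimes> s) \<odot>\<^bsub>M\<^esub> n)"
  using M c x u(1) by (simp add: smult_arith m_ac)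
 also have "\<dots> = (u \<otimes> t) \<odot>\<^bsub>M\<^esub> (w \<odot>\<^bsub>M\<^esub> (v \<odot>\<^bsub>M\<^esub> m))"
  unfolding u(2)[symmetric] using M c x u(1) by (simp add: smult_arith m_ac)
 also have "\<dots> = ?w \<odot>\<^bsub>M\<^esub> (t \<odot>\<^bsub>M\<^esub> x)"
  unfolding e using M c x u(1) by (simp add: smult_arith m_ac)
 finally show "EX u:S. u \<odot>\<^bsub>M\<^esub> (v \<odot>\<^bsub>M\<^esub> n) = u \<odot>\<^bsub>M\<^esub> (t \<odot>\<^bsub>M\<^esub> x)"
  using x u c by (intro bexI[of _ ?w]) auto
qed

lemma fraction_mem:
 assumes "gm M" "m : carrier M" "s : S" shows "(m, s) : fraction S M m s"
 using assms S_one by (auto simp: fraction_def)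

lemma fraction_eq_iff:
 assumes M: "gm M" and c: "m : carrier M" "n : carrier M" "s : S" "t : S"
 shows "fraction S M m s = fraction S M n t \<longleftrightarrow> (EX u:S. (u \<otimes> t) \<odot>\<^bsub>M\<^esub> m = (u \<otimes> s) \<odot>\<^bsub>M\<^esub> n)"
proof
 assume "fraction S M m s = fraction S M n t"
 then have "(n, t) : fraction S M m s" using fraction_mem[OF M c(2,4)] by simp
 then show "EX u:S. (u \<otimes> t) \<odot>\<^bsub>M\<^esub> m = (u \<otimes> s) \<odot>\<^bsub>M\<^esub> n"
  using M c by (auto simp: fraction_def smult_arith)
next
 assume "EX u:S. (u \<otimes> t) \<odot>\<^bsub>M\<^esub> m = (u \<otimes> s) \<odot>\<^bsub>M\<^esub> n"
 then obtain u where "u : S" "(u \<otimes> t) \<odot>\<^bsub>M\<^esub> m = (u \<otimes> s) \<odot>\<^bsub>M\<^esub> n" by blast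
 then show "fraction S M m s = fraction S M n t"
  using fraction_subset[OF M c] fraction_subset[OF M c(2,1,4,3)] by (metis subset_antisym)
qed

lemma fraction_mem_eq:
 assumes M: "gm M" and c: "m : carrier M" "s : S" and x: "(n, t) : fraction S M m s"
 shows "n : carrier M" "t : S" "fraction S M n t = fraction S M m s"
proof -
 show n: "n : carrier M" "t : S" using x by (auto simp: fraction_def)
 have "EX u:S. (u \<otimes> t) \<odot>\<^bsub>M\<^esub> m = (u \<otimes> s) \<odot>\<^bsub>M\<^esub> n"
  using x M c by (auto simp: fraction_def smult_arith)
 then show "fraction S M n t = fraction S M m s" using fraction_eq_iff[OF M c(1) n(1) c(2) n(2)] by simp
qed

lemma fraction_cancel:
 assumes "gm M" "m : carrier M" "s : S" "u : S"
 shows "fraction S M (u \<odot>\<^bsub>M\<^esub> m) (u \<otimes> s) = fraction S M m s"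
 using assms by (subst fraction_eq_iff) (auto simp: smult_arith m_ac intro!: bexI[of _ \<one>])

text \<open>Evaluates the operations of \<open>localized_module\<close>, which are unions over
  representatives: once the summand is independent of the representative, the union over a nonempty
  class is that one value.\<close>

lemma UN_fraction:
 assumes M: "gm M" and c: "m : carrier M" "s : S"
  and F: "!!n t. n : carrier M ==> t : S ==> fraction S M n t = fraction S M m s ==> F n t = C"
 shows "(\<Union>(n, t) \<in> fraction S M m s. F n t) = C"
proof -
 have "F n t = C" if "(n, t) : fraction S M m s" for n t
  using fraction_mem_eq[OF M c that] F by blast
 then have "(\<Union>(n, t) \<in> fraction S M m s. F n t) = (\<Union>x \<in> fraction S M m s. C)"
  by (intro SUP_cong refl) auto
 then show ?thesis using fraction_mem[OF M c] by auto
qed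

lemma loc_simps:
 "carrier (localized_module A p M) = {fraction S M m s | m s. m : carrier M & s : S}"
 "\<zero>\<^bsub>localized_module A p M\<^esub> = fraction S M \<zero>\<^bsub>M\<^esub> \<one>"
 "mgrad (localized_module A p M) i = {fraction S M m s | m s j. s : S \<inter> rgrad A j & m : mgrad M (i + j)}"
 "rgrad (localized_ring A p) = mgrad (localized_module A p U)"
 by (simp_all add: localized_module_def localized_ring_def Let_def)

lemma loc_add:
 assumes M: "gm M" and c: "m : carrier M" "s : S" "n : carrier M" "t : S"
 shows "fraction S M m s \<oplus>\<^bsub>localized_module A p M\<^esub> fraction S M n t =
  fraction S M (t \<odot>\<^bsub>M\<^esub> m \<oplus>\<^bsub>M\<^esub> s \<odot>\<^bsub>M\<^esub> n) (s \<otimes> t)"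
proof -
 let ?F = "%m s n t. fraction S M (t \<odot>\<^bsub>M\<^esub> m \<oplus>\<^bsub>M\<^esub> s \<odot>\<^bsub>M\<^esub> n) (s \<otimes> t)"
 have eq: "?F m' s' n' t' = ?F m s n t"
  if B: "m' : carrier M" "s' : S" "fraction S M m' s' = fraction S M m s"
   "m : carrier M" "s : S"
   "n' : carrier M" "t' : S" "fraction S M n' t' = fraction S M n t" "n : carrier M" "t : S"
  for m s n t m' s' n' t'
 proof -
  obtain u where u: "u : S" "(u \<otimes> s) \<odot>\<^bsub>M\<^esub> m' = (u \<otimes> s') \<odot>\<^bsub>M\<^esub> m"
   using B(3) fraction_eq_iff[OF M B(1,4,2,5)] by blast
  obtain v where v: "v : S" "(v \<otimes> t) \<odot>\<^bsub>M\<^esub> n' = (v \<otimes> t') \<odot>\<^bsub>M\<^esub> n"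
   using B(8) fraction_eq_iff[OF M B(6,9,7,10)] by blast
  have "(u \<otimes> v \<otimes> (s \<otimes> t)) \<odot>\<^bsub>M\<^esub> (t' \<odot>\<^bsub>M\<^esub> m' \<oplus>\<^bsub>M\<^esub> s' \<odot>\<^bsub>M\<^esub> n') =
   (v \<otimes> t \<otimes> t') \<odot>\<^bsub>M\<^esub> ((u \<otimes> s) \<odot>\<^bsub>M\<^esub> m') \<oplus>\<^bsub>M\<^esub> (u \<otimes> s \<otimes> s') \<odot>\<^bsub>M\<^esub> ((v \<otimes> t) \<odot>\<^bsub>M\<^esub> n')"
   using M B u(1) v(1) by (simp add: smult_arith m_ac)
  also have "\<dots> = (u \<otimes> v \<otimes> (s' \<otimes> t')) \<odot>\<^bsub>M\<^esub> (t \<odot>\<^bsub>M\<^esub> m \<oplus>\<^bsub>M\<^esub> s \<odot>\<^bsub>M\<^esub> n)"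
   unfolding u(2) v(2) using M B u(1) v(1) by (simp add: smult_arith m_ac)
  finally show ?thesis
   using M B u(1) v(1) by (subst fraction_eq_iff) (auto simp: group_closed intro!: bexI[of _ "u \<otimes> v"])
 qed
 have "fraction S M m s \<oplus>\<^bsub>localized_module A p M\<^esub> fraction S M n t =
  (\<Union>(m, s) \<in> fraction S M m s. \<Union>(n, t) \<in> fraction S M n t. ?F m s n t)"
  by (simp add: localized_module_def Let_def)
 also have "\<dots> = ?F m s n t"
  by (intro UN_fraction[OF M c(1,2)] UN_fraction[OF M c(3,4)] eq c)
 finally show ?thesis .
qed

lemma loc_smult:
 assumes M: "gm M" and c: "a : carrier A" "s : S" "n : carrier M" "t : S"
 shows "fraction S U a s \<odot>\<^bsub>localized_module A p M\<^esub> fraction S M n t = fraction S M (a \<odot>\<^bsub>M\<^esub> n) (s \<otimes> t)"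
proof -
 let ?F = "%a s n t. fraction S M (a \<odot>\<^bsub>M\<^esub> n) (s \<otimes> t)"
 have eq: "?F a' s' n' t' = ?F a s n t"
  if B: "a' : carrier A" "s' : S" "fraction S U a' s' = fraction S U a s"
   "a : carrier A" "s : S"
   "n' : carrier M" "t' : S" "fraction S M n' t' = fraction S M n t" "n : carrier M" "t : S"
  for a s n t a' s' n' t'
 proof -
  obtain u where u: "u : S" "u \<otimes> s \<otimes> a' = u \<otimes> s' \<otimes> a"
   using B(3) fraction_eq_iff[OF unit_gm, of a' a s' s] B by auto
  obtain v where v: "v : S" "(v \<otimes> t) \<odot>\<^bsub>M\<^esub> n' = (v \<otimes> t') \<odot>\<^bsub>M\<^esub> n"
   using B(8) fraction_eq_iff[OF M B(6,9,7,10)] by blast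
  have "(u \<otimes> v \<otimes> (s \<otimes> t)) \<odot>\<^bsub>M\<^esub> (a' \<odot>\<^bsub>M\<^esub> n') = (u \<otimes> s \<otimes> a') \<odot>\<^bsub>M\<^esub> ((v \<otimes> t) \<odot>\<^bsub>M\<^esub> n')"
   using M B u(1) v(1) by (simp add: smult_arith m_ac)
  also have "\<dots> = (u \<otimes> v \<otimes> (s' \<otimes> t')) \<odot>\<^bsub>M\<^esub> (a \<odot>\<^bsub>M\<^esub> n)"
   unfolding u(2) v(2) using M B u(1) v(1) by (simp add: smult_arith m_ac)
  finally show ?thesis
   using M B u(1) v(1) by (subst fraction_eq_iff) (auto simp: group_closed intro!: bexI[of _ "u \<otimes> v"])
 qed
 have ac: "a : carrier U" using c by simp
 have "fraction S U a s \<odot>\<^bsub>localized_module A p M\<^esub> fraction S M n t =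
  (\<Union>(a, s) \<in> fraction S U a s. \<Union>(n, t) \<in> fraction S M n t. ?F a s n t)"
  by (simp add: localized_module_def Let_def)
 also have "\<dots> = ?F a s n t"
 proof (intro UN_fraction[OF unit_gm ac c(2)] UN_fraction[OF M c(3,4)])
  fix a' s' n' t' assume "a' : carrier U" "s' : S" "fraction S U a' s' = fraction S U a s"
   "n' : carrier M" "t' : S" "fraction S M n' t' = fraction S M n t"
  then show "?F a' s' n' t' = ?F a s n t" by (intro eq c) simp_all
 qed
 finally show ?thesis .
qed

lemma lmap_fraction:
 assumes M: "gm M" and N: "gm N" and f: "lmap k M N f"
  and "m : carrier M" "s : S" "n : carrier M" "t : S" "fraction S M m s = fraction S M n t" "r : S"
 shows "fraction S N (f m) (r \<otimes> s) = fraction S N (f n) (r \<otimes> t)"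
proof -
 obtain u where u: "u : S" "(u \<otimes> t) \<odot>\<^bsub>M\<^esub> m = (u \<otimes> s) \<odot>\<^bsub>M\<^esub> n"
  using fraction_eq_iff[OF M] assms by metis
 have "(u \<otimes> (r \<otimes> t)) \<odot>\<^bsub>N\<^esub> f m = r \<odot>\<^bsub>N\<^esub> f ((u \<otimes> t) \<odot>\<^bsub>M\<^esub> m)"
  using assms u(1) lmapD[OF f] by (simp add: smult_arith m_ac)
 also have "\<dots> = (u \<otimes> (r \<otimes> s)) \<odot>\<^bsub>N\<^esub> f n"
  unfolding u(2) using assms u(1) lmapD[OF f] by (simp add: smult_arith m_ac)
 finally show ?thesis
  using assms u(1) lmapD(1)[OF f] by (subst fraction_eq_iff) (auto intro!: bexI[of _ u])
qed

lemma loc_diff: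
 assumes M: "dg_module A M" and c: "m : carrier M" "s : S"
 shows "\<partial>\<^bsub>localized_module A p M\<^esub> (fraction S M m s) = fraction S M (\<partial>\<^bsub>M\<^esub> m) s"
proof -
 have "\<partial>\<^bsub>localized_module A p M\<^esub> (fraction S M m s) = (\<Union>(m, s) \<in> fraction S M m s. fraction S M (\<partial>\<^bsub>M\<^esub> m) s)"
  by (simp add: localized_module_def Let_def)
 also have "\<dots> = fraction S M (\<partial>\<^bsub>M\<^esub> m) s"
 proof (rule UN_fraction[OF dg_gm[OF M] c])
  fix n t assume n: "n : carrier M" "t : S" "fraction S M n t = fraction S M m s"
  show "fraction S M (\<partial>\<^bsub>M\<^esub> n) t = fraction S M (\<partial>\<^bsub>M\<^esub> m) s"
   using lmap_fraction[OF dg_gm[OF M] dg_gm[OF M] dg_lmap[OF M] n(1,2) c n(3) S_one] n(2) c(2) by simp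
 qed
 finally show ?thesis .
qed

lemma loc_add_same:
 assumes M: "gm M" and c: "m : carrier M" "s : S" "n : carrier M"
 shows "fraction S M m s \<oplus>\<^bsub>localized_module A p M\<^esub> fraction S M n s = fraction S M (m \<oplus>\<^bsub>M\<^esub> n) s"
proof -
 have "fraction S M m s \<oplus>\<^bsub>localized_module A p M\<^esub> fraction S M n s = fraction S M (s \<odot>\<^bsub>M\<^esub> (m \<oplus>\<^bsub>M\<^esub> n)) (s \<otimes> s)"
  using assms by (simp add: loc_add smult_add_r)
 then show ?thesis using assms by (simp add: fraction_cancel group_closed)
qed

lemma fraction_zero:
 assumes M: "gm M" and "s : S"
 shows "fraction S M \<zero>\<^bsub>M\<^esub> s = fraction S M \<zero>\<^bsub>M\<^esub> \<one>"
 using assms by (subst fraction_eq_iff) (auto simp: group_closed)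

text \<open>No group structure on the localization is established. The definite description behind
  the additive inverse is therefore verified directly, including uniqueness, by clearing
  denominators in \<open>M\<close>.\<close>

lemma loc_minus:
 assumes M: "gm M" and c: "m : carrier M" "s : S"
 shows "\<ominus>\<^bsub>localized_module A p M\<^esub> fraction S M m s = fraction S M (\<ominus>\<^bsub>M\<^esub> m) s"
 unfolding a_inv_def[of "localized_module A p M"] m_inv_def[of "add_monoid (localized_module A p M)"]
proof (rule the_equality)
 let ?L = "localized_module A p M"
 interpret M: abelian_group M using M by simp
 have "fraction S M m s \<oplus>\<^bsub>?L\<^esub> fraction S M (\<ominus>\<^bsub>M\<^esub> m) s = \<zero>\<^bsub>?L\<^esub>"
  "fraction S M (\<ominus>\<^bsub>M\<^esub> m) s \<oplus>\<^bsub>?L\<^esub> fraction S M m s = \<zero>\<^bsub>?L\<^esub>"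
  using M c fraction_zero[OF M c(2)] by (simp_all add: loc_add_same loc_simps M.r_neg M.l_neg)
 moreover have "fraction S M (\<ominus>\<^bsub>M\<^esub> m) s : carrier ?L"
  unfolding loc_simps using c M.a_inv_closed[OF c(1)] by blast
 ultimately show "fraction S M (\<ominus>\<^bsub>M\<^esub> m) s : carrier (add_monoid ?L) &
  fraction S M m s \<otimes>\<^bsub>add_monoid ?L\<^esub> fraction S M (\<ominus>\<^bsub>M\<^esub> m) s = \<one>\<^bsub>add_monoid ?L\<^esub> &
  fraction S M (\<ominus>\<^bsub>M\<^esub> m) s \<otimes>\<^bsub>add_monoid ?L\<^esub> fraction S M m s = \<one>\<^bsub>add_monoid ?L\<^esub>"
  by simp
 fix Y assume "Y : carrier (add_monoid ?L) &
  fraction S M m s \<otimes>\<^bsub>add_monoid ?L\<^esub> Y = \<one>\<^bsub>add_monoid ?L\<^esub> &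
  Y \<otimes>\<^bsub>add_monoid ?L\<^esub> fraction S M m s = \<one>\<^bsub>add_monoid ?L\<^esub>"
 then obtain n t where Y: "Y = fraction S M n t" "n : carrier M" "t : S"
  and "fraction S M m s \<oplus>\<^bsub>?L\<^esub> fraction S M n t = \<zero>\<^bsub>?L\<^esub>"
  by (auto simp: loc_simps)
 then have "fraction S M (t \<odot>\<^bsub>M\<^esub> m \<oplus>\<^bsub>M\<^esub> s \<odot>\<^bsub>M\<^esub> n) (s \<otimes> t) = fraction S M \<zero>\<^bsub>M\<^esub> \<one>"
  using M c by (simp add: loc_add loc_simps)
 then obtain u where u: "u : S" "u \<odot>\<^bsub>M\<^esub> (t \<odot>\<^bsub>M\<^esub> m \<oplus>\<^bsub>M\<^esub> s \<odot>\<^bsub>M\<^esub> n) = \<zero>\<^bsub>M\<^esub>"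
  using M c Y by (subst (asm) fraction_eq_iff) (auto simp: group_closed)
 then have "(u \<otimes> s) \<odot>\<^bsub>M\<^esub> n = (u \<otimes> t) \<odot>\<^bsub>M\<^esub> (\<ominus>\<^bsub>M\<^esub> m)"
  using M c Y by (simp add: smult_arith group_closed group_arith)
 then show "Y = fraction S M (\<ominus>\<^bsub>M\<^esub> m) s"
  unfolding Y(1) using M c Y u(1) by (subst fraction_eq_iff) (auto simp: group_closed)
qed

end

end

section \<open>Support in terms of null-homotopic scalars\<close>

context even_graded_ring
begin

lemma zero_dg_simps [simp]: "carrier zero_dg = {()}" "mgrad zero_dg = (%_. {()})" "\<partial>\<^bsub>zero_dg\<^esub> = (%_. ())"
 by (simp_all add: zero_dg_def)

text \<open>The scalar \<open>s\<close> is a unit in the localization, so dividing the homotopy by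
  it contracts the localized module: \<open>m/t\<close> goes to \<open>- h m/(s t)\<close>. The
  minus sign is there because the contraction has to realize the difference of zero and the
  identity, in this order.\<close>

lemma null_imp_localized_zero:
 assumes p: "p : Spec A" and P: "dg_module A P" and n: "null P s l h" and sp: "s ~: p"
 shows "ho_iso (localized_ring A p) (localized_module A p P) zero_dg"
proof -
 note g [simp] = dg_gm[OF P]
 note dD = dgD[OF P]
 let ?S = "denominators A p" and ?L = "localized_module A p P" and ?R = "localized_ring A p"
 let ?fr = "fraction ?S P"
 interpret PG: abelian_group P by simp
 note [simp] = S_carrier[OF p] S_mult[OF p] S_one[OF p]
 have s: "s : rgrad A l" and h: "lmap (l + 1) P P h" and
  eq: "!!x. x : carrier P ==> s \<odot>\<^bsub>P\<^esub> x = \<partial>\<^bsub>P\<^esub> (h x) \<oplus>\<^bsub>P\<^esub> h (\<partial>\<^bsub>P\<^esub> x)"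
  using n by (auto simp: null_def)
 have sS [simp]: "s : ?S" using SI[OF p s sp] .
 note hD = lmapD[OF h] lmapD0[OF g g h]
 define k where "k X = (\<Union>(m, t) \<in> X. ?fr (\<ominus>\<^bsub>P\<^esub> h m) (s \<otimes> t))" for X
 have kf: "k (?fr m t) = ?fr (\<ominus>\<^bsub>P\<^esub> h m) (s \<otimes> t)" if "m : carrier P" "t : ?S" for m t
  unfolding k_def
 proof (rule UN_fraction[OF p g that])
  fix n r assume n: "n : carrier P" "r : ?S" "?fr n r = ?fr m t"
  show "?fr (\<ominus>\<^bsub>P\<^esub> h n) (s \<otimes> r) = ?fr (\<ominus>\<^bsub>P\<^esub> h m) (s \<otimes> t)"
   by (rule lmap_fraction[OF p g g lmap_uminus[OF g g h] n(1,2) that n(3) sS])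
 qed
 have Lc: "?fr m t : carrier ?L" if "m : carrier P" "t : ?S" for m t
  using that by (auto simp: loc_simps[OF p])
 have Lz: "\<zero>\<^bsub>?L\<^esub> = ?fr \<zero>\<^bsub>P\<^esub> t" if "t : ?S" for t
  using fraction_zero[OF p g that] by (simp add: loc_simps[OF p])
 have La: "?fr m t \<oplus>\<^bsub>?L\<^esub> ?fr n u = ?fr (u \<odot>\<^bsub>P\<^esub> m \<oplus>\<^bsub>P\<^esub> t \<odot>\<^bsub>P\<^esub> n) (t \<otimes> u)"
  if "m : carrier P" "t : ?S" "n : carrier P" "u : ?S" for m n t u
  using loc_add[OF p g] that by simp
 have Las: "?fr m t \<oplus>\<^bsub>?L\<^esub> ?fr n t = ?fr (m \<oplus>\<^bsub>P\<^esub> n) t"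
  if "m : carrier P" "t : ?S" "n : carrier P" for m n t
  using loc_add_same[OF p g] that by simp
 have Ls: "fraction ?S U a u \<odot>\<^bsub>?L\<^esub> ?fr n t = ?fr (a \<odot>\<^bsub>P\<^esub> n) (u \<otimes> t)"
  if "a : carrier A" "u : ?S" "n : carrier P" "t : ?S" for a u n t
  using loc_smult[OF p g] that by simp
 have Lm: "\<ominus>\<^bsub>?L\<^esub> ?fr m t = ?fr (\<ominus>\<^bsub>P\<^esub> m) t" if "m : carrier P" "t : ?S" for m t
  using loc_minus[OF p g] that by simp
 have Ld: "\<partial>\<^bsub>?L\<^esub> (?fr m t) = ?fr (\<partial>\<^bsub>P\<^esub> m) t" if "m : carrier P" "t : ?S" for m t
  using loc_diff[OF p P] that by simp
 have LE: "EX m t. X = ?fr m t & m : carrier P & t : ?S" if "X : carrier ?L" for X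
  using that by (auto simp: loc_simps[OF p])
 have RE: "EX a u j. a : rgrad A (i + j) & u : rgrad A j & u : ?S & b = fraction ?S U a u"
  if "b : rgrad ?R i" for b i using that by (auto simp: loc_simps[OF p])
 have Lsz: "b \<odot>\<^bsub>?L\<^esub> \<zero>\<^bsub>?L\<^esub> = \<zero>\<^bsub>?L\<^esub>" if "b : rgrad ?R i" for b i
 proof -
  obtain a u j where a: "a : rgrad A (i + j)" "u : ?S" "b = fraction ?S U a u"
   using RE[OF \<open>b : rgrad ?R i\<close>] by blast
  have "a : carrier A" using a(1) by simp
  note a = this a(2,3)
  have "b \<odot>\<^bsub>?L\<^esub> \<zero>\<^bsub>?L\<^esub> = ?fr \<zero>\<^bsub>P\<^esub> (u \<otimes> \<one>)"
   unfolding Lz[OF S_one[OF p]] a(3) by (subst Ls) (simp_all add: a group_closed)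
  also have "\<dots> = \<zero>\<^bsub>?L\<^esub>" using a by (intro Lz[symmetric]) simp
  finally show ?thesis .
 qed
 \<comment> \<open>Denominators have even degree, since they are nonzero. So a fraction of odd
   degree has a numerator of odd degree, which is zero, and no Koszul sign is visible.\<close>
 have kos: "koszul (n * i) ?L (b \<odot>\<^bsub>?L\<^esub> X) = b \<odot>\<^bsub>?L\<^esub> X"
  if b: "b : rgrad ?R i" and X: "X : carrier ?L" for b i X n
 proof (cases "even i")
  case False
  obtain a u j where a: "a : rgrad A (i + j)" "u : rgrad A j" "u : ?S" "b = fraction ?S U a u"
   using RE[OF b] by blast
  have "even j" using S_even[OF p a(3,2)] .
  then have "a = \<zero>" using A_odd[OF a(1)] False by simp
  moreover obtain m t where "X = ?fr m t" "m : carrier P" "t : ?S" using LE[OF X] by blast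
  ultimately have "b \<odot>\<^bsub>?L\<^esub> X = \<zero>\<^bsub>?L\<^esub>" using a by (simp add: Ls Lz[of "u \<otimes> t"])
  then show ?thesis by (simp add: koszul_def Lz[of \<one>] Lm PG.minus_zero)
 qed (simp add: koszul_def)
 have klin: "graded_linear ?R 1 ?L ?L k"
  unfolding graded_linear_def
 proof (intro conjI allI ballI)
  show "k : hom (add_monoid ?L) (add_monoid ?L)"
   unfolding hom_def
  proof (clarsimp, intro conjI funcsetI ballI)
   fix X assume "X : carrier ?L"
   with LE show "k X : carrier ?L" by (fastforce simp: kf hD intro!: Lc)
  next
   fix X Y assume "X : carrier ?L" "Y : carrier ?L"
   then obtain m t n u where X: "X = ?fr m t" "m : carrier P" "t : ?S"
    "Y = ?fr n u" "n : carrier P" "u : ?S" using LE by metis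
   have "k (X \<oplus>\<^bsub>?L\<^esub> Y) = ?fr (\<ominus>\<^bsub>P\<^esub> (u \<odot>\<^bsub>P\<^esub> h m \<oplus>\<^bsub>P\<^esub> t \<odot>\<^bsub>P\<^esub> h n)) (s \<otimes> (t \<otimes> u))"
    using X by (simp add: La kf hD)
   also have "\<dots> = ?fr (s \<odot>\<^bsub>P\<^esub> (\<ominus>\<^bsub>P\<^esub> (u \<odot>\<^bsub>P\<^esub> h m \<oplus>\<^bsub>P\<^esub> t \<odot>\<^bsub>P\<^esub> h n))) (s \<otimes> (s \<otimes> (t \<otimes> u)))"
    using X by (intro fraction_cancel[OF p, symmetric]) (auto simp: hD)
   also have "\<dots> = k X \<oplus>\<^bsub>?L\<^esub> k Y"
    using X by (simp add: kf La hD smult_arith PG.minus_add m_ac)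
   finally show "k (X \<oplus>\<^bsub>?L\<^esub> Y) = k X \<oplus>\<^bsub>?L\<^esub> k Y" .
  qed
  fix i
  show "k ` mgrad ?L i \<subseteq> mgrad ?L (i + 1)"
  proof
   fix Y assume "Y : k ` mgrad ?L i"
   then obtain m t j where Y: "Y = k (?fr m t)" "t : ?S" "t : rgrad A j" "m : mgrad P (i + j)"
    by (auto simp: loc_simps[OF p])
   have "\<ominus>\<^bsub>P\<^esub> h m : mgrad P (i + 1 + (l + j))"
    using graded_group.G_minus[OF gm_graded[OF g] hD(4)[OF Y(4)]] by (simp add: algebra_simps)
   moreover have "s \<otimes> t : ?S \<inter> rgrad A (l + j)" using Y A_mult[OF s] by simp
   moreover have "Y = ?fr (\<ominus>\<^bsub>P\<^esub> h m) (s \<otimes> t)" using Y gm_carrier[OF g] by (simp add: kf)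
   ultimately show "Y : mgrad ?L (i + 1)" unfolding loc_simps[OF p] by blast
  qed
  fix b X assume b: "b : rgrad ?R i" and X: "X : carrier ?L"
  obtain a u j where a': "a : rgrad A (i + j)" "u : ?S" "b = fraction ?S U a u" using RE[OF b] by blast
  have "a : carrier A" using a'(1) by simp
  note a = this a'(2,3)
  obtain m t where m: "X = ?fr m t" "m : carrier P" "t : ?S" using LE[OF X] by blast
  have kX: "k X : carrier ?L" using m by (simp add: kf hD Lc)
  have "k (b \<odot>\<^bsub>?L\<^esub> X) = b \<odot>\<^bsub>?L\<^esub> k X"
   using a m by (simp add: Ls kf hD smult_arith m_ac)
  then show "k (b \<odot>\<^bsub>?L\<^esub> X) = koszul (1 * i) ?L (b \<odot>\<^bsub>?L\<^esub> k X)" using kos[OF b kX, of 1] by (simp only:)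
 qed
 have hom1: "homotopic ?R ?L ?L ((%_. \<zero>\<^bsub>?L\<^esub>) \<circ> (%_. ())) id"
  unfolding homotopic_def
 proof (intro exI[of _ k] conjI klin ballI)
  fix X assume "X : carrier ?L"
  then obtain m t where m: "X = ?fr m t" "m : carrier P" "t : ?S" using LE by blast
  have "\<partial>\<^bsub>?L\<^esub> (k X) \<oplus>\<^bsub>?L\<^esub> k (\<partial>\<^bsub>?L\<^esub> X) = ?fr (\<ominus>\<^bsub>P\<^esub> (s \<odot>\<^bsub>P\<^esub> m)) (s \<otimes> t)"
   using m by (simp add: kf Ld hD dD Las eq PG.minus_add)
  also have "\<dots> = ?fr (\<ominus>\<^bsub>P\<^esub> m) t"
   using m fraction_cancel[OF p g, of "\<ominus>\<^bsub>P\<^esub> m" t s] by (simp add: smult_arith)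
  also have "\<dots> = \<zero>\<^bsub>?L\<^esub> \<ominus>\<^bsub>?L\<^esub> X"
   using m by (simp add: a_minus_def Lm Lz[of t] Las)
  finally show "((%_. \<zero>\<^bsub>?L\<^esub>) \<circ> (%_. ())) X \<ominus>\<^bsub>?L\<^esub> id X = \<partial>\<^bsub>?L\<^esub> (k X) \<oplus>\<^bsub>?L\<^esub> k (\<partial>\<^bsub>?L\<^esub> X)" by simp
 qed
 have 1: "chain_map ?R ?L zero_dg (%_. ())"
  by (auto simp: chain_map_def graded_linear_def hom_def)
 have 2: "chain_map ?R zero_dg ?L (%_. \<zero>\<^bsub>?L\<^esub>)"
  unfolding chain_map_def graded_linear_def hom_def
 proof (clarsimp, intro conjI allI ballI)
  show "\<zero>\<^bsub>?L\<^esub> : carrier ?L" "\<zero>\<^bsub>?L\<^esub> = \<zero>\<^bsub>?L\<^esub> \<oplus>\<^bsub>?L\<^esub> \<zero>\<^bsub>?L\<^esub>" "\<zero>\<^bsub>?L\<^esub> = \<partial>\<^bsub>?L\<^esub> \<zero>\<^bsub>?L\<^esub>"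
   by (simp_all add: Lz[of \<one>] Lc Las Ld dD)
  show "\<zero>\<^bsub>?L\<^esub> : mgrad ?L i" for i
   unfolding loc_simps[OF p] using graded_group.G_zero[OF gm_graded[OF g], of "i + 0"] A_one S_one[OF p] by blast
  show "\<zero>\<^bsub>?L\<^esub> = koszul 0 ?L (b \<odot>\<^bsub>?L\<^esub> \<zero>\<^bsub>?L\<^esub>)" if "b : rgrad ?R i" for b i
   using Lsz[OF that] by (simp add: koszul_def)
 qed
 have 3: "homotopic ?R zero_dg zero_dg ((%_. ()) \<circ> (%_. \<zero>\<^bsub>?L\<^esub>)) id"
  unfolding homotopic_def
  by (intro exI[of _ "%_. ()"]) (auto simp: graded_linear_def hom_def)
 show ?thesis unfolding ho_iso_def using 1 2 hom1 3 by blast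
qed

text \<open>A contraction of the localization is determined by its values on finitely many
  generators. A common denominator \<open>s\<close> of these values turns it into a map
  \<open>h'\<close> on \<open>P\<close> itself. The homotopy equation then holds for the generators
  after localization, hence in \<open>P\<close> after multiplication by one further scalar
  \<open>u\<close>.\<close>

lemma localized_zero_imp_null:
 assumes p: "p : Spec A" and P: "dg_module A P" and db: "dual_basis P n q d \<phi>"
  and iso: "ho_iso (localized_ring A p) (localized_module A p P) zero_dg"
 shows "EX s l h. s ~: p & null P s l h"
proof -
 note g [simp] = dg_gm[OF P]
 note dD = dgD[OF P]
 let ?S = "denominators A p" and ?L = "localized_module A p P" and ?R = "localized_ring A p"
 let ?fr = "fraction ?S P"
 interpret PG: abelian_group P by simp
 note [simp] = S_carrier[OF p] S_mult[OF p] S_one[OF p]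
 have Lc: "?fr m t : carrier ?L" if "m : carrier P" "t : ?S" for m t
  using that by (auto simp: loc_simps[OF p])
 have Lz: "\<zero>\<^bsub>?L\<^esub> = ?fr \<zero>\<^bsub>P\<^esub> t" if "t : ?S" for t
  using fraction_zero[OF p g that] by (simp add: loc_simps[OF p])
 have Las: "?fr m t \<oplus>\<^bsub>?L\<^esub> ?fr n t = ?fr (m \<oplus>\<^bsub>P\<^esub> n) t"
  if "m : carrier P" "t : ?S" "n : carrier P" for m n t
  using loc_add_same[OF p g] that by simp
 have Ls: "fraction ?S U a u \<odot>\<^bsub>?L\<^esub> ?fr n t = ?fr (a \<odot>\<^bsub>P\<^esub> n) (u \<otimes> t)"
  if "a : carrier A" "u : ?S" "n : carrier P" "t : ?S" for a u n t
  using loc_smult[OF p g] that by simp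
 have Lm: "\<ominus>\<^bsub>?L\<^esub> ?fr m t = ?fr (\<ominus>\<^bsub>P\<^esub> m) t" if "m : carrier P" "t : ?S" for m t
  using loc_minus[OF p g] that by simp
 have Ld: "\<partial>\<^bsub>?L\<^esub> (?fr m t) = ?fr (\<partial>\<^bsub>P\<^esub> m) t" if "m : carrier P" "t : ?S" for m t
  using loc_diff[OF p P] that by simp
 obtain f0 g0 where g0: "chain_map ?R zero_dg ?L g0" and hom: "homotopic ?R ?L ?L (g0 \<circ> f0) id"
  using iso unfolding ho_iso_def by blast
 have g0h: "g0 () : carrier ?L" "g0 () = g0 () \<oplus>\<^bsub>?L\<^esub> g0 ()"
  using g0 by (auto simp: chain_map_def graded_linear_def hom_def)
 obtain m s where ms: "g0 () = ?fr m s" "m : carrier P" "s : ?S" using g0h(1) by (auto simp: loc_simps[OF p])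
 \<comment> \<open>The image of the zero object satisfies \<open>x = x + x\<close>. Cancellation
   takes place in \<open>P\<close> after clearing denominators, as no group law is at hand in the
   localization.\<close>
 have "?fr m s = ?fr (m \<oplus>\<^bsub>P\<^esub> m) s" using g0h(2) ms by (simp add: Las)
 then obtain u where "u : ?S" "(u \<otimes> s) \<odot>\<^bsub>P\<^esub> m = (u \<otimes> s) \<odot>\<^bsub>P\<^esub> (m \<oplus>\<^bsub>P\<^esub> m)"
  using ms by (subst (asm) fraction_eq_iff[OF p]) (auto simp: group_closed)
 then have "(u \<otimes> s) \<odot>\<^bsub>P\<^esub> m = \<zero>\<^bsub>P\<^esub>" "u : ?S"
  using ms PG.add.r_cancel_one'[of "(u \<otimes> s) \<odot>\<^bsub>P\<^esub> m" "(u \<otimes> s) \<odot>\<^bsub>P\<^esub> m"] by (auto simp: smult_add_r)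
 then have g00: "g0 () = \<zero>\<^bsub>?L\<^esub>"
  unfolding ms(1) Lz[OF ms(3)] using ms by (subst fraction_eq_iff[OF p]) (auto simp: group_closed intro!: bexI[of _ u])
 obtain h where hl: "graded_linear ?R 1 ?L ?L h" and
  heq: "!!X. X : carrier ?L ==> \<zero>\<^bsub>?L\<^esub> \<ominus>\<^bsub>?L\<^esub> X = \<partial>\<^bsub>?L\<^esub> (h X) \<oplus>\<^bsub>?L\<^esub> h (\<partial>\<^bsub>?L\<^esub> X)"
  using hom g00 unfolding homotopic_def by auto
 have hc: "!!X. X : carrier ?L ==> h X : carrier ?L"
  and ha: "!!X Y. X : carrier ?L ==> Y : carrier ?L ==> h (X \<oplus>\<^bsub>?L\<^esub> Y) = h X \<oplus>\<^bsub>?L\<^esub> h Y"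
  and hd: "!!X i. X : mgrad ?L i ==> h X : mgrad ?L (i + 1)"
  and hs: "!!b i X. b : rgrad ?R i ==> X : carrier ?L ==> h (b \<odot>\<^bsub>?L\<^esub> X) = koszul (1 * i) ?L (b \<odot>\<^bsub>?L\<^esub> h X)"
  using hl unfolding graded_linear_def hom_def by (simp_all add: Pi_iff image_subset_iff del: mult_1)
 define H where "H x = h (?fr x \<one>)" for x
 have Hc: "H x : carrier ?L" if "x : carrier P" for x using that by (simp add: H_def hc Lc)
 have Ha: "H (x \<oplus>\<^bsub>P\<^esub> y) = H x \<oplus>\<^bsub>?L\<^esub> H y" if "x : carrier P" "y : carrier P" for x y
  using that by (simp add: H_def Lc flip: Las ha)
 have Hz: "H \<zero>\<^bsub>P\<^esub> = \<zero>\<^bsub>?L\<^esub>"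
 proof -
  obtain m s where ms: "H \<zero>\<^bsub>P\<^esub> = ?fr m s" "m : carrier P" "s : ?S"
   using Hc[of "\<zero>\<^bsub>P\<^esub>"] by (auto simp: loc_simps[OF p] group_closed)
  have z: "fraction ?S U \<zero> \<one> : rgrad ?R 0"
   unfolding loc_simps[OF p] unit_simps using S_one[OF p] A_one GA.G_zero[of "0 + 0"] by blast
  have "H \<zero>\<^bsub>P\<^esub> = h (fraction ?S U \<zero> \<one> \<odot>\<^bsub>?L\<^esub> ?fr \<zero>\<^bsub>P\<^esub> \<one>)" by (simp add: H_def Ls group_closed)
  also have "\<dots> = fraction ?S U \<zero> \<one> \<odot>\<^bsub>?L\<^esub> H \<zero>\<^bsub>P\<^esub>"
   using hs[OF z, of "?fr \<zero>\<^bsub>P\<^esub> \<one>"] by (simp add: H_def koszul_def Lc group_closed)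
  also have "\<dots> = \<zero>\<^bsub>?L\<^esub>" using ms by (simp add: Ls Lz[of s])
  finally show ?thesis .
 qed
 have Hs: "H (a \<odot>\<^bsub>P\<^esub> x) = ?fr (a \<odot>\<^bsub>P\<^esub> y) s"
  if a: "a : rgrad A i" and x: "x : carrier P" "y : carrier P" "s : ?S" "H x = ?fr y s" for a i x y s
 proof (cases "even i")
  case True
  have "a : rgrad A (i + 0)" using a by simp
  then have b: "fraction ?S U a \<one> : rgrad ?R i"
   unfolding loc_simps[OF p] unit_simps using S_one[OF p] A_one by blast
  have "H (a \<odot>\<^bsub>P\<^esub> x) = h (fraction ?S U a \<one> \<odot>\<^bsub>?L\<^esub> ?fr x \<one>)" using a x by (simp add: H_def Ls)
  also have "\<dots> = fraction ?S U a \<one> \<odot>\<^bsub>?L\<^esub> H x"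
   using hs[OF b, of "?fr x \<one>"] True x by (simp add: H_def koszul_def Lc)
  also have "\<dots> = ?fr (a \<odot>\<^bsub>P\<^esub> y) s" using a x by (simp add: Ls)
  finally show ?thesis .
 next
  case False
  then have "a = \<zero>" using A_odd[OF a] by simp
  then show ?thesis using x Hz by (simp add: Lz[of s])
 qed
 let ?P = "%i l s. s : ?S & (EX y : mgrad P (d i + (l + 1)). H (q i) = ?fr y s)"
 have "EX l s. s : rgrad A l & s ~: p & (ALL i:{..<n}. ?P i l s)"
 proof (rule common_den[OF p])
  fix i assume "i : {..<n}"
  then have "q i : mgrad P (d i + 0)" using dbD(1)[OF db] by simp
  then have "?fr (q i) \<one> : mgrad ?L (d i)"
   unfolding loc_simps[OF p] using A_one S_one[OF p] by blast
  from hd[OF this] obtain y s l where "H (q i) = ?fr y s" "s : ?S" "s : rgrad A l" "y : mgrad P (d i + 1 + l)"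
   unfolding loc_simps[OF p] H_def by blast
  then show "EX l s. s : rgrad A l & s ~: p & ?P i l s"
   using S_notin[OF p] by (intro exI[of _ l] exI[of _ s] conjI bexI[of _ y]) (auto simp: algebra_simps)
 next
  fix i l s m u assume s: "s : rgrad A l" "u : rgrad A m" "u ~: p" and "?P i l s"
  then obtain y where y: "y : mgrad P (d i + (l + 1))" "H (q i) = ?fr y s" "s : ?S" by blast
  have "u \<odot>\<^bsub>P\<^esub> y : mgrad P (d i + (m + l + 1))"
   using gm_smult_deg[OF g s(2) y(1)] by (simp add: algebra_simps)
  moreover have "u : ?S" using SI[OF p] s by blast
  ultimately show "?P i (m + l) (u \<otimes> s)"
   using y gm_carrier[OF g y(1)] fraction_cancel[OF p g _ y(3), of y u] by (auto intro!: bexI[of _ "u \<odot>\<^bsub>P\<^esub> y"])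
 qed simp
 then obtain l s where s: "s : rgrad A l" "s ~: p" and "ALL i:{..<n}. ?P i l s" by blast
 then obtain y where y: "!!i. i < n ==> y i : mgrad P (d i + (l + 1))"
  and Hy: "!!i. i < n ==> H (q i) = ?fr (y i) s"
  unfolding Ball_def Bex_def lessThan_iff by (metis (no_types, lifting))
 have sS [simp]: "s : ?S" by (rule SI[OF p s])
 have yc: "y i : carrier P" if "i < n" for i using gm_carrier[OF g y[OF that]] .
 note qc = db_closed[OF g db]
 define h' where "h' x = finsum P (%i. \<phi> i x \<odot>\<^bsub>P\<^esub> y i) {..<n}" for x
 have h': "lmap (l + 1) P P h'" unfolding h'_def[abs_def] by (rule db_lmap[OF g g db y])
 note hD = lmapD[OF h'] lmapD0[OF g g h']
 have HH: "H x = ?fr (h' x) s" if x: "x : mgrad P j" for x j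
 proof -
  have xc: "x : carrier P" by (rule gm_carrier[OF g x])
  have "H (finsum P (%i. \<phi> i x \<odot>\<^bsub>P\<^esub> q i) {..<m}) = ?fr (finsum P (%i. \<phi> i x \<odot>\<^bsub>P\<^esub> y i) {..<m}) s"
   if "m \<le> n" for m
   using that
  proof (induction m)
   case 0
   show ?case by (simp add: Hz Lz[of s])
  next
   case (Suc m)
   have c: "\<phi> i x \<odot>\<^bsub>P\<^esub> q i : carrier P" "\<phi> i x \<odot>\<^bsub>P\<^esub> y i : carrier P" if "i \<le> m" for i
    using qc(1,2)[of i] yc[of i] Suc.prems xc that by auto
   have m: "m < n" using Suc.prems by simp
   have "H (\<phi> m x \<odot>\<^bsub>P\<^esub> q m) = ?fr (\<phi> m x \<odot>\<^bsub>P\<^esub> y m) s"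
    by (rule Hs[OF qc(3)[OF m x] qc(1)[OF m] yc[OF m] sS Hy[OF m]])
   moreover have "finsum P (%i. \<phi> i x \<odot>\<^bsub>P\<^esub> q i) {..<m} : carrier P"
    "finsum P (%i. \<phi> i x \<odot>\<^bsub>P\<^esub> y i) {..<m} : carrier P"
    using c by (auto intro!: finsum_lmap_closed)
   ultimately show ?case using Suc c by (simp add: finsum_Suc' Ha Las)
  qed
  from this[OF le_refl] show ?thesis using dbD(3)[OF db xc] by (simp add: h'_def)
 qed
 let ?P2 = "%i l u. (u \<otimes> s) \<odot>\<^bsub>P\<^esub> (\<ominus>\<^bsub>P\<^esub> q i) = u \<odot>\<^bsub>P\<^esub> (\<partial>\<^bsub>P\<^esub> (h' (q i)) \<oplus>\<^bsub>P\<^esub> h' (\<partial>\<^bsub>P\<^esub> (q i)))"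
 have "EX l u. u : rgrad A l & u ~: p & (ALL i:{..<n}. ?P2 i l u)"
 proof (rule common_den[OF p])
  fix i assume "i : {..<n}"
  then have i: "i < n" by simp
  note qd = dbD(1)[OF db i] and qi = qc(1)[OF i]
  have "?fr (\<ominus>\<^bsub>P\<^esub> q i) \<one> = \<zero>\<^bsub>?L\<^esub> \<ominus>\<^bsub>?L\<^esub> ?fr (q i) \<one>"
   using qi by (simp add: a_minus_def Lm Lz[of \<one>] Las)
  also have "\<dots> = \<partial>\<^bsub>?L\<^esub> (H (q i)) \<oplus>\<^bsub>?L\<^esub> H (\<partial>\<^bsub>P\<^esub> (q i))"
   using heq[OF Lc[OF qi S_one[OF p]]] qi by (simp add: H_def Ld)
  also have "\<dots> = ?fr (\<partial>\<^bsub>P\<^esub> (h' (q i)) \<oplus>\<^bsub>P\<^esub> h' (\<partial>\<^bsub>P\<^esub> (q i))) s"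
   using qi by (simp add: HH[OF qd] HH[OF dD(4)[OF qd]] Ld hD dD Las)
  finally obtain u where "u : ?S" "(u \<otimes> s) \<odot>\<^bsub>P\<^esub> (\<ominus>\<^bsub>P\<^esub> q i) =
    (u \<otimes> \<one>) \<odot>\<^bsub>P\<^esub> (\<partial>\<^bsub>P\<^esub> (h' (q i)) \<oplus>\<^bsub>P\<^esub> h' (\<partial>\<^bsub>P\<^esub> (q i)))"
   using qi by (subst (asm) fraction_eq_iff[OF p]) (auto simp: group_closed hD dD)
  then show "EX l u. u : rgrad A l & u ~: p & ?P2 i l u"
   by (auto simp: denominators_def)
 next
  fix i l u m v assume i: "i : {..<n}" and u: "u : rgrad A l" "v : rgrad A m" and P2: "?P2 i l u"
  have "v \<odot>\<^bsub>P\<^esub> ((u \<otimes> s) \<odot>\<^bsub>P\<^esub> (\<ominus>\<^bsub>P\<^esub> q i)) =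
    v \<odot>\<^bsub>P\<^esub> (u \<odot>\<^bsub>P\<^esub> (\<partial>\<^bsub>P\<^esub> (h' (q i)) \<oplus>\<^bsub>P\<^esub> h' (\<partial>\<^bsub>P\<^esub> (q i))))"
   unfolding P2 ..
  moreover have "\<ominus>\<^bsub>P\<^esub> q i : carrier P" "\<partial>\<^bsub>P\<^esub> (h' (q i)) \<oplus>\<^bsub>P\<^esub> h' (\<partial>\<^bsub>P\<^esub> (q i)) : carrier P"
   using qc(1) i by (simp_all add: hD dD)
  ultimately show "?P2 i (m + l) (v \<otimes> u)" using u by (simp add: smult_smult m_assoc)
 qed simp
 then obtain m u where u: "u : rgrad A m" "u ~: p" and ueq: "!!i. i < n ==> ?P2 i m u" by blast
 have uc [simp]: "u : carrier A" using u by auto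
 \<comment> \<open>The given homotopy contracts the difference of zero and the identity; the sign
   turns this into the identity, and \<open>u\<close> clears the remaining denominators.\<close>
 define k where "k x = \<ominus>\<^bsub>P\<^esub> (u \<odot>\<^bsub>P\<^esub> h' x)" for x
 have k: "lmap (m + l + 1) P P k" unfolding k_def[abs_def]
  by (rule lmap_uminus[OF g g lmap_cong[OF lmap_smult_left[OF g g h' u(1)] g]]) auto
 have us: "u \<otimes> s : rgrad A (m + l)" by (rule A_mult[OF u(1) s(1)])
 have L1: "lmap (m + l) P P (%x. (u \<otimes> s) \<odot>\<^bsub>P\<^esub> x)"
  using lmap_smult_left[OF g g lmap_id us] by simp
 have L2: "lmap (m + l) P P (%x. \<partial>\<^bsub>P\<^esub> (k x) \<oplus>\<^bsub>P\<^esub> k (\<partial>\<^bsub>P\<^esub> x))"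
  using lmap_comp[OF k dg_lmap[OF P]] lmap_comp[OF dg_lmap[OF P] k] by (intro lmap_add) (auto simp: algebra_simps)
 have "null P (u \<otimes> s) (m + l) k"
  unfolding null_def
 proof (intro conjI us k ballI)
  fix x assume x: "x : carrier P"
  show "(u \<otimes> s) \<odot>\<^bsub>P\<^esub> x = \<partial>\<^bsub>P\<^esub> (k x) \<oplus>\<^bsub>P\<^esub> k (\<partial>\<^bsub>P\<^esub> x)"
   unfolding db_expand[OF g g db L1 x] db_expand[OF g g db L2 x]
  proof (rule finsum_congr[OF g])
   fix i assume "i : {..<n}"
   then have i: "i < n" by simp
   note qi = qc(1)[OF i]
   show "\<phi> i x \<odot>\<^bsub>P\<^esub> ((u \<otimes> s) \<odot>\<^bsub>P\<^esub> q i) : carrier P" using qi qc(2)[OF i x] by simp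
   have "(u \<otimes> s) \<odot>\<^bsub>P\<^esub> q i = \<ominus>\<^bsub>P\<^esub> ((u \<otimes> s) \<odot>\<^bsub>P\<^esub> (\<ominus>\<^bsub>P\<^esub> q i))"
    using qi by (simp add: smult_minus_r)
   also have "\<dots> = \<partial>\<^bsub>P\<^esub> (k (q i)) \<oplus>\<^bsub>P\<^esub> k (\<partial>\<^bsub>P\<^esub> (q i))"
    unfolding ueq[OF i] using qi by (simp add: k_def hD dD smult_add_r PG.minus_add)
   finally show "\<phi> i x \<odot>\<^bsub>P\<^esub> ((u \<otimes> s) \<odot>\<^bsub>P\<^esub> q i) = \<phi> i x \<odot>\<^bsub>P\<^esub> (\<partial>\<^bsub>P\<^esub> (k (q i)) \<oplus>\<^bsub>P\<^esub> k (\<partial>\<^bsub>P\<^esub> (q i)))"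
    by simp
  qed
 qed
 moreover have "u \<otimes> s ~: p" by (rule den_mult[OF p u s])
 ultimately show ?thesis by blast
qed

lemma not_in_supp_iff:
 assumes "p : Spec A" "dg_module A P" "dual_basis P n q d \<phi>"
 shows "p ~: supp A P \<longleftrightarrow> (EX s l h. s ~: p & null P s l h)"
 using null_imp_localized_zero[OF assms(1,2)] localized_zero_imp_null[OF assms] assms(1)
 unfolding supp_def by blast

end

section \<open>Criteria for graded modules, maps of finite rank, sums and shifts\<close>

lemma additive_finsum:
 assumes M: "abelian_group M" and N: "abelian_group N"
  and cl: "!!x. x : carrier M ==> f x : carrier N"
  and ad: "!!x y. x : carrier M ==> y : carrier M ==> f (x \<oplus>\<^bsub>M\<^esub> y) = f x \<oplus>\<^bsub>N\<^esub> f y"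
  and g: "!!i. i : F ==> g i : carrier M"
 shows "f (finsum M g F) = finsum N (%i. f (g i)) F"
proof -
 interpret M: abelian_group M by fact
 interpret N: abelian_group N by fact
 have f0: "f \<zero>\<^bsub>M\<^esub> = \<zero>\<^bsub>N\<^esub>"
  using ad[of "\<zero>\<^bsub>M\<^esub>" "\<zero>\<^bsub>M\<^esub>"] cl[of "\<zero>\<^bsub>M\<^esub>"] N.add.r_cancel_one'[of "f \<zero>\<^bsub>M\<^esub>" "f \<zero>\<^bsub>M\<^esub>"] by simp
 show ?thesis using g
 proof (induction F rule: infinite_finite_induct)
  case (insert x F)
  then have "finsum M g (insert x F) = g x \<oplus>\<^bsub>M\<^esub> finsum M g F"
   by (intro M.finsum_insert) auto
  moreover have "finsum N (%i. f (g i)) (insert x F) = f (g x) \<oplus>\<^bsub>N\<^esub> finsum N (%i. f (g i)) F"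
   using insert cl by (intro N.finsum_insert) auto
  moreover have "finsum M g F : carrier M" using insert by (intro M.finsum_closed) auto
  ultimately show ?case using insert by (simp add: ad)
 qed (simp_all add: f0)
qed

lemma (in graded_group) cmp_sum_shift:
 assumes x: "x : carrier M" and F: "finite F" "!!k. k ~: F ==> cmp x (k - d) = \<zero>"
 shows "finsum M (%k. cmp x (k - d)) F = x"
proof -
 have "finsum M (cmp x) ((%k. k - d) ` F) = finsum M (%k. cmp x (k - d)) F"
  using x by (intro finsum_reindex) (auto simp: inj_on_def)
 moreover have "x = finsum M (cmp x) ((%k. k - d) ` F)"
 proof (rule cmp_sum_superset[OF x])
  show "cmp x i = \<zero>" if "i ~: (%k. k - d) ` F" for i
  proof -
   have "i + d ~: F" using that by (metis add_diff_cancel_right' image_eqI)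
   then show ?thesis using F(2)[of "i + d"] by simp
  qed
 qed (use F in simp)
 ultimately show ?thesis by simp
qed

context even_graded_ring
begin

text \<open>A checklist for concrete modules. Negatives are obtained from the scalar
  \<open>- 1\<close> and homogeneous decompositions from an explicit component function
  \<open>c\<close>, so neither inverses nor uniqueness have to be treated in each construction. The
  premise \<open>sum\<close> may assume that \<open>W\<close> is a group, because finite sums can
  only be manipulated there.\<close>

lemma gmI:
 fixes W :: "('a, 'w, 'u) gr_module_scheme"
 assumes cl: "!!x y. x : carrier W ==> y : carrier W ==> x \<oplus>\<^bsub>W\<^esub> y : carrier W"
  and z: "\<zero>\<^bsub>W\<^esub> : carrier W"
  and assoc: "!!x y z. x : carrier W ==> y : carrier W ==> z : carrier W ==>
   (x \<oplus>\<^bsub>W\<^esub> y) \<oplus>\<^bsub>W\<^esub> z = x \<oplus>\<^bsub>W\<^esub> (y \<oplus>\<^bsub>W\<^esub> z)"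
  and comm: "!!x y. x : carrier W ==> y : carrier W ==> x \<oplus>\<^bsub>W\<^esub> y = y \<oplus>\<^bsub>W\<^esub> x"
  and lz: "!!x. x : carrier W ==> \<zero>\<^bsub>W\<^esub> \<oplus>\<^bsub>W\<^esub> x = x"
  and sm: "!!a x. a : carrier A ==> x : carrier W ==> a \<odot>\<^bsub>W\<^esub> x : carrier W"
  and sl: "!!a b x. a : carrier A ==> b : carrier A ==> x : carrier W ==>
   (a \<oplus> b) \<odot>\<^bsub>W\<^esub> x = a \<odot>\<^bsub>W\<^esub> x \<oplus>\<^bsub>W\<^esub> b \<odot>\<^bsub>W\<^esub> x"
  and sr: "!!a x y. a : carrier A ==> x : carrier W ==> y : carrier W ==>
   a \<odot>\<^bsub>W\<^esub> (x \<oplus>\<^bsub>W\<^esub> y) = a \<odot>\<^bsub>W\<^esub> x \<oplus>\<^bsub>W\<^esub> a \<odot>\<^bsub>W\<^esub> y"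
  and ss: "!!a b x. a : carrier A ==> b : carrier A ==> x : carrier W ==>
   (a \<otimes> b) \<odot>\<^bsub>W\<^esub> x = a \<odot>\<^bsub>W\<^esub> (b \<odot>\<^bsub>W\<^esub> x)"
  and so: "!!x. x : carrier W ==> \<one> \<odot>\<^bsub>W\<^esub> x = x"
  and s0: "!!x. x : carrier W ==> \<zero> \<odot>\<^bsub>W\<^esub> x = \<zero>\<^bsub>W\<^esub>"
  and Hc: "!!i x. x : mgrad W i ==> x : carrier W" and H0: "!!i. \<zero>\<^bsub>W\<^esub> : mgrad W i"
  and Ha: "!!i x y. x : mgrad W i ==> y : mgrad W i ==> x \<oplus>\<^bsub>W\<^esub> y : mgrad W i"
  and Hs: "!!i j a x. a : rgrad A i ==> x : mgrad W j ==> a \<odot>\<^bsub>W\<^esub> x : mgrad W (i + j)"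
  and c: "!!x i. x : carrier W ==> c x i : mgrad W i"
  and fin: "!!x. x : carrier W ==> finite {i. c x i ~= \<zero>\<^bsub>W\<^esub>}"
  and sum: "!!x. x : carrier W ==> abelian_group W ==> finsum W (c x) {i. c x i ~= \<zero>\<^bsub>W\<^esub>} = x"
  and cadd: "!!x y i. x : carrier W ==> y : carrier W ==> c (x \<oplus>\<^bsub>W\<^esub> y) i = c x i \<oplus>\<^bsub>W\<^esub> c y i"
  and chom: "!!x i j. x : mgrad W i ==> c x j = (if j = i then x else \<zero>\<^bsub>W\<^esub>)"
 shows "gm W"
proof -
 have neg: "((\<ominus> \<one>) \<odot>\<^bsub>W\<^esub> x) \<oplus>\<^bsub>W\<^esub> x = \<zero>\<^bsub>W\<^esub>" if "x : carrier W" for x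
  using sl[of "\<ominus> \<one>" \<one> x] that by (simp add: so s0 GA.l_neg)
 have ag: "abelian_group W"
 proof (rule abelian_groupI)
  show "EX y:carrier W. y \<oplus>\<^bsub>W\<^esub> x = \<zero>\<^bsub>W\<^esub>" if "x : carrier W" for x
   using neg[OF that] sm[OF _ that, of "\<ominus> \<one>"] by blast
 qed (fact cl z assoc comm lz)+
 interpret W: abelian_group W by (rule ag)
 have m: "module A W"
  by (intro module.intro is_cring ag module_axioms.intro) (fact sm sl sr ss so)+
 have "additive_subgroup (mgrad W i) W" for i
 proof (intro additive_subgroup.intro W.add.subgroupI)
  fix x assume x: "x : mgrad W i"
  have "(\<ominus> \<one>) \<odot>\<^bsub>W\<^esub> x = \<ominus>\<^bsub>W\<^esub> x"
   using W.minus_equality[OF neg[OF Hc[OF x]]] Hc[OF x] sm by simp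
  then show "\<ominus>\<^bsub>W\<^esub> x : mgrad W i" using Hs[of "\<ominus> \<one>" 0 x i] x by simp
 next
  show "mgrad W i ~= {}" using H0[of i] by blast
 qed (use Hc H0 Ha in auto)
 then have "grading W (mgrad W)"
 proof (rule W.gradingI[of _ c])
  show "c x i : mgrad W i" if "x : carrier W" for x i by (rule c[OF that])
  show "finite {i. c x i ~= \<zero>\<^bsub>W\<^esub>}" if "x : carrier W" for x by (rule fin[OF that])
  show "x = finsum W (c x) {i. c x i ~= \<zero>\<^bsub>W\<^esub>}" if "x : carrier W" for x
   using sum[OF that ag] by simp
  show "c (x \<oplus>\<^bsub>W\<^esub> y) i = c x i \<oplus>\<^bsub>W\<^esub> c y i" if "x : carrier W" "y : carrier W" for x y i
   by (rule cadd[OF that])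
  show "c x j = (if j = i then x else \<zero>\<^bsub>W\<^esub>)" if "x : mgrad W i" for x i j
   by (rule chom[OF that])
 qed
 with m Hs show ?thesis by (simp add: graded_module_def)
qed

lemma finsum_record_cong:
 fixes M :: "('m, 'u) ring_scheme" and N :: "('m, 'v) ring_scheme"
 assumes "carrier N = carrier M" "add N = add M" "\<zero>\<^bsub>N\<^esub> = \<zero>\<^bsub>M\<^esub>"
 shows "finsum N = finsum M"
proof (intro ext)
 show "finsum N f F = finsum M f F" for f :: "'c => 'm" and F
  by (simp add: finsum_def finprod_def assms)
qed

lemma gm_cong:
 fixes M :: "('a, 'm, 'u) gr_module_scheme" and N :: "('a, 'm, 'v) gr_module_scheme"
 assumes M: "gm M" and e: "carrier N = carrier M" "add N = add M" "\<zero>\<^bsub>N\<^esub> = \<zero>\<^bsub>M\<^esub>"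
  "smult N = smult M" "mgrad N = mgrad M"
 shows "gm N"
proof -
 interpret graded_group M "mgrad M" by (rule gm_graded[OF M])
 show ?thesis
  by (rule gmI[of N cmp])
   (use M cmp_finite cmp_sum gm_smult_deg[OF M] in \<open>simp_all add: e finsum_record_cong[OF e(1-3)]
    smult_arith group_rearrange cmp_add cmp_hom\<close>)
qed

text \<open>Maps that are finite sums of a functional times a homogeneous vector. A module has a
  dual basis exactly if its identity is of this kind; since such maps can be added and arise by
  factoring through a module with a dual basis, closure under sums and retracts is
  immediate.\<close>

definition frk :: "int => ('a, 'm, 'u) gr_module_scheme => ('a, 'n, 'v) gr_module_scheme => ('m => 'n) => bool" where
 "frk k M N f \<longleftrightarrow> (EX (n::nat) y d \<phi>. (ALL i<n. y i : mgrad N (d i) & lmap (k - d i) M U (\<phi> i)) &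
  (ALL x:carrier M. f x = finsum N (%i. \<phi> i x \<odot>\<^bsub>N\<^esub> y i) {..<n}))"

definition fg :: "('a, 'm, 'u) gr_module_scheme => bool" where
 "fg M \<longleftrightarrow> (EX n q d \<phi>. dual_basis M n q d \<phi>)"

lemma fgI: "frk 0 M M (%x. x) ==> fg M"
 by (simp add: frk_def fg_def dual_basis_def)

lemma frk_cong: "frk k M N f ==> k = l ==> (!!x. x : carrier M ==> g x = f x) ==> frk l M N g"
 by (simp add: frk_def)

text \<open>Inserting the dual basis of the middle module writes the composite as a finite
  sum.\<close>

lemma frk_comp:
 assumes "gm W" "gm M" "gm N" "fg M" and \<alpha>: "lmap a W M \<alpha>" and \<beta>: "lmap b M N \<beta>"
 shows "frk (a + b) W N (%x. \<beta> (\<alpha> x))"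
proof -
 obtain n q d \<phi> where db: "dual_basis M n q d \<phi>" using assms by (auto simp: fg_def)
 have "ALL i<n. \<beta> (q i) : mgrad N (d i + b) & lmap (a + b - (d i + b)) W U (%x. \<phi> i (\<alpha> x))"
  using lmap_deg[OF \<beta> dbD(1)[OF db]] lmap_comp[OF \<alpha> dbD(2)[OF db]] by simp
 moreover have "ALL x:carrier W. \<beta> (\<alpha> x) = finsum N (%i. \<phi> i (\<alpha> x) \<odot>\<^bsub>N\<^esub> \<beta> (q i)) {..<n}"
  using db_expand[OF assms(2,3) db \<beta> lmap_closed[OF \<alpha>]] by simp
 ultimately show ?thesis unfolding frk_def
  by (intro exI[of _ n] exI[of _ "%i. \<beta> (q i)"] exI[of _ "%i. d i + b"] exI[of _ "%i x. \<phi> i (\<alpha> x)"]) simp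
qed

lemma frk_add:
 assumes M: "gm M" and N: "gm N" and f: "frk k M N f" and g: "frk k M N g"
 shows "frk k M N (%x. f x \<oplus>\<^bsub>N\<^esub> g x)"
proof -
 interpret N: abelian_group N using N by simp
 obtain n :: nat and y d \<phi> where 1: "!!i. i < n ==> y i : mgrad N (d i)" "!!i. i < n ==> lmap (k - d i) M U (\<phi> i)"
  "!!x. x : carrier M ==> f x = finsum N (%i. \<phi> i x \<odot>\<^bsub>N\<^esub> y i) {..<n}"
  using f unfolding frk_def by blast
 obtain n' :: nat and y' d' \<phi>' where 2: "!!i. i < n' ==> y' i : mgrad N (d' i)" "!!i. i < n' ==> lmap (k - d' i) M U (\<phi>' i)"
  "!!x. x : carrier M ==> g x = finsum N (%i. \<phi>' i x \<odot>\<^bsub>N\<^esub> y' i) {..<n'}"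
  using g unfolding frk_def by blast
 let ?m = "%u u' i. if i < n then u i else u' (i - n)"
 have c1: "\<phi> i x \<odot>\<^bsub>N\<^esub> y i : carrier N" if "i < n" "x : carrier M" for i x
  using lmap_closed[OF 1(2)[OF that(1)] that(2)] gm_carrier[OF N 1(1)[OF that(1)]] N by simp
 have c2: "\<phi>' i x \<odot>\<^bsub>N\<^esub> y' i : carrier N" if "i < n'" "x : carrier M" for i x
  using lmap_closed[OF 2(2)[OF that(1)] that(2)] gm_carrier[OF N 2(1)[OF that(1)]] N by simp
 have "finsum N (%i. ?m \<phi> \<phi>' i x \<odot>\<^bsub>N\<^esub> ?m y y' i) {..<n + m} =
  finsum N (%i. \<phi> i x \<odot>\<^bsub>N\<^esub> y i) {..<n} \<oplus>\<^bsub>N\<^esub> finsum N (%i. \<phi>' i x \<odot>\<^bsub>N\<^esub> y' i) {..<m}"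
  if x: "x : carrier M" and "m \<le> n'" for x m
  using that(2)
 proof (induction m)
  case 0
  have "finsum N (%i. ?m \<phi> \<phi>' i x \<odot>\<^bsub>N\<^esub> ?m y y' i) {..<n} = finsum N (%i. \<phi> i x \<odot>\<^bsub>N\<^esub> y i) {..<n}"
   using c1 x by (intro N.finsum_cong') auto
  moreover have "finsum N (%i. \<phi> i x \<odot>\<^bsub>N\<^esub> y i) {..<n} : carrier N"
   using c1 x by (intro finsum_lmap_closed[OF N]) auto
  ultimately show ?case by simp
 next
  case (Suc m)
  have cc: "?m \<phi> \<phi>' i x \<odot>\<^bsub>N\<^esub> ?m y y' i : carrier N" if "i \<le> n + m" for i
   using c1[of i x] c2[of "i - n" x] x Suc.prems that by auto
  have "finsum N (%i. \<phi> i x \<odot>\<^bsub>N\<^esub> y i) {..<n} : carrier N" "finsum N (%i. \<phi>' i x \<odot>\<^bsub>N\<^esub> y' i) {..<m} : carrier N"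
   using c1 c2 x Suc.prems by (auto intro!: finsum_lmap_closed[OF N])
  then show ?case
   using Suc cc finsum_Suc'[OF N, of "n + m" "%i. ?m \<phi> \<phi>' i x \<odot>\<^bsub>N\<^esub> ?m y y' i"]
    finsum_Suc'[OF N, of m "%i. \<phi>' i x \<odot>\<^bsub>N\<^esub> y' i"] c2[OF _ x]
   by (simp add: N.a_assoc)
 qed
 from this[OF _ le_refl] have "ALL x:carrier M. f x \<oplus>\<^bsub>N\<^esub> g x =
   finsum N (%i. ?m \<phi> \<phi>' i x \<odot>\<^bsub>N\<^esub> ?m y y' i) {..<n + n'}"
  using 1(3) 2(3) by simp
 moreover have "ALL i<n + n'. ?m y y' i : mgrad N (?m d d' i) & lmap (k - ?m d d' i) M U (?m \<phi> \<phi>' i)"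
  using 1(1,2) 2(1,2) by simp
 ultimately show ?thesis unfolding frk_def
  by (intro exI[of _ "n + n'"] exI[of _ "?m y y'"] exI[of _ "?m d d'"] exI[of _ "?m \<phi> \<phi>'"] conjI)
qed

lemma frk_zero:
 assumes "gm N" shows "frk k M N (%_. \<zero>\<^bsub>N\<^esub>)"
proof -
 interpret N: abelian_group N using assms by simp
 show ?thesis unfolding frk_def by (intro exI[of _ "0 :: nat"]) simp
qed

lemma frk_sum:
 assumes M: "gm M" and N: "gm N" and "finite F" "!!j. j : F ==> frk k M N (f j)"
  and c: "!!j x. j : F ==> x : carrier M ==> f j x : carrier N"
 shows "frk k M N (%x. finsum N (%j. f j x) F)"
 using assms(3-)
proof (induction F)
 case empty
 interpret N: abelian_group N using assms by simp
 show ?case using frk_zero[OF N] by simp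
next
 case (insert j F)
 interpret N: abelian_group N using assms by simp
 have "frk k M N (%x. f j x \<oplus>\<^bsub>N\<^esub> finsum N (%j. f j x) F)"
  using insert by (intro frk_add[OF M N]) auto
 then show ?case
  by (rule frk_cong[OF _ refl]) (use insert in \<open>auto intro!: N.finsum_insert\<close>)
qed

lemma dg_sum_simps [simp]:
 "carrier (dg_sum M N) = carrier M \<times> carrier N" "\<zero>\<^bsub>dg_sum M N\<^esub> = (\<zero>\<^bsub>M\<^esub>, \<zero>\<^bsub>N\<^esub>)"
 "(x, y) \<oplus>\<^bsub>dg_sum M N\<^esub> (x', y') = (x \<oplus>\<^bsub>M\<^esub> x', y \<oplus>\<^bsub>N\<^esub> y')"
 "a \<odot>\<^bsub>dg_sum M N\<^esub> (x, y) = (a \<odot>\<^bsub>M\<^esub> x, a \<odot>\<^bsub>N\<^esub> y)"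
 "mgrad (dg_sum M N) i = mgrad M i \<times> mgrad N i"
 "\<partial>\<^bsub>dg_sum M N\<^esub> (x, y) = (\<partial>\<^bsub>M\<^esub> x, \<partial>\<^bsub>N\<^esub> y)"
 by (simp_all add: dg_sum_def)

lemma dg_sum_gm [simp]:
 assumes M: "gm M" and N: "gm N" shows "gm (dg_sum M N)"
proof -
 interpret M: graded_group M "mgrad M" by (rule gm_graded[OF M])
 interpret N: graded_group N "mgrad N" by (rule gm_graded[OF N])
 let ?c = "%x i. (M.cmp (fst x) i, N.cmp (snd x) i)"
 have fin: "finite {i. ?c x i ~= \<zero>\<^bsub>dg_sum M N\<^esub>}" if "x : carrier (dg_sum M N)" for x
 proof -
  have "{i. ?c x i ~= \<zero>\<^bsub>dg_sum M N\<^esub>} \<subseteq> {i. M.cmp (fst x) i ~= \<zero>\<^bsub>M\<^esub>} \<union> {i. N.cmp (snd x) i ~= \<zero>\<^bsub>N\<^esub>}" by auto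
  moreover have "finite \<dots>" using that M.cmp_finite N.cmp_finite by auto
  ultimately show ?thesis by (rule finite_subset)
 qed
 show ?thesis
 proof (rule gmI[of _ ?c])
  fix x assume x: "x : carrier (dg_sum M N)" and ag: "abelian_group (dg_sum M N)"
  let ?F = "{i. ?c x i ~= \<zero>\<^bsub>dg_sum M N\<^esub>}"
  let ?s = "finsum (dg_sum M N) (?c x) ?F"
  have cc: "?c x i : carrier (dg_sum M N)" for i using x by auto
  have "fst ?s = finsum M (%i. fst (?c x i)) ?F"
   using cc by (intro additive_finsum[OF ag M.abelian_group_axioms, of fst]) auto
  also have "\<dots> = finsum M (M.cmp (fst x)) ?F" by simp
  also have "\<dots> = fst x" by (rule M.cmp_sum_superset[symmetric]) (use x fin[OF x] in auto)
  finally have 1: "fst ?s = fst x" .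
  have "snd ?s = finsum N (%i. snd (?c x i)) ?F"
   using cc by (intro additive_finsum[OF ag N.abelian_group_axioms, of snd]) auto
  also have "\<dots> = finsum N (N.cmp (snd x)) ?F" by simp
  also have "\<dots> = snd x" by (rule N.cmp_sum_superset[symmetric]) (use x fin[OF x] in auto)
  finally show "?s = x" using 1 by (simp add: prod_eq_iff)
 qed (use M N fin gm_smult_deg[OF M] gm_smult_deg[OF N] in \<open>auto simp: M.group_rearrange N.group_rearrange smult_arith M.cmp_add N.cmp_add
   M.cmp_hom N.cmp_hom\<close>)
qed

lemma shift_simps [simp]:
 "carrier (shift k M) = carrier M" "add (shift k M) = add M" "\<zero>\<^bsub>shift k M\<^esub> = \<zero>\<^bsub>M\<^esub>"
 "smult (shift k M) = smult M" "mgrad (shift k M) = (%i. mgrad M (i - k))"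
 "diff (shift k M) = (%x. koszul k M (\<partial>\<^bsub>M\<^esub> x))"
 by (simp_all add: shift_def)

lemma shift_gm [simp]:
 assumes M: "gm M" shows "gm (shift k M)"
proof -
 interpret graded_group M "mgrad M" by (rule gm_graded[OF M])
 have fin: "finite {i. cmp x (i - k) ~= \<zero>\<^bsub>M\<^esub>}" if "x : carrier M" for x
 proof -
  have "{i. cmp x (i - k) ~= \<zero>\<^bsub>M\<^esub>} = (%i. i + k) ` {i. cmp x i ~= \<zero>\<^bsub>M\<^esub>}"
   by (auto intro: image_eqI[of _ _ "_ - k"])
  then show ?thesis using cmp_finite[OF that] by simp
 qed
 show ?thesis
 proof (rule gmI[of _ "%x i. cmp x (i - k)"])
  show "finsum (shift k M) (%i. cmp x (i - k)) {i. cmp x (i - k) ~= \<zero>\<^bsub>shift k M\<^esub>} = x"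
   if "x : carrier (shift k M)" for x
   using that cmp_sum_shift[of x _ k, OF _ fin[of x]] by (simp add: finsum_record_cong[of "shift k M" M])
  show "a \<odot>\<^bsub>shift k M\<^esub> x : mgrad (shift k M) (i + j)" if "a : rgrad A i" "x : mgrad (shift k M) j" for a x i j
   using gm_smult_deg[OF M that(1), of x "j - k"] that(2) by (simp add: algebra_simps)
 qed (use M fin in \<open>auto simp: group_rearrange smult_arith cmp_add cmp_hom\<close>)
qed

lemma shift_a_inv [simp]: "a_inv (shift k M) = a_inv M" "a_minus (shift k M) = a_minus M"
 by (simp_all add: a_inv_def m_inv_def[abs_def] a_minus_def[abs_def] fun_eq_iff)

end

section \<open>Signs, cones and transport along injections\<close>

context even_graded_ring
begin

lemma koszul_simps [simp]:
 assumes M: "gm M"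
 shows "x : carrier M ==> koszul k M x : carrier M"
  and "x : carrier M ==> koszul k M (koszul k M x) = x"
  and "koszul k M \<zero>\<^bsub>M\<^esub> = \<zero>\<^bsub>M\<^esub>"
 using M abelian_group.minus_zero[OF gm_group[OF M]] abelian_group.minus_minus[OF gm_group[OF M]]
 by (auto simp: koszul_def group_closed)

lemma koszul_add: "gm M ==> x : carrier M ==> y : carrier M ==>
  koszul k M (x \<oplus>\<^bsub>M\<^esub> y) = koszul k M x \<oplus>\<^bsub>M\<^esub> koszul k M y"
 using abelian_group.minus_add[OF gm_group] by (auto simp: koszul_def)

lemma koszul_smult: "gm M ==> a : carrier A ==> x : carrier M ==>
  koszul k M (a \<odot>\<^bsub>M\<^esub> x) = a \<odot>\<^bsub>M\<^esub> koszul k M x"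
 by (simp add: koszul_def smult_minus_r)

lemma koszul_lmap: "gm M ==> gm N ==> lmap l M N f ==> x : carrier M ==>
  f (koszul k M x) = koszul k N (f x)"
 by (simp add: koszul_def lmap_minus)

lemma koszul_deg: "gm M ==> x : mgrad M i ==> koszul k M x : mgrad M i"
 using graded_group.G_minus[OF gm_graded] by (auto simp: koszul_def)

text \<open>A nonzero \<open>a\<close> has even degree, and then \<open>k\<close> and
  \<open>l\<close> have the same parity. Applied to a matrix entry, whose degree is the difference
  of its row and column degrees, this makes the signs of row and column interchangeable.\<close>

lemma koszul_coeff:
 assumes "gm M" "a : rgrad A m" "even m \<longleftrightarrow> even (k - l)" "x : carrier M"
 shows "a \<odot>\<^bsub>M\<^esub> koszul k M x = a \<odot>\<^bsub>M\<^esub> koszul l M x"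
proof (cases "even m")
 case False
 then have "a = \<zero>" using A_odd assms(2) by blast
 then show ?thesis using assms by simp
next
 case True
 then have "even k \<longleftrightarrow> even l" using assms(3) by simp
 then show ?thesis by (simp add: koszul_def)
qed

lemma lmap_koszul: "gm M ==> gm N ==> lmap l M N f ==> lmap l M N (%x. koszul k N (f x))"
 by (cases "even k") (simp_all add: koszul_def lmap_uminus)

lemma dgI:
 assumes "gm M" "lmap (-1) M M \<partial>\<^bsub>M\<^esub>" "!!x. x : carrier M ==> \<partial>\<^bsub>M\<^esub> (\<partial>\<^bsub>M\<^esub> x) = \<zero>\<^bsub>M\<^esub>"
 shows "dg_module A M"
 using assms graded_linear_iff[OF assms(1,1)] unfolding dg_module_def by blast

lemma shift_lmap:
 assumes "lmap l M N f" shows "lmap l (shift k M) (shift k N) f"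
proof -
 have "f x : mgrad N (i + l - k)" if "x : mgrad M (i - k)" for x i
  using lmap_deg[OF assms that] by (simp add: algebra_simps)
 then show ?thesis using lmapD(1-3)[OF assms] by (simp add: lmap_def)
qed

lemma shift_dg [simp]:
 assumes "dg_module A M" shows "dg_module A (shift k M)"
proof (rule dgI)
 note g = dg_gm[OF assms] and dD = dgD[OF assms]
 have "lmap (-1) M M (%x. koszul k M (\<partial>\<^bsub>M\<^esub> x))" using lmap_koszul[OF g g dg_lmap[OF assms]] .
 from shift_lmap[OF this] show "lmap (-1) (shift k M) (shift k M) \<partial>\<^bsub>shift k M\<^esub>"
  by simp
 show "\<partial>\<^bsub>shift k M\<^esub> (\<partial>\<^bsub>shift k M\<^esub> x) = \<zero>\<^bsub>shift k M\<^esub>" if "x : carrier (shift k M)" for x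
  using that koszul_lmap[OF g g dg_lmap[OF assms]] g by (simp add: dD)
qed (use assms in simp)

lemma dg_sum_dg [simp]:
 assumes M: "dg_module A M" and N: "dg_module A N" shows "dg_module A (dg_sum M N)"
 by (rule dgI) (use assms dgD[OF M] dgD[OF N] in \<open>auto simp: lmap_def\<close>)

lemma cone_simps [simp]:
 "carrier (cone M N f) = carrier N \<times> carrier M" "\<zero>\<^bsub>cone M N f\<^esub> = (\<zero>\<^bsub>N\<^esub>, \<zero>\<^bsub>M\<^esub>)"
 "(y, x) \<oplus>\<^bsub>cone M N f\<^esub> (y', x') = (y \<oplus>\<^bsub>N\<^esub> y', x \<oplus>\<^bsub>M\<^esub> x')"
 "a \<odot>\<^bsub>cone M N f\<^esub> (y, x) = (a \<odot>\<^bsub>N\<^esub> y, a \<odot>\<^bsub>M\<^esub> x)"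
 "mgrad (cone M N f) i = mgrad N i \<times> mgrad M (i - 1)"
 "\<partial>\<^bsub>cone M N f\<^esub> (y, x) = (\<partial>\<^bsub>N\<^esub> y \<oplus>\<^bsub>N\<^esub> f x, \<ominus>\<^bsub>M\<^esub> \<partial>\<^bsub>M\<^esub> x)"
 by (simp_all add: cone_def dg_sum_def koszul_def)

lemma cone_gm [simp]:
 assumes "gm M" "gm N" shows "gm (cone M N f)"
 by (rule gm_cong[OF dg_sum_gm[OF assms(2) shift_gm[OF assms(1)]]]) (simp_all add: cone_def dg_sum_def)

lemma pair_minus:
 assumes "gm M" "gm N" "x : carrier M" "y : carrier N" "gm W" "carrier W = carrier M \<times> carrier N"
  "!!x y x' y'. (x, y) \<oplus>\<^bsub>W\<^esub> (x', y') = (x \<oplus>\<^bsub>M\<^esub> x', y \<oplus>\<^bsub>N\<^esub> y')" "\<zero>\<^bsub>W\<^esub> = (\<zero>\<^bsub>M\<^esub>, \<zero>\<^bsub>N\<^esub>)"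
 shows "\<ominus>\<^bsub>W\<^esub> (x, y) = (\<ominus>\<^bsub>M\<^esub> x, \<ominus>\<^bsub>N\<^esub> y)"
proof -
 interpret W: abelian_group W using assms by simp
 interpret M: abelian_group M using assms by simp
 interpret N: abelian_group N using assms by simp
 show ?thesis using assms by (intro W.minus_equality) (simp_all add: M.l_neg N.l_neg)
qed

lemma cone_minus [simp]:
 assumes "gm M" "gm N" "y : carrier N" "x : carrier M"
 shows "\<ominus>\<^bsub>cone M N f\<^esub> (y, x) = (\<ominus>\<^bsub>N\<^esub> y, \<ominus>\<^bsub>M\<^esub> x)"
 using assms by (intro pair_minus) simp_all

lemma cone_diff [simp]:
 assumes "gm M" "gm N" "y : carrier N" "x : carrier M" "y' : carrier N" "x' : carrier M"
 shows "(y, x) \<ominus>\<^bsub>cone M N f\<^esub> (y', x') = (y \<ominus>\<^bsub>N\<^esub> y', x \<ominus>\<^bsub>M\<^esub> x')"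
 using assms by (simp add: a_minus_def group_closed)

lemma dg_sum_minus [simp]:
 assumes "gm M" "gm N" "y : carrier N" "x : carrier M"
 shows "\<ominus>\<^bsub>dg_sum N M\<^esub> (y, x) = (\<ominus>\<^bsub>N\<^esub> y, \<ominus>\<^bsub>M\<^esub> x)"
 using assms by (intro pair_minus) simp_all

lemma dg_sum_diff [simp]:
 assumes "gm M" "gm N" "y : carrier N" "x : carrier M" "y' : carrier N" "x' : carrier M"
 shows "(y, x) \<ominus>\<^bsub>dg_sum N M\<^esub> (y', x') = (y \<ominus>\<^bsub>N\<^esub> y', x \<ominus>\<^bsub>M\<^esub> x')"
 using assms by (simp add: a_minus_def group_closed)


definition cm :: "('a, 'm) dg_module => ('a, 'n) dg_module => ('m => 'n) => bool" where
 "cm M N f \<longleftrightarrow> lmap 0 M N f & (ALL x:carrier M. f (\<partial>\<^bsub>M\<^esub> x) = \<partial>\<^bsub>N\<^esub> (f x))"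

lemma chain_map_iff: "gm M ==> gm N ==> chain_map A M N f \<longleftrightarrow> cm M N f"
 by (simp add: chain_map_def cm_def graded_linear_iff)

lemma cmD: "cm M N f ==> lmap 0 M N f" "cm M N f ==> x : carrier M ==> f (\<partial>\<^bsub>M\<^esub> x) = \<partial>\<^bsub>N\<^esub> (f x)"
 by (simp_all add: cm_def)

lemma cm_comp: "cm M N f ==> cm N P g ==> cm M P (%x. g (f x))"
 using lmap_comp[of 0 M N f 0 P g] lmap_closed[of 0 M N f] by (auto simp: cm_def)

lemma cm_id: "cm M M (%x. x)"
 by (simp add: cm_def lmap_id)

lemma cone_dg [simp]:
 assumes M: "dg_module A M" and N: "dg_module A N" and f: "cm M N f"
 shows "dg_module A (cone M N f)"
proof (rule dgI)
 note gM [simp] = dg_gm[OF M] and gN [simp] = dg_gm[OF N]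
 note D = dgD[OF M] dgD[OF N] lmapD[OF cmD(1)[OF f]] lmapD0[OF gM gN cmD(1)[OF f]] cmD(2)[OF f]
 interpret M: graded_group M "mgrad M" by (rule gm_graded[OF gM])
 interpret N: graded_group N "mgrad N" by (rule gm_graded[OF gN])
 show "gm (cone M N f)" by simp
 show "lmap (-1) (cone M N f) (cone M N f) \<partial>\<^bsub>cone M N f\<^esub>"
 proof -
  have dg: "f b : mgrad N (i - 1)" if "b : mgrad M (i - 1)" for i b
   using lmap_deg[OF cmD(1)[OF f] that] by simp
  have dg2: "\<partial>\<^bsub>M\<^esub> b : mgrad M (i - 2)" if "b : mgrad M (i - 1)" for i b
   using D(4)[OF that] by simp
  have ar: "\<partial>\<^bsub>N\<^esub> y \<oplus>\<^bsub>N\<^esub> \<partial>\<^bsub>N\<^esub> y' \<oplus>\<^bsub>N\<^esub> (f x \<oplus>\<^bsub>N\<^esub> f x') = (\<partial>\<^bsub>N\<^esub> y \<oplus>\<^bsub>N\<^esub> f x) \<oplus>\<^bsub>N\<^esub> (\<partial>\<^bsub>N\<^esub> y' \<oplus>\<^bsub>N\<^esub> f x')"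
   if "x : carrier M" "x' : carrier M" "y : carrier N" "y' : carrier N" for x x' y y'
   using that by (simp add: D N.group_rearrange)
  show ?thesis unfolding lmap_def
  proof (intro conjI ballI allI)
   fix x y assume "x : carrier (cone M N f)" "y : carrier (cone M N f)"
   then show "\<partial>\<^bsub>cone M N f\<^esub> (x \<oplus>\<^bsub>cone M N f\<^esub> y) = \<partial>\<^bsub>cone M N f\<^esub> x \<oplus>\<^bsub>cone M N f\<^esub> \<partial>\<^bsub>cone M N f\<^esub> y"
    by (cases x, cases y) (simp add: D ar M.minus_add)
  next
   fix a x assume "a : carrier A" "x : carrier (cone M N f)"
   then show "\<partial>\<^bsub>cone M N f\<^esub> (a \<odot>\<^bsub>cone M N f\<^esub> x) = a \<odot>\<^bsub>cone M N f\<^esub> \<partial>\<^bsub>cone M N f\<^esub> x"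
    by (cases x) (simp add: D smult_add_r smult_minus_r)
  next
   fix i x assume "x : mgrad (cone M N f) i"
   then show "\<partial>\<^bsub>cone M N f\<^esub> x : mgrad (cone M N f) (i + - 1)"
    by (cases x) (use dg dg2 D(12) in simp)
  next
   fix x assume "x : carrier (cone M N f)"
   then show "\<partial>\<^bsub>cone M N f\<^esub> x : carrier (cone M N f)" by (cases x) (simp add: D)
  qed
 qed
 show "\<partial>\<^bsub>cone M N f\<^esub> (\<partial>\<^bsub>cone M N f\<^esub> x) = \<zero>\<^bsub>cone M N f\<^esub>" if "x : carrier (cone M N f)" for x
  using that by (auto simp: D M.minus_zero N.r_neg)
qed

lemma cone_fg [simp]:
 assumes M: "gm M" and N: "gm N" and "fg M" "fg N" shows "fg (cone M N f)"
proof (rule fgI)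
 interpret M: abelian_group M using M by simp
 interpret N: abelian_group N using N by simp
 let ?C = "cone M N f"
 have C: "gm ?C" using assms by simp
 have z: "\<zero>\<^bsub>M\<^esub> : mgrad M i" "\<zero>\<^bsub>N\<^esub> : mgrad N i" for i
  using graded_group.G_zero[OF gm_graded[OF M]] graded_group.G_zero[OF gm_graded[OF N]] by auto
 have 1: "lmap 0 ?C N fst" "lmap (-1) ?C M snd" "lmap 0 N ?C (%y. (y, \<zero>\<^bsub>M\<^esub>))"
  "lmap 1 M ?C (%x. (\<zero>\<^bsub>N\<^esub>, x))"
  using M N z by (auto simp: lmap_def group_closed)
 have "frk 0 ?C ?C (%x. (fst x, \<zero>\<^bsub>M\<^esub>) \<oplus>\<^bsub>?C\<^esub> (\<zero>\<^bsub>N\<^esub>, snd x))"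
  using frk_comp[OF C N C assms(4) 1(1,3)] frk_comp[OF C M C assms(3) 1(2,4)]
  by (intro frk_add[OF C C]) simp_all
 then show "frk 0 ?C ?C (%x. x)" by (rule frk_cong) auto
qed

lemma shift_fg [simp]:
 assumes M: "gm M" and "fg M" shows "fg (shift k M)"
proof (rule fgI)
 have "lmap k M (shift k M) (%x. x)" "lmap (- k) (shift k M) M (%x. x)"
  by (auto simp: lmap_def)
 from frk_comp[OF shift_gm[OF M] M shift_gm[OF M] assms(2) this(2,1)]
 show "frk 0 (shift k M) (shift k M) (%x. x)" by simp
qed

text \<open>The copy of \<open>M\<close> on the image of an injection \<open>c\<close>.\<close>

definition tr :: "('m => 'n) => ('a, 'm) dg_module => ('a, 'n) dg_module" where
 "tr c M = (let b = inv_into (carrier M) c in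
  \<lparr>carrier = c ` carrier M, mult = undefined, one = undefined, ring.zero = c \<zero>\<^bsub>M\<^esub>,
   add = %x y. c (b x \<oplus>\<^bsub>M\<^esub> b y), smult = %a x. c (a \<odot>\<^bsub>M\<^esub> b x),
   mgrad = %i. c ` mgrad M i, diff = %x. c (\<partial>\<^bsub>M\<^esub> (b x))\<rparr>)"

lemma tr_simps:
 "carrier (tr c M) = c ` carrier M" "\<zero>\<^bsub>tr c M\<^esub> = c \<zero>\<^bsub>M\<^esub>" "mgrad (tr c M) i = c ` mgrad M i"
 by (simp_all add: tr_def Let_def)

lemma tr_ops:
 assumes "inj_on c (carrier M)"
 shows "x : carrier M ==> y : carrier M ==> c x \<oplus>\<^bsub>tr c M\<^esub> c y = c (x \<oplus>\<^bsub>M\<^esub> y)"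
  "x : carrier M ==> a \<odot>\<^bsub>tr c M\<^esub> c x = c (a \<odot>\<^bsub>M\<^esub> x)"
  "x : carrier M ==> \<partial>\<^bsub>tr c M\<^esub> (c x) = c (\<partial>\<^bsub>M\<^esub> x)"
 using assms by (simp_all add: tr_def Let_def inv_into_f_f)

lemma tr_gm:
 assumes M: "gm M" and c: "inj_on c (carrier M)" shows "gm (tr c M)"
proof -
 interpret graded_group M "mgrad M" by (rule gm_graded[OF M])
 let ?b = "inv_into (carrier M) c"
 have b [simp]: "?b (c x) = x" if "x : carrier M" for x using c that by (rule inv_into_f_f)
 have ci: "c x = c y \<longleftrightarrow> x = y" if "x : carrier M" "y : carrier M" for x y
  using c that by (auto simp: inj_on_def)
 have Z: "\<zero>\<^bsub>M\<^esub> : carrier M" by simp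
 note ops = tr_simps tr_ops[OF c]
 show ?thesis
 proof (rule gmI[of _ "%x i. c (cmp (?b x) i)"])
  fix x assume "x : carrier (tr c M)" and ag: "abelian_group (tr c M)"
  then obtain y where y: "x = c y" "y : carrier M" by (auto simp: ops)
  have 1: "{i. c (cmp y i) ~= \<zero>\<^bsub>tr c M\<^esub>} = {i. cmp y i ~= \<zero>\<^bsub>M\<^esub>}"
   using y ci by (simp add: ops)
  have 2: "c (finsum M (cmp y) F) = finsum (tr c M) (%i. c (cmp y i)) F" for F
   using y by (intro additive_finsum[OF abelian_group_axioms ag]) (auto simp: ops)
  show "finsum (tr c M) (%i. c (cmp (?b x) i)) {i. c (cmp (?b x) i) ~= \<zero>\<^bsub>tr c M\<^esub>} = x"
   unfolding y(1) b[OF y(2)] 1 2[symmetric] cmp_sum[OF y(2), symmetric] ..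
 next
  show "finite {i. c (cmp (?b x) i) ~= \<zero>\<^bsub>tr c M\<^esub>}" if "x : carrier (tr c M)" for x
   using that ci cmp_finite by (auto simp: ops)
  show "a \<odot>\<^bsub>tr c M\<^esub> x : mgrad (tr c M) (i + j)" if "a : rgrad A i" "x : mgrad (tr c M) j" for a x i j
   using that gm_smult_deg[OF M] by (auto simp: ops)
 qed (use M in \<open>auto simp: ops Z group_rearrange smult_arith cmp_add cmp_hom\<close>)
qed

definition dg_iso :: "('a, 'm) dg_module => ('a, 'n) dg_module => ('m => 'n) => ('n => 'm) => bool" where
 "dg_iso M N f g \<longleftrightarrow> cm M N f & cm N M g & (ALL x:carrier M. g (f x) = x) & (ALL y:carrier N. f (g y) = y)"

lemma tr_iso:
 assumes M: "dg_module A M" and c: "inj_on c (carrier M)"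
 shows "dg_iso M (tr c M) c (inv_into (carrier M) c)" "dg_module A (tr c M)"
proof -
 note g = dg_gm[OF M] and D = dgD[OF M]
 let ?b = "inv_into (carrier M) c"
 have b [simp]: "?b (c x) = x" if "x : carrier M" for x using c that by (rule inv_into_f_f)
 note ops = tr_simps tr_ops[OF c]
 show "dg_iso M (tr c M) c (inv_into (carrier M) c)"
  using g gm_carrier[OF g] by (auto simp: dg_iso_def cm_def lmap_def ops D group_closed)
 show "dg_module A (tr c M)"
 proof (rule dgI[OF tr_gm[OF g c]])
  show "lmap (- 1) (tr c M) (tr c M) \<partial>\<^bsub>tr c M\<^esub>"
   using g gm_carrier[OF g] by (auto simp: lmap_def ops D group_closed)
 qed (auto simp: ops D)
qed

lemma fg_iso:
 assumes "gm M" "gm N" "fg M" "lmap 0 M N f" "lmap 0 N M g" "!!y. y : carrier N ==> f (g y) = y"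
 shows "fg N"
 by (rule fgI, rule frk_cong[OF frk_comp[OF assms(2,1,2,3,5,4)]]) (simp_all add: assms(6))

end

section \<open>Modules presented by an idempotent matrix\<close>

context even_graded_ring
begin

lemma A_abelian [simp]: "abelian_group A"
 by (rule GA.abelian_group_axioms)

lemma finsum_swap:
 assumes X: "gm X" and "finite F" and g: "!!l j. l : F ==> j : G ==> g l j : carrier X"
 shows "finsum X (%l. finsum X (%j. g l j) G) F = finsum X (%j. finsum X (%l. g l j) F) G"
 using assms(2,3)
proof (induction F)
 case empty
 interpret X: abelian_group X using X by simp
 show ?case by simp
next
 case (insert l F)
 interpret X: abelian_group X using X by simp
 have in1: "finsum X (g k) G : carrier X" if "k : insert l F" for k
  using insert(4) that by (intro finsum_lmap_closed[OF X]) auto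
 have "finsum X (%l. finsum X (g l) G) (insert l F) = finsum X (g l) G \<oplus>\<^bsub>X\<^esub> finsum X (%l. finsum X (g l) G) F"
  using insert(1,2) in1 by (intro X.finsum_insert) auto
 also have "\<dots> = finsum X (g l) G \<oplus>\<^bsub>X\<^esub> finsum X (%j. finsum X (%l. g l j) F) G"
  using insert(3,4) by simp
 also have "\<dots> = finsum X (%j. g l j \<oplus>\<^bsub>X\<^esub> finsum X (%l. g l j) F) G"
  using insert(4) by (intro finsum_plus[OF X, symmetric]) (auto intro!: finsum_lmap_closed[OF X])
 also have "\<dots> = finsum X (%j. finsum X (%l. g l j) (insert l F)) G"
 proof (rule finsum_congr[OF X])
  fix j assume j: "j : G"
  show "g l j \<oplus>\<^bsub>X\<^esub> finsum X (%l. g l j) F : carrier X"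
   using insert(4) j X by (intro group_closed gm_group finsum_lmap_closed) auto
  show "g l j \<oplus>\<^bsub>X\<^esub> finsum X (%l. g l j) F = finsum X (%l. g l j) (insert l F)"
   using insert(1,2,4) j by (intro X.finsum_insert[symmetric]) auto
 qed
 finally show ?case .
qed

lemma finsum_smult_left:
 assumes "gm X" "!!l. l : F ==> c l : carrier A" "x : carrier X"
 shows "finsum A c F \<odot>\<^bsub>X\<^esub> x = finsum X (%l. c l \<odot>\<^bsub>X\<^esub> x) F"
 using assms by (intro additive_finsum) (auto simp: smult_arith)

lemma row_matrix:
 assumes X: "gm X" and "finite J" and a: "!!l. l : J ==> a l : carrier A"
  and b: "!!l j. l : J ==> j : K ==> b l j : carrier A" and y: "!!j. j : K ==> y j : carrier X"
 shows "finsum X (%l. a l \<odot>\<^bsub>X\<^esub> finsum X (%j. b l j \<odot>\<^bsub>X\<^esub> y j) K) J =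
  finsum X (%j. finsum A (%l. a l \<otimes> b l j) J \<odot>\<^bsub>X\<^esub> y j) K"
proof -
 have "finsum X (%l. a l \<odot>\<^bsub>X\<^esub> finsum X (%j. b l j \<odot>\<^bsub>X\<^esub> y j) K) J =
  finsum X (%l. finsum X (%j. (a l \<otimes> b l j) \<odot>\<^bsub>X\<^esub> y j) K) J"
 proof (rule finsum_congr[OF X])
  fix l assume l: "l : J"
  show "a l \<odot>\<^bsub>X\<^esub> finsum X (%j. b l j \<odot>\<^bsub>X\<^esub> y j) K : carrier X"
   using X a b y l by (intro gm_smult finsum_lmap_closed) auto
  show "a l \<odot>\<^bsub>X\<^esub> finsum X (%j. b l j \<odot>\<^bsub>X\<^esub> y j) K = finsum X (%j. (a l \<otimes> b l j) \<odot>\<^bsub>X\<^esub> y j) K"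
   using X a b y l by (subst smult_finsum) (auto simp: smult_smult intro!: finsum_congr)
 qed
 also have "\<dots> = finsum X (%j. finsum X (%l. (a l \<otimes> b l j) \<odot>\<^bsub>X\<^esub> y j) J) K"
  using X assms(2) a b y by (intro finsum_swap) auto
 also have "\<dots> = finsum X (%j. finsum A (%l. a l \<otimes> b l j) J \<odot>\<^bsub>X\<^esub> y j) K"
  using X a b y by (intro finsum_congr) (auto simp: finsum_smult_left intro!: finsum_lmap_closed)
 finally show ?thesis .
qed

text \<open>The tensor product of \<open>X\<close> with a projective module, in coordinates: the module is given by an
 idempotent matrix \<open>e\<close> in degrees \<open>d\<close>, its differential by the matrix \<open>D\<close>.\<close>

definition box_data :: "'i set => ('i => int) => ('i => 'i => 'a) => ('i => 'i => 'a) => bool" where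
 "box_data J d e D \<longleftrightarrow> finite J & (ALL i:J. ALL j:J.
  e i j : rgrad A (d j - d i) & D i j : rgrad A (d j - 1 - d i) &
  finsum A (%l. e i l \<otimes> e l j) J = e i j & finsum A (%l. e i l \<otimes> D l j) J = D i j &
  finsum A (%l. D i l \<otimes> D l j) J = \<zero>)"

text \<open>An element is the family of coefficients of the generators, which is fixed by
  \<open>e\<close>; a generator of degree \<open>d i\<close> leaves degree \<open>k - d i\<close>
  for its coefficient. The sign in the differential comes from moving it past that generator.
  Coordinates outside \<open>J\<close> are set to zero, so that equality of elements is equality of
  functions.\<close>

definition box :: "'i set => ('i => int) => ('i => 'i => 'a) => ('i => 'i => 'a) => ('a, 'm) dg_module
  => ('a, 'i => 'm) dg_module" where
 "box J d e D X = (let C = {y. (ALL i:J. y i : carrier X & y i = finsum X (%j. e i j \<odot>\<^bsub>X\<^esub> y j) J) &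
   (ALL i. i ~: J --> y i = \<zero>\<^bsub>X\<^esub>)} in
  \<lparr>carrier = C, mult = undefined, one = undefined, ring.zero = (%_. \<zero>\<^bsub>X\<^esub>),
   add = %y z i. y i \<oplus>\<^bsub>X\<^esub> z i, smult = %a y i. a \<odot>\<^bsub>X\<^esub> y i,
   mgrad = %k. {y : C. ALL i:J. y i : mgrad X (k - d i)},
   diff = %y i. if i : J then finsum X (%j. D i j \<odot>\<^bsub>X\<^esub> y j) J \<oplus>\<^bsub>X\<^esub> koszul (d i) X (\<partial>\<^bsub>X\<^esub> (y i)) else \<zero>\<^bsub>X\<^esub>\<rparr>)"

lemma box_carrier: "y : carrier (box J d e D X) \<longleftrightarrow>
  (ALL i:J. y i : carrier X & finsum X (%j. e i j \<odot>\<^bsub>X\<^esub> y j) J = y i) & (ALL i. i ~: J --> y i = \<zero>\<^bsub>X\<^esub>)"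
 and box_mgrad: "y : mgrad (box J d e D X) k \<longleftrightarrow>
  y : carrier (box J d e D X) & (ALL i:J. y i : mgrad X (k - d i))"
 by (auto simp: box_def Let_def)

lemma box_ops: "\<zero>\<^bsub>box J d e D X\<^esub> = (%_. \<zero>\<^bsub>X\<^esub>)" "y \<oplus>\<^bsub>box J d e D X\<^esub> z = (%i. y i \<oplus>\<^bsub>X\<^esub> z i)"
  "a \<odot>\<^bsub>box J d e D X\<^esub> y = (%i. a \<odot>\<^bsub>X\<^esub> y i)"
  "\<partial>\<^bsub>box J d e D X\<^esub> y = (%i. if i : J
   then finsum X (%j. D i j \<odot>\<^bsub>X\<^esub> y j) J \<oplus>\<^bsub>X\<^esub> koszul (d i) X (\<partial>\<^bsub>X\<^esub> (y i)) else \<zero>\<^bsub>X\<^esub>)"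
 by (simp_all add: box_def Let_def)

lemma box_all:
 assumes "y : carrier (box J d e D X)" "gm X" shows "y i : carrier X"
 using assms by (cases "i : J") (auto simp: box_carrier group_closed)

context
 fixes J d e D
 assumes bd: "box_data J d e D"
begin

lemma bdD: "finite J" "i : J ==> j : J ==> e i j : rgrad A (d j - d i)"
  "i : J ==> j : J ==> D i j : rgrad A (d j - 1 - d i)"
  "i : J ==> j : J ==> finsum A (%l. e i l \<otimes> e l j) J = e i j"
  "i : J ==> j : J ==> finsum A (%l. e i l \<otimes> D l j) J = D i j"
  "i : J ==> j : J ==> finsum A (%l. D i l \<otimes> D l j) J = \<zero>"
 using bd by (auto simp: box_data_def)

lemma bd_c: "i : J ==> j : J ==> e i j : carrier A" "i : J ==> j : J ==> D i j : carrier A"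
 using bdD(2,3) GA.G_carrier by blast+

lemma box_gm:
 assumes X: "gm X" shows "gm (box J d e D X)"
proof -
 interpret X: graded_group X "mgrad X" by (rule gm_graded[OF X])
 let ?W = "box J d e D X" and ?c = "%y k i. X.cmp (y i) (k - d i)"
 note all = box_all[OF _ X, where J = J and d = d and e = e and D = D]
 have e_eq: "finsum X (%j. e i j \<odot>\<^bsub>X\<^esub> y j) J = y i" if "y : carrier ?W" "i : J" for y i
  using that by (simp add: box_carrier)
 have out: "y i = \<zero>\<^bsub>X\<^esub>" if "y : carrier ?W" "i ~: J" for y i
  using that by (simp add: box_carrier)
 have add: "(%i. y i \<oplus>\<^bsub>X\<^esub> z i) : carrier ?W" if y: "y : carrier ?W" and z: "z : carrier ?W" for y z
 proof -
  have "finsum X (%j. e i j \<odot>\<^bsub>X\<^esub> (y j \<oplus>\<^bsub>X\<^esub> z j)) J = y i \<oplus>\<^bsub>X\<^esub> z i" if i: "i : J" for i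
  proof -
   have "finsum X (%j. e i j \<odot>\<^bsub>X\<^esub> (y j \<oplus>\<^bsub>X\<^esub> z j)) J = finsum X (%j. e i j \<odot>\<^bsub>X\<^esub> y j \<oplus>\<^bsub>X\<^esub> e i j \<odot>\<^bsub>X\<^esub> z j) J"
    using X bd_c i all[OF y] all[OF z] by (intro finsum_congr) (auto simp: smult_add_r)
   also have "\<dots> = y i \<oplus>\<^bsub>X\<^esub> z i"
    using X bd_c i all[OF y] all[OF z] by (subst finsum_plus) (auto simp: e_eq[OF y i] e_eq[OF z i])
   finally show ?thesis .
  qed
  then show ?thesis using all[OF y] all[OF z] by (simp add: box_carrier out[OF y] out[OF z])
 qed
 have sm: "(%i. a \<odot>\<^bsub>X\<^esub> y i) : carrier ?W" if a: "a : carrier A" and y: "y : carrier ?W" for a y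
 proof -
  have "finsum X (%j. e i j \<odot>\<^bsub>X\<^esub> (a \<odot>\<^bsub>X\<^esub> y j)) J = a \<odot>\<^bsub>X\<^esub> y i" if i: "i : J" for i
  proof -
   have "finsum X (%j. e i j \<odot>\<^bsub>X\<^esub> (a \<odot>\<^bsub>X\<^esub> y j)) J = finsum X (%j. a \<odot>\<^bsub>X\<^esub> (e i j \<odot>\<^bsub>X\<^esub> y j)) J"
    using X bd_c i a all[OF y] by (intro finsum_congr) (auto simp: smult_smult m_comm)
   also have "\<dots> = a \<odot>\<^bsub>X\<^esub> y i"
    using X bd_c i a all[OF y] smult_finsum[OF X a, of "%j. e i j \<odot>\<^bsub>X\<^esub> y j" J] by (auto simp: e_eq[OF y i])
   finally show ?thesis .
  qed
  then show ?thesis using all[OF y] X a by (simp add: box_carrier out[OF y])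
 qed
 have zer: "(%_. \<zero>\<^bsub>X\<^esub>) : carrier ?W"
 proof -
  have "finsum X (%j. e i j \<odot>\<^bsub>X\<^esub> \<zero>\<^bsub>X\<^esub>) J = finsum X (%j. \<zero>\<^bsub>X\<^esub>) J" if "i : J" for i
   using X bd_c that by (intro finsum_congr) auto
  then show ?thesis by (simp add: box_carrier)
 qed
 have cc: "?c y k : carrier ?W" if y: "y : carrier ?W" for y k
 proof -
  have "finsum X (%j. e i j \<odot>\<^bsub>X\<^esub> ?c y k j) J = ?c y k i" if i: "i : J" for i
  proof -
   have "?c y k i = X.cmp (finsum X (%j. e i j \<odot>\<^bsub>X\<^esub> y j) J) (k - d i)" using e_eq[OF y i] by simp
   also have "\<dots> = finsum X (%j. X.cmp (e i j \<odot>\<^bsub>X\<^esub> y j) (k - d i)) J"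
    using X bd_c i all[OF y] by (intro additive_finsum) (auto simp: X.cmp_add)
   also have "\<dots> = finsum X (%j. e i j \<odot>\<^bsub>X\<^esub> ?c y k j) J"
   proof (rule finsum_congr[OF X])
    fix j assume j: "j : J"
    show "X.cmp (e i j \<odot>\<^bsub>X\<^esub> y j) (k - d i) : carrier X" using X bd_c i j all[OF y] by simp
    show "X.cmp (e i j \<odot>\<^bsub>X\<^esub> y j) (k - d i) = e i j \<odot>\<^bsub>X\<^esub> ?c y k j"
     using lmap_cmp[OF X X lmap_smult_left[OF X X lmap_id bdD(2)[OF i j]] all[OF y], of j "k - d j"] by simp
   qed
   finally show ?thesis by simp
  qed
  then show ?thesis using all[OF y] by (simp add: box_carrier out[OF y])
 qed
 have fin: "finite {k. ?c y k ~= \<zero>\<^bsub>?W\<^esub>}" if y: "y : carrier ?W" for y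
 proof -
  have "{k. ?c y k ~= \<zero>\<^bsub>?W\<^esub>} \<subseteq> (\<Union>i\<in>J. (%k. k + d i) ` {k. X.cmp (y i) k ~= \<zero>\<^bsub>X\<^esub>})"
  proof
   fix k assume "k : {k. ?c y k ~= \<zero>\<^bsub>?W\<^esub>}"
   then obtain i where i: "X.cmp (y i) (k - d i) ~= \<zero>\<^bsub>X\<^esub>" by (auto simp: box_ops fun_eq_iff)
   then have "i : J" using out[OF y] by force
   with i show "k \<in> (\<Union>i\<in>J. (%k. k + d i) ` {k. X.cmp (y i) k ~= \<zero>\<^bsub>X\<^esub>})"
    by (intro UN_I[of i] image_eqI[of _ _ "k - d i"]) auto
  qed
  then show ?thesis by (rule finite_subset) (use bdD(1) X.cmp_finite all[OF y] in auto)
 qed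
 show ?thesis
 proof (rule gmI[of _ ?c])
  fix y assume y: "y : carrier ?W" and ag: "abelian_group ?W"
  let ?F = "{k. ?c y k ~= \<zero>\<^bsub>?W\<^esub>}"
  show "finsum ?W (?c y) ?F = y"
  proof
   fix i
   have "(finsum ?W (?c y) ?F) i = finsum X (%k. ?c y k i) ?F"
    using cc[OF y] all X by (intro additive_finsum[OF ag gm_group[OF X]]) (auto simp: box_ops)
   also have "\<dots> = y i"
    using all[OF y] fin[OF y] by (intro X.cmp_sum_shift) (auto simp: box_ops fun_eq_iff)
   finally show "(finsum ?W (?c y) ?F) i = y i" .
  qed
 next
  show "?c x j = (if j = i then x else \<zero>\<^bsub>?W\<^esub>)" if "x : mgrad ?W i" for x i j
  proof
   fix l
   show "?c x j l = (if j = i then x else \<zero>\<^bsub>?W\<^esub>) l"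
    using that out[of x l] by (cases "l : J") (auto simp: box_mgrad box_ops X.cmp_hom)
  qed
  show "a \<odot>\<^bsub>?W\<^esub> x : mgrad ?W (i + j)" if a: "a : rgrad A i" and x: "x : mgrad ?W j" for a x i j
   using sm[of a x] a x gm_smult_deg[OF X a, of _ "j - d _"] by (auto simp: box_mgrad box_ops add_diff_eq)
 qed (use X in \<open>auto simp: box_ops box_mgrad all add sm zer cc fin[unfolded box_ops] X.group_rearrange smult_arith X.cmp_add\<close>)
qed

lemma box_dg:
 assumes X: "dg_module A X" shows "dg_module A (box J d e D X)"
proof (rule dgI)
 let ?W = "box J d e D X"
 note g [simp] = dg_gm[OF X] and XD = dgD[OF X]
 interpret X: graded_group X "mgrad X" by (rule gm_graded[OF g])
 show W: "gm ?W" by (rule box_gm[OF g])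
 note all = box_all[OF _ g, where J = J and d = d and e = e and D = D]
 have row: "finsum X (%l. a l \<odot>\<^bsub>X\<^esub> (\<partial>\<^bsub>?W\<^esub> y) l) J = finsum X (%j. finsum A (%l. a l \<otimes> D l j) J \<odot>\<^bsub>X\<^esub> y j) J \<oplus>\<^bsub>X\<^esub>
   finsum X (%l. a l \<odot>\<^bsub>X\<^esub> koszul (d l) X (\<partial>\<^bsub>X\<^esub> (y l))) J"
  if y: "y : carrier ?W" and a: "!!l. l : J ==> a l : carrier A" for a y
 proof -
  have Dc: "finsum X (%j. D l j \<odot>\<^bsub>X\<^esub> y j) J : carrier X" if "l : J" for l
   using bd_c that all[OF y] by (intro finsum_lmap_closed) auto
  have "finsum X (%l. a l \<odot>\<^bsub>X\<^esub> (\<partial>\<^bsub>?W\<^esub> y) l) J = finsum X (%l. a l \<odot>\<^bsub>X\<^esub> finsum X (%j. D l j \<odot>\<^bsub>X\<^esub> y j) J \<oplus>\<^bsub>X\<^esub>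
   a l \<odot>\<^bsub>X\<^esub> koszul (d l) X (\<partial>\<^bsub>X\<^esub> (y l))) J"
   using a Dc all[OF y] by (intro finsum_congr) (auto simp: box_ops smult_add_r XD group_closed)
  also have "\<dots> = finsum X (%l. a l \<odot>\<^bsub>X\<^esub> finsum X (%j. D l j \<odot>\<^bsub>X\<^esub> y j) J) J \<oplus>\<^bsub>X\<^esub>
   finsum X (%l. a l \<odot>\<^bsub>X\<^esub> koszul (d l) X (\<partial>\<^bsub>X\<^esub> (y l))) J"
   using a Dc all[OF y] by (intro finsum_plus) (auto simp: XD)
  also have "finsum X (%l. a l \<odot>\<^bsub>X\<^esub> finsum X (%j. D l j \<odot>\<^bsub>X\<^esub> y j) J) J =
   finsum X (%j. finsum A (%l. a l \<otimes> D l j) J \<odot>\<^bsub>X\<^esub> y j) J"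
   using a bd_c all[OF y] bdD(1) by (intro row_matrix) auto
  finally show ?thesis .
 qed
 \<comment> \<open>An entry of degree \<open>d l - k\<close> vanishes unless \<open>d l\<close> and
   \<open>k\<close> have the same parity. So the signs, which vary with \<open>l\<close>, can be
   replaced by the single sign of \<open>k\<close>, and the differential of \<open>X\<close> is
   pulled out of the sum.\<close>
 have kos: "finsum X (%l. a l \<odot>\<^bsub>X\<^esub> koszul (d l) X (\<partial>\<^bsub>X\<^esub> (y l))) J =
   koszul k X (\<partial>\<^bsub>X\<^esub> (finsum X (%l. a l \<odot>\<^bsub>X\<^esub> y l) J))"
  if y: "y : carrier ?W" and a: "!!l. l : J ==> a l : rgrad A (d l - k)" for a y k
 proof -
  have ac: "a l : carrier A" if "l : J" for l using a[OF that] by simp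
  have "koszul k X (\<partial>\<^bsub>X\<^esub> (finsum X (%l. a l \<odot>\<^bsub>X\<^esub> y l) J)) = finsum X (%l. koszul k X (\<partial>\<^bsub>X\<^esub> (a l \<odot>\<^bsub>X\<^esub> y l))) J"
   using ac all[OF y] by (intro lmap_finsum[OF g g lmap_koszul[OF g g dg_lmap[OF X]]]) auto
  also have "\<dots> = finsum X (%l. a l \<odot>\<^bsub>X\<^esub> koszul (d l) X (\<partial>\<^bsub>X\<^esub> (y l))) J"
   using ac all[OF y] koszul_coeff[OF g a, of _ "d _" k]
   by (intro finsum_congr) (auto simp: XD koszul_smult)
  finally show ?thesis by simp
 qed
 have Dy: "finsum X (%j. D i j \<odot>\<^bsub>X\<^esub> y j) J : carrier X" if "i : J" "y : carrier ?W" for i y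
  using bd_c that all by (intro finsum_lmap_closed) auto
 have cl: "\<partial>\<^bsub>?W\<^esub> y : carrier ?W" if y: "y : carrier ?W" for y
 proof -
  have "finsum X (%l. e i l \<odot>\<^bsub>X\<^esub> (\<partial>\<^bsub>?W\<^esub> y) l) J = (\<partial>\<^bsub>?W\<^esub> y) i" if i: "i : J" for i
  proof -
   have "finsum X (%j. finsum A (%l. e i l \<otimes> D l j) J \<odot>\<^bsub>X\<^esub> y j) J = finsum X (%j. D i j \<odot>\<^bsub>X\<^esub> y j) J"
    using bd_c i all[OF y] by (intro finsum_congr) (auto simp: bdD(5))
   then show ?thesis
    using row[OF y, of "e i"] kos[OF y, of "e i" "d i"] bd_c i bdD(2) y by (simp add: box_ops box_carrier)
  qed
  moreover have "(\<partial>\<^bsub>?W\<^esub> y) i : carrier X" if "i : J" for i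
   using that Dy[OF that y] all[OF y] by (simp add: box_ops XD group_closed)
  ultimately show ?thesis unfolding box_carrier by (simp add: box_ops)
 qed
 show "lmap (-1) ?W ?W \<partial>\<^bsub>?W\<^esub>"
 proof (rule lmapI_hom[OF W W])
  fix x y assume x: "x : carrier ?W" and y: "y : carrier ?W"
  have "finsum X (%j. D i j \<odot>\<^bsub>X\<^esub> (x j \<oplus>\<^bsub>X\<^esub> y j)) J = finsum X (%j. D i j \<odot>\<^bsub>X\<^esub> x j) J \<oplus>\<^bsub>X\<^esub> finsum X (%j. D i j \<odot>\<^bsub>X\<^esub> y j) J"
   if "i : J" for i
   using bd_c that all[OF x] all[OF y] finsum_plus[OF g, of J "%j. D i j \<odot>\<^bsub>X\<^esub> x j" "%j. D i j \<odot>\<^bsub>X\<^esub> y j"]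
   by (simp add: smult_add_r cong: X.finsum_cong)
  then show "\<partial>\<^bsub>?W\<^esub> (x \<oplus>\<^bsub>?W\<^esub> y) = \<partial>\<^bsub>?W\<^esub> x \<oplus>\<^bsub>?W\<^esub> \<partial>\<^bsub>?W\<^esub> y"
   using all[OF x] all[OF y] Dy[OF _ x] Dy[OF _ y]
   by (auto simp: box_ops fun_eq_iff XD koszul_add X.group_rearrange)
 next
  fix a y assume a: "a : carrier A" and y: "y : carrier ?W"
  have "finsum X (%j. D i j \<odot>\<^bsub>X\<^esub> (a \<odot>\<^bsub>X\<^esub> y j)) J = a \<odot>\<^bsub>X\<^esub> finsum X (%j. D i j \<odot>\<^bsub>X\<^esub> y j) J" if "i : J" for i
   using a bd_c that all[OF y] by (subst smult_finsum) (auto simp: smult_smult m_comm intro!: finsum_congr)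
  then show "\<partial>\<^bsub>?W\<^esub> (a \<odot>\<^bsub>?W\<^esub> y) = a \<odot>\<^bsub>?W\<^esub> \<partial>\<^bsub>?W\<^esub> y"
   using a all[OF y] Dy[OF _ y] by (auto simp: box_ops fun_eq_iff XD koszul_smult smult_add_r)
 next
  fix k y assume y: "y : mgrad ?W k"
  have "(\<partial>\<^bsub>?W\<^esub> y) i : mgrad X (k + - 1 - d i)" if i: "i : J" for i
  proof -
   have "D i j \<odot>\<^bsub>X\<^esub> y j : mgrad X (k + - 1 - d i)" if j: "j : J" for j
    using gm_smult_deg[OF g bdD(3)[OF i j], of "y j" "k - d j"] y j by (simp add: box_mgrad algebra_simps)
   then have "finsum X (%j. D i j \<odot>\<^bsub>X\<^esub> y j) J : mgrad X (k + - 1 - d i)" by (intro X.G_finsum) auto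
   moreover have "koszul (d i) X (\<partial>\<^bsub>X\<^esub> (y i)) : mgrad X (k + - 1 - d i)"
    using koszul_deg[OF g XD(4)[of "y i" "k - d i"]] y i by (simp add: box_mgrad algebra_simps)
   ultimately show ?thesis using i by (simp add: box_ops)
  qed
  then show "\<partial>\<^bsub>?W\<^esub> y : mgrad ?W (k + - 1)" using cl[of y] y by (simp add: box_mgrad)
 qed (rule cl)
 show "\<partial>\<^bsub>?W\<^esub> (\<partial>\<^bsub>?W\<^esub> y) = \<zero>\<^bsub>?W\<^esub>" if y: "y : carrier ?W" for y
 proof
  fix i
  show "(\<partial>\<^bsub>?W\<^esub> (\<partial>\<^bsub>?W\<^esub> y)) i = \<zero>\<^bsub>?W\<^esub> i"
  proof (cases "i : J")
   case i: True
   have 1: "finsum X (%j. finsum A (%l. D i l \<otimes> D l j) J \<odot>\<^bsub>X\<^esub> y j) J = \<zero>\<^bsub>X\<^esub>"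
    using bdD(6)[OF i] all[OF y] by (simp cong: X.finsum_cong)
   have Dc: "finsum X (%l. D i l \<odot>\<^bsub>X\<^esub> y l) J : carrier X" by (rule Dy[OF i y])
   \<comment> \<open>The matrix \<open>D\<close> lowers degrees by one, so its row \<open>i\<close>
     falls under \<open>kos\<close> with \<open>k = d i + 1\<close>. The additional minus sign makes
     the two mixed terms of the square cancel.\<close>
   have "finsum X (%l. D i l \<odot>\<^bsub>X\<^esub> koszul (d l) X (\<partial>\<^bsub>X\<^esub> (y l))) J =
    koszul (d i + 1) X (\<partial>\<^bsub>X\<^esub> (finsum X (%l. D i l \<odot>\<^bsub>X\<^esub> y l) J))"
    using kos[OF y, of "D i" "d i + 1"] bdD(3)[OF i] by (simp add: algebra_simps)
   also have "\<dots> = \<ominus>\<^bsub>X\<^esub> koszul (d i) X (\<partial>\<^bsub>X\<^esub> (finsum X (%l. D i l \<odot>\<^bsub>X\<^esub> y l) J))"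
    using Dc by (simp add: koszul_def XD)
   finally have 2: "finsum X (%l. D i l \<odot>\<^bsub>X\<^esub> (\<partial>\<^bsub>?W\<^esub> y) l) J = \<ominus>\<^bsub>X\<^esub> koszul (d i) X (\<partial>\<^bsub>X\<^esub> (finsum X (%l. D i l \<odot>\<^bsub>X\<^esub> y l) J))"
    using row[OF y, of "D i"] bd_c i 1 Dc by (simp add: XD)
   have 3: "\<partial>\<^bsub>X\<^esub> ((\<partial>\<^bsub>?W\<^esub> y) i) = \<partial>\<^bsub>X\<^esub> (finsum X (%l. D i l \<odot>\<^bsub>X\<^esub> y l) J)"
    using i Dc all[OF y] koszul_lmap[OF g g dg_lmap[OF X], of "\<partial>\<^bsub>X\<^esub> (y i)" "d i"] by (simp add: box_ops XD)
   have "(\<partial>\<^bsub>?W\<^esub> (\<partial>\<^bsub>?W\<^esub> y)) i = finsum X (%l. D i l \<odot>\<^bsub>X\<^esub> (\<partial>\<^bsub>?W\<^esub> y) l) J \<oplus>\<^bsub>X\<^esub> koszul (d i) X (\<partial>\<^bsub>X\<^esub> ((\<partial>\<^bsub>?W\<^esub> y) i))"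
    unfolding box_ops(4)[of J d e D X "\<partial>\<^bsub>?W\<^esub> y"] using i by simp
   also have "\<dots> = \<zero>\<^bsub>X\<^esub>" unfolding 2 3 using Dc by (simp add: XD X.l_neg)
   finally show ?thesis by (simp add: box_ops)
  qed (simp add: box_ops)
 qed
qed

end

end

section \<open>Generators, functoriality and duals of the coordinate modules\<close>

context even_graded_ring
begin

lemma finsum_delta:
 assumes X: "gm X" and "finite J" "i : J" "!!j. j : J ==> y j : carrier X"
 shows "finsum X (%j. (if i = j then \<one> else \<zero>) \<odot>\<^bsub>X\<^esub> y j) J = y i"
proof -
 interpret X: abelian_group X using X by simp
 have "finsum X (%j. (if i = j then \<one> else \<zero>) \<odot>\<^bsub>X\<^esub> y j) J = finsum X (%j. if i = j then y j else \<zero>\<^bsub>X\<^esub>) J"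
  using X assms by (intro finsum_congr) auto
 also have "\<dots> = y i" using assms by (intro X.finsum_singleton) auto
 finally show ?thesis .
qed

lemma finsum_zeros: "gm X ==> (!!j. j : F ==> f j = \<zero>\<^bsub>X\<^esub>) ==> finsum X f F = \<zero>\<^bsub>X\<^esub>"
 using finsum_congr[of X F f "%_. \<zero>\<^bsub>X\<^esub>"] abelian_monoid.finsum_zero[OF abelian_group.axioms(1)[OF gm_group]]
 by (simp add: group_closed)

context
 fixes J d e D
 assumes bd: "box_data J d e D"
begin

lemma box_eval: "i : J ==> lmap (- d i) (box J d e D X) X (%y. y i)"
 by (auto simp: lmap_def box_carrier box_ops box_mgrad)

lemma box_finsum:
 assumes "gm X" "!!j. j : F ==> f j : carrier (box J d e D X)"
 shows "(finsum (box J d e D X) f F) i = finsum X (%j. f j i) F"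
 using assms box_all[where J = J and d = d and e = e and D = D]
 by (intro additive_finsum[of _ _ "%y. y i"]) (auto simp: box_gm[OF bd] box_ops)

lemma box_minus:
 assumes X: "gm X" and y: "y : carrier (box J d e D X)" and z: "z : carrier (box J d e D X)"
 shows "(y \<ominus>\<^bsub>box J d e D X\<^esub> z) i = y i \<ominus>\<^bsub>X\<^esub> z i" "(\<ominus>\<^bsub>box J d e D X\<^esub> y) i = \<ominus>\<^bsub>X\<^esub> y i"
proof -
 let ?W = "box J d e D X"
 interpret X: abelian_group X using X by simp
 note W = box_gm[OF bd X]
 interpret W: abelian_group ?W using W by simp
 note all = box_all[OF _ X, where J = J and d = d and e = e and D = D]
 have m: "(\<ominus>\<^bsub>?W\<^esub> y) i = \<ominus>\<^bsub>X\<^esub> y i" if y: "y : carrier ?W" for y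
 proof -
  have "(\<ominus>\<^bsub>?W\<^esub> y \<oplus>\<^bsub>?W\<^esub> y) i = \<zero>\<^bsub>X\<^esub>" using W.l_neg[OF y] by (simp add: box_ops)
  then show ?thesis using all[OF y] all[OF W.a_inv_closed[OF y]]
   by (intro X.minus_equality[symmetric]) (auto simp: box_ops)
 qed
 show "(\<ominus>\<^bsub>?W\<^esub> y) i = \<ominus>\<^bsub>X\<^esub> y i" by (rule m[OF y])
 show "(y \<ominus>\<^bsub>?W\<^esub> z) i = y i \<ominus>\<^bsub>X\<^esub> z i" using m[OF z] by (simp add: a_minus_def box_ops)
qed

text \<open>The tensor of the \<open>j\<close>-th generator with \<open>x\<close>. The columns of an
  idempotent matrix are fixed by it, so this lies in the box; by \<open>box_col_sum\<close> such
  elements generate the box, which writes its identity as a finite sum of maps through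
  \<open>X\<close>.\<close>

definition box_col where "box_col X j x = (%i. if i : J then e i j \<odot>\<^bsub>X\<^esub> x else \<zero>\<^bsub>X\<^esub>)"

lemma box_col:
 assumes X: "gm X" and j: "j : J"
 shows "lmap (d j) X (box J d e D X) (box_col X j)"
proof -
 interpret X: graded_group X "mgrad X" by (rule gm_graded[OF X])
 note ec = bd_c(1)[OF bd]
 have cl: "box_col X j x : carrier (box J d e D X)" if x: "x : carrier X" for x
 proof -
  have "finsum X (%l. e i l \<odot>\<^bsub>X\<^esub> box_col X j x l) J = e i j \<odot>\<^bsub>X\<^esub> x" if i: "i : J" for i
  proof -
   have "finsum X (%l. e i l \<odot>\<^bsub>X\<^esub> box_col X j x l) J = finsum X (%l. (e i l \<otimes> e l j) \<odot>\<^bsub>X\<^esub> x) J"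
    using X ec i j x by (intro finsum_congr) (auto simp: box_col_def smult_smult)
   also have "\<dots> = e i j \<odot>\<^bsub>X\<^esub> x"
    using X ec i j x by (subst finsum_smult_left[symmetric]) (auto simp: bdD(4)[OF bd])
   finally show ?thesis .
  qed
  then show ?thesis using X ec j x by (simp add: box_carrier box_col_def)
 qed
 show ?thesis
 proof (rule lmapI_hom[OF X box_gm[OF bd X] cl])
  show "box_col X j x : mgrad (box J d e D X) (k + d j)" if x: "x : mgrad X k" for x k
   using cl[of x] x gm_smult_deg[OF X bdD(2)[OF bd _ j] x] by (auto simp: box_mgrad box_col_def algebra_simps)
 qed (use X ec j in \<open>auto simp: box_col_def box_ops fun_eq_iff smult_arith m_comm\<close>)
qed

lemma box_col_sum:
 assumes X: "gm X" and y: "y : carrier (box J d e D X)"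
 shows "finsum (box J d e D X) (%j. box_col X j (y j)) J = y"
proof
 fix i
 interpret X: abelian_group X using X by simp
 note all = box_all[OF y X]
 have "(finsum (box J d e D X) (%j. box_col X j (y j)) J) i = finsum X (%j. box_col X j (y j) i) J"
  using lmap_closed[OF box_col[OF X]] all by (intro box_finsum[OF X]) auto
 also have "\<dots> = y i"
 proof (cases "i : J")
  case True
  then have "finsum X (%j. box_col X j (y j) i) J = finsum X (%j. e i j \<odot>\<^bsub>X\<^esub> y j) J"
   by (simp add: box_col_def)
  with True y show ?thesis by (simp add: box_carrier)
 qed (use y in \<open>simp add: box_col_def box_carrier\<close>)
 finally show "(finsum (box J d e D X) (%j. box_col X j (y j)) J) i = y i" .
qed

lemma box_fg:
 assumes X: "gm X" and "fg X" shows "fg (box J d e D X)"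
proof (rule fgI)
 let ?W = "box J d e D X"
 note W = box_gm[OF bd X]
 have "frk 0 ?W ?W (%y. finsum ?W (%j. box_col X j (y j)) J)"
 proof (rule frk_sum[OF W W bdD(1)[OF bd]])
  show "frk 0 ?W ?W (%y. box_col X j (y j))" if "j : J" for j
   using frk_comp[OF W X W assms(2) box_eval[OF that] box_col[OF X that]] by simp
  show "box_col X j (y j) : carrier ?W" if "j : J" "y : carrier ?W" for j y
   using lmap_closed[OF box_col[OF X that(1)] box_all[OF that(2) X]] .
 qed
 then show "frk 0 ?W ?W (%y. y)" by (rule frk_cong) (simp_all add: box_col_sum[OF X])
qed

lemma box_IM:
 assumes X: "gm X" and I: "ideal I A" and w: "w : carrier (box J d e D X)"
  and "!!i. i : J ==> w i : IM I X"
 shows "w : IM I (box J d e D X)"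
proof -
 have "finsum (box J d e D X) (%j. box_col X j (w j)) J : IM I (box J d e D X)"
  by (rule IM_finsum[OF box_gm[OF bd X] I bdD(1)[OF bd]]) (rule IM_lmap[OF box_col[OF X] assms(4)])
 then show ?thesis by (simp add: box_col_sum[OF X w])
qed

lemma box_map:
 assumes X: "gm X" and Y: "gm Y" and f: "lmap k X Y f"
 shows "lmap k (box J d e D X) (box J d e D Y) (%y i. f (y i))"
proof -
 note fD = lmapD[OF f] lmapD0[OF X Y f]
 note ec = bd_c(1)[OF bd]
 note all = box_all[OF _ X, where J = J and d = d and e = e and D = D]
 have cl: "(%i. f (y i)) : carrier (box J d e D Y)" if y: "y : carrier (box J d e D X)" for y
 proof -
  have "finsum Y (%j. e i j \<odot>\<^bsub>Y\<^esub> f (y j)) J = f (y i)" if i: "i : J" for i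
  proof -
   have "f (y i) = f (finsum X (%j. e i j \<odot>\<^bsub>X\<^esub> y j) J)" using y i by (simp add: box_carrier)
   also have "\<dots> = finsum Y (%j. f (e i j \<odot>\<^bsub>X\<^esub> y j)) J"
    using X ec i all[OF y] by (intro lmap_finsum[OF X Y f]) auto
   also have "\<dots> = finsum Y (%j. e i j \<odot>\<^bsub>Y\<^esub> f (y j)) J"
    using X Y ec i all[OF y] by (intro finsum_congr) (auto simp: fD)
   finally show ?thesis by simp
  qed
  then show ?thesis using y by (simp add: box_carrier fD)
 qed
 show ?thesis
 proof (rule lmapI_hom[OF box_gm[OF bd X] box_gm[OF bd Y] cl])
  show "(%j. f (y j)) : mgrad (box J d e D Y) (i + k)" if "y : mgrad (box J d e D X) i" for y i
   using that cl[of y] fD(4) by (fastforce simp: box_mgrad algebra_simps)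
 qed (auto simp: box_ops fD all)
qed

text \<open>The matrix part of the differential commutes with every linear \<open>f\<close>. So the
  failure of the induced map to be a chain map is that of \<open>f\<close>, coordinate by coordinate
  and up to sign. This covers exact chain maps and chain maps modulo an ideal at the same
  time.\<close>

lemma box_map_diff:
 assumes X: "dg_module A X" and Y: "dg_module A Y" and f: "lmap k X Y f"
  and y: "y : carrier (box J d e D X)"
 shows "((%i. f ((\<partial>\<^bsub>box J d e D X\<^esub> y) i)) \<ominus>\<^bsub>box J d e D Y\<^esub> \<partial>\<^bsub>box J d e D Y\<^esub> (%i. f (y i))) i =
  (if i : J then koszul (d i) Y (f (\<partial>\<^bsub>X\<^esub> (y i)) \<ominus>\<^bsub>Y\<^esub> \<partial>\<^bsub>Y\<^esub> (f (y i))) else \<zero>\<^bsub>Y\<^esub>)"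
proof -
 note gX = dg_gm[OF X] and gY = dg_gm[OF Y]
 interpret Y: abelian_group Y using gY by simp
 note fD = lmapD[OF f] lmapD0[OF gX gY f]
 note Dc = bd_c(2)[OF bd] and all = box_all[OF y gX]
 have 1: "f (finsum X (%j. D i j \<odot>\<^bsub>X\<^esub> y j) J) = finsum Y (%j. D i j \<odot>\<^bsub>Y\<^esub> f (y j)) J" if i: "i : J"
 proof -
  have "f (finsum X (%j. D i j \<odot>\<^bsub>X\<^esub> y j) J) = finsum Y (%j. f (D i j \<odot>\<^bsub>X\<^esub> y j)) J"
   using gX Dc i all by (intro lmap_finsum[OF gX gY f]) auto
  also have "\<dots> = finsum Y (%j. D i j \<odot>\<^bsub>Y\<^esub> f (y j)) J"
   using gX gY Dc i all by (intro finsum_congr) (auto simp: fD)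
  finally show ?thesis .
 qed
 have c: "finsum X (%j. D i j \<odot>\<^bsub>X\<^esub> y j) J : carrier X" "finsum Y (%j. D i j \<odot>\<^bsub>Y\<^esub> f (y j)) J : carrier Y"
  if "i : J" using gX gY Dc all fD that by (auto intro!: finsum_lmap_closed)
 have cl: "(%i. f ((\<partial>\<^bsub>box J d e D X\<^esub> y) i)) : carrier (box J d e D Y)"
  "\<partial>\<^bsub>box J d e D Y\<^esub> (%i. f (y i)) : carrier (box J d e D Y)"
  using lmap_closed[OF box_map[OF gX gY f]] dgD(1)[OF box_dg[OF bd X]] dgD(1)[OF box_dg[OF bd Y]] y by auto
 show ?thesis
  unfolding box_minus(1)[OF gY cl]
  using all c 1 gX gY fD dgD(1)[OF X] dgD(1)[OF Y] koszul_lmap[OF gX gY f]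
  by (simp add: box_ops koszul_def group_arith Y.minus_zero)
qed

lemma box_cm:
 assumes X: "dg_module A X" and Y: "dg_module A Y" and f: "cm X Y f"
 shows "cm (box J d e D X) (box J d e D Y) (%y i. f (y i))"
 unfolding cm_def
proof (intro conjI ballI)
 note gX = dg_gm[OF X] and gY = dg_gm[OF Y]
 interpret Y: abelian_group Y using gY by simp
 let ?B = "box J d e D Y"
 interpret B: abelian_group ?B using box_gm[OF bd gY] by simp
 show l: "lmap 0 (box J d e D X) ?B (%y i. f (y i))" by (rule box_map[OF gX gY cmD(1)[OF f]])
 fix y assume y: "y : carrier (box J d e D X)"
 have c: "(%i. f ((\<partial>\<^bsub>box J d e D X\<^esub> y) i)) : carrier ?B" "\<partial>\<^bsub>?B\<^esub> (%i. f (y i)) : carrier ?B"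
  using lmap_closed[OF l] dgD(1)[OF box_dg[OF bd X]] dgD(1)[OF box_dg[OF bd Y]] y by auto
 have "(%i. f ((\<partial>\<^bsub>box J d e D X\<^esub> y) i)) \<ominus>\<^bsub>?B\<^esub> \<partial>\<^bsub>?B\<^esub> (%i. f (y i)) = \<zero>\<^bsub>?B\<^esub>"
  unfolding fun_eq_iff box_map_diff[OF X Y cmD(1)[OF f] y]
  using box_all[OF y gX] cmD(2)[OF f] dgD(1)[OF Y] lmap_closed[OF cmD(1)[OF f]] gY
  by (simp add: Y.gr_diff_self box_ops(1))
 then show "(%i. f ((\<partial>\<^bsub>box J d e D X\<^esub> y) i)) = \<partial>\<^bsub>?B\<^esub> (%i. f (y i))"
  using c B.gr_diff_eq[OF c B.zero_closed] by simp
qed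

end

text \<open>A functional expanded in the dual basis. The matrix identities for tensor products and
  sections are instances of it.\<close>

lemma phi_row:
 assumes Q: "gm Q" and db: "dual_basis Q n q d \<phi>" and \<psi>: "lmap k Q U \<psi>" and x: "x : carrier Q"
 shows "finsum A (%l. \<psi> (q l) \<otimes> \<phi> l x) {..<n} = \<psi> x"
proof -
 note c = db_closed[OF Q db]
 have "\<psi> x = finsum A (%l. \<phi> l x \<otimes> \<psi> (q l)) {..<n}"
  using db_expand[OF Q unit_gm db \<psi> x] by (simp add: unit_finsum)
 also have "\<dots> = finsum A (%l. \<psi> (q l) \<otimes> \<phi> l x) {..<n}"
  using c x lmap_closed[OF \<psi>] by (intro GA.finsum_cong') (auto simp: m_comm)
 finally show ?thesis by simp
qed

lemma tensor_box_data:
 assumes Q: "dg_module A Q" and db: "dual_basis Q n q d \<phi>"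
 shows "box_data {..<n} d (%i j. \<phi> i (q j)) (%i j. \<phi> i (\<partial>\<^bsub>Q\<^esub> (q j)))"
proof -
 note g = dg_gm[OF Q] and D = dgD[OF Q]
 note c = db_closed[OF g db]
 note row = phi_row[OF g db]
 have "lmap (- 1 + - d i) Q U (%x. \<phi> i (\<partial>\<^bsub>Q\<^esub> x))" if "i < n" for i
  using lmap_comp[OF dg_lmap[OF Q] dbD(2)[OF db that]] .
 note row2 = row[OF this]
 have z: "\<phi> i \<zero>\<^bsub>Q\<^esub> = \<zero>" if "i < n" for i
  using lmap_zero[OF g unit_gm dbD(2)[OF db that]] by simp
 show ?thesis unfolding box_data_def
  using c(3)[OF _ dbD(1)[OF db]] c(3)[OF _ D(4)[OF dbD(1)[OF db]]] c(1) row[OF dbD(2)[OF db]] row2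
  by (simp add: D z)
qed

text \<open>The differential of a dual is the transposed one with the sign of the degree and a
  minus. In the square, an entry \<open>D l i\<close> is nonzero only if \<open>d i\<close> and
  \<open>d l\<close> have opposite parity. So the two degree signs always multiply to -1, a common
  factor that can be taken out, and the square of the transpose is that of \<open>D\<close>.\<close>

lemma dual_box_data:
 assumes bd: "box_data J d e D"
 shows "box_data J (%i. - d i) (%i j. if i = j then \<one> else \<zero>) (%i j. \<ominus> koszul (d i) A (D j i))"
proof -
 note Dc = bd_c(2)[OF bd] and Dd = bdD(3)[OF bd] and fin = bdD(1)[OF bd]
 have delta: "finsum A (%l. (if i = l then \<one> else \<zero>) \<otimes> g l) J = g i"
  if "i : J" "!!l. l : J ==> g l : carrier A" for g i
  using finsum_delta[OF unit_gm fin that(1), of g] that(2) by (simp add: unit_finsum)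
 have kd: "koszul k A a : rgrad A m" if "a : rgrad A m" for k a m
  using that by (simp add: koszul_def)
 have kc: "koszul k A a : carrier A" if "a : carrier A" for k a
  using that by (simp add: koszul_def)
 have DD: "finsum A (%l. \<ominus> koszul (d i) A (D l i) \<otimes> \<ominus> koszul (d l) A (D j l)) J = \<zero>" if i: "i : J" and j: "j : J" for i j
 proof -
  have "\<ominus> koszul (d i) A (D l i) \<otimes> \<ominus> koszul (d l) A (D j l) = \<ominus> (D j l \<otimes> D l i)" if l: "l : J" for l
  proof (cases "even (d i - 1 - d l)")
   case True
   then show ?thesis using Dc i j l by (auto simp: koszul_def l_minus r_minus m_comm)
  next
   case False
   then have "D l i = \<zero>" using A_odd[OF Dd[OF l i]] by simp
   then show ?thesis using Dc i j l by (simp add: koszul_def GA.minus_zero)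
  qed
  then have "finsum A (%l. \<ominus> koszul (d i) A (D l i) \<otimes> \<ominus> koszul (d l) A (D j l)) J = finsum A (%l. \<ominus> (D j l \<otimes> D l i)) J"
   using Dc i j by (intro GA.finsum_cong') auto
  also have "\<dots> = \<ominus> finsum A (%l. D j l \<otimes> D l i) J"
   using Dc i j by (intro additive_finsum[symmetric]) (auto simp: GA.minus_add)
  finally show ?thesis using bdD(6)[OF bd j i] by (simp add: GA.minus_zero)
 qed
 show ?thesis unfolding box_data_def
 proof (intro conjI ballI fin)
  fix i j assume i: "i : J" and j: "j : J"
  show "(if i = j then \<one> else \<zero>) : rgrad A (- d j - - d i)" by simp
  show "\<ominus> koszul (d i) A (D j i) : rgrad A (- d j - 1 - - d i)"
   using kd[OF Dd[OF j i], of "d i"] by (simp add: algebra_simps)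
  show "finsum A (%l. (if i = l then \<one> else \<zero>) \<otimes> (if l = j then \<one> else \<zero>)) J = (if i = j then \<one> else \<zero>)"
   using i by (subst delta) auto
  show "finsum A (%l. (if i = l then \<one> else \<zero>) \<otimes> \<ominus> koszul (d l) A (D j l)) J = \<ominus> koszul (d i) A (D j i)"
   using i j Dc kc by (subst delta) auto
  show "finsum A (%l. \<ominus> koszul (d i) A (D l i) \<otimes> \<ominus> koszul (d l) A (D j l)) J = \<zero>" by (rule DD[OF i j])
 qed
qed

end

section \<open>Evaluation on a module tensored with its dual, and sections of it\<close>

context even_graded_ring
begin

abbreviation dual_box where
 "dual_box J d D \<equiv> box J (%i. - d i) (%i j. if i = j then \<one> else \<zero>) (%i j. \<ominus> koszul (d i) A (D j i))"

lemma box_row: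
 assumes bd: "box_data J d e D" and X: "gm X"
  and "!!l. l : F ==> a l : carrier A" "!!l. l : F ==> w l : carrier (box J d e D X)"
 shows "(finsum (box J d e D X) (%l. a l \<odot>\<^bsub>box J d e D X\<^esub> w l) F) i = finsum X (%l. a l \<odot>\<^bsub>X\<^esub> w l i) F"
proof -
 have "a l \<odot>\<^bsub>box J d e D X\<^esub> w l : carrier (box J d e D X)" if "l : F" for l
  using assms(3,4)[OF that] box_gm[OF bd X] by simp
 then have "(finsum (box J d e D X) (%l. a l \<odot>\<^bsub>box J d e D X\<^esub> w l) F) i =
  finsum X (%l. (a l \<odot>\<^bsub>box J d e D X\<^esub> w l) i) F" by (rule box_finsum[OF bd X])
 then show ?thesis by (simp add: box_ops(3))
qed

text \<open>The evaluation \<open>Q \<otimes> Q\<^sup>* \<otimes> X \<rightarrow> X\<close> in coordinates. The dual factor is taken with the identity matrix in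
 place of an idempotent: \<open>Q\<^sup>*\<close> is a quotient of the resulting free module.\<close>

definition box_ev :: "'i set => ('a, 'm) dg_module => ('i => 'i => 'm) => 'm" where
 "box_ev J X w = finsum X (%i. w i i) J"

lemma box_ev_lmap:
 assumes X: "gm X" and Y: "gm Y" and f: "lmap k X Y f" and "!!i j. w i j : carrier X"
 shows "box_ev J Y (%i j. f (w i j)) = f (box_ev J X w)"
 unfolding box_ev_def using assms by (intro lmap_finsum[OF X Y f, symmetric]) auto

context
 fixes J d e D and X :: "('a, 'm) dg_module"
 assumes bd: "box_data J d e D" and X: "dg_module A X"
begin

text \<open>Evaluation is a trace. The contribution of \<open>D\<close> acting on the first index
  and that of its signed transpose acting on the second cancel once the two summations are
  exchanged; only the differential of \<open>X\<close> remains.\<close>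

lemma box_ev_cm: "cm (box J d e D (dual_box J d D X)) X (box_ev J X)"
proof -
 let ?Y = "dual_box J d D X"
 let ?W = "box J d e D ?Y"
 let ?D' = "%i j. \<ominus> koszul (d i) A (D j i)"
 note g [simp] = dg_gm[OF X] and XD = dgD[OF X]
 note bd' = dual_box_data[OF bd]
 have Yd: "dg_module A ?Y" by (rule box_dg[OF bd' X])
 have Wd: "dg_module A ?W" by (rule box_dg[OF bd Yd])
 note gY = dg_gm[OF Yd] and gW = dg_gm[OF Wd]
 interpret X: graded_group X "mgrad X" by (rule gm_graded[OF g])
 note fin = bdD(1)[OF bd] and Dc = bd_c(2)[OF bd]
 have wY: "w i : carrier ?Y" if "w : carrier ?W" for w i using box_all[OF that gY] .
 have wX: "w i j : carrier X" if "w : carrier ?W" for w i j using box_all[OF wY[OF that] g] .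
 have "lmap 0 ?W X (%w. finsum X (%i. w i i) J)"
 proof (rule lmap_sum[OF gW g fin])
  show "lmap 0 ?W X (%w. w i i)" if i: "i : J" for i
   using lmap_comp[OF box_eval[OF bd i] box_eval[OF bd' i]] by simp
 qed
 moreover have "finsum X (%i. (\<partial>\<^bsub>?W\<^esub> w) i i) J = \<partial>\<^bsub>X\<^esub> (finsum X (%i. w i i) J)" if w: "w : carrier ?W" for w
 proof -
  have Dw: "D i l \<odot>\<^bsub>X\<^esub> w l i : carrier X" "D l i \<odot>\<^bsub>X\<^esub> w i l : carrier X" if "i : J" "l : J" for i l
   using Dc that wX[OF w] by auto
  have diag: "(\<partial>\<^bsub>?W\<^esub> w) i i = (finsum X (%l. D i l \<odot>\<^bsub>X\<^esub> w l i) J \<oplus>\<^bsub>X\<^esub> finsum X (%l. \<ominus>\<^bsub>X\<^esub> (D l i \<odot>\<^bsub>X\<^esub> w i l)) J) \<oplus>\<^bsub>X\<^esub> \<partial>\<^bsub>X\<^esub> (w i i)"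
   if i: "i : J" for i
  proof -
   have 1: "(finsum ?Y (%l. D i l \<odot>\<^bsub>?Y\<^esub> w l) J) i = finsum X (%l. D i l \<odot>\<^bsub>X\<^esub> w l i) J"
    using wY[OF w] Dc i by (intro box_row[OF bd' g]) auto
   have 2: "(koszul (d i) ?Y (\<partial>\<^bsub>?Y\<^esub> (w i))) i = koszul (d i) X ((\<partial>\<^bsub>?Y\<^esub> (w i)) i)"
    by (rule koszul_lmap[OF gY g box_eval[OF bd' i]]) (rule dgD(1)[OF Yd wY[OF w]])
   have 3: "koszul (d i) X (finsum X (%l. ?D' i l \<odot>\<^bsub>X\<^esub> w i l) J) = finsum X (%l. \<ominus>\<^bsub>X\<^esub> (D l i \<odot>\<^bsub>X\<^esub> w i l)) J"
   proof -
    have "koszul (d i) X (finsum X (%l. ?D' i l \<odot>\<^bsub>X\<^esub> w i l) J) = finsum X (%l. koszul (d i) X (?D' i l \<odot>\<^bsub>X\<^esub> w i l)) J"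
     using Dc i wX[OF w] by (intro lmap_finsum[OF g g lmap_koszul[OF g g lmap_id]]) (auto simp: koszul_def)
    also have "\<dots> = finsum X (%l. \<ominus>\<^bsub>X\<^esub> (D l i \<odot>\<^bsub>X\<^esub> w i l)) J"
     using Dc i wX[OF w] by (intro finsum_congr) (auto simp: koszul_def smult_minus_l)
    finally show ?thesis .
   qed
   have c: "finsum X (%l. ?D' i l \<odot>\<^bsub>X\<^esub> w i l) J : carrier X"
    using Dc i wX[OF w] by (intro finsum_lmap_closed) (auto simp: koszul_def)
   have kk: "koszul (d i) X (koszul (- d i) X (\<partial>\<^bsub>X\<^esub> (w i i))) = \<partial>\<^bsub>X\<^esub> (w i i)"
    using wX[OF w] by (simp add: koszul_def XD)
   have "(\<partial>\<^bsub>?W\<^esub> w) i i = finsum X (%l. D i l \<odot>\<^bsub>X\<^esub> w l i) J \<oplus>\<^bsub>X\<^esub> koszul (d i) X ((\<partial>\<^bsub>?Y\<^esub> (w i)) i)"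
    unfolding box_ops(4)[of J d e D ?Y w] using i by (simp add: box_ops(2) 1 2)
   also have "koszul (d i) X ((\<partial>\<^bsub>?Y\<^esub> (w i)) i) = finsum X (%l. \<ominus>\<^bsub>X\<^esub> (D l i \<odot>\<^bsub>X\<^esub> w i l)) J \<oplus>\<^bsub>X\<^esub> \<partial>\<^bsub>X\<^esub> (w i i)"
    using i c wX[OF w] by (simp add: box_ops(4) koszul_add XD 3 kk)
   finally show ?thesis
    using Dw i wX[OF w] by (simp add: X.a_assoc finsum_lmap_closed XD)
  qed
  let ?a = "%i. finsum X (%l. D i l \<odot>\<^bsub>X\<^esub> w l i) J" and ?b = "%i. finsum X (%l. \<ominus>\<^bsub>X\<^esub> (D l i \<odot>\<^bsub>X\<^esub> w i l)) J"
  have ac: "?a i : carrier X" and bc: "?b i : carrier X" if "i : J" for i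
   using Dw that by (auto intro!: finsum_lmap_closed)
  have "finsum X ?b J = finsum X (%l. finsum X (%i. \<ominus>\<^bsub>X\<^esub> (D l i \<odot>\<^bsub>X\<^esub> w i l)) J) J"
   using Dw fin by (intro finsum_swap) auto
  also have "\<dots> = finsum X (%l. \<ominus>\<^bsub>X\<^esub> ?a l) J"
  proof (rule finsum_congr[OF g])
   fix l assume l: "l : J"
   show "finsum X (%i. \<ominus>\<^bsub>X\<^esub> (D l i \<odot>\<^bsub>X\<^esub> w i l)) J : carrier X" using Dw l by (auto intro!: finsum_lmap_closed)
   show "finsum X (%i. \<ominus>\<^bsub>X\<^esub> (D l i \<odot>\<^bsub>X\<^esub> w i l)) J = \<ominus>\<^bsub>X\<^esub> ?a l"
    using Dw l by (intro additive_finsum[symmetric]) (auto simp: X.minus_add)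
  qed
  also have "\<dots> = \<ominus>\<^bsub>X\<^esub> finsum X ?a J"
   using ac by (intro additive_finsum[symmetric]) (auto simp: X.minus_add)
  finally have b: "finsum X ?b J = \<ominus>\<^bsub>X\<^esub> finsum X ?a J" .
  have "finsum X (%i. (\<partial>\<^bsub>?W\<^esub> w) i i) J = finsum X (%i. (?a i \<oplus>\<^bsub>X\<^esub> ?b i) \<oplus>\<^bsub>X\<^esub> \<partial>\<^bsub>X\<^esub> (w i i)) J"
   by (rule finsum_congr[OF g wX[OF dgD(1)[OF Wd w]] diag])
  also have "\<dots> = (finsum X ?a J \<oplus>\<^bsub>X\<^esub> finsum X ?b J) \<oplus>\<^bsub>X\<^esub> finsum X (%i. \<partial>\<^bsub>X\<^esub> (w i i)) J"
   using ac bc wX[OF w] by (subst finsum_plus, auto simp: XD group_closed)+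
  also have "\<dots> = finsum X (%i. \<partial>\<^bsub>X\<^esub> (w i i)) J"
   unfolding b using ac wX[OF w] by (simp add: X.r_neg finsum_lmap_closed XD)
  also have "\<dots> = \<partial>\<^bsub>X\<^esub> (finsum X (%i. w i i) J)"
   using wX[OF w] by (intro lmap_finsum[OF g g dg_lmap[OF X], symmetric]) auto
  finally show ?thesis .
 qed
 ultimately show ?thesis unfolding cm_def box_ev_def[abs_def] by simp
qed

end

text \<open>The map \<open>y \<mapsto> x \<otimes> \<psi> \<otimes> y\<close>.\<close>

definition cosection :: "nat => (nat => 'q) => (nat => 'q => 'a) => 'q => ('q => 'a) => ('a, 'm) dg_module => 'm => nat => nat => 'm" where
 "cosection n q \<phi> x \<psi> X y = (%i j. if i < n & j < n then (\<phi> i x \<otimes> \<psi> (q j)) \<odot>\<^bsub>X\<^esub> y else \<zero>\<^bsub>X\<^esub>)"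

context
 fixes Q :: "('a, 'q) dg_module" and n q d \<phi> and X :: "('a, 'm) dg_module" and x \<psi> k m
 assumes Q: "dg_module A Q" and db: "dual_basis Q n q d \<phi>" and X: "dg_module A X"
  and x: "x : mgrad Q k" and \<psi>: "lmap m Q U \<psi>"
begin

abbreviation (input) "eQ \<equiv> %i j. \<phi> i (q j)"
abbreviation (input) "DQ \<equiv> %i j. \<phi> i (\<partial>\<^bsub>Q\<^esub> (q j))"
abbreviation (input) "QY \<equiv> dual_box {..<n} d DQ X"
abbreviation (input) "QW \<equiv> box {..<n} d eQ DQ QY"

lemma cosection_lmap: "lmap (k + m) X QW (cosection n q \<phi> x \<psi> X)"
proof -
 note gQ = dg_gm[OF Q] and g [simp] = dg_gm[OF X]
 note bd = tensor_box_data[OF Q db] and bd' = dual_box_data[OF tensor_box_data[OF Q db]]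
 note gY = box_gm[OF bd' g] and gW = box_gm[OF bd box_gm[OF bd' g]]
 note c = db_closed[OF gQ db] and \<psi>c = lmap_closed[OF \<psi>]
 have xc: "x : carrier Q" using gm_carrier[OF gQ x] .
 interpret X: graded_group X "mgrad X" by (rule gm_graded[OF g])
 have ac: "\<phi> i x \<otimes> \<psi> (q j) : carrier A" if "i < n" "j < n" for i j
  using c that \<psi>c[of "q j"] xc by auto
 have Y: "(%j. cosection n q \<phi> x \<psi> X y i j) : carrier QY" if y: "y : carrier X" for y i
  using finsum_delta[OF g finite_lessThan, of _ n "%j. cosection n q \<phi> x \<psi> X y i j"] ac y
  by (simp add: box_carrier cosection_def)
 have W: "cosection n q \<phi> x \<psi> X y : carrier QW" if y: "y : carrier X" for y
 proof -
  have "finsum QY (%l. \<phi> i (q l) \<odot>\<^bsub>QY\<^esub> cosection n q \<phi> x \<psi> X y l) {..<n} = cosection n q \<phi> x \<psi> X y i"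
   if i: "i < n" for i
  proof
   fix j
   have "(finsum QY (%l. \<phi> i (q l) \<odot>\<^bsub>QY\<^esub> cosection n q \<phi> x \<psi> X y l) {..<n}) j =
    finsum X (%l. \<phi> i (q l) \<odot>\<^bsub>X\<^esub> cosection n q \<phi> x \<psi> X y l j) {..<n}"
    using Y[OF y] c i by (intro box_row[OF bd' g]) auto
   also have "\<dots> = cosection n q \<phi> x \<psi> X y i j"
   proof (cases "j < n")
    case True
    have jc: "\<psi> (q j) : carrier A" using \<psi>c[OF c(1)[OF True]] by simp
    have "finsum X (%l. \<phi> i (q l) \<odot>\<^bsub>X\<^esub> cosection n q \<phi> x \<psi> X y l j) {..<n} =
     finsum X (%l. (\<phi> i (q l) \<otimes> \<phi> l x) \<odot>\<^bsub>X\<^esub> (\<psi> (q j) \<odot>\<^bsub>X\<^esub> y)) {..<n}"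
     using True c i xc y jc by (intro finsum_congr) (auto simp: cosection_def smult_smult m_assoc)
    also have "\<dots> = \<phi> i x \<odot>\<^bsub>X\<^esub> (\<psi> (q j) \<odot>\<^bsub>X\<^esub> y)"
     using phi_row[OF gQ db dbD(2)[OF db i] xc] c i xc y jc
     by (subst finsum_smult_left[symmetric]) auto
    finally show ?thesis using True i c xc y jc by (simp add: cosection_def smult_smult)
   next
    case False
    then show ?thesis using c i by (auto simp: cosection_def intro!: finsum_zeros)
   qed
   finally show "(finsum QY (%l. \<phi> i (q l) \<odot>\<^bsub>QY\<^esub> cosection n q \<phi> x \<psi> X y l) {..<n}) j = cosection n q \<phi> x \<psi> X y i j" .
  qed
  moreover have "cosection n q \<phi> x \<psi> X y i = \<zero>\<^bsub>QY\<^esub>" if "\<not> i < n" for i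
   using that by (simp add: cosection_def box_ops(1))
  ultimately show ?thesis using Y[OF y] unfolding box_carrier[of _ _ _ _ _ QY] by simp
 qed
 show ?thesis
 proof (rule lmapI_hom[OF g gW W])
  show "cosection n q \<phi> x \<psi> X y : mgrad QW (l + (k + m))" if y: "y : mgrad X l" for y l
  proof -
   have yc: "y : carrier X" using y by simp
   have "cosection n q \<phi> x \<psi> X y i j : mgrad X (l + (k + m) - d i - - d j)" if "i < n" "j < n" for i j
    using gm_smult_deg[OF g A_mult[OF c(3)[OF that(1) x] lmap_deg[OF \<psi> dbD(1)[OF db that(2)], simplified]] y] that
    by (simp add: algebra_simps cosection_def)
   then show ?thesis
    using W[OF yc] Y[OF yc] unfolding box_mgrad by simp
  qed
 qed (use ac in \<open>auto simp: cosection_def box_ops fun_eq_iff smult_arith m_comm\<close>)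
qed

lemma box_ev_cosection:
 assumes y: "y : carrier X"
 shows "box_ev {..<n} X (cosection n q \<phi> x \<psi> X y) = \<psi> x \<odot>\<^bsub>X\<^esub> y"
proof -
 note gQ = dg_gm[OF Q] and g [simp] = dg_gm[OF X]
 note c = db_closed[OF gQ db] and \<psi>c = lmap_closed[OF \<psi>]
 have xc: "x : carrier Q" using gm_carrier[OF gQ x] .
 have jc: "\<psi> (q j) : carrier A" if "j < n" for j using \<psi>c[OF c(1)[OF that]] by simp
 have "box_ev {..<n} X (cosection n q \<phi> x \<psi> X y) = finsum X (%i. (\<psi> (q i) \<otimes> \<phi> i x) \<odot>\<^bsub>X\<^esub> y) {..<n}"
  unfolding box_ev_def using c xc jc y by (intro finsum_congr) (auto simp: cosection_def m_comm)
 also have "\<dots> = \<psi> x \<odot>\<^bsub>X\<^esub> y"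
  using phi_row[OF gQ db \<psi> xc] c xc jc y by (subst finsum_smult_left[symmetric]) auto
 finally show ?thesis .
qed

text \<open>Modulo \<open>p\<close> both \<open>x\<close> and \<open>\<psi>\<close> are cycles, so
  tensoring with them commutes with the differential up to the sign of their total degree. Evenness
  of \<open>k + m\<close> makes this sign trivial: entry \<open>(i, j)\<close> of the tensor
  vanishes unless \<open>d i\<close> and \<open>d j\<close> have the same parity.\<close>

lemma cosection_diff:
 assumes p: "ideal p A" and dx: "\<partial>\<^bsub>Q\<^esub> x : IM p Q" and d\<psi>: "!!y. y : carrier Q ==> \<psi> (\<partial>\<^bsub>Q\<^esub> y) : p"
  and ev: "even (k + m)" and y: "y : carrier X"
 shows "eqm p QW (\<partial>\<^bsub>QW\<^esub> (cosection n q \<phi> x \<psi> X y)) (cosection n q \<phi> x \<psi> X (\<partial>\<^bsub>X\<^esub> y))"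
proof -
 note gQ = dg_gm[OF Q] and g [simp] = dg_gm[OF X] and XD = dgD[OF X]
 note bd = tensor_box_data[OF Q db] and bd' = dual_box_data[OF tensor_box_data[OF Q db]]
 note gY = box_gm[OF bd' g] and gW = box_gm[OF bd box_gm[OF bd' g]]
 have Yd: "dg_module A QY" by (rule box_dg[OF bd' X])
 have Wd: "dg_module A QW" by (rule box_dg[OF bd Yd])
 note c = db_closed[OF gQ db] and \<psi>c = lmap_closed[OF \<psi>]
 have xc: "x : carrier Q" using gm_carrier[OF gQ x] .
 interpret X: graded_group X "mgrad X" by (rule gm_graded[OF g])
 let ?k = "cosection n q \<phi> x \<psi> X"
 note K = lmap_closed[OF cosection_lmap]
 have kY: "?k y i : carrier QY" for i using box_all[OF K[OF y] gY] .
 have jc: "\<psi> (q j) : carrier A" if "j < n" for j using \<psi>c[OF c(1)[OF that]] by simp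
 have dqc: "\<partial>\<^bsub>Q\<^esub> (q j) : carrier Q" if "j < n" for j using dgD(1)[OF Q c(1)[OF that]] .
 have c1: "(\<partial>\<^bsub>QW\<^esub> (?k y)) : carrier QW" and c2: "?k (\<partial>\<^bsub>X\<^esub> y) : carrier QW"
  using K y XD(1) dgD(1)[OF Wd] by auto
 have ent: "(\<partial>\<^bsub>QW\<^esub> (?k y)) i j \<ominus>\<^bsub>X\<^esub> ?k (\<partial>\<^bsub>X\<^esub> y) i j : IM p X" if i: "i < n" and j: "j < n" for i j
 proof -
  have 1: "(finsum QY (%l. DQ i l \<odot>\<^bsub>QY\<^esub> ?k y l) {..<n}) j = (\<phi> i (\<partial>\<^bsub>Q\<^esub> x) \<otimes> \<psi> (q j)) \<odot>\<^bsub>X\<^esub> y"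
  proof -
   have "(finsum QY (%l. DQ i l \<odot>\<^bsub>QY\<^esub> ?k y l) {..<n}) j = finsum X (%l. DQ i l \<odot>\<^bsub>X\<^esub> ?k y l j) {..<n}"
    using kY c i dqc by (intro box_row[OF bd' g]) auto
   also have "\<dots> = finsum X (%l. (DQ i l \<otimes> \<phi> l x) \<odot>\<^bsub>X\<^esub> (\<psi> (q j) \<odot>\<^bsub>X\<^esub> y)) {..<n}"
    using c i j xc y jc dqc by (intro finsum_congr) (auto simp: cosection_def smult_smult m_assoc)
   also have "\<dots> = \<phi> i (\<partial>\<^bsub>Q\<^esub> x) \<odot>\<^bsub>X\<^esub> (\<psi> (q j) \<odot>\<^bsub>X\<^esub> y)"
    using phi_row[OF gQ db lmap_comp[OF dg_lmap[OF Q] dbD(2)[OF db i]] xc] c i j xc y jc dqc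
    by (subst finsum_smult_left[symmetric]) auto
   finally show ?thesis using c(2)[OF i dgD(1)[OF Q xc]] jc[OF j] y by (simp add: smult_smult)
  qed
  have 2: "(koszul (d i) QY (\<partial>\<^bsub>QY\<^esub> (?k y i))) j = koszul (d i) X ((\<partial>\<^bsub>QY\<^esub> (?k y i)) j)"
   using box_eval[OF bd', of j] j by (intro koszul_lmap[OF gY g]) (auto intro: dgD(1)[OF Yd kY])
  let ?s = "finsum X (%l. (\<ominus> koszul (d j) A (DQ l j)) \<odot>\<^bsub>X\<^esub> ?k y i l) {..<n}"
  have kp: "koszul r A a : p" if "a : p" for r a
   using that ideal_simps(4)[OF p] by (simp add: koszul_def)
  have 3: "?s : IM p X"
  proof -
   have Dc: "DQ l j : carrier A" if "l < n" for l using c(2)[OF that dqc[OF j]] .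
   have "?s = finsum X (%l. (\<psi> (q l) \<otimes> DQ l j) \<odot>\<^bsub>X\<^esub> ((\<ominus> koszul (d j) A (\<phi> i x)) \<odot>\<^bsub>X\<^esub> y)) {..<n}"
    using c i j xc y jc Dc
    by (intro finsum_congr) (auto simp: cosection_def smult_smult koszul_def l_minus r_minus m_ac)
   also have "\<dots> = \<psi> (\<partial>\<^bsub>Q\<^esub> (q j)) \<odot>\<^bsub>X\<^esub> ((\<ominus> koszul (d j) A (\<phi> i x)) \<odot>\<^bsub>X\<^esub> y)"
    using phi_row[OF gQ db \<psi> dqc[OF j]] c i j xc y jc Dc
    by (subst finsum_smult_left[symmetric]) (auto simp: koszul_def)
   finally show ?thesis
    using d\<psi>[OF c(1)[OF j]] c(2)[OF i xc] y
    by (simp add: IM_ideal_smult[OF g p] koszul_def)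
  qed
  have 4: "koszul (d i) X (koszul (- d j) X (\<partial>\<^bsub>X\<^esub> (?k y i j))) = ?k (\<partial>\<^bsub>X\<^esub> y) i j"
  proof -
   have a: "\<phi> i x \<otimes> \<psi> (q j) : rgrad A (k - d i + (d j + m))"
    using A_mult[OF c(3)[OF i x] lmap_deg[OF \<psi> dbD(1)[OF db j], simplified]] .
   show ?thesis
   proof (cases "even (k - d i + (d j + m))")
    case False
    then have "\<phi> i x \<otimes> \<psi> (q j) = \<zero>" using A_odd[OF a] by simp
    then show ?thesis using y i j by (simp add: cosection_def XD)
   next
    case True
    then have "even (d i) \<longleftrightarrow> even (d j)" using ev by presburger
    then show ?thesis using y i j a XD by (simp add: cosection_def koszul_def)
   qed
  qed
  have sc: "?s : carrier X" using IM_carrier[OF 3] .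
  have kc: "?k (\<partial>\<^bsub>X\<^esub> y) i j : carrier X" "?k y i j : carrier X"
   using box_all[OF box_all[OF c2 gY] g] box_all[OF kY g] by auto
  have "(\<partial>\<^bsub>QY\<^esub> (?k y i)) j = ?s \<oplus>\<^bsub>X\<^esub> koszul (- d j) X (\<partial>\<^bsub>X\<^esub> (?k y i j))"
   using j by (simp add: box_ops(4))
  then have "koszul (d i) X ((\<partial>\<^bsub>QY\<^esub> (?k y i)) j) = koszul (d i) X ?s \<oplus>\<^bsub>X\<^esub> ?k (\<partial>\<^bsub>X\<^esub> y) i j"
   using sc kc by (simp add: koszul_add 4 XD)
  moreover have "(\<partial>\<^bsub>QW\<^esub> (?k y)) i j = (\<phi> i (\<partial>\<^bsub>Q\<^esub> x) \<otimes> \<psi> (q j)) \<odot>\<^bsub>X\<^esub> y \<oplus>\<^bsub>X\<^esub> koszul (d i) X ((\<partial>\<^bsub>QY\<^esub> (?k y i)) j)"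
   unfolding box_ops(4)[of "{..<n}" d eQ DQ QY "?k y"] using i by (simp add: box_ops(2) 1 2)
  moreover have f: "\<phi> i (\<partial>\<^bsub>Q\<^esub> x) \<otimes> \<psi> (q j) : carrier A" using c(2)[OF i dgD(1)[OF Q xc]] jc[OF j] by simp
  ultimately have "(\<partial>\<^bsub>QW\<^esub> (?k y)) i j \<ominus>\<^bsub>X\<^esub> ?k (\<partial>\<^bsub>X\<^esub> y) i j = (\<phi> i (\<partial>\<^bsub>Q\<^esub> x) \<otimes> \<psi> (q j)) \<odot>\<^bsub>X\<^esub> y \<oplus>\<^bsub>X\<^esub> koszul (d i) X ?s"
   using sc kc y by (simp add: group_arith group_closed)
  moreover have "koszul (d i) X ?s : IM p X" using IM_minus[OF g p 3] 3 by (simp add: koszul_def)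
  moreover have "(\<phi> i (\<partial>\<^bsub>Q\<^esub> x) \<otimes> \<psi> (q j)) \<odot>\<^bsub>X\<^esub> y : IM p X"
   using IMD[OF dx dbD(2)[OF db i]] ideal_simps(7)[OF p] jc[OF j] y by (intro IM_ideal_smult[OF g p]) auto
  ultimately show ?thesis using IM_add[OF g p] by simp
 qed
 let ?df = "\<partial>\<^bsub>QW\<^esub> (?k y) \<ominus>\<^bsub>QW\<^esub> ?k (\<partial>\<^bsub>X\<^esub> y)"
 have dfW: "?df : carrier QW" by (rule abelian_group.minus_closed[OF gm_group[OF gW] c1 c2])
 have "?df : IM p QW"
 proof (rule box_IM[OF bd gY p dfW])
  fix i assume "i : {..<n}"
  then have i: "i < n" by simp
  show "?df i : IM p QY"
  proof (rule box_IM[OF bd' g p box_all[OF dfW gY]])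
   fix j assume "j : {..<n}"
   then show "?df i j : IM p X"
    using ent[OF i] box_minus(1)[OF bd' g box_all[OF c1 gY] box_all[OF c2 gY]]
    by (simp add: box_minus(1)[OF bd gY c1 c2])
  qed
 qed
 then show ?thesis using c1 c2 by (simp add: eqm_def)
qed

end

end

section \<open>The tensor product by generators and relations\<close>

context even_graded_ring
begin

lemma frag_additive_eq:
 fixes f g :: "('b \<Rightarrow>\<^sub>0 int) => 'c"
 assumes H: "abelian_group H" and f: "!!u. Poly_Mapping.keys u \<subseteq> Z ==> f u : carrier H" and g: "!!u. Poly_Mapping.keys u \<subseteq> Z ==> g u : carrier H"
  and fa: "!!u v. Poly_Mapping.keys u \<subseteq> Z ==> Poly_Mapping.keys v \<subseteq> Z ==> f (u + v) = f u \<oplus>\<^bsub>H\<^esub> f v"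
  and ga: "!!u v. Poly_Mapping.keys u \<subseteq> Z ==> Poly_Mapping.keys v \<subseteq> Z ==> g (u + v) = g u \<oplus>\<^bsub>H\<^esub> g v"
  and e: "!!x. x : Z ==> f (frag_of x) = g (frag_of x)" and u: "Poly_Mapping.keys u \<subseteq> Z"
 shows "f u = g u"
proof -
 interpret H: abelian_group H by fact
 have z: "h 0 = \<zero>\<^bsub>H\<^esub>" if "h 0 : carrier H" "h (0 + 0) = h 0 \<oplus>\<^bsub>H\<^esub> h 0" for h :: "('b \<Rightarrow>\<^sub>0 int) => 'c"
  using that H.add.r_cancel_one'[of "h 0" "h 0"] by simp
 have "f u = g u & Poly_Mapping.keys u \<subseteq> Z" using u
 proof (induction u rule: frag_induction)
  case zero
  have "f 0 = \<zero>\<^bsub>H\<^esub>" by (rule z) (use f[of 0] fa[of 0 0] in simp_all)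
  moreover have "g 0 = \<zero>\<^bsub>H\<^esub>" by (rule z) (use g[of 0] ga[of 0 0] in simp_all)
  ultimately show ?case by simp
 next
  case (one x)
  then show ?case using e by simp
 next
  case (diff a b)
  have k: "Poly_Mapping.keys (a - b) \<subseteq> Z" using diff keys_diff[of a b] by blast
  have "f (a - b) \<oplus>\<^bsub>H\<^esub> f b = g (a - b) \<oplus>\<^bsub>H\<^esub> g b"
   using fa[OF k, of b] ga[OF k, of b] diff by simp
  then have "f (a - b) = g (a - b)" using f[OF k] g[OF k] f[of b] g[of b] diff by simp
  then show ?case using k by simp
 qed
 then show ?thesis by simp
qed

text \<open>Multiplication by a nonzero homogeneous scalar changes the degree by an even number and
  so does not affect the sign; this makes \<open>parity\<close> linear.\<close>

lemma parity_props:
 assumes M: "dg_module A M"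
 shows "lmap 0 M M (parity M)" "x : mgrad M i ==> parity M x = koszul i M x"
proof -
 note g = dg_gm[OF M]
 interpret graded_group M "mgrad M" by (rule gm_graded[OF g])
 have sup: "parity M x = finsum M (%i. koszul i M (cmp x i)) F"
  if "x : carrier M" "finite F" "!!i. i ~: F ==> cmp x i = \<zero>\<^bsub>M\<^esub>" for x F
  unfolding parity_def using that g by (intro add.finprod_mono_neutral_cong_left) auto
 show hom: "parity M x = koszul i M x" if "x : mgrad M i" for x i
 proof -
  have "parity M x = finsum M (%i. koszul i M (cmp x i)) {i}"
   using that by (intro sup) (auto simp: cmp_hom)
  then show ?thesis using that g by (simp add: finsum_insert cmp_hom)
 qed
 have cl: "parity M x : carrier M" if "x : carrier M" for x
  unfolding parity_def using that g by (intro finsum_closed) auto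
 have ad: "parity M (x \<oplus>\<^bsub>M\<^esub> y) = parity M x \<oplus>\<^bsub>M\<^esub> parity M y" if x: "x : carrier M" and y: "y : carrier M" for x y
 proof -
  let ?F = "{i. cmp x i ~= \<zero>\<^bsub>M\<^esub>} \<union> {i. cmp y i ~= \<zero>\<^bsub>M\<^esub>}"
  have F: "finite ?F" using cmp_finite x y by simp
  have "parity M (x \<oplus>\<^bsub>M\<^esub> y) = finsum M (%i. koszul i M (cmp x i) \<oplus>\<^bsub>M\<^esub> koszul i M (cmp y i)) ?F"
   using x y F g by (subst sup[of _ ?F]) (auto simp: cmp_add koszul_add)
  also have "\<dots> = finsum M (%i. koszul i M (cmp x i)) ?F \<oplus>\<^bsub>M\<^esub> finsum M (%i. koszul i M (cmp y i)) ?F"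
   using x y g by (intro finsum_plus) auto
  finally show ?thesis using sup[OF x F] sup[OF y F] by simp
 qed
 have z: "parity M \<zero>\<^bsub>M\<^esub> = \<zero>\<^bsub>M\<^esub>" using hom[of "\<zero>\<^bsub>M\<^esub>" 0] g by simp
 have sm1: "parity M (a \<odot>\<^bsub>M\<^esub> x) = a \<odot>\<^bsub>M\<^esub> parity M x" if a: "a : rgrad A j" and x: "x : carrier M" for a x j
  using x
 proof (induction x rule: hom_induct)
  case zero
  then show ?case using a g z by simp
 next
  case (add x y)
  then show ?case using a g by (simp add: smult_add_r ad cl)
 next
  case (hom x i)
  have "parity M (a \<odot>\<^bsub>M\<^esub> x) = koszul (j + i) M (a \<odot>\<^bsub>M\<^esub> x)"
   by (rule \<open>!!x i. x : mgrad M i ==> parity M x = koszul i M x\<close>[OF gm_smult_deg[OF g a hom]])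
  also have "\<dots> = a \<odot>\<^bsub>M\<^esub> koszul (j + i) M x" using a hom g by (simp add: koszul_smult)
  also have "\<dots> = a \<odot>\<^bsub>M\<^esub> koszul i M x" using a hom g by (intro koszul_coeff[OF g a]) auto
  finally show ?case using \<open>!!x i. x : mgrad M i ==> parity M x = koszul i M x\<close>[OF hom] by simp
 qed
 have sm: "parity M (a \<odot>\<^bsub>M\<^esub> x) = a \<odot>\<^bsub>M\<^esub> parity M x" if a: "a : carrier A" and x: "x : carrier M" for a x
  using a
 proof (induction a rule: GA.hom_induct)
  case zero
  then show ?case using x g z cl by simp
 next
  case (add a b)
  then show ?case using x g by (simp add: smult_add_l ad cl)
 next
  case (hom a i)
  then show ?case using sm1 x by blast
 qed
 show "lmap 0 M M (parity M)"
  using cl ad sm hom koszul_deg[OF g] by (simp add: lmap_def)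
qed

context
 fixes Q :: "('a, 'q) dg_module" and Y :: "('a, 'm) dg_module"
 assumes Q: "dg_module A Q" and Y: "dg_module A Y"
begin

abbreviation (input) "TG \<equiv> tensor_group Q Y"
abbreviation (input) "TN \<equiv> tensor_null A Q Y"
abbreviation (input) "TS \<equiv> carrier Q \<times> carrier Y"
abbreviation (input) "cl \<equiv> tensor_class A Q Y"

lemma TG_comm: "comm_group TG"
 by (simp add: tensor_group_def abelian_free_Abelian_group)

lemma TG_simps: "u : carrier TG \<longleftrightarrow> Poly_Mapping.keys u \<subseteq> TS" "\<one>\<^bsub>TG\<^esub> = 0" "u \<otimes>\<^bsub>TG\<^esub> v = u + v"
 "Poly_Mapping.keys u \<subseteq> TS ==> inv\<^bsub>TG\<^esub> u = - u"
 by (simp_all add: tensor_group_def)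

lemma rel_TG: "tensor_relations A Q Y \<subseteq> carrier TG"
proof -
 have k: "Poly_Mapping.keys (frag_of a - frag_of b - frag_of c) \<subseteq> TS" "Poly_Mapping.keys (frag_of a - frag_of b) \<subseteq> TS"
  if "a : TS" "b : TS" "c : TS" for a b c
  using that keys_diff[of "frag_of a - frag_of b" "frag_of c"] keys_diff[of "frag_of a" "frag_of b"]
  by (auto simp: keys_frag_of)
 note [simp] = dg_gm[OF Q] dg_gm[OF Y]
 show ?thesis
 proof
  fix h assume "h : tensor_relations A Q Y"
  then consider
    x x' y where "h = frag_of (x \<oplus>\<^bsub>Q\<^esub> x', y) - frag_of (x, y) - frag_of (x', y)"
     "x : carrier Q" "x' : carrier Q" "y : carrier Y"
   | x y y' where "h = frag_of (x, y \<oplus>\<^bsub>Y\<^esub> y') - frag_of (x, y) - frag_of (x, y')"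
     "x : carrier Q" "y : carrier Y" "y' : carrier Y"
   | a x y where "h = frag_of (a \<odot>\<^bsub>Q\<^esub> x, y) - frag_of (x, a \<odot>\<^bsub>Y\<^esub> y)"
     "a : carrier A" "x : carrier Q" "y : carrier Y"
   unfolding tensor_relations_def by blast
  then show "h : carrier TG" unfolding TG_simps(1)
  proof cases
   case 1
   show "Poly_Mapping.keys h \<subseteq> TS" unfolding 1(1) by (rule k) (use 1(2-) in \<open>simp_all add: group_closed\<close>)
  next
   case 2
   show "Poly_Mapping.keys h \<subseteq> TS" unfolding 2(1) by (rule k) (use 2(2-) in \<open>simp_all add: group_closed\<close>)
  next
   case 3
   show "Poly_Mapping.keys h \<subseteq> TS" unfolding 3(1) by (rule k(2)[of _ _ "(x, y)"]) (use 3(2-) in \<open>simp_all\<close>)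
  qed
 qed
qed

lemma TN_sub: "subgroup TN TG"
 unfolding tensor_null_def
 using group.generate_is_subgroup[OF comm_group.axioms(2)[OF TG_comm]] rel_TG by blast

lemma TN_keys: "h : TN ==> Poly_Mapping.keys h \<subseteq> TS"
 using subgroup.subset[OF TN_sub] TG_simps(1) by blast

lemma TN_zero: "0 : TN" and TN_add: "h : TN ==> k : TN ==> h + k : TN"
 and TN_minus: "h : TN ==> - h : TN"
 using subgroup.one_closed[OF TN_sub] subgroup.m_closed[OF TN_sub] subgroup.m_inv_closed[OF TN_sub]
  TN_keys TG_simps by metis+

lemma cl_def': "cl u = (%h. h + u) ` TN"
 by (auto simp: tensor_class_def r_coset_def TG_simps)

lemma cl_eq: "cl u = cl v \<longleftrightarrow> u - v : TN"
proof
 assume "cl u = cl v"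
 then have "u : cl v" using TN_zero unfolding cl_def' by force
 then show "u - v : TN" by (auto simp: cl_def')
next
 assume *: "u - v : TN"
 show "cl u = cl v"
 proof
  show "cl u \<subseteq> cl v"
  proof
   fix x assume "x : cl u"
   then obtain h where "h : TN" "x = h + u" by (auto simp: cl_def')
   then have "x = (h + (u - v)) + v" "h + (u - v) : TN" using TN_add * by auto
   then show "x : cl v" unfolding cl_def' by blast
  qed
  show "cl v \<subseteq> cl u"
  proof
   fix x assume "x : cl v"
   then obtain h where "h : TN" "x = h + v" by (auto simp: cl_def')
   then have "x = (h + - (u - v)) + u" "h + - (u - v) : TN" using TN_add[OF _ TN_minus[OF *]] by auto
   then show "x : cl u" unfolding cl_def' by blast
  qed
 qed
qed

lemma T_carrier: "carrier (tensor A Q Y) = {cl u | u. Poly_Mapping.keys u \<subseteq> TS}"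
 by (auto simp: tensor_def FactGroup_def RCOSETS_def tensor_class_def TG_simps)

lemma T_mem: "Poly_Mapping.keys u \<subseteq> TS ==> cl u : carrier (tensor A Q Y)"
 by (auto simp: T_carrier)

lemma T_zero: "\<zero>\<^bsub>tensor A Q Y\<^esub> = cl 0"
 by (simp add: tensor_def FactGroup_def cl_def')

lemma T_add: "cl u \<oplus>\<^bsub>tensor A Q Y\<^esub> cl v = cl (u + v)"
proof -
 have "cl u \<oplus>\<^bsub>tensor A Q Y\<^esub> cl v = {a + b | a b. a : cl u & b : cl v}"
  by (auto simp: tensor_def FactGroup_def set_mult_def TG_simps)
 also have "\<dots> = cl (u + v)"
 proof (intro equalityI subsetI)
  fix x assume "x : {a + b | a b. a : cl u & b : cl v}"
  then obtain h k where "h : TN" "k : TN" "x = (h + u) + (k + v)" by (auto simp: cl_def')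
  then have "x = (h + k) + (u + v)" "h + k : TN" using TN_add by auto
  then show "x : cl (u + v)" unfolding cl_def' by blast
 next
  fix x assume "x : cl (u + v)"
  then obtain h where "h : TN" "x = (h + u) + (0 + v)" by (auto simp: cl_def' add.assoc)
  then show "x : {a + b | a b. a : cl u & b : cl v}" using TN_zero unfolding cl_def' by blast
 qed
 finally show ?thesis .
qed

lemma T_abelian: "abelian_group (tensor A Q Y)"
proof (rule abelian_groupI)
 show "EX y:carrier (tensor A Q Y). y \<oplus>\<^bsub>tensor A Q Y\<^esub> x = \<zero>\<^bsub>tensor A Q Y\<^esub>" if X: "x : carrier (tensor A Q Y)" for x
 proof -
  obtain u where u: "x = cl u" "Poly_Mapping.keys u \<subseteq> TS" using X by (auto simp: T_carrier)
  then have "cl (- u) : carrier (tensor A Q Y)" "cl (- u) \<oplus>\<^bsub>tensor A Q Y\<^esub> x = \<zero>\<^bsub>tensor A Q Y\<^esub>"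
   using T_mem[of "- u"] by (auto simp: T_add T_zero)
  then show ?thesis by blast
 qed
 show "x \<oplus>\<^bsub>tensor A Q Y\<^esub> y : carrier (tensor A Q Y)"
  if X: "x : carrier (tensor A Q Y)" "y : carrier (tensor A Q Y)" for x y
 proof -
  obtain u v where "x = cl u" "Poly_Mapping.keys u \<subseteq> TS" "y = cl v" "Poly_Mapping.keys v \<subseteq> TS" using X by (auto simp: T_carrier)
  then show ?thesis using keys_add[of u v] T_mem[of "u + v"] by (auto simp: T_add)
 qed
 show "\<zero>\<^bsub>tensor A Q Y\<^esub> : carrier (tensor A Q Y)" unfolding T_zero by (rule T_mem) simp
qed (auto simp: T_carrier T_add T_zero ac_simps)


text \<open>One half of the universal property of the tensor product: an additive map that is
  biadditive and balanced on pairs kills the generators of the relation subgroup, hence the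
  subgroup.\<close>

lemma TN_induct:
 assumes "abelian_group H" and f: "!!u. Poly_Mapping.keys u \<subseteq> TS ==> f u : carrier H"
  and fa: "!!u v. Poly_Mapping.keys u \<subseteq> TS ==> Poly_Mapping.keys v \<subseteq> TS ==> f (u + v) = f u \<oplus>\<^bsub>H\<^esub> f v"
  and l: "!!x x' y. x : carrier Q ==> x' : carrier Q ==> y : carrier Y ==>
   f (frag_of (x \<oplus>\<^bsub>Q\<^esub> x', y)) = f (frag_of (x, y)) \<oplus>\<^bsub>H\<^esub> f (frag_of (x', y))"
  and r: "!!x y y'. x : carrier Q ==> y : carrier Y ==> y' : carrier Y ==>
   f (frag_of (x, y \<oplus>\<^bsub>Y\<^esub> y')) = f (frag_of (x, y)) \<oplus>\<^bsub>H\<^esub> f (frag_of (x, y'))"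
  and b: "!!a x y. a : carrier A ==> x : carrier Q ==> y : carrier Y ==>
   f (frag_of (a \<odot>\<^bsub>Q\<^esub> x, y)) = f (frag_of (x, a \<odot>\<^bsub>Y\<^esub> y))"
  and h: "h : TN"
 shows "f h = \<zero>\<^bsub>H\<^esub>"
proof -
 interpret H: abelian_group H by fact
 note gQ = dg_gm[OF Q] and gY = dg_gm[OF Y]
 have f0: "f 0 = \<zero>\<^bsub>H\<^esub>" using fa[of 0 0] f[of 0] H.add.r_cancel_one'[of "f 0" "f 0"] by simp
 have fd: "f (u - v) \<oplus>\<^bsub>H\<^esub> f v = f u" if "Poly_Mapping.keys u \<subseteq> TS" "Poly_Mapping.keys v \<subseteq> TS" for u v
 proof -
  have "Poly_Mapping.keys (u - v) \<subseteq> TS" using that keys_diff[of u v] by blast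
  then show ?thesis using fa[of "u - v" v] that by simp
 qed
 have fof: "f (frag_of p) : carrier H" if "p : TS" for p using f[of "frag_of p"] that by (auto simp: keys_frag_of)
 have d2: "f (frag_of p - frag_of q) = \<zero>\<^bsub>H\<^esub>" if "p : TS" "q : TS" "f (frag_of p) = f (frag_of q)" for p q
 proof -
  have k: "Poly_Mapping.keys (frag_of p) \<subseteq> TS" "Poly_Mapping.keys (frag_of q) \<subseteq> TS" using that by (auto simp: keys_frag_of)
  have "Poly_Mapping.keys (frag_of p - frag_of q) \<subseteq> TS" using k keys_diff[of "frag_of p" "frag_of q"] by blast
  then show ?thesis using fd[OF k] that(3) f[of "frag_of p - frag_of q"] fof[OF that(2)] by simp
 qed
 have d3: "f (frag_of p - frag_of q - frag_of r) = \<zero>\<^bsub>H\<^esub>"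
  if "p : TS" "q : TS" "r : TS" "f (frag_of p) = f (frag_of q) \<oplus>\<^bsub>H\<^esub> f (frag_of r)" for p q r
 proof -
  have k: "Poly_Mapping.keys (frag_of p) \<subseteq> TS" "Poly_Mapping.keys (frag_of q) \<subseteq> TS" "Poly_Mapping.keys (frag_of r) \<subseteq> TS" using that by (auto simp: keys_frag_of)
  have k2: "Poly_Mapping.keys (frag_of p - frag_of q) \<subseteq> TS" using k keys_diff[of "frag_of p" "frag_of q"] by blast
  have k3: "Poly_Mapping.keys (frag_of p - frag_of q - frag_of r) \<subseteq> TS" using k k2 keys_diff[of "frag_of p - frag_of q" "frag_of r"] by blast
  have "(f (frag_of p - frag_of q - frag_of r) \<oplus>\<^bsub>H\<^esub> f (frag_of r)) \<oplus>\<^bsub>H\<^esub> f (frag_of q) = f (frag_of q) \<oplus>\<^bsub>H\<^esub> f (frag_of r)"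
   using fd[OF k2 k(3)] fd[OF k(1,2)] that(4) by simp
  then show ?thesis using f[OF k3] fof[OF that(2)] fof[OF that(3)] H.a_comm by (simp add: H.a_assoc)
 qed
 have rel: "f h = \<zero>\<^bsub>H\<^esub>" if "h : tensor_relations A Q Y" for h
 proof -
  note [simp] = gQ gY
  from that consider
    x x' y where "h = frag_of (x \<oplus>\<^bsub>Q\<^esub> x', y) - frag_of (x, y) - frag_of (x', y)"
     "x : carrier Q" "x' : carrier Q" "y : carrier Y"
   | x y y' where "h = frag_of (x, y \<oplus>\<^bsub>Y\<^esub> y') - frag_of (x, y) - frag_of (x, y')"
     "x : carrier Q" "y : carrier Y" "y' : carrier Y"
   | a x y where "h = frag_of (a \<odot>\<^bsub>Q\<^esub> x, y) - frag_of (x, a \<odot>\<^bsub>Y\<^esub> y)"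
     "a : carrier A" "x : carrier Q" "y : carrier Y"
   unfolding tensor_relations_def by blast
  then show ?thesis
  proof cases
   case 1
   show ?thesis unfolding 1(1) by (rule d3) (use 1(2-) l in \<open>simp_all add: group_closed\<close>)
  next
   case 2
   show ?thesis unfolding 2(1) by (rule d3) (use 2(2-) r in \<open>simp_all add: group_closed\<close>)
  next
   case 3
   show ?thesis unfolding 3(1) by (rule d2) (use 3(2-) b in \<open>simp_all\<close>)
  qed
 qed
 show ?thesis using h unfolding tensor_null_def
 proof (induction h rule: generate.induct)
  case one
  then show ?case by (simp add: TG_simps f0)
 next
  case (incl h)
  then show ?case by (rule rel)
 next
  case (inv h)
  have k: "Poly_Mapping.keys h \<subseteq> TS" using inv rel_TG TG_simps(1) by blast
  have "f (- h) \<oplus>\<^bsub>H\<^esub> f h = f 0" using fa[of "- h" h] k by simp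
  then show ?case using f[of "- h"] k rel[OF inv] f0 by (simp add: TG_simps)
 next
  case (eng h k)
  have "Poly_Mapping.keys h \<subseteq> TS" "Poly_Mapping.keys k \<subseteq> TS" using eng(1,2) TN_keys by (auto simp: tensor_null_def)
  then show ?case using fa[of h k] eng by (simp add: TG_simps)
 qed
qed

text \<open>Evaluates the operations of \<open>tensor\<close>, which are unions over the
  representatives of a coset: if \<open>f\<close> sends relations to the zero coset, all members of
  the union coincide.\<close>

lemma UN_cl:
 assumes f: "!!u. Poly_Mapping.keys u \<subseteq> TS ==> Poly_Mapping.keys (f u) \<subseteq> TS" and fa: "!!u v. f (u + v) = f u + f v"
  and N: "!!h. h : TN ==> cl (f h) = cl 0"
 shows "(\<Union>v \<in> cl u. cl (f v)) = cl (f u)"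
proof -
 have "cl (f v) = cl (f u)" if "v : cl u" for v
 proof -
  obtain h where h: "h : TN" "v = h + u" using \<open>v : cl u\<close> by (auto simp: cl_def')
  have "f v - f u = f h - 0" by (simp add: h fa)
  then show ?thesis using N[OF h(1)] by (simp add: cl_eq)
 qed
 then have "(\<Union>v \<in> cl u. cl (f v)) = (\<Union>v \<in> cl u. cl (f u))" by simp
 moreover have "cl u ~= {}" using TN_zero by (auto simp: cl_def')
 ultimately show ?thesis by simp
qed

lemma cl_l: "[|x : carrier Q; x' : carrier Q; y : carrier Y|] ==> cl (frag_of (x \<oplus>\<^bsub>Q\<^esub> x', y)) = cl (frag_of (x, y) + frag_of (x', y))"
 and cl_r: "[|x : carrier Q; y : carrier Y; y' : carrier Y|] ==> cl (frag_of (x, y \<oplus>\<^bsub>Y\<^esub> y')) = cl (frag_of (x, y) + frag_of (x, y'))"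
 and cl_b: "[|a : carrier A; x : carrier Q; y : carrier Y|] ==> cl (frag_of (a \<odot>\<^bsub>Q\<^esub> x, y)) = cl (frag_of (x, a \<odot>\<^bsub>Y\<^esub> y))"
proof -
 note inc = generate.incl[of _ "tensor_relations A Q Y" TG, folded tensor_null_def]
 show "cl (frag_of (x \<oplus>\<^bsub>Q\<^esub> x', y)) = cl (frag_of (x, y) + frag_of (x', y))"
  if "x : carrier Q" "x' : carrier Q" "y : carrier Y"
  unfolding cl_eq diff_diff_eq[symmetric] by (rule inc) (use that in \<open>unfold tensor_relations_def, blast\<close>)
 show "cl (frag_of (x, y \<oplus>\<^bsub>Y\<^esub> y')) = cl (frag_of (x, y) + frag_of (x, y'))"
  if "x : carrier Q" "y : carrier Y" "y' : carrier Y"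
  unfolding cl_eq diff_diff_eq[symmetric] by (rule inc) (use that in \<open>unfold tensor_relations_def, blast\<close>)
 show "cl (frag_of (a \<odot>\<^bsub>Q\<^esub> x, y)) = cl (frag_of (x, a \<odot>\<^bsub>Y\<^esub> y))"
  if "a : carrier A" "x : carrier Q" "y : carrier Y"
  unfolding cl_eq by (rule inc) (use that in \<open>unfold tensor_relations_def, blast\<close>)
qed

lemma keys_ext:
 assumes "!!p. p : TS ==> Poly_Mapping.keys (g p) \<subseteq> TS" "Poly_Mapping.keys u \<subseteq> TS" shows "Poly_Mapping.keys (frag_extend g u) \<subseteq> TS"
 using keys_frag_extend[of g u] assms by blast

lemma T_smult:
 assumes a: "a : carrier A"
 shows "a \<odot>\<^bsub>tensor A Q Y\<^esub> cl u = cl (frag_extend (%(x, y). frag_of (a \<odot>\<^bsub>Q\<^esub> x, y)) u)"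
  and "Poly_Mapping.keys u \<subseteq> TS ==> Poly_Mapping.keys (frag_extend (%(x, y). frag_of (a \<odot>\<^bsub>Q\<^esub> x, y)) u) \<subseteq> TS"
proof -
 note gQ = dg_gm[OF Q] and gY = dg_gm[OF Y]
 let ?f = "frag_extend (%(x, y). frag_of (a \<odot>\<^bsub>Q\<^esub> x, y))"
 show k: "Poly_Mapping.keys u \<subseteq> TS ==> Poly_Mapping.keys (?f u) \<subseteq> TS" for u :: "'q \<times> 'm \<Rightarrow>\<^sub>0 int"
  by (rule keys_ext) (use a gQ in \<open>auto simp: keys_frag_of\<close>)
 have "cl (?f h) = cl 0" if "h : TN" for h
  unfolding T_zero[symmetric]
  by (rule TN_induct[OF T_abelian _ _ _ _ _ that])
   (use k a gQ gY in \<open>auto simp: T_carrier frag_extend_add T_add[symmetric] smult_arith cl_l cl_r m_comm[of _ a]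
    simp flip: cl_b\<close>)
 from UN_cl[OF k frag_extend_add this] show "a \<odot>\<^bsub>tensor A Q Y\<^esub> cl u = cl (?f u)" by (simp add: tensor_def)
qed

end

end

section \<open>Comparison of the tensor product with its coordinate form\<close>

context even_graded_ring
begin

text \<open>The module axioms are not proved for cosets but pulled back along the bijection
  \<open>F\<close>: two elements of \<open>W\<close> are equal as soon as their images in
  \<open>B\<close> are, and there the axioms are known.\<close>

lemma gm_transfer:
 fixes W :: "('a, 'w) dg_module" and B :: "('a, 'b) dg_module"
 assumes B: "gm B"
  and F: "!!x. x : carrier W ==> F x : carrier B" and G: "!!y. y : carrier B ==> G y : carrier W"
  and GF: "!!x. x : carrier W ==> G (F x) = x" and FG: "!!y. y : carrier B ==> F (G y) = y"
  and ag: "abelian_group W" and sm: "!!a x. a : carrier A ==> x : carrier W ==> a \<odot>\<^bsub>W\<^esub> x : carrier W"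
  and Fa: "!!x y. x : carrier W ==> y : carrier W ==> F (x \<oplus>\<^bsub>W\<^esub> y) = F x \<oplus>\<^bsub>B\<^esub> F y"
  and Fs: "!!a x. a : carrier A ==> x : carrier W ==> F (a \<odot>\<^bsub>W\<^esub> x) = a \<odot>\<^bsub>B\<^esub> F x"
  and Fd: "!!x i. x : mgrad W i ==> x : carrier W & F x : mgrad B i"
  and Gd: "!!y i. y : mgrad B i ==> G y : mgrad W i"
  and D: "dg_module A B" "!!x. x : carrier W ==> \<partial>\<^bsub>W\<^esub> x : carrier W & F (\<partial>\<^bsub>W\<^esub> x) = \<partial>\<^bsub>B\<^esub> (F x)"
 shows "dg_module A W & dg_iso B W G F"
proof (rule conjI)
 interpret B: graded_group B "mgrad B" by (rule gm_graded[OF B])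
 interpret W: abelian_group W by (rule ag)
 note DB = dgD[OF D(1)]
 have eqI: "x = y" if "x : carrier W" "y : carrier W" "F x = F y" for x y
  using GF[OF that(1)] GF[OF that(2)] that(3) by metis
 have F0: "F \<zero>\<^bsub>W\<^esub> = \<zero>\<^bsub>B\<^esub>"
  using Fa[of "\<zero>\<^bsub>W\<^esub>" "\<zero>\<^bsub>W\<^esub>"] F[of "\<zero>\<^bsub>W\<^esub>"] B.add.r_cancel_one'[of "F \<zero>\<^bsub>W\<^esub>" "F \<zero>\<^bsub>W\<^esub>"] by simp
 have G0: "G \<zero>\<^bsub>B\<^esub> = \<zero>\<^bsub>W\<^esub>" using GF[OF W.zero_closed] F0 by simp
 have Ga: "G (x \<oplus>\<^bsub>B\<^esub> y) = G x \<oplus>\<^bsub>W\<^esub> G y" if "x : carrier B" "y : carrier B" for x y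
  by (rule eqI) (use that G in \<open>simp_all add: FG Fa\<close>)
 have Gs: "G (a \<odot>\<^bsub>B\<^esub> x) = a \<odot>\<^bsub>W\<^esub> G x" if "a : carrier A" "x : carrier B" for a x
  by (rule eqI) (use that G sm B in \<open>simp_all add: FG Fs\<close>)
 have Gd': "G y : mgrad W i & F (G y) = y" if "y : mgrad B i" for y i
  using Gd[OF that] FG that by simp
 have Wd: "x : mgrad W i \<longleftrightarrow> x : carrier W & F x : mgrad B i" for x i
  using Fd Gd GF by metis
 have gW: "gm W"
 proof (rule gmI[of _ "%x i. G (B.cmp (F x) i)"])
  fix x assume x: "x : carrier W"
  have c: "B.cmp (F x) i : carrier B" for i using F[OF x] by simp
  have s: "{i. G (B.cmp (F x) i) ~= \<zero>\<^bsub>W\<^esub>} = {i. B.cmp (F x) i ~= \<zero>\<^bsub>B\<^esub>}" (is "?S = ?S'")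
   using FG[OF c] F0 G0 by metis
  show "finite ?S" unfolding s using B.cmp_finite[OF F[OF x]] .
  have "F (finsum W (%i. G (B.cmp (F x) i)) ?S) = finsum B (%i. F (G (B.cmp (F x) i))) ?S"
   using c G by (intro additive_finsum[OF ag B.abelian_group_axioms F Fa]) auto
  also have "\<dots> = F x" unfolding s FG[OF c] by (rule B.cmp_sum[OF F[OF x], symmetric])
  finally show "finsum W (%i. G (B.cmp (F x) i)) ?S = x"
   using x c G by (intro eqI) (auto intro!: W.finsum_closed)
 next
  show "\<zero> \<odot>\<^bsub>W\<^esub> x = \<zero>\<^bsub>W\<^esub>" if "x : carrier W" for x
   by (rule eqI) (use that F sm B in \<open>simp_all add: Fs F0\<close>)
  show "\<one> \<odot>\<^bsub>W\<^esub> x = x" if "x : carrier W" for x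
   by (rule eqI) (use that F sm B in \<open>simp_all add: Fs\<close>)
  show "(a \<otimes> b) \<odot>\<^bsub>W\<^esub> x = a \<odot>\<^bsub>W\<^esub> (b \<odot>\<^bsub>W\<^esub> x)" if "a : carrier A" "b : carrier A" "x : carrier W" for a b x
   by (rule eqI) (use that F sm B in \<open>simp_all add: Fs smult_smult\<close>)
  show "(a \<oplus> b) \<odot>\<^bsub>W\<^esub> x = a \<odot>\<^bsub>W\<^esub> x \<oplus>\<^bsub>W\<^esub> b \<odot>\<^bsub>W\<^esub> x" if "a : carrier A" "b : carrier A" "x : carrier W" for a b x
   by (rule eqI) (use that F sm B in \<open>simp_all add: Fs Fa smult_add_l\<close>)
  show "a \<odot>\<^bsub>W\<^esub> (x \<oplus>\<^bsub>W\<^esub> y) = a \<odot>\<^bsub>W\<^esub> x \<oplus>\<^bsub>W\<^esub> a \<odot>\<^bsub>W\<^esub> y" if "a : carrier A" "x : carrier W" "y : carrier W" for a x y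
   by (rule eqI) (use that F sm B in \<open>simp_all add: Fs Fa smult_add_r\<close>)
  show "a \<odot>\<^bsub>W\<^esub> x : mgrad W (i + j)" if "a : rgrad A i" "x : mgrad W j" for a x i j
   using that gm_smult_deg[OF B that(1)] sm Fs by (auto simp: Wd)
  show "G (B.cmp (F (x \<oplus>\<^bsub>W\<^esub> y)) i) = G (B.cmp (F x) i) \<oplus>\<^bsub>W\<^esub> G (B.cmp (F y) i)"
   if "x : carrier W" "y : carrier W" for x y i
   using that F by (simp add: Fa B.cmp_add Ga)
  show "G (B.cmp (F x) j) = (if j = i then x else \<zero>\<^bsub>W\<^esub>)" if "x : mgrad W i" for x i j
   using Fd[OF that] B.cmp_hom[of "F x" i] by (auto simp: GF G0)
 qed (use sm G F Gd in \<open>auto simp: Wd Fa F0 W.group_rearrange\<close>)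
 have lF: "lmap 0 W B F" using F Fa Fs Fd by (simp add: lmap_def)
 have lG: "lmap 0 B W G" using G Ga Gs Gd by (simp add: lmap_def)
 have Gdiff: "G (\<partial>\<^bsub>B\<^esub> y) = \<partial>\<^bsub>W\<^esub> (G y)" if "y : carrier B" for y
  using D(2)[OF G[OF that]] that by (intro eqI) (simp_all add: G FG DB)
 show "dg_module A W"
 proof (rule dgI[OF gW])
  have "lmap (-1) W W (%x. G (\<partial>\<^bsub>B\<^esub> (F x)))"
   using lmap_comp[OF lmap_comp[OF lF dg_lmap[OF D(1)]] lG] by simp
  then show "lmap (-1) W W \<partial>\<^bsub>W\<^esub>" by (rule lmap_cong[OF _ gW refl]) (simp add: Gdiff F GF)
  show "\<partial>\<^bsub>W\<^esub> (\<partial>\<^bsub>W\<^esub> x) = \<zero>\<^bsub>W\<^esub>" if "x : carrier W" for x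
   by (rule eqI) (use that D(2) F in \<open>simp_all add: F0 DB\<close>)
 qed
 show "dg_iso B W G F"
  using lF lG Gdiff D(2) GF FG by (simp add: dg_iso_def cm_def)
qed

text \<open>One map sends the tensor of \<open>x\<close> and \<open>y\<close> to the family
  \<open>\<phi> i x y\<close>, the other sends a family \<open>y\<close> to the sum of the tensors
  of \<open>q i\<close> and \<open>y i\<close>. One composite is the identity by the dual basis
  expansion of \<open>x\<close>, the other because elements of the box are fixed by the matrix
  \<open>\<phi> i (q j)\<close>.\<close>

lemma tensor_box:
 fixes Q :: "('a, 'q) dg_module" and Y :: "('a, 'm) dg_module"
 assumes Q: "dg_module A Q" and Y: "dg_module A Y" and db: "dual_basis Q n q d \<phi>"
 shows "dg_module A (tensor A Q Y)"
  "EX G F. dg_iso (box {..<n} d (%i j. \<phi> i (q j)) (%i j. \<phi> i (\<partial>\<^bsub>Q\<^esub> (q j))) Y) (tensor A Q Y) G F"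
proof -
 let ?T = "tensor A Q Y" and ?B = "box {..<n} d (%i j. \<phi> i (q j)) (%i j. \<phi> i (\<partial>\<^bsub>Q\<^esub> (q j))) Y"
 let ?TS = "carrier Q \<times> carrier Y" and ?cl = "tensor_class A Q Y"
 note gQ [simp] = dg_gm[OF Q] and gY [simp] = dg_gm[OF Y] and DQ = dgD[OF Q] and DY = dgD[OF Y]
 note bd = tensor_box_data[OF Q db]
 have Bd: "dg_module A ?B" by (rule box_dg[OF bd Y])
 note gB [simp] = dg_gm[OF Bd] and DB = dgD[OF Bd]
 interpret B: graded_group ?B "mgrad ?B" by (rule gm_graded[OF gB])
 interpret T: abelian_group ?T by (rule T_abelian[OF Q Y])
 interpret Y: abelian_group Y by simp
 note all = box_all[OF _ gY, where J = "{..<n}" and d = d and e = "%i j. \<phi> i (q j)" and D = "%i j. \<phi> i (\<partial>\<^bsub>Q\<^esub> (q j))"]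
 note c = db_closed[OF gQ db] and phl = dbD(2)[OF db]
 note Tm = T_mem[OF Q Y] and Ta = T_add[OF Q Y]
 note par = lmapD[OF parity_props(1)[OF Q]]
 have fo: "?cl (frag_of (x, y)) : carrier ?T" if "x : carrier Q" "y : carrier Y" for x y
  using that by (intro Tm) (simp add: keys_frag_of)
 let ?D = "frag_extend (%(x, y). frag_of (\<partial>\<^bsub>Q\<^esub> x, y) + frag_of (parity Q x, \<partial>\<^bsub>Y\<^esub> y))"
 have Dk: "Poly_Mapping.keys (?D u) \<subseteq> ?TS" if "Poly_Mapping.keys u \<subseteq> ?TS" for u
 proof (rule keys_ext[OF Q Y _ that])
  fix p assume "p : ?TS"
  then show "Poly_Mapping.keys (case p of (x, y) => frag_of (\<partial>\<^bsub>Q\<^esub> x, y) + frag_of (parity Q x, \<partial>\<^bsub>Y\<^esub> y)) \<subseteq> ?TS"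
   using keys_add[of "frag_of (\<partial>\<^bsub>Q\<^esub> (fst p), snd p)" "frag_of (parity Q (fst p), \<partial>\<^bsub>Y\<^esub> (snd p))"]
   by (auto simp: keys_frag_of DQ DY par split: prod.splits)
 qed
 have DN: "?cl (?D h) = ?cl 0" if "h : tensor_null A Q Y" for h
  unfolding T_zero[OF Q Y, symmetric]
 proof (rule TN_induct[OF Q Y T.abelian_group_axioms _ _ _ _ _ that])
  show "?cl (?D u) : carrier ?T" if "Poly_Mapping.keys u \<subseteq> ?TS" for u using Tm[OF Dk[OF that]] .
  show "?cl (?D (u + v)) = ?cl (?D u) \<oplus>\<^bsub>?T\<^esub> ?cl (?D v)" for u v by (simp add: frag_extend_add Ta)
  show "?cl (?D (frag_of (x \<oplus>\<^bsub>Q\<^esub> x', y))) = ?cl (?D (frag_of (x, y))) \<oplus>\<^bsub>?T\<^esub> ?cl (?D (frag_of (x', y)))"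
   if "x : carrier Q" "x' : carrier Q" "y : carrier Y" for x x' y
   using that cl_l[OF Q Y, of "\<partial>\<^bsub>Q\<^esub> x" "\<partial>\<^bsub>Q\<^esub> x'" y] cl_l[OF Q Y, of "parity Q x" "parity Q x'" "\<partial>\<^bsub>Y\<^esub> y"]
   by (simp add: DQ DY par fo T.group_rearrange flip: Ta)
  show "?cl (?D (frag_of (x, y \<oplus>\<^bsub>Y\<^esub> y'))) = ?cl (?D (frag_of (x, y))) \<oplus>\<^bsub>?T\<^esub> ?cl (?D (frag_of (x, y')))"
   if "x : carrier Q" "y : carrier Y" "y' : carrier Y" for x y y'
   using that cl_r[OF Q Y, of "\<partial>\<^bsub>Q\<^esub> x" y y'] cl_r[OF Q Y, of "parity Q x" "\<partial>\<^bsub>Y\<^esub> y" "\<partial>\<^bsub>Y\<^esub> y'"]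
   by (simp add: DQ DY par fo T.group_rearrange flip: Ta)
  show "?cl (?D (frag_of (a \<odot>\<^bsub>Q\<^esub> x, y))) = ?cl (?D (frag_of (x, a \<odot>\<^bsub>Y\<^esub> y)))"
   if "a : carrier A" "x : carrier Q" "y : carrier Y" for a x y
   using that cl_b[OF Q Y, of a "\<partial>\<^bsub>Q\<^esub> x" y] cl_b[OF Q Y, of a "parity Q x" "\<partial>\<^bsub>Y\<^esub> y"]
   by (simp add: DQ DY par fo flip: Ta)
 qed
 have Td: "\<partial>\<^bsub>?T\<^esub> (?cl u) = ?cl (?D u)" for u
  using UN_cl[OF Q Y Dk frag_extend_add DN] by (simp add: tensor_def)
 have cg: "comm_group (add_monoid ?B)" by (rule B.a_comm_group)
 let ?g = "%p i. if i < n then \<phi> i (fst p) \<odot>\<^bsub>Y\<^esub> snd p else \<zero>\<^bsub>Y\<^esub>"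
 have gB': "?g (x, y) : carrier ?B" if x: "x : carrier Q" and y: "y : carrier Y" for x y
 proof -
  have "finsum Y (%j. \<phi> i (q j) \<odot>\<^bsub>Y\<^esub> ?g (x, y) j) {..<n} = \<phi> i x \<odot>\<^bsub>Y\<^esub> y" if i: "i < n" for i
  proof -
   have "finsum Y (%j. \<phi> i (q j) \<odot>\<^bsub>Y\<^esub> ?g (x, y) j) {..<n} = finsum Y (%j. (\<phi> i (q j) \<otimes> \<phi> j x) \<odot>\<^bsub>Y\<^esub> y) {..<n}"
    using c i x y by (intro finsum_congr) (auto simp: smult_smult)
   also have "\<dots> = \<phi> i x \<odot>\<^bsub>Y\<^esub> y"
    using phi_row[OF gQ db phl[OF i] x] c i x y by (subst finsum_smult_left[symmetric]) auto
   finally show ?thesis .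
  qed
  then show ?thesis using c x y by (simp add: box_carrier)
 qed
 have gsub: "?g ` ?TS \<subseteq> carrier (add_monoid ?B)" using gB' by auto
 obtain \<Phi> where Ph: "\<Phi> : hom (free_Abelian_group ?TS) (add_monoid ?B)" and Phof: "!!p. p : ?TS ==> \<Phi> (frag_of p) = ?g p"
  using comm_group.free_Abelian_group_universal[OF cg gsub] by blast
 have Phc: "\<Phi> u : carrier ?B" if "Poly_Mapping.keys u \<subseteq> ?TS" for u
  using Ph that by (auto simp: hom_def)
 have Pha: "\<Phi> (u + v) = \<Phi> u \<oplus>\<^bsub>?B\<^esub> \<Phi> v" if "Poly_Mapping.keys u \<subseteq> ?TS" "Poly_Mapping.keys v \<subseteq> ?TS" for u v
  using Ph that by (auto simp: hom_def)
 have Phof': "\<Phi> (frag_of (x, y)) = ?g (x, y)" if "x : carrier Q" "y : carrier Y" for x y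
  using Phof[of "(x, y)"] that by simp
 have PhN: "\<Phi> h = \<zero>\<^bsub>?B\<^esub>" if "h : tensor_null A Q Y" for h
  by (rule TN_induct[OF Q Y B.abelian_group_axioms Phc Pha _ _ _ that])
   (use c lmap_plus[OF phl] lmap_smult[OF phl] in
    \<open>auto simp: Phof' box_ops(2) fun_eq_iff smult_arith m_comm group_closed\<close>)
 \<comment> \<open>The map on cosets uses a chosen representative; \<open>Fcl\<close> shows that any
   other gives the same value.\<close>
 define F where "F C = \<Phi> (SOME u. Poly_Mapping.keys u \<subseteq> ?TS & ?cl u = C)" for C
 have Fcl: "F (?cl u) = \<Phi> u" if u: "Poly_Mapping.keys u \<subseteq> ?TS" for u
 proof -
  define v where "v = (SOME v. Poly_Mapping.keys v \<subseteq> ?TS & ?cl v = ?cl u)"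
  have v: "Poly_Mapping.keys v \<subseteq> ?TS" "?cl v = ?cl u"
   unfolding v_def using someI[of "%v. Poly_Mapping.keys v \<subseteq> ?TS & ?cl v = ?cl u" u] u by auto
  have vu: "v - u : tensor_null A Q Y" using v(2) cl_eq[OF Q Y] by blast
  have "\<Phi> v = \<Phi> (v - u) \<oplus>\<^bsub>?B\<^esub> \<Phi> u" using Pha[OF TN_keys[OF Q Y vu] u] by simp
  then show ?thesis using PhN[OF vu] Phc[OF u] by (simp add: F_def flip: v_def)
 qed
 define G where "G y = ?cl (\<Sum>i<n. frag_of (q i, y i))" for y
 have ks: "Poly_Mapping.keys (\<Sum>i<m. frag_of (q i, y i)) \<subseteq> ?TS" if "m \<le> n" "!!i. y i \<in> carrier Y" for m y
  using that(1)
 proof (induction m)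
  case (Suc m)
  then have "(q m, y m) : ?TS" using c(1)[of m] that(2) by simp
  then show ?case using Suc keys_add[of "\<Sum>i<m. frag_of (q i, y i)" "frag_of (q m, y m)"]
   by (simp add: keys_frag_of) blast
 qed simp
 have kf: "Poly_Mapping.keys (frag_of (x, y)) \<subseteq> ?TS" if "x : carrier Q" "y : carrier Y" for x y
  using that by (simp add: keys_frag_of)
 have FG: "F (G y) = y" if y: "y : carrier ?B" for y
 proof -
  have yc: "y i : carrier Y" for i using all[OF y] .
  have "\<Phi> (\<Sum>i<m. frag_of (q i, y i)) l = finsum Y (%i. \<phi> l (q i) \<odot>\<^bsub>Y\<^esub> y i) {..<m}" if "m \<le> n" "l < n" for m l
   using that(1)
  proof (induction m)
   case 0
   have "\<Phi> 0 = \<zero>\<^bsub>?B\<^esub>" by (rule PhN[OF TN_zero[OF Q Y]])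
   then show ?case by (simp add: box_ops(1))
  next
   case (Suc m)
   have m: "m < n" using Suc by simp
   have "\<Phi> (\<Sum>i<Suc m. frag_of (q i, y i)) = \<Phi> (\<Sum>i<m. frag_of (q i, y i)) \<oplus>\<^bsub>?B\<^esub> \<Phi> (frag_of (q m, y m))"
    using Pha[OF ks[of m y] kf[OF c(1)[OF m] yc]] m yc by simp
   then show ?case using Suc that c m yc by (subst finsum_Suc') (auto simp: box_ops(2) Phof')
  qed
  note e = this[OF le_refl]
  have "\<Phi> (\<Sum>i<n. frag_of (q i, y i)) = y"
  proof
   fix l
   show "\<Phi> (\<Sum>i<n. frag_of (q i, y i)) l = y l"
   proof (cases "l < n")
    case True
    then show ?thesis using e y by (simp add: box_carrier)
   next
    case False
    then show ?thesis using Phc[OF ks[OF le_refl yc]] y by (simp add: box_carrier)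
   qed
  qed
  then show ?thesis unfolding G_def Fcl[OF ks[OF le_refl yc]] .
 qed
 have Ga: "G (%i. y i \<oplus>\<^bsub>Y\<^esub> z i) = G y \<oplus>\<^bsub>?T\<^esub> G z" if yz: "!!i. y i : carrier Y" "!!i. z i : carrier Y" for y z
 proof -
  have "?cl (\<Sum>i<m. frag_of (q i, y i \<oplus>\<^bsub>Y\<^esub> z i)) = ?cl (\<Sum>i<m. frag_of (q i, y i)) \<oplus>\<^bsub>?T\<^esub> ?cl (\<Sum>i<m. frag_of (q i, z i))"
   if "m \<le> n" for m using that
  proof (induction m)
   case 0
   show ?case by (simp add: Ta)
  next
   case (Suc m)
   have m: "m < n" "m \<le> n" using Suc by auto
   show ?case
    using Suc.IH[OF m(2)] cl_r[OF Q Y c(1)[OF m(1)] yz(1)[of m] yz(2)[of m]]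
     Tm[OF ks[OF m(2) yz(1)]] Tm[OF ks[OF m(2) yz(2)]] fo[OF c(1)[OF m(1)]] yz
    by (simp add: T.group_rearrange flip: Ta)
  qed
  then show ?thesis by (simp add: G_def)
 qed
 have z0: "?cl (frag_of (\<zero>\<^bsub>Q\<^esub>, y)) = ?cl 0" if y: "y : carrier Y" for y
 proof -
  let ?z = "?cl (frag_of (\<zero>\<^bsub>Q\<^esub>, y))"
  have z: "?z : carrier ?T" by (rule fo) (simp_all add: y group_closed)
  have "?z = ?z \<oplus>\<^bsub>?T\<^esub> ?z"
   using cl_l[OF Q Y, of "\<zero>\<^bsub>Q\<^esub>" "\<zero>\<^bsub>Q\<^esub>" y] y by (simp add: group_closed flip: Ta)
  then show ?thesis using z T.add.r_cancel_one'[of ?z ?z] by (simp add: T_zero[OF Q Y])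
 qed
 have Gg: "G (?g (x, y)) = ?cl (frag_of (x, y))" if x: "x : carrier Q" and y: "y : carrier Y" for x y
 proof -
  have "?cl (\<Sum>i<m. frag_of (q i, ?g (x, y) i)) = ?cl (frag_of (finsum Q (%i. \<phi> i x \<odot>\<^bsub>Q\<^esub> q i) {..<m}, y))"
   if "m \<le> n" for m using that
  proof (induction m)
   case 0
   interpret Q: abelian_group Q by simp
   show ?case using z0[OF y] by simp
  next
   case (Suc m)
   have m: "m < n" using Suc by simp
   have fc: "finsum Q (%i. \<phi> i x \<odot>\<^bsub>Q\<^esub> q i) {..<m} : carrier Q"
    using c x m by (intro finsum_lmap_closed) auto
   have "finsum Q (%i. \<phi> i x \<odot>\<^bsub>Q\<^esub> q i) {..<Suc m} = finsum Q (%i. \<phi> i x \<odot>\<^bsub>Q\<^esub> q i) {..<m} \<oplus>\<^bsub>Q\<^esub> \<phi> m x \<odot>\<^bsub>Q\<^esub> q m"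
    using c x m by (intro finsum_Suc') auto
   then show ?case
    using Suc.IH m cl_l[OF Q Y fc _ y, of "\<phi> m x \<odot>\<^bsub>Q\<^esub> q m"] cl_b[OF Q Y c(2)[OF m x] c(1)[OF m] y] c x
    by (simp flip: Ta)
  qed
  from this[OF le_refl] show ?thesis unfolding G_def using dbD(3)[OF db x] by simp
 qed
 have GPh: "G (\<Phi> u) = ?cl u" if u: "Poly_Mapping.keys u \<subseteq> ?TS" for u
 proof (rule frag_additive_eq[OF T.abelian_group_axioms _ _ _ _ _ u])
  show "G (\<Phi> u) : carrier ?T" if "Poly_Mapping.keys u \<subseteq> ?TS" for u
   unfolding G_def by (rule Tm[OF ks[OF le_refl all[OF Phc[OF that]]]])
  show "G (\<Phi> (u + v)) = G (\<Phi> u) \<oplus>\<^bsub>?T\<^esub> G (\<Phi> v)" if "Poly_Mapping.keys u \<subseteq> ?TS" "Poly_Mapping.keys v \<subseteq> ?TS" for u v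
   using Ga[OF all[OF Phc[OF that(1)]] all[OF Phc[OF that(2)]]] Pha[OF that] by (simp add: box_ops(2))
  show "G (\<Phi> (frag_of p)) = ?cl (frag_of p)" if p: "p : ?TS" for p
  proof -
   obtain x y where p': "p = (x, y)" "x : carrier Q" "y : carrier Y" using p by auto
   show ?thesis unfolding p'(1) Phof'[OF p'(2,3)] by (rule Gg[OF p'(2,3)])
  qed
 qed (simp_all add: Tm Ta)
 let ?W = "%k. \<Union>i. mgrad Q i \<times> mgrad Y (k - i)"
 have Wk: "?W k \<subseteq> ?TS" for k using gm_carrier[OF gQ] gm_carrier[OF gY] by blast
 have Tg: "mgrad ?T k = {?cl u | u. Poly_Mapping.keys u \<subseteq> ?W k}" for k by (simp add: tensor_def)
 have Phd: "\<Phi> u : mgrad ?B k" if u: "Poly_Mapping.keys u \<subseteq> ?W k" for u k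
 proof -
  have "Poly_Mapping.keys u \<subseteq> ?TS & \<Phi> u : mgrad ?B k" using u
  proof (induction u rule: frag_induction)
   case zero
   show ?case using PhN[OF TN_zero[OF Q Y]] by simp
  next
   case (one p)
   then obtain i where i: "fst p : mgrad Q i" "snd p : mgrad Y (k - i)" by auto
   have pc: "fst p : carrier Q" "snd p : carrier Y" using gm_carrier[OF gQ i(1)] gm_carrier[OF gY i(2)] .
   have "\<phi> l (fst p) \<odot>\<^bsub>Y\<^esub> snd p : mgrad Y (k - d l)" if "l < n" for l
    using gm_smult_deg[OF gY c(3)[OF that i(1)] i(2)] by simp
   then show ?case using pc gB'[OF pc, unfolded fst_conv snd_conv] Phof[of p]
    by (simp add: box_mgrad keys_frag_of mem_Times_iff)
  next
   case (diff a b)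
   have k: "Poly_Mapping.keys (a - b) \<subseteq> ?TS" using diff keys_diff[of a b] by blast
   have "\<Phi> (a - b) \<oplus>\<^bsub>?B\<^esub> \<Phi> b = \<Phi> a" using Pha[OF k, of b] diff by simp
   then have "\<Phi> (a - b) = \<Phi> a \<ominus>\<^bsub>?B\<^esub> \<Phi> b"
    using Phc[OF k] Phc[of a] Phc[of b] diff by (simp add: B.gr_eq_diff)
   then show ?case using k diff by simp
  qed
  then show ?thesis by simp
 qed
 have TE: "EX u. x = ?cl u & Poly_Mapping.keys u \<subseteq> ?TS" if "x : carrier ?T" for x
  using that unfolding T_carrier[OF Q Y] by blast
 note sm = T_smult[OF Q Y]
 have Fs: "\<Phi> (frag_extend (%(x, y). frag_of (a \<odot>\<^bsub>Q\<^esub> x, y)) u) = a \<odot>\<^bsub>?B\<^esub> \<Phi> u"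
  if a: "a : carrier A" and u: "Poly_Mapping.keys u \<subseteq> ?TS" for a u
 proof (rule frag_additive_eq[OF B.abelian_group_axioms _ _ _ _ _ u])
  show "\<Phi> (frag_extend (%(x, y). frag_of (a \<odot>\<^bsub>Q\<^esub> x, y)) (frag_of p)) = a \<odot>\<^bsub>?B\<^esub> \<Phi> (frag_of p)" if "p : ?TS" for p
   using that a c lmap_smult[OF phl] by (auto simp: Phof' box_ops(3) fun_eq_iff smult_smult)
 qed (simp_all add: a Phc Pha sm(2) frag_extend_add smult_add_r)
 have Fd: "\<Phi> (?D u) = \<partial>\<^bsub>?B\<^esub> (\<Phi> u)" if u: "Poly_Mapping.keys u \<subseteq> ?TS" for u
 proof (rule frag_additive_eq[OF B.abelian_group_axioms _ _ _ _ _ u])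
  show "\<Phi> (?D (frag_of p)) = \<partial>\<^bsub>?B\<^esub> (\<Phi> (frag_of p))" if p: "p : ?TS" for p
  proof -
   obtain x y where p': "p = (x, y)" and x: "x : carrier Q" and y: "y : carrier Y" using p by auto
   \<comment> \<open>For \<open>x\<close> of degree \<open>k\<close>, \<open>parity\<close> uses the
     sign of \<open>k\<close>, whereas the box uses that of \<open>d i\<close>. They agree on
     \<open>\<phi> i x\<close>, whose degree is \<open>k - d i\<close>: it is zero unless
     \<open>k\<close> and \<open>d i\<close> have the same parity.\<close>
   have pph: "\<phi> i (parity Q x) = koszul (d i) A (\<phi> i x)" if i: "i < n" for i
   proof -
    interpret Q: graded_group Q "mgrad Q" by (rule gm_graded[OF gQ])
    have kk: "koszul k A (a \<oplus> b) = koszul k A a \<oplus> koszul k A b" if "a : carrier A" "b : carrier A" for k a b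
     using that by (simp add: koszul_def GA.minus_add)
    show ?thesis using x
    proof (induction x rule: Q.hom_induct)
     case zero
     then show ?case using lmap_zero[OF gQ gQ parity_props(1)[OF Q]] lmap_zero[OF gQ unit_gm phl[OF i]]
      by (simp add: koszul_def GA.minus_zero)
    next
     case (add x y)
     then show ?case using c(2)[OF i] par kk lmap_plus[OF phl[OF i]] by simp
    next
     case (hom x k)
     have xc: "x : carrier Q" using hom by simp
     have 1: "\<phi> i (parity Q x) = koszul k A (\<phi> i x)"
      using parity_props(2)[OF Q hom] lmap_minus[OF gQ unit_gm phl[OF i] xc] by (simp add: koszul_def)
     have px: "\<phi> i x : rgrad A (k - d i)" by (rule c(3)[OF i hom])
     show ?case
     proof (cases "even (k - d i)")
      case True
      then have "even k \<longleftrightarrow> even (d i)" by simp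
      then show ?thesis using 1 by (simp add: koszul_def)
     next
      case False
      then have "\<phi> i x = \<zero>" using A_odd[OF px] by simp
      then show ?thesis using 1 by (simp add: koszul_def GA.minus_zero)
     qed
    qed
   qed
   have "\<Phi> (?D (frag_of p)) i = \<partial>\<^bsub>?B\<^esub> (\<Phi> (frag_of p)) i" for i
   proof (cases "i < n")
    case i: True
    have "finsum Y (%j. \<phi> i (\<partial>\<^bsub>Q\<^esub> (q j)) \<odot>\<^bsub>Y\<^esub> ?g (x, y) j) {..<n} =
     finsum Y (%j. (\<phi> i (\<partial>\<^bsub>Q\<^esub> (q j)) \<otimes> \<phi> j x) \<odot>\<^bsub>Y\<^esub> y) {..<n}"
     using c DQ i x y by (intro finsum_congr) (auto simp: smult_smult)
    also have "\<dots> = \<phi> i (\<partial>\<^bsub>Q\<^esub> x) \<odot>\<^bsub>Y\<^esub> y"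
     using phi_row[OF gQ db lmap_comp[OF dg_lmap[OF Q] phl[OF i]] x] c DQ i x y
     by (subst finsum_smult_left[symmetric]) auto
    finally have 1: "finsum Y (%j. \<phi> i (\<partial>\<^bsub>Q\<^esub> (q j)) \<odot>\<^bsub>Y\<^esub> ?g (x, y) j) {..<n} = \<phi> i (\<partial>\<^bsub>Q\<^esub> x) \<odot>\<^bsub>Y\<^esub> y" .
    have 2: "koszul (d i) Y (\<partial>\<^bsub>Y\<^esub> (?g (x, y) i)) = \<phi> i (parity Q x) \<odot>\<^bsub>Y\<^esub> \<partial>\<^bsub>Y\<^esub> y"
     using i c(2)[OF i x] y by (simp add: pph DY koszul_def smult_minus_l)
    have "\<Phi> (?D (frag_of p)) = ?g (\<partial>\<^bsub>Q\<^esub> x, y) \<oplus>\<^bsub>?B\<^esub> ?g (parity Q x, \<partial>\<^bsub>Y\<^esub> y)"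
     using Pha[OF kf kf] x y by (simp add: p' Phof' DQ DY par)
    then show ?thesis using i Phof'[OF x y] 1 2 by (simp add: p' box_ops)
   next
    case False
    then show ?thesis using Pha[OF kf kf] x y by (simp add: p' Phof' DQ DY par box_ops)
   qed
   then show ?thesis by blast
  qed
 qed (simp_all add: Phc Pha Dk frag_extend_add DB)
 have main: "dg_module A ?T & dg_iso ?B ?T G F"
 proof (rule gm_transfer[OF gB, of ?T F G])
  fix x assume "x : carrier ?T"
  then obtain u where u: "x = ?cl u" "Poly_Mapping.keys u \<subseteq> ?TS" using TE by blast
  show "F x : carrier ?B" "G (F x) = x" using u by (simp_all add: Fcl Phc GPh)
  show "\<partial>\<^bsub>?T\<^esub> x : carrier ?T & F (\<partial>\<^bsub>?T\<^esub> x) = \<partial>\<^bsub>?B\<^esub> (F x)"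
   using u by (simp add: Td Tm Dk Fcl Fd)
  fix a assume a: "a : carrier A"
  show "a \<odot>\<^bsub>?T\<^esub> x : carrier ?T" "F (a \<odot>\<^bsub>?T\<^esub> x) = a \<odot>\<^bsub>?B\<^esub> F x"
   using u a by (simp_all add: sm Tm Fcl Fs)
 next
  fix x y assume "x : carrier ?T" "y : carrier ?T"
  then obtain u v where u: "x = ?cl u" "Poly_Mapping.keys u \<subseteq> ?TS" and v: "y = ?cl v" "Poly_Mapping.keys v \<subseteq> ?TS"
   using TE by metis
  have "Poly_Mapping.keys (u + v) \<subseteq> ?TS" using keys_add[of u v] u v by blast
  then show "F (x \<oplus>\<^bsub>?T\<^esub> y) = F x \<oplus>\<^bsub>?B\<^esub> F y"
   using u v by (simp add: Ta Fcl Pha)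
 next
  fix x i assume "x : mgrad ?T i"
  then obtain u where u: "x = ?cl u" "Poly_Mapping.keys u \<subseteq> ?W i" unfolding Tg by blast
  have "Poly_Mapping.keys u \<subseteq> ?TS" using u(2) Wk by blast
  then show "x : carrier ?T & F x : mgrad ?B i" using u Phd by (simp add: Tm Fcl)
 next
  fix y i assume y: "y : mgrad ?B i"
  have "Poly_Mapping.keys (\<Sum>j<m. frag_of (q j, y j)) \<subseteq> ?W i" if "m \<le> n" for m
   using that
  proof (induction m)
   case (Suc m)
   then have "(q m, y m) : ?W i" using dbD(1)[OF db, of m] y by (auto simp: box_mgrad)
   then show ?case using Suc keys_add[of "\<Sum>j<m. frag_of (q j, y j)" "frag_of (q m, y m)"]
    by (simp add: keys_frag_of) blast
  qed simp
  from this[OF le_refl] show "G y : mgrad ?T i" unfolding Tg G_def by blast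
 next
  show "G y : carrier ?T" if "y : carrier ?B" for y
   unfolding G_def by (rule Tm[OF ks[OF le_refl all[OF that]]])
 qed (simp_all add: FG T.abelian_group_axioms Bd)
 then show "dg_module A ?T" "EX G F. dg_iso ?B ?T G F" by blast+
qed

end

section \<open>Homotopy equivalences and the objects of perf(A,0)\<close>

context even_graded_ring
begin

definition ho_eq :: "('a, 'm) dg_module => ('a, 'n) dg_module => ('m => 'n) => ('m => 'n) => bool" where
 "ho_eq M N f g \<longleftrightarrow> (EX h. lmap 1 M N h &
  (ALL x:carrier M. f x \<ominus>\<^bsub>N\<^esub> g x = \<partial>\<^bsub>N\<^esub> (h x) \<oplus>\<^bsub>N\<^esub> h (\<partial>\<^bsub>M\<^esub> x)))"

lemma ho_iso_iff:
 assumes "gm M" "gm N"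
 shows "ho_iso A M N \<longleftrightarrow> (EX f g. cm M N f & cm N M g &
  ho_eq M M (%x. g (f x)) (%x. x) & ho_eq N N (%x. f (g x)) (%x. x))"
 using assms by (simp add: ho_iso_def chain_map_iff homotopic_def ho_eq_def graded_linear_iff)

lemma ho_eq_refl:
 assumes "gm M" "dg_module A N" "!!x. x : carrier M ==> f x = g x" "!!x. x : carrier M ==> g x : carrier N"
 shows "ho_eq M N f g"
 unfolding ho_eq_def
 using assms lmap_0[of N 1 M] dgD(7)[OF assms(2)]
 by (intro exI[of _ "%_. \<zero>\<^bsub>N\<^esub>"]) (simp add: abelian_group.gr_diff_self group_closed)

lemma dg_iso_ho:
 assumes M: "dg_module A M" and N: "dg_module A N" and i: "dg_iso M N f g"
 shows "ho_iso A M N"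
 using i M N unfolding ho_iso_iff[OF dg_gm[OF M] dg_gm[OF N]] dg_iso_def
 by (intro exI[of _ f] exI[of _ g] conjI ho_eq_refl) auto

lemma dg_iso_sym: "dg_iso M N f g ==> dg_iso N M g f"
 by (auto simp: dg_iso_def)

lemma dg_iso_trans:
 assumes "dg_iso M N f g" "dg_iso N P f' g'"
 shows "dg_iso M P (%x. f' (f x)) (%x. g (g' x))"
proof -
 have f: "cm M N f" "cm N M g" "ALL x:carrier M. g (f x) = x" "ALL y:carrier N. f (g y) = y"
  and f': "cm N P f'" "cm P N g'" "ALL x:carrier N. g' (f' x) = x" "ALL y:carrier P. f' (g' y) = y"
  using assms by (auto simp: dg_iso_def)
 show ?thesis unfolding dg_iso_def
  using cm_comp[OF f(1) f'(1)] cm_comp[OF f'(2) f(2)] f(3,4) f'(3,4)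
   lmap_closed[OF cmD(1)[OF f(1)]] lmap_closed[OF cmD(1)[OF f'(2)]] by simp
qed

lemma ho_iso_sym: "ho_iso A M N ==> ho_iso A N M"
 unfolding ho_iso_def by blast

lemma ho_iso_dg_trans:
 assumes M: "dg_module A M" and N: "dg_module A N" and P: "dg_module A P"
  and MN: "ho_iso A M N" and i: "dg_iso N P F G"
 shows "ho_iso A M P"
proof -
 note gM = dg_gm[OF M] and gN = dg_gm[OF N] and gP = dg_gm[OF P]
 obtain f g where fg: "cm M N f" "cm N M g" and h: "ho_eq M M (%x. g (f x)) (%x. x)" and k: "ho_eq N N (%x. f (g x)) (%x. x)"
  using MN unfolding ho_iso_iff[OF gM gN] by blast
 have F: "cm N P F" and G: "cm P N G" and GF: "!!x. x : carrier N ==> G (F x) = x" and FG: "!!y. y : carrier P ==> F (G y) = y"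
  using i by (auto simp: dg_iso_def)
 note fD = lmapD[OF cmD(1)[OF fg(1)]] and gD = lmapD[OF cmD(1)[OF fg(2)]]
 note FD = lmapD[OF cmD(1)[OF F]] lmapD0[OF gN gP cmD(1)[OF F]] and GD = lmapD[OF cmD(1)[OF G]]
 have 1: "ho_eq M M (%x. g (G (F (f x)))) (%x. x)" using h fD by (simp add: ho_eq_def GF)
 obtain K where K: "lmap 1 N N K" "!!x. x : carrier N ==> f (g x) \<ominus>\<^bsub>N\<^esub> x = \<partial>\<^bsub>N\<^esub> (K x) \<oplus>\<^bsub>N\<^esub> K (\<partial>\<^bsub>N\<^esub> x)"
  using k by (auto simp: ho_eq_def)
 note KD = lmapD[OF K(1)]
 have "ho_eq P P (%x. F (f (g (G x)))) (%x. x)"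
  unfolding ho_eq_def
 proof (intro exI[of _ "%x. F (K (G x))"] conjI ballI)
  show "lmap 1 P P (%x. F (K (G x)))"
   using lmap_comp[OF lmap_comp[OF cmD(1)[OF G] K(1)] cmD(1)[OF F]] by simp
  fix x assume x: "x : carrier P"
  have "F (f (g (G x))) \<ominus>\<^bsub>P\<^esub> x = F (f (g (G x)) \<ominus>\<^bsub>N\<^esub> G x)"
   using x by (simp add: FD GD fD gD FG)
  also have "\<dots> = \<partial>\<^bsub>P\<^esub> (F (K (G x))) \<oplus>\<^bsub>P\<^esub> F (K (G (\<partial>\<^bsub>P\<^esub> x)))"
   using x by (simp add: K(2) GD FD KD dgD[OF N] dgD[OF P] cmD(2)[OF F] cmD(2)[OF G])
  finally show "F (f (g (G x))) \<ominus>\<^bsub>P\<^esub> x = \<partial>\<^bsub>P\<^esub> (F (K (G x))) \<oplus>\<^bsub>P\<^esub> F (K (G (\<partial>\<^bsub>P\<^esub> x)))" .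
 qed
 with 1 show ?thesis unfolding ho_iso_iff[OF gM gP]
  using cm_comp[OF fg(1) F] cm_comp[OF G fg(2)] by (intro exI conjI) simp_all
qed

lemma U_fg: "fg U"
proof -
 interpret U: abelian_group U by simp
 have "dual_basis U 1 (%_. \<one>) (%_. 0) (%_ x. x)"
  using lmap_id[of U] by (simp add: dual_basis_def lessThan_Suc U.finsum_insert)
 then show ?thesis unfolding fg_def by blast
qed

lemma U_dg: "dg_module A U"
 by (rule dgI) (auto simp: lmap_def)

text \<open>The dual basis lemma, subject to the carrier types in \<open>graded_projective\<close>.
  The free module mapping onto \<open>P\<close> is the box over the unit with the identity matrix
  and zero differential. It is indexed by elements of \<open>P\<close> itself, so its carrier has
  the type \<open>'m => 'a\<close> for which lifting is assumed. Lifting the identity of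
  \<open>P\<close> factors it through this free module, so it has finite rank.\<close>

lemma perf_iff: "P : perf A \<longleftrightarrow> dg_module A P & fg P" for P :: "('a, 'm) dg_module"
proof
 assume "P : perf A"
 then have dg: "dg_module A P" and f: "finitely_generated A P" and pr: "graded_projective A P" by (auto simp: perf_def)
 note g = dg_gm[OF dg]
 interpret P: graded_group P "mgrad P" by (rule gm_graded[OF g])
 obtain X where X: "X \<subseteq> carrier P" "finite X" "!!N. submodule N A P ==> X \<subseteq> N ==> N = carrier P"
  using f unfolding finitely_generated_def by blast
 \<comment> \<open>The given generators may be inhomogeneous; their nonzero components are finitely
   many and generate as well.\<close>
 define J where "J = (\<Union>x\<in>X. P.cmp x ` {i. P.cmp x i ~= \<zero>\<^bsub>P\<^esub>})"
 have "finite J" unfolding J_def using X P.cmp_finite by blast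
 have "ALL y:J. EX i. y : mgrad P i" unfolding J_def using X(1) P.cmp_in by blast
 then obtain d where d: "!!y. y : J ==> y : mgrad P (d y)" by metis
 define E where "E i j = (if i = j then \<one> else \<zero>)" for i j :: 'm
 have Es: "finsum A (%l. E i l \<otimes> f l) J = f i" if "i : J" "!!l. l : J ==> f l : carrier A" for i f
  using finsum_delta[OF unit_gm \<open>finite J\<close> that(1), of f] that(2) by (simp add: unit_finsum E_def)
 have bd: "box_data J d E (%_ _. \<zero>)"
  unfolding box_data_def using \<open>finite J\<close> Es[of _ "%_. \<zero>"] Es[of _ "%l. E l _"]
  by (auto simp: E_def)
 let ?F = "box J d E (%_ _. \<zero>) U"
 note gF = box_gm[OF bd unit_gm] and Fd = box_dg[OF bd U_dg]
 define G where "G y = finsum P (%j. y j \<odot>\<^bsub>P\<^esub> j) J" for y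
 have G: "lmap 0 ?F P G"
  unfolding G_def[abs_def]
 proof (rule lmap_sum[OF gF g \<open>finite J\<close>])
  fix j assume j: "j : J"
  show "lmap 0 ?F P (%y. y j \<odot>\<^bsub>P\<^esub> j)"
   using lmap_scale[OF gF g box_eval[OF bd j] d[OF j]] by simp
 qed
 have unitv: "(%i. E i j) : carrier ?F" if j: "j : J" for j
  using Es[of _ "%l. E l j"] j by (auto simp: box_carrier unit_finsum E_def)
 have GE: "G (%i. E i j) = j" if j: "j : J" for j
  using finsum_delta[OF g \<open>finite J\<close> j, of "%j. j"] gm_carrier[OF g d]
  by (simp add: G_def E_def eq_commute cong: if_cong)
 have sub: "submodule (G ` carrier ?F) A P"
 proof (intro submodule.intro P.add.subgroupI submodule_axioms.intro)
  show "G ` carrier ?F \<subseteq> carrier P" using lmap_closed[OF G] by blast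
  show "G ` carrier ?F ~= {}" using group_closed(4)[OF gm_group[OF gF]] by blast
  show "\<ominus>\<^bsub>P\<^esub> a : G ` carrier ?F" if a: "a : G ` carrier ?F" for a
  proof -
   obtain u where u: "a = G u" "u : carrier ?F" using a by blast
   show ?thesis unfolding u(1) lmap_minus[OF gF g G u(2), symmetric]
    by (rule imageI) (rule group_closed(2)[OF gm_group[OF gF] u(2)])
  qed
  show "a \<oplus>\<^bsub>P\<^esub> b : G ` carrier ?F" if ab: "a : G ` carrier ?F" "b : G ` carrier ?F" for a b
  proof -
   obtain u v where "a = G u" "b = G v" "u : carrier ?F" "v : carrier ?F" using ab by blast
   then have "a \<oplus>\<^bsub>P\<^esub> b = G (u \<oplus>\<^bsub>?F\<^esub> v)" "u \<oplus>\<^bsub>?F\<^esub> v : carrier ?F"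
    using lmap_plus[OF G] group_closed(1)[OF gm_group[OF gF]] by auto
   then show ?thesis using imageI[of "u \<oplus>\<^bsub>?F\<^esub> v" "carrier ?F" G] by simp
  qed
  show "a \<odot>\<^bsub>P\<^esub> b : G ` carrier ?F" if a: "a : carrier A" and b: "b : G ` carrier ?F" for a b
  proof -
   obtain u where u: "b = G u" "u : carrier ?F" using b by blast
   show ?thesis unfolding u(1) lmap_smult[OF G a u(2), symmetric]
    by (rule imageI) (rule gm_smult(1)[OF gF u(2) a])
  qed
 qed
 have surj: "G ` carrier ?F = carrier P"
 proof (rule X(3)[OF sub], rule subsetI)
  fix x assume x: "x : X"
  then have xc: "x : carrier P" using X by blast
  have "finsum P (P.cmp x) {i. P.cmp x i ~= \<zero>\<^bsub>P\<^esub>} : G ` carrier ?F"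
  proof (rule P.finsum_induct)
   show "finite {i. P.cmp x i ~= \<zero>\<^bsub>P\<^esub>}" by (rule P.cmp_finite[OF xc])
   show "P.cmp x : {i. P.cmp x i ~= \<zero>\<^bsub>P\<^esub>} \<rightarrow> carrier P" using xc by simp
   show "\<zero>\<^bsub>P\<^esub> : G ` carrier ?F"
    unfolding lmap_zero[OF gF g G, symmetric] by (rule imageI) (rule group_closed(4)[OF gm_group[OF gF]])
   show "u \<oplus>\<^bsub>P\<^esub> v : G ` carrier ?F" if "u : G ` carrier ?F" "v : G ` carrier ?F" for u v
    using subgroup.m_closed[OF submodule.axioms(1)[OF sub] that] by simp
   show "P.cmp x i : G ` carrier ?F" if "i : {i. P.cmp x i ~= \<zero>\<^bsub>P\<^esub>}" for i
   proof -
    have j: "P.cmp x i : J" unfolding J_def using that x by blast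
    show ?thesis using imageI[OF unitv[OF j], of G] unfolding GE[OF j] .
   qed
  qed
  then show "x : G ` carrier ?F" using P.cmp_sum[OF xc] by simp
 qed
 let ?X = "gr_module.truncate ?F" and ?Y = "gr_module.truncate P"
 have gX: "gm ?X" by (rule gm_cong[OF gF]) (simp_all add: gr_module.truncate_def)
 have gY: "gm ?Y" by (rule gm_cong[OF g]) (simp_all add: gr_module.truncate_def)
 have 1: "graded_linear A 0 ?X ?Y G" unfolding graded_linear_iff[OF gX gY]
  using G by (simp add: lmap_def gr_module.truncate_def)
 have 2: "graded_linear A 0 P ?Y (%x. x)" unfolding graded_linear_iff[OF g gY]
  by (simp add: lmap_def gr_module.truncate_def)
 have "G ` carrier ?X = carrier ?Y" using surj by (simp add: gr_module.truncate_def)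
 then obtain l where l: "graded_linear A 0 P ?X l" "!!x. x : carrier P ==> G (l x) = x"
  using pr gX gY 1 2 unfolding graded_projective_def by metis
 have "lmap 0 P ?F l" using l(1) unfolding graded_linear_iff[OF g gX]
  by (simp add: lmap_def gr_module.truncate_def)
 from frk_comp[OF g gF g box_fg[OF bd unit_gm U_fg] this G] have "frk 0 P P (%x. x)"
  by (rule frk_cong) (simp_all add: l(2))
 then show "dg_module A P & fg P" using dg fgI by blast
next
 assume "dg_module A P & fg P"
 then obtain n q d \<phi> where dg: "dg_module A P" and db: "dual_basis P n q d \<phi>" by (auto simp: fg_def)
 note g = dg_gm[OF dg]
 note c = db_closed[OF g db]
 have "finitely_generated A P"
  unfolding finitely_generated_def
 proof (intro exI[of _ "q ` {..<n}"] conjI allI impI)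
  show "q ` {..<n} \<subseteq> carrier P" using c by auto
  fix N assume N: "submodule N A P & q ` {..<n} \<subseteq> N"
  then have Ns: "submodule N A P" by blast
  have Nc: "N \<subseteq> carrier P" using submodule.axioms(1)[OF Ns] subgroup.subset by fastforce
  have "x : N" if x: "x : carrier P" for x
  proof -
   have "finsum P (%i. \<phi> i x \<odot>\<^bsub>P\<^esub> q i) {..<m} : N" if "m \<le> n" for m
    using that
   proof (induction m)
    case 0
    interpret P: abelian_group P using g by simp
    show ?case using subgroup.one_closed[OF submodule.axioms(1)[OF Ns]] by simp
   next
    case (Suc m)
    then have m: "m < n" by simp
    then have "\<phi> m x \<odot>\<^bsub>P\<^esub> q m : N" using N submodule.smult_closed[OF Ns c(2)[OF m x]] by blast
    then show ?case using Suc subgroup.m_closed[OF submodule.axioms(1)[OF Ns]] c x g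
     by (subst finsum_Suc'[OF g]) auto
   qed
   from this[OF le_refl] show ?thesis using dbD(3)[OF db x] by simp
  qed
  then show "N = carrier P" using Nc by blast
 qed simp
 moreover have "graded_projective A P"
  unfolding graded_projective_def
 proof (intro allI impI)
  fix X :: "('a, 'm => 'a) gr_module" and Y :: "('a, 'm) gr_module" and G f
  assume *: "gm X & gm Y & graded_linear A 0 X Y G & G ` carrier X = carrier Y & graded_linear A 0 P Y f"
  then have gX: "gm X" and gY: "gm Y" and G: "lmap 0 X Y G" and s: "G ` carrier X = carrier Y" and f: "lmap 0 P Y f"
   using g by (auto simp: graded_linear_iff)
  interpret X: graded_group X "mgrad X" by (rule gm_graded[OF gX])
  interpret Y: graded_group Y "mgrad Y" by (rule gm_graded[OF gY])
  \<comment> \<open>Some preimage of \<open>f (q i)\<close> exists by surjectivity; its component of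
    degree \<open>d i\<close> is a homogeneous preimage.\<close>
  have "EX y. y : mgrad X (d i) & G y = f (q i)" if i: "i < n" for i
  proof -
   have fq: "f (q i) : mgrad Y (d i)" using lmap_deg[OF f dbD(1)[OF db i]] by simp
   then obtain z where z: "z : carrier X" "G z = f (q i)" using s Y.G_carrier by (metis imageE)
   have "G (X.cmp z (d i)) = f (q i)"
    using lmap_cmp[OF gX gY G z(1), of "d i"] Y.cmp_hom[OF fq] z(2) by simp
   then show ?thesis using X.cmp_in[OF z(1)] by blast
  qed
  then obtain y where y: "!!i. i < n ==> y i : mgrad X (d i)" "!!i. i < n ==> G (y i) = f (q i)" by metis
  define l where "l x = finsum X (%i. \<phi> i x \<odot>\<^bsub>X\<^esub> y i) {..<n}" for x
  have "lmap 0 P X l" unfolding l_def[abs_def] by (rule db_lmap[OF g gX db]) (simp add: y)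
  moreover have "G (l x) = f x" if x: "x : carrier P" for x
  proof -
   have "G (l x) = finsum Y (%i. G (\<phi> i x \<odot>\<^bsub>X\<^esub> y i)) {..<n}"
    unfolding l_def using c x gX gm_carrier[OF gX y(1)] by (intro lmap_finsum[OF gX gY G]) auto
   also have "\<dots> = finsum Y (%i. \<phi> i x \<odot>\<^bsub>Y\<^esub> f (q i)) {..<n}"
    using c x gY gm_carrier[OF gX y(1)] lmapD[OF G] lmapD(1)[OF f] y(2) by (intro finsum_congr) auto
   also have "\<dots> = f x" by (rule db_expand[OF g gY db f x, symmetric])
   finally show ?thesis .
  qed
  ultimately show "EX l. graded_linear A 0 P X l & (ALL x:carrier P. G (l x) = f x)"
   unfolding graded_linear_iff[OF g gX] by blast
 qed
 ultimately show "P : perf A" using dg by (simp add: perf_def)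
qed

text \<open>An element is determined by its finitely many coordinates in a dual basis, that is, by a
  list of ring elements.\<close>

lemma fg_embed:
 fixes W :: "('a, 'w) dg_module"
 assumes W: "gm W" and f: "fg W" and room: "lists (carrier A) \<lesssim> (UNIV :: 'm set)"
 shows "EX c :: 'w => 'm. inj_on c (carrier W)"
proof -
 obtain n q d \<phi> where db: "dual_basis W n q d \<phi>" using f by (auto simp: fg_def)
 obtain r :: "'a list => 'm" where r: "inj_on r (lists (carrier A))" using room by (auto simp: lepoll_def)
 have "inj_on (%x. map (%i. \<phi> i x) [0..<n]) (carrier W)"
 proof (rule inj_onI)
  fix x y assume x: "x : carrier W" and y: "y : carrier W"
   and "map (%i. \<phi> i x) [0..<n] = map (%i. \<phi> i y) [0..<n]"
  then have "\<phi> i x = \<phi> i y" if "i < n" for i using that by (simp add: list_eq_iff_nth_eq)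
  then have "finsum W (%i. \<phi> i x \<odot>\<^bsub>W\<^esub> q i) {..<n} = finsum W (%i. \<phi> i y \<odot>\<^bsub>W\<^esub> q i) {..<n}"
   using db_closed[OF W db] x y W gm_smult(1)[OF W] by (intro finsum_congr) auto
  then show "x = y" using dbD(3)[OF db x] dbD(3)[OF db y] by simp
 qed
 moreover have "(%x. map (%i. \<phi> i x) [0..<n]) ` carrier W \<subseteq> lists (carrier A)"
  using db_closed(2)[OF W db] by auto
 ultimately have "inj_on (r \<circ> (%x. map (%i. \<phi> i x) [0..<n])) (carrier W)"
  using r by (intro comp_inj_on) (auto intro: inj_on_subset)
 then show ?thesis by blast
qed

end

section \<open>Triangles, tensor products and retracts inside a thick tensor ideal\<close>

locale tensor_ideal = even_graded_ring A for A :: "'a gr_ring" (structure) +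
 fixes T :: "('a, 'm) dg_module set"
 assumes thick: "thick_tensor_ideal A T"
  and room: "lists (carrier A) \<lesssim> (UNIV :: 'm set)"
begin

text \<open>A thick ideal contains only objects carried by the type \<open>'m\<close>. Cones and
  tensor products live on other types and are brought back along an injection, which exists by
  \<open>fg_embed\<close>; \<open>dc\<close> inverts it and \<open>cpy\<close> is the resulting
  copy.\<close>

definition cp :: "('a, 'w) dg_module => 'w => 'm" where
 "cp W = (SOME c. inj_on c (carrier W))"

definition dc :: "('a, 'w) dg_module => 'm => 'w" where
 "dc W = inv_into (carrier W) (cp W)"

definition cpy :: "('a, 'w) dg_module => ('a, 'm) dg_module" where
 "cpy W = tr (cp W) W"

lemma cpy:
 assumes W: "dg_module A W" and f: "fg W"
 shows "dg_iso W (cpy W) (cp W) (dc W)" "dg_module A (cpy W)" "fg (cpy W)" "cpy W : perf A"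
proof -
 have c: "inj_on (cp W) (carrier W)"
  unfolding cp_def using fg_embed[OF dg_gm[OF W] f room] by (rule someI_ex)
 show i: "dg_iso W (cpy W) (cp W) (dc W)" and d: "dg_module A (cpy W)"
  using tr_iso[OF W c] by (simp_all add: cpy_def dc_def)
 show "fg (cpy W)"
  using fg_iso[OF dg_gm[OF W] dg_gm[OF d] f, of "cp W" "dc W"] i by (auto simp: dg_iso_def cm_def)
 then show "cpy W : perf A" using d by (simp add: perf_iff)
qed

lemma T_perf: "X : T ==> dg_module A X" "X : T ==> fg X" "X : T ==> X : perf A"
proof -
 assume "X : T"
 then have "X : perf A" using thick unfolding thick_tensor_ideal_def triangulated_subcategory_def by blast
 then show "dg_module A X" "fg X" "X : perf A" by (simp_all add: perf_iff)
qed

lemma T_tri: "triangulated_subcategory A T"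
 using thick by (simp add: thick_tensor_ideal_def)

lemma T_ho: "X : T ==> Y : perf A ==> ho_iso A X Y ==> Y : T"
 by (rule T_tri[unfolded triangulated_subcategory_def, THEN conjunct2, THEN conjunct2, THEN conjunct1, rule_format])

lemma T_zero: "Z : perf A ==> ho_iso A Z zero_dg ==> Z : T"
 by (rule T_tri[unfolded triangulated_subcategory_def, THEN conjunct2, THEN conjunct1, rule_format])

lemma T_shift: "X : T ==> shift k X : T"
 by (rule T_tri[unfolded triangulated_subcategory_def, THEN conjunct2, THEN conjunct2, THEN conjunct2, THEN conjunct1, rule_format])

lemma T_cone0: "X : T ==> Y : T ==> chain_map A X Y f ==> Z : perf A ==> ho_iso A Z (cone X Y f) ==> Z : T"
 by (rule T_tri[unfolded triangulated_subcategory_def, THEN conjunct2, THEN conjunct2, THEN conjunct2, THEN conjunct2, rule_format])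

lemma T_summand: "X : T ==> Y : perf A ==> Y' : perf A ==> ho_iso A X (dg_sum Y Y') ==> Y : T"
 for Y' :: "('a, 'm) dg_module"
 by (rule thick[unfolded thick_tensor_ideal_def, THEN conjunct2, THEN conjunct1, rule_format, of X Y Y'])

lemma T_tensor: "X : T ==> Y : perf A ==> Z : perf A ==> ho_iso A Z (tensor A X Y) ==> Z : T"
 for Y :: "('a, 'm) dg_module"
 by (rule thick[unfolded thick_tensor_ideal_def, THEN conjunct2, THEN conjunct2, rule_format, of X Y])

lemma T_cone:
 assumes "X : T" "Y : T" "cm X Y f"
 shows "cpy (cone X Y f) : T"
proof -
 note X = T_perf(1,2)[OF assms(1)] and Y = T_perf(1,2)[OF assms(2)]
 have C: "dg_module A (cone X Y f)" "fg (cone X Y f)" using X Y assms(3) by simp_all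
 have "chain_map A X Y f" using X(1) Y(1) assms(3) by (simp add: chain_map_iff)
 then show ?thesis
  by (rule T_cone0[OF assms(1,2) _ cpy(4)[OF C] dg_iso_ho[OF cpy(2)[OF C] C(1) dg_iso_sym[OF cpy(1)[OF C]]]])
qed

text \<open>Tensor closure is available for a second factor on the type \<open>'m\<close>, so
  \<open>Y\<close> is first replaced by its copy; the box construction carries the isomorphism
  over.\<close>

lemma T_box:
 assumes X: "X : T" and db: "dual_basis X n q d \<phi>" and Y: "dg_module A Y" "fg Y"
 shows "cpy (box {..<n} d (%i j. \<phi> i (q j)) (%i j. \<phi> i (\<partial>\<^bsub>X\<^esub> (q j))) Y) : T" (is "cpy ?B : T")
proof -
 note Xd = T_perf(1)[OF X]
 note bd = tensor_box_data[OF Xd db]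
 have B: "dg_module A ?B" "fg ?B" using box_dg[OF bd Y(1)] box_fg[OF bd dg_gm[OF Y(1)] Y(2)] by auto
 let ?Y = "cpy Y"
 let ?B' = "box {..<n} d (%i j. \<phi> i (q j)) (%i j. \<phi> i (\<partial>\<^bsub>X\<^esub> (q j))) ?Y"
 note Y' = cpy[OF Y]
 have B': "dg_module A ?B'" by (rule box_dg[OF bd Y'(2)])
 have i: "cm Y ?Y (cp Y)" "cm ?Y Y (dc Y)" "ALL x:carrier Y. dc Y (cp Y x) = x" "ALL y:carrier ?Y. cp Y (dc Y y) = y"
  using Y'(1) by (auto simp: dg_iso_def)
 have BB: "dg_iso ?B ?B' (%y i. cp Y (y i)) (%y i. dc Y (y i))"
 proof -
  have "dc Y (cp Y (y j)) = y j" if "y : carrier ?B" for y j using i(3) box_all[OF that dg_gm[OF Y(1)]] by blast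
  moreover have "cp Y (dc Y (y j)) = y j" if "y : carrier ?B'" for y j using i(4) box_all[OF that dg_gm[OF Y'(2)]] by blast
  ultimately show ?thesis
   unfolding dg_iso_def using box_cm[OF bd Y(1) Y'(2) i(1)] box_cm[OF bd Y'(2) Y(1) i(2)] by simp
 qed
 obtain G F where GF: "dg_iso ?B' (tensor A X ?Y) G F" using tensor_box(2)[OF Xd Y'(2) db] by blast
 have "dg_iso (cpy ?B) (tensor A X ?Y) (%x. G (%i. cp Y (dc ?B x i))) (%x. cp ?B (%i. dc Y (F x i)))"
  using dg_iso_trans[OF dg_iso_trans[OF dg_iso_sym[OF cpy(1)[OF B]] BB] GF] .
 from dg_iso_ho[OF cpy(2)[OF B] tensor_box(1)[OF Xd Y'(2) db] this]
 show ?thesis using T_tensor[OF X Y'(4) cpy(4)[OF B]] by blast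
qed

text \<open>For \<open>U'\<close> in \<open>T\<close> these are the maps that become zero in the
  Verdier quotient by \<open>T\<close>.\<close>

definition fac :: "('a, 'u) dg_module => ('a, 'p) dg_module => ('a, 'x) dg_module => ('p => 'x) => bool" where
 "fac U' P X g \<longleftrightarrow> (EX \<alpha> \<beta> h. cm P U' \<alpha> & cm U' X \<beta> & lmap 1 P X h &
  (ALL x:carrier P. g x = \<beta> (\<alpha> x) \<oplus>\<^bsub>X\<^esub> (\<partial>\<^bsub>X\<^esub> (h x) \<oplus>\<^bsub>X\<^esub> h (\<partial>\<^bsub>P\<^esub> x))))"

lemma fac_comp:
 assumes P: "dg_module A P" and X: "dg_module A X" and Y: "dg_module A Y" and U': "gm U'"
  and g: "fac U' P X g" and k: "cm X Y k" and g': "!!x. x : carrier P ==> g' x = k (g x)"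
 shows "fac U' P Y g'"
proof -
 obtain \<alpha> \<beta> h where *: "cm P U' \<alpha>" "cm U' X \<beta>" "lmap 1 P X h"
  "!!x. x : carrier P ==> g x = \<beta> (\<alpha> x) \<oplus>\<^bsub>X\<^esub> (\<partial>\<^bsub>X\<^esub> (h x) \<oplus>\<^bsub>X\<^esub> h (\<partial>\<^bsub>P\<^esub> x))"
  using g unfolding fac_def by blast
 note D = lmapD[OF cmD(1)[OF *(1)]] lmapD[OF cmD(1)[OF *(2)]] lmapD[OF *(3)] lmapD[OF cmD(1)[OF k]]
 have "g' x = k (\<beta> (\<alpha> x)) \<oplus>\<^bsub>Y\<^esub> (\<partial>\<^bsub>Y\<^esub> (k (h x)) \<oplus>\<^bsub>Y\<^esub> k (h (\<partial>\<^bsub>P\<^esub> x)))" if "x : carrier P" for x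
  using that X P by (simp add: g' *(4) D dgD[OF P] dgD[OF X] group_closed cmD(2)[OF k])
 moreover have "lmap 1 P Y (%x. k (h x))" using lmap_comp[OF *(3) cmD(1)[OF k]] by simp
 ultimately show ?thesis unfolding fac_def using *(1) cm_comp[OF *(2) k] by blast
qed

text \<open>In the Verdier quotient by \<open>T\<close> the inclusion of \<open>X\<close> into the
  cone of \<open>E\<close> is invertible, so \<open>g\<close> vanishes there if its composite with
  the inclusion does. Explicitly, the second component of \<open>\<beta>\<close> gives a map from
  the shifted \<open>V\<close> to \<open>W\<close>, whose cone belongs to \<open>T\<close> up to a
  copy. The second component of the homotopy together with \<open>\<alpha>\<close> maps
  \<open>P\<close> to this cone, \<open>E\<close> and the first component of \<open>\<beta>\<close>
  map it to \<open>X\<close>, and the first component of the homotopy compares the composite with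
  \<open>g\<close>.\<close>

lemma T_descent:
 assumes W: "W : T" and X: "dg_module A X" and E: "cm W X E" and P: "dg_module A P" and V: "V : T"
  and f: "fac V P (cone W X E) (%x. (g x, \<zero>\<^bsub>W\<^esub>))" and g: "cm P X g"
 shows "EX U':T. fac U' P X g"
proof -
 note Wd = T_perf(1)[OF W] and Vd = T_perf(1)[OF V]
 note [simp] = dg_gm[OF X] dg_gm[OF P] dg_gm[OF Wd] dg_gm[OF Vd]
 interpret X: abelian_group X by simp
 interpret W: graded_group W "mgrad W" by (rule gm_graded) simp
 let ?C = "cone W X E"
 obtain \<alpha> \<beta> h where *: "cm P V \<alpha>" "cm V ?C \<beta>" "lmap 1 P ?C h"
  "!!x. x : carrier P ==> (g x, \<zero>\<^bsub>W\<^esub>) = \<beta> (\<alpha> x) \<oplus>\<^bsub>?C\<^esub> (\<partial>\<^bsub>?C\<^esub> (h x) \<oplus>\<^bsub>?C\<^esub> h (\<partial>\<^bsub>P\<^esub> x))"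
  using f unfolding fac_def by blast
 have p1: "lmap 0 ?C X fst" and p2: "lmap (-1) ?C W snd" by (auto simp: lmap_def)
 define b1 where "b1 u = fst (\<beta> u)" for u
 define b2 where "b2 u = snd (\<beta> u)" for u
 define h1 where "h1 u = fst (h u)" for u
 define h2 where "h2 u = snd (h u)" for u
 have b1: "lmap 0 V X b1" and b2: "lmap (-1) V W b2" and h1: "lmap 1 P X h1" and h2: "lmap 0 P W h2"
  using lmap_comp[OF cmD(1)[OF *(2)] p1] lmap_comp[OF cmD(1)[OF *(2)] p2] lmap_comp[OF *(3) p1] lmap_comp[OF *(3) p2]
  by (simp_all add: b1_def[abs_def] b2_def[abs_def] h1_def[abs_def] h2_def[abs_def])
 note D = lmapD[OF b1] lmapD[OF b2] lmapD[OF h1] lmapD[OF h2] lmapD[OF cmD(1)[OF *(1)]]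
  lmapD[OF cmD(1)[OF E]] dgD[OF X] dgD[OF P] dgD[OF Wd] dgD[OF Vd] cmD(2)[OF *(1)] cmD(2)[OF E]
 have \<beta>: "\<beta> u = (b1 u, b2 u)" for u by (simp add: b1_def b2_def)
 have h: "h u = (h1 u, h2 u)" for u by (simp add: h1_def h2_def)
 have \<beta>d: "b1 (\<partial>\<^bsub>V\<^esub> u) = \<partial>\<^bsub>X\<^esub> (b1 u) \<oplus>\<^bsub>X\<^esub> E (b2 u)" "b2 (\<partial>\<^bsub>V\<^esub> u) = \<ominus>\<^bsub>W\<^esub> \<partial>\<^bsub>W\<^esub> (b2 u)" if "u : carrier V" for u
  using cmD(2)[OF *(2) that] by (auto simp: \<beta>)
 have eq1: "g x = b1 (\<alpha> x) \<oplus>\<^bsub>X\<^esub> ((\<partial>\<^bsub>X\<^esub> (h1 x) \<oplus>\<^bsub>X\<^esub> E (h2 x)) \<oplus>\<^bsub>X\<^esub> h1 (\<partial>\<^bsub>P\<^esub> x))"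
  and eq2: "\<zero>\<^bsub>W\<^esub> = b2 (\<alpha> x) \<oplus>\<^bsub>W\<^esub> ((\<ominus>\<^bsub>W\<^esub> \<partial>\<^bsub>W\<^esub> (h2 x)) \<oplus>\<^bsub>W\<^esub> h2 (\<partial>\<^bsub>P\<^esub> x))" if "x : carrier P" for x
  using *(4)[OF that] by (auto simp: \<beta> h)
 \<comment> \<open>The minus sign is dictated by \<open>eq2\<close>: with it the pair of
   \<open>h2\<close> and \<open>\<alpha>\<close> is a chain map into the cone.\<close>
 let ?S = "shift (-1) V" and ?f = "%u. \<ominus>\<^bsub>W\<^esub> b2 u"
 have nb: "lmap (-1) V W ?f" by (rule lmap_uminus[OF _ _ b2]) simp_all
 have f: "cm ?S W ?f"
  unfolding cm_def
 proof (intro conjI ballI)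
  show "lmap 0 ?S W ?f" unfolding lmap_def
  proof (intro conjI allI ballI)
   show "\<ominus>\<^bsub>W\<^esub> b2 x : mgrad W (i + 0)" if "x : mgrad ?S i" for i x
    using lmap_deg[OF nb, of x "i + 1"] that by simp
  qed (use lmapD[OF nb] in simp_all)
  show "\<ominus>\<^bsub>W\<^esub> b2 (\<partial>\<^bsub>?S\<^esub> x) = \<partial>\<^bsub>W\<^esub> (\<ominus>\<^bsub>W\<^esub> b2 x)" if "x : carrier ?S" for x
   using that lmap_minus[OF _ _ b2] by (simp add: koszul_def \<beta>d D)
 qed
 have S: "?S : T" by (rule T_shift[OF V])
 let ?U = "cone ?S W ?f"
 have Ud: "dg_module A ?U" "fg ?U" using f T_perf(1,2)[OF S] T_perf(1,2)[OF W] by simp_all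
 have deg: "x : mgrad V (i - 1 - - 1) \<longleftrightarrow> x : mgrad V i" for x i by simp
 have \<alpha>': "cm P ?U (%x. (h2 x, \<alpha> x))"
  unfolding cm_def
 proof (intro conjI ballI)
  show "lmap 0 P ?U (%x. (h2 x, \<alpha> x))" unfolding lmap_def
   using lmapD[OF h2] lmapD[OF cmD(1)[OF *(1)]] by auto
  fix x assume x: "x : carrier P"
  have "h2 (\<partial>\<^bsub>P\<^esub> x) = \<partial>\<^bsub>W\<^esub> (h2 x) \<ominus>\<^bsub>W\<^esub> b2 (\<alpha> x)"
  proof -
   have "\<partial>\<^bsub>W\<^esub> (h2 x) \<ominus>\<^bsub>W\<^esub> b2 (\<alpha> x) = (\<partial>\<^bsub>W\<^esub> (h2 x) \<ominus>\<^bsub>W\<^esub> b2 (\<alpha> x)) \<oplus>\<^bsub>W\<^esub>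
     (b2 (\<alpha> x) \<oplus>\<^bsub>W\<^esub> ((\<ominus>\<^bsub>W\<^esub> \<partial>\<^bsub>W\<^esub> (h2 x)) \<oplus>\<^bsub>W\<^esub> h2 (\<partial>\<^bsub>P\<^esub> x)))"
    using x by (simp add: D flip: eq2)
   also have "\<dots> = h2 (\<partial>\<^bsub>P\<^esub> x)" using x by (simp add: D group_arith group_closed)
   finally show ?thesis by simp
  qed
  then show "(h2 (\<partial>\<^bsub>P\<^esub> x), \<alpha> (\<partial>\<^bsub>P\<^esub> x)) = \<partial>\<^bsub>?U\<^esub> (h2 x, \<alpha> x)"
   using x abelian_group.minus_minus[OF gm_group[OF dg_gm[OF Vd]]] by (simp add: D koszul_def a_minus_def)
 qed
 have \<beta>': "cm ?U X (%p. E (fst p) \<oplus>\<^bsub>X\<^esub> b1 (snd p))"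
  unfolding cm_def
 proof (intro conjI ballI)
  have q1: "lmap 0 ?U W fst" and q2: "lmap 0 ?U V snd" by (auto simp: lmap_def)
  show "lmap 0 ?U X (%p. E (fst p) \<oplus>\<^bsub>X\<^esub> b1 (snd p))"
   using lmap_comp[OF q1 cmD(1)[OF E]] lmap_comp[OF q2 b1] Ud(1) by (intro lmap_add) simp_all
  fix p assume "p : carrier ?U"
  then obtain w u where p: "p = (w, u)" "w : carrier W" "u : carrier V" by auto
  show "E (fst (\<partial>\<^bsub>?U\<^esub> p)) \<oplus>\<^bsub>X\<^esub> b1 (snd (\<partial>\<^bsub>?U\<^esub> p)) = \<partial>\<^bsub>X\<^esub> (E (fst p) \<oplus>\<^bsub>X\<^esub> b1 (snd p))"
   using p by (simp add: D lmapD0[OF dg_gm[OF Wd] dg_gm[OF X] cmD(1)[OF E]] koszul_def \<beta>d group_arith group_closed)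
 qed
 have "fac ?U P X g"
  unfolding fac_def
 proof (intro exI conjI ballI)
  fix x assume x: "x : carrier P"
  show "g x = (E (fst (h2 x, \<alpha> x)) \<oplus>\<^bsub>X\<^esub> b1 (snd (h2 x, \<alpha> x))) \<oplus>\<^bsub>X\<^esub> (\<partial>\<^bsub>X\<^esub> (h1 x) \<oplus>\<^bsub>X\<^esub> h1 (\<partial>\<^bsub>P\<^esub> x))"
   unfolding eq1[OF x] using x by (simp add: D X.group_rearrange)
 qed (rule \<alpha>' \<beta>' h1)+
 then obtain \<alpha>1 \<beta>1 h' where **: "cm P ?U \<alpha>1" "cm ?U X \<beta>1" "lmap 1 P X h'"
  "!!x. x : carrier P ==> g x = \<beta>1 (\<alpha>1 x) \<oplus>\<^bsub>X\<^esub> (\<partial>\<^bsub>X\<^esub> (h' x) \<oplus>\<^bsub>X\<^esub> h' (\<partial>\<^bsub>P\<^esub> x))"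
  unfolding fac_def by blast
 have i: "cm ?U (cpy ?U) (cp ?U)" "cm (cpy ?U) ?U (dc ?U)" "ALL x:carrier ?U. dc ?U (cp ?U x) = x"
  using cpy(1)[OF Ud] by (auto simp: dg_iso_def)
 have e: "dc ?U (cp ?U (\<alpha>1 x)) = \<alpha>1 x" if "x : carrier P" for x
  by (rule bspec[OF i(3) lmap_closed[OF cmD(1)[OF **(1)] that]])
 have "fac (cpy ?U) P X g"
  unfolding fac_def
 proof (intro exI conjI ballI)
  fix x assume x: "x : carrier P"
  show "g x = \<beta>1 (dc ?U (cp ?U (\<alpha>1 x))) \<oplus>\<^bsub>X\<^esub> (\<partial>\<^bsub>X\<^esub> (h' x) \<oplus>\<^bsub>X\<^esub> h' (\<partial>\<^bsub>P\<^esub> x))"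
   unfolding e[OF x] by (rule **(4)[OF x])
 qed (rule cm_comp[OF **(1) i(1)] cm_comp[OF i(2) **(2)] **(3))+
 moreover have "cpy ?U : T" by (rule T_cone[OF S W f])
 ultimately show ?thesis by blast
qed

text \<open>A map with a left inverse up to homotopy splits: \<open>V\<close> is homotopy equivalent
  to the sum of \<open>P\<close> and the cone of \<open>\<alpha>\<close>. In one direction
  \<open>u\<close> goes to \<open>(\<beta> u, u, 0)\<close>. In the other, \<open>P\<close> is
  mapped by \<open>\<alpha>\<close> and the cone by
  \<open>u - \<alpha> \<beta> u + \<alpha> h x\<close>, where the last term makes up for the failure
  of \<open>\<beta> \<alpha>\<close> to be the identity. Closure under summands finishes the
  argument.\<close>

lemma T_retract:
 assumes V: "V : T" and P: "P : perf A" and f: "fac V P P (%x. x)"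
 shows "P : T"
proof -
 note Vd = T_perf(1,2)[OF V]
 have Pd: "dg_module A P" "fg P" using P by (simp_all add: perf_iff)
 note [simp] = dg_gm[OF Pd(1)] dg_gm[OF Vd(1)]
 interpret P: abelian_group P by simp
 interpret V: abelian_group V by simp
 obtain \<alpha> \<beta> h where *: "cm P V \<alpha>" "cm V P \<beta>" "lmap 1 P P h"
  "!!x. x : carrier P ==> x = \<beta> (\<alpha> x) \<oplus>\<^bsub>P\<^esub> (\<partial>\<^bsub>P\<^esub> (h x) \<oplus>\<^bsub>P\<^esub> h (\<partial>\<^bsub>P\<^esub> x))"
  using f unfolding fac_def by blast
 note D = lmapD[OF cmD(1)[OF *(1)]] lmapD0[OF _ _ cmD(1)[OF *(1)]] lmapD[OF cmD(1)[OF *(2)]] lmapD0[OF _ _ cmD(1)[OF *(2)]]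
  lmapD[OF *(3)] lmapD0[OF _ _ *(3)] dgD[OF Pd(1)] dgD[OF Vd(1)] cmD(2)[OF *(1)] cmD(2)[OF *(2)]
 have ba: "\<beta> (\<alpha> x) = x \<ominus>\<^bsub>P\<^esub> (\<partial>\<^bsub>P\<^esub> (h x) \<oplus>\<^bsub>P\<^esub> h (\<partial>\<^bsub>P\<^esub> x))" if x: "x : carrier P" for x
  using *(4)[OF x] x by (subst P.gr_eq_diff) (simp_all add: D group_closed)
 let ?C = "cone P V \<alpha>"
 have C: "dg_module A ?C" "fg ?C" using Pd Vd *(1) by simp_all
 note [simp] = dg_gm[OF C(1)]
 let ?S = "dg_sum P ?C"
 have Sd: "dg_module A ?S" using Pd C by simp
 define v where "v y u x = (\<alpha> y \<oplus>\<^bsub>V\<^esub> u) \<oplus>\<^bsub>V\<^esub> (\<alpha> (h x) \<ominus>\<^bsub>V\<^esub> \<alpha> (\<beta> u))" for y u x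
 define B where "B s = (case s of (y, u, x) => v y u x)" for s
 have vc: "v y u x : carrier V" if "y : carrier P" "u : carrier V" "x : carrier P" for y u x
  using that by (simp add: v_def D group_closed)
 have F: "cm V ?S (%u. (\<beta> u, u, \<zero>\<^bsub>P\<^esub>))"
 proof -
  have z: "\<zero>\<^bsub>P\<^esub> : mgrad P i" for i by (rule graded_group.G_zero[OF gm_graded[OF dg_gm[OF Pd(1)]]])
  show ?thesis unfolding cm_def lmap_def using z lmap_deg[OF cmD(1)[OF *(2)], simplified] by (auto simp: D group_closed P.minus_zero)
 qed
 have p: "lmap 0 ?S P fst" "lmap 0 ?S V (%s. fst (snd s))" "lmap (-1) ?S P (%s. snd (snd s))"
  by (auto simp: lmap_def)
 have Bl: "lmap 0 ?S V B"
 proof -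
  have "lmap 0 ?S V (%s. (\<alpha> (fst s) \<oplus>\<^bsub>V\<^esub> fst (snd s)) \<oplus>\<^bsub>V\<^esub> (\<alpha> (h (snd (snd s))) \<ominus>\<^bsub>V\<^esub> \<alpha> (\<beta> (fst (snd s)))))"
   using lmap_comp[OF p(1) cmD(1)[OF *(1)]] p(2) lmap_comp[OF lmap_comp[OF p(3) *(3)] cmD(1)[OF *(1)]]
    lmap_comp[OF lmap_comp[OF p(2) cmD(1)[OF *(2)]] cmD(1)[OF *(1)]] Sd
   by (intro lmap_add lmap_subtract) simp_all
  then show ?thesis by (rule lmap_cong) (use Sd in \<open>auto simp: B_def v_def\<close>)
 qed
 have Bd: "B (\<partial>\<^bsub>?S\<^esub> s) = \<partial>\<^bsub>V\<^esub> (B s)" if s: "s : carrier ?S" for s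
 proof -
  obtain y u x where s': "s = (y, u, x)" "y : carrier P" "u : carrier V" "x : carrier P" using s by auto
  then show ?thesis
   by (simp add: B_def v_def D ba group_arith group_closed)
 qed
 have Bcm: "cm ?S V B" using Bl Bd by (simp add: cm_def)
 have 1: "ho_eq V V (%u. B (\<beta> u, u, \<zero>\<^bsub>P\<^esub>)) (%x. x)"
  by (rule ho_eq_refl[OF _ Vd(1)]) (simp_all add: B_def v_def D group_arith group_closed V.minus_zero)
 \<comment> \<open>Chosen so that \<open>v y u x - u = \<alpha> (k3 y u x)\<close>, which is what
   the cone differential produces from \<open>k3\<close> in the last component. Its failure to
   commute with the differential is exactly \<open>x\<close>, as required there; the first component
   of \<open>K\<close> corrects the part in \<open>P\<close>.\<close>
 define k3 where "k3 y u x = (y \<ominus>\<^bsub>P\<^esub> \<beta> u) \<oplus>\<^bsub>P\<^esub> h x" for y u x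
 define K where "K s = (case s of (y, u, x) => (\<ominus>\<^bsub>P\<^esub> h (k3 y u x), \<zero>\<^bsub>V\<^esub>, k3 y u x))" for s
 have k3l: "lmap 0 ?S P (%s. k3 (fst s) (fst (snd s)) (snd (snd s)))"
  unfolding k3_def using p(1) lmap_comp[OF p(2) cmD(1)[OF *(2)]] lmap_comp[OF p(3) *(3)] Sd
  by (intro lmap_add lmap_subtract) simp_all
 have Kl: "lmap 1 ?S ?S K"
 proof -
  have i: "lmap 0 P ?S (%x. (x, \<zero>\<^bsub>V\<^esub>, \<zero>\<^bsub>P\<^esub>))" "lmap 1 P ?S (%x. (\<zero>\<^bsub>P\<^esub>, \<zero>\<^bsub>V\<^esub>, x))"
   using graded_group.G_zero[OF gm_graded[of P]] graded_group.G_zero[OF gm_graded[of V]]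
   by (auto simp: lmap_def group_closed)
  have "lmap 1 ?S ?S (%s. (\<ominus>\<^bsub>P\<^esub> h (k3 (fst s) (fst (snd s)) (snd (snd s))), \<zero>\<^bsub>V\<^esub>, \<zero>\<^bsub>P\<^esub>) \<oplus>\<^bsub>?S\<^esub>
    (\<zero>\<^bsub>P\<^esub>, \<zero>\<^bsub>V\<^esub>, k3 (fst s) (fst (snd s)) (snd (snd s))))"
   using lmap_comp[OF lmap_uminus[OF _ _ lmap_comp[OF k3l *(3)]] i(1)] lmap_comp[OF k3l i(2)] Sd
   by (intro lmap_add) simp_all
  then show ?thesis
  proof (rule lmap_cong)
   show "(\<ominus>\<^bsub>P\<^esub> h (k3 (fst s) (fst (snd s)) (snd (snd s))), \<zero>\<^bsub>V\<^esub>, \<zero>\<^bsub>P\<^esub>) \<oplus>\<^bsub>?S\<^esub>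
    (\<zero>\<^bsub>P\<^esub>, \<zero>\<^bsub>V\<^esub>, k3 (fst s) (fst (snd s)) (snd (snd s))) = K s" if "s : carrier ?S" for s
    using lmap_closed[OF k3l that] by (simp add: K_def D split: prod.splits)
  qed (use Sd in simp_all)
 qed
 have 2: "ho_eq ?S ?S (%s. (\<beta> (B s), B s, \<zero>\<^bsub>P\<^esub>)) (%s. s)"
  unfolding ho_eq_def
 proof (intro exI[of _ K] conjI Kl ballI)
  fix s assume "s : carrier ?S"
  then obtain y u x where s: "s = (y, u, x)" "y : carrier P" "u : carrier V" "x : carrier P" by auto
  let ?k = "k3 y u x"
  have kc: "?k : carrier P" using s by (simp add: k3_def D group_closed)
  have dk: "k3 (\<partial>\<^bsub>P\<^esub> y) (\<partial>\<^bsub>V\<^esub> u \<oplus>\<^bsub>V\<^esub> \<alpha> x) (\<ominus>\<^bsub>P\<^esub> \<partial>\<^bsub>P\<^esub> x) = \<partial>\<^bsub>P\<^esub> ?k \<ominus>\<^bsub>P\<^esub> x"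
   using s by (simp add: k3_def D ba group_arith group_closed)
  have vk: "v y u x \<ominus>\<^bsub>V\<^esub> u = \<alpha> ?k" using s by (simp add: v_def k3_def D group_arith group_closed)
  have bv: "\<beta> (v y u x) \<ominus>\<^bsub>P\<^esub> y = (\<ominus>\<^bsub>P\<^esub> \<partial>\<^bsub>P\<^esub> (h ?k)) \<oplus>\<^bsub>P\<^esub> (\<ominus>\<^bsub>P\<^esub> h (\<partial>\<^bsub>P\<^esub> ?k \<ominus>\<^bsub>P\<^esub> x))"
  proof -
   have "v y u x = u \<oplus>\<^bsub>V\<^esub> \<alpha> ?k" using s vk vc[of y u x] kc by (simp add: D V.gr_diff_eq V.a_comm)
   then have "\<beta> (v y u x) = (\<beta> u \<oplus>\<^bsub>P\<^esub> ?k) \<ominus>\<^bsub>P\<^esub> (\<partial>\<^bsub>P\<^esub> (h ?k) \<oplus>\<^bsub>P\<^esub> h (\<partial>\<^bsub>P\<^esub> ?k))"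
    using s kc by (simp add: D ba group_arith group_closed)
   moreover have "\<beta> u \<oplus>\<^bsub>P\<^esub> ?k = y \<oplus>\<^bsub>P\<^esub> h x" using s by (simp add: k3_def D group_arith group_closed)
   ultimately have "\<beta> (v y u x) = (y \<oplus>\<^bsub>P\<^esub> h x) \<ominus>\<^bsub>P\<^esub> (\<partial>\<^bsub>P\<^esub> (h ?k) \<oplus>\<^bsub>P\<^esub> h (\<partial>\<^bsub>P\<^esub> ?k))" by simp
   then show ?thesis using s kc by (simp add: D group_arith group_closed)
  qed
  have "(\<beta> (B s), B s, \<zero>\<^bsub>P\<^esub>) \<ominus>\<^bsub>?S\<^esub> s = (\<beta> (v y u x) \<ominus>\<^bsub>P\<^esub> y, v y u x \<ominus>\<^bsub>V\<^esub> u, \<ominus>\<^bsub>P\<^esub> x)"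
   using s vc[of y u x] by (simp add: B_def D group_closed P.gr_zero_diff)
  also have "\<dots> = \<partial>\<^bsub>?S\<^esub> (K s) \<oplus>\<^bsub>?S\<^esub> K (\<partial>\<^bsub>?S\<^esub> s)"
  proof -
   have "K (\<partial>\<^bsub>?S\<^esub> s) = (\<ominus>\<^bsub>P\<^esub> h (\<partial>\<^bsub>P\<^esub> ?k \<ominus>\<^bsub>P\<^esub> x), \<zero>\<^bsub>V\<^esub>, \<partial>\<^bsub>P\<^esub> ?k \<ominus>\<^bsub>P\<^esub> x)" using s by (simp add: K_def D dk)
   moreover have "\<partial>\<^bsub>?S\<^esub> (K s) = (\<ominus>\<^bsub>P\<^esub> \<partial>\<^bsub>P\<^esub> (h ?k), \<alpha> ?k, \<ominus>\<^bsub>P\<^esub> \<partial>\<^bsub>P\<^esub> ?k)" using s kc by (simp add: K_def D group_closed)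
   ultimately show ?thesis using s kc bv vk by (simp add: D group_arith group_closed)
  qed
  finally show "(\<beta> (B s), B s, \<zero>\<^bsub>P\<^esub>) \<ominus>\<^bsub>?S\<^esub> s = \<partial>\<^bsub>?S\<^esub> (K s) \<oplus>\<^bsub>?S\<^esub> K (\<partial>\<^bsub>?S\<^esub> s)" .
 qed
 have "ho_iso A V ?S"
  unfolding ho_iso_iff[OF dg_gm[OF Vd(1)] dg_gm[OF Sd]] using F Bcm 1 2 by blast
 moreover have "dg_iso ?S (dg_sum P (cpy ?C)) (%s. (fst s, cp ?C (snd s))) (%s. (fst s, dc ?C (snd s)))"
 proof -
  have i: "cm ?C (cpy ?C) (cp ?C)" "cm (cpy ?C) ?C (dc ?C)" "ALL x:carrier ?C. dc ?C (cp ?C x) = x"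
   "ALL x:carrier (cpy ?C). cp ?C (dc ?C x) = x"
   using cpy(1)[OF C] by (auto simp: dg_iso_def)
  have a: "cm (dg_sum P M) (dg_sum P N) (%s. (fst s, f (snd s)))" if "cm M N f"
   for M :: "('a, 'x) dg_module" and N :: "('a, 'y) dg_module" and f
   using lmapD[OF cmD(1)[OF that]] cmD(2)[OF that] by (auto simp: cm_def lmap_def)
  show ?thesis unfolding dg_iso_def using a[OF i(1)] a[OF i(2)] i(3,4) by auto
 qed
 ultimately have "ho_iso A V (dg_sum P (cpy ?C))"
  by (rule ho_iso_dg_trans[OF Vd(1) Sd dg_sum_dg[OF Pd(1) cpy(2)[OF C]]])
 then show ?thesis using T_summand[OF V P cpy(4)[OF C]] by blast
qed

end

section \<open>Products of ideals, adjoining a scalar, homogeneous primes\<close>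

context even_graded_ring
begin

lemma IM_pair:
 assumes X: "gm X" and W: "gm W" and I: "ideal I A" and y: "y : IM I X" and w: "w : IM I W"
 shows "(y, w) : IM I (cone W X E)"
proof -
 interpret X: graded_group X "mgrad X" by (rule gm_graded[OF X])
 interpret W: graded_group W "mgrad W" by (rule gm_graded[OF W])
 have "lmap 0 X (cone W X E) (%y. (y, \<zero>\<^bsub>W\<^esub>))" "lmap 1 W (cone W X E) (%w. (\<zero>\<^bsub>X\<^esub>, w))"
  using X W by (auto simp: lmap_def)
 from IM_add[OF cone_gm[OF W X] I IM_lmap[OF this(1) y] IM_lmap[OF this(2) w]]
 show ?thesis using IM_carrier[OF y] IM_carrier[OF w] by simp
qed

text \<open>\<open>x\<close> is a combination of the generators with coefficients in
  \<open>K\<close>, and \<open>F\<close> sends the generators into \<open>J N\<close>; so every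
  functional takes a sum of products from \<open>K\<close> and \<open>J\<close> on
  \<open>F x\<close>.\<close>

lemma IM_product:
 assumes M: "gm M" and N: "gm N" and I: "ideal I A" and db: "dual_basis M n q d \<phi>" and F: "lmap k M N F"
  and FJ: "!!x. x : carrier M ==> F x : IM J N" and x: "x : IM K M"
  and JK: "!!a b. a : K ==> b : J ==> a \<otimes> b : I"
 shows "F x : IM I N"
proof -
 note c = db_closed[OF M db] and xc = IM_carrier[OF x]
 have "\<phi> i x \<odot>\<^bsub>N\<^esub> F (q i) : IM I N" if i: "i < n" for i
  unfolding IM_def
 proof (intro CollectI conjI allI impI)
  show "\<phi> i x \<odot>\<^bsub>N\<^esub> F (q i) : carrier N" using c i xc lmap_closed[OF F] N by simp
  fix m \<psi> assume \<psi>: "lmap m N U \<psi>"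
  have "\<psi> (\<phi> i x \<odot>\<^bsub>N\<^esub> F (q i)) = \<phi> i x \<otimes> \<psi> (F (q i))"
   using lmap_smult[OF \<psi> c(2)[OF i xc] lmap_closed[OF F c(1)[OF i]]] by simp
  then show "\<psi> (\<phi> i x \<odot>\<^bsub>N\<^esub> F (q i)) : I"
   using JK[OF IMD[OF x dbD(2)[OF db i]] IMD[OF FJ[OF c(1)[OF i]] \<psi>]] by simp
 qed
 then have "finsum N (%i. \<phi> i x \<odot>\<^bsub>N\<^esub> F (q i)) {..<n} : IM I N" by (intro IM_finsum[OF N I]) auto
 then show ?thesis unfolding db_expand[OF M N db F xc, symmetric] .
qed

lemma IM_prime_cancel:
 assumes M: "gm M" and p: "p : Spec A" and t: "t : carrier A" "t ~: p" and z: "z : carrier M"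
  and tz: "t \<odot>\<^bsub>M\<^esub> z : IM p M"
 shows "z : IM p M"
 unfolding IM_def
proof (intro CollectI conjI z allI impI)
 fix k \<psi> assume \<psi>: "lmap k M U \<psi>"
 have "t \<otimes> \<psi> z : p" using IMD[OF tz \<psi>] lmap_smult[OF \<psi> t(1) z] by simp
 then show "\<psi> z : p" using spec_notin[OF p t] lmap_closed[OF \<psi> z] by auto
qed

lemma box_comm_mod:
 assumes bd: "box_data J d e D" and X: "dg_module A X" and Y: "dg_module A Y" and f: "lmap k X Y f" and I: "ideal I A"
  and c: "!!x. x : carrier X ==> eqm I Y (f (\<partial>\<^bsub>X\<^esub> x)) (\<partial>\<^bsub>Y\<^esub> (f x))" and y: "y : carrier (box J d e D X)"
 shows "eqm I (box J d e D Y) (%i. f ((\<partial>\<^bsub>box J d e D X\<^esub> y) i)) (\<partial>\<^bsub>box J d e D Y\<^esub> (%i. f (y i)))"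
proof -
 note gX = dg_gm[OF X] and gY = dg_gm[OF Y]
 note gB = box_gm[OF bd gY]
 have cl: "(%i. f ((\<partial>\<^bsub>box J d e D X\<^esub> y) i)) : carrier (box J d e D Y)"
  "\<partial>\<^bsub>box J d e D Y\<^esub> (%i. f (y i)) : carrier (box J d e D Y)"
  using lmap_closed[OF box_map[OF bd gX gY f]] dgD(1)[OF box_dg[OF bd X]] dgD(1)[OF box_dg[OF bd Y]] y by auto
 have "((%i. f ((\<partial>\<^bsub>box J d e D X\<^esub> y) i)) \<ominus>\<^bsub>box J d e D Y\<^esub> \<partial>\<^bsub>box J d e D Y\<^esub> (%i. f (y i))) : IM I (box J d e D Y)"
 proof (rule box_IM[OF bd gY I group_closed(3)[OF gm_group[OF gB] cl]])
  fix i assume i: "i : J"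
  have "f (\<partial>\<^bsub>X\<^esub> (y i)) \<ominus>\<^bsub>Y\<^esub> \<partial>\<^bsub>Y\<^esub> (f (y i)) : IM I Y" by (rule eqmD(3)[OF c[OF box_all[OF y gX]]])
  then show "((%i. f ((\<partial>\<^bsub>box J d e D X\<^esub> y) i)) \<ominus>\<^bsub>box J d e D Y\<^esub> \<partial>\<^bsub>box J d e D Y\<^esub> (%i. f (y i))) i : IM I Y"
   unfolding box_map_diff[OF bd X Y f y] using i IM_minus[OF gY I] by (simp add: koszul_def)
 qed
 then show ?thesis using cl by (simp add: eqm_def)
qed

lemma unit_component: "component U (rgrad A) = GA.cmp"
 by (rule ext) (simp add: component_def decomposes_def unit_finsum)

lemma cmp_mult:
 assumes "t : rgrad A l" "c : carrier A" shows "GA.cmp (t \<otimes> c) i = t \<otimes> GA.cmp c (i - l)"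
proof -
 have "lmap (0 + l) U U (%x. t \<odot>\<^bsub>U\<^esub> x)" by (rule lmap_smult_left[OF unit_gm unit_gm lmap_id assms(1)])
 from lmap_cmp[OF unit_gm unit_gm this, of c "i - l"] assms(2) show ?thesis by (simp add: unit_component)
qed

definition adj :: "'a set => 'a => 'a set" where
 "adj I t = I <+>\<^bsub>A\<^esub> PIdl\<^bsub>A\<^esub> t"

lemma adj_iff: "t : carrier A ==> z : adj I t \<longleftrightarrow> (EX r:I. EX c:carrier A. z = r \<oplus> t \<otimes> c)"
 by (auto simp: adj_def set_add_def' cgenideal_def m_comm)

lemma adj_homogeneous:
 assumes I: "homogeneous_ideal A I" and t: "t : rgrad A l"
 shows "homogeneous_ideal A (adj I t)" "I \<subseteq> adj I t" "t : adj I t"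
proof -
 have i: "ideal I A" using I by (simp add: homogeneous_ideal_def)
 note s = ideal_simps[OF i] and tc = GA.G_carrier[OF t]
 have "ideal (adj I t) A" unfolding adj_def by (rule add_ideals[OF i cgenideal_ideal[OF tc]])
 moreover have "GA.cmp z k : adj I t" if z: "z : adj I t" for z k
 proof -
  obtain r c where rc: "r : I" "c : carrier A" "z = r \<oplus> t \<otimes> c" using z[unfolded adj_iff[OF tc]] by blast
  have "GA.cmp z k = GA.cmp r k \<oplus> t \<otimes> GA.cmp c (k - l)"
   using rc s(1)[OF rc(1)] tc cmp_mult[OF t rc(2)] by (simp add: GA.cmp_add)
  moreover have "GA.cmp r k : I" using I rc(1) by (simp add: homogeneous_ideal_def)
  ultimately show ?thesis unfolding adj_iff[OF tc] using GA.cmp_carrier[OF rc(2)]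
   by (intro bexI[of _ "GA.cmp r k"] bexI[of _ "GA.cmp c (k - l)"])
 qed
 ultimately show "homogeneous_ideal A (adj I t)" by (simp add: homogeneous_ideal_def)
 show "I \<subseteq> adj I t"
 proof
  fix r assume r: "r : I"
  have "r = r \<oplus> t \<otimes> \<zero>" using tc s(1)[OF r] by simp
  then show "r : adj I t" unfolding adj_iff[OF tc] using r by (intro bexI[of _ r] bexI[of _ \<zero>]) simp_all
 qed
 have "t = \<zero> \<oplus> t \<otimes> \<one>" using tc by simp
 then show "t : adj I t" unfolding adj_iff[OF tc] using s(2) by (intro bexI[of _ \<zero>] bexI[of _ \<one>]) simp_all
qed

text \<open>Each coordinate of \<open>z\<close> has the form \<open>r + t b\<close> with
  \<open>r\<close> in \<open>I\<close>. Passing to the component of degree \<open>e - d k\<close>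
  keeps this form and makes \<open>b\<close> homogeneous, so the quotient \<open>y\<close> is
  homogeneous of degree \<open>e - l\<close>.\<close>

lemma adj_divide:
 assumes N: "gm N" and db: "dual_basis N n q d \<phi>" and I: "homogeneous_ideal A I" and t: "t : rgrad A l"
  and z: "z : mgrad N e" "z : IM (adj I t) N"
 shows "EX y:mgrad N (e - l). eqm I N z (t \<odot>\<^bsub>N\<^esub> y)"
proof -
 have i: "ideal I A" using I by (simp add: homogeneous_ideal_def)
 note s = ideal_simps[OF i] and tc = GA.G_carrier[OF t] and c = db_closed[OF N db]
 have zc: "z : carrier N" using gm_carrier[OF N z(1)] .
 interpret N: graded_group N "mgrad N" by (rule gm_graded[OF N])
 have "EX b:rgrad A (e - d k - l). \<phi> k z \<ominus> t \<otimes> b : I" if k: "k < n" for k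
 proof -
  obtain r b where rb: "r : I" "b : carrier A" "\<phi> k z = r \<oplus> t \<otimes> b"
   using IMD[OF z(2) dbD(2)[OF db k]] adj_iff[OF tc] by blast
  have "\<phi> k z = GA.cmp (r \<oplus> t \<otimes> b) (e - d k)"
   using GA.cmp_hom[OF c(3)[OF k z(1)], of "e - d k"] rb(3) by simp
  also have "\<dots> = GA.cmp r (e - d k) \<oplus> t \<otimes> GA.cmp b (e - d k - l)"
   using rb s(1)[OF rb(1)] tc cmp_mult[OF t rb(2)] by (simp add: GA.cmp_add)
  finally have "\<phi> k z \<ominus> t \<otimes> GA.cmp b (e - d k - l) = GA.cmp r (e - d k)"
   using rb s(1)[OF rb(1)] tc by (simp add: group_arith)
  moreover have "GA.cmp r (e - d k) : I" using I rb(1) by (simp add: homogeneous_ideal_def)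
  ultimately show ?thesis using GA.cmp_in[OF rb(2)] by (intro bexI[of _ "GA.cmp b (e - d k - l)"]) simp_all
 qed
 then obtain b where b: "!!k. k < n ==> b k : rgrad A (e - d k - l)" "!!k. k < n ==> \<phi> k z \<ominus> t \<otimes> b k : I"
  by metis
 have bc: "b k : carrier A" if "k < n" for k using GA.G_carrier[OF b(1)[OF that]] .
 define y where "y = finsum N (%k. b k \<odot>\<^bsub>N\<^esub> q k) {..<n}"
 have "y : mgrad N (e - l)" unfolding y_def
 proof (rule N.G_finsum, rule)
  fix k assume "k : {..<n}"
  then show "b k \<odot>\<^bsub>N\<^esub> q k : mgrad N (e - l)" using gm_smult_deg[OF N b(1) dbD(1)[OF db], of k k] by simp
 qed
 moreover have "eqm I N (finsum N (%k. \<phi> k z \<odot>\<^bsub>N\<^esub> q k) {..<n}) (finsum N (%k. (t \<otimes> b k) \<odot>\<^bsub>N\<^esub> q k) {..<n})"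
 proof (rule eqm_finsum[OF N i])
  fix k assume "k : {..<n}"
  then have k: "k < n" by simp
  show "eqm I N (\<phi> k z \<odot>\<^bsub>N\<^esub> q k) ((t \<otimes> b k) \<odot>\<^bsub>N\<^esub> q k)" unfolding eqm_def
   using IM_ideal_smult[OF N i c(1)[OF k] b(2)[OF k]] c[OF k] zc N bc[OF k] tc by (simp add: smult_diff_l)
 qed simp
 moreover have "finsum N (%k. (t \<otimes> b k) \<odot>\<^bsub>N\<^esub> q k) {..<n} = t \<odot>\<^bsub>N\<^esub> y"
  unfolding y_def using N bc c tc by (subst smult_finsum[OF N tc]) (auto intro!: finsum_congr simp: smult_smult)
 ultimately show ?thesis using dbD(3)[OF db zc] by auto
qed

text \<open>A leading term argument. Let \<open>k\<close> and \<open>m\<close> be the top degrees in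
  which \<open>a\<close> and \<open>b\<close> have components outside \<open>I\<close>. In degree
  \<open>k + m\<close> of the product every term but one contains a component above \<open>k\<close>
  or above \<open>m\<close>, so the product of the two top components lies in
  \<open>I\<close>.\<close>

lemma homogeneous_prime:
 assumes I: "homogeneous_ideal A I" and proper: "I ~= carrier A"
  and pr: "!!a b i j. a : rgrad A i ==> b : rgrad A j ==> a \<otimes> b : I ==> a : I \<or> b : I"
 shows "I : Spec A"
proof -
 have i: "ideal I A" using I by (simp add: homogeneous_ideal_def)
 note s = ideal_simps[OF i]
 have Ic: "GA.cmp x k : I" if "x : I" for x k using that I by (simp add: homogeneous_ideal_def)
 have top: "EX k. GA.cmp x k ~: I & (ALL l>k. GA.cmp x l : I)" if x: "x : carrier A" "x ~: I" for x
 proof -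
  let ?B = "{k. GA.cmp x k ~: I}"
  have "?B \<subseteq> {k. GA.cmp x k ~= \<zero>}" using s(2) by auto
  then have fin: "finite ?B" using GA.cmp_finite[OF x(1)] finite_subset by blast
  have "finsum A (GA.cmp x) {k. GA.cmp x k ~= \<zero>} : I" if "?B = {}"
   using that by (intro ideal_finsum[OF i GA.cmp_finite[OF x(1)]]) auto
  then have ne: "?B ~= {}" using GA.cmp_sum[OF x(1)] x(2) by auto
  have "Max ?B : ?B" by (rule Max_in[OF fin ne])
  moreover have "ALL l>Max ?B. GA.cmp x l : I" using Max_ge[OF fin] by force
  ultimately show ?thesis by blast
 qed
 have "a : I \<or> b : I" if a: "a : carrier A" and b: "b : carrier A" and ab: "a \<otimes> b : I" for a b
 proof (rule ccontr)
  assume "\<not> (a : I \<or> b : I)"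
  then obtain k m where k: "GA.cmp a k ~: I" "ALL l>k. GA.cmp a l : I" and m: "GA.cmp b m ~: I" "ALL l>m. GA.cmp b l : I"
   using top[OF a] top[OF b] by blast
  let ?F = "{l. GA.cmp a l ~= \<zero>}"
  have F: "finite ?F" by (rule GA.cmp_finite[OF a])
  have kF: "k : ?F" using k(1) s(2) by auto
  let ?g = "%l. GA.cmp a l \<otimes> GA.cmp b (k + m - l)"
  have "GA.cmp (a \<otimes> b) (k + m) = GA.cmp (finsum A (%l. GA.cmp a l \<otimes> b) ?F) (k + m)"
   using GA.cmp_sum[OF a] a b F finsum_ldistr[OF F b, of "GA.cmp a"] by simp
  also have "\<dots> = finsum A (%l. GA.cmp (GA.cmp a l \<otimes> b) (k + m)) ?F"
   using a b by (intro additive_finsum) (simp_all add: GA.cmp_add)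
  also have "\<dots> = finsum A ?g ?F"
   using cmp_mult[OF GA.cmp_in[OF a] b] by simp
  also have "\<dots> = ?g k \<oplus> finsum A ?g (?F - {k})"
   using GA.finsum_insert[of "?F - {k}" k ?g] F kF a b by (simp add: insert_absorb)
  finally have e: "GA.cmp (a \<otimes> b) (k + m) = ?g k \<oplus> finsum A ?g (?F - {k})" .
  have "finsum A ?g (?F - {k}) : I"
  proof (rule ideal_finsum[OF i])
   fix l assume "l : ?F - {k}"
   then consider "l > k" | "k + m - l > m" by fastforce
   then show "?g l : I" using k(2) m(2) s(6,7) a b by cases auto
  qed (use F in simp)
  then have "GA.cmp (a \<otimes> b) (k + m) \<ominus> finsum A ?g (?F - {k}) : I" using s(5) Ic[OF ab] by blast
  moreover have "GA.cmp (a \<otimes> b) (k + m) \<ominus> finsum A ?g (?F - {k}) = ?g k"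
   unfolding e using a b by (simp add: group_arith)
  ultimately have "GA.cmp a k \<otimes> GA.cmp b m : I" by simp
  then show False using pr[OF GA.cmp_in[OF a] GA.cmp_in[OF b]] k(1) m(1) by blast
 qed
 then have "primeideal I A" using proper by (intro primeidealI[OF i is_cring]) auto
 then show ?thesis using I by (simp add: Spec_def)
qed

text \<open>The union of a chain of homogeneous ideals is finitely generated, and finitely many
  generators already lie in one member. So the union belongs to the chain, and Zorn's lemma applies
  to an arbitrary property \<open>N\<close>.\<close>

lemma homogeneous_ideal_maximal:
 assumes noeth: "graded_noetherian A" and J: "homogeneous_ideal A J" "\<not> N J"
 shows "EX I. homogeneous_ideal A I & \<not> N I & (ALL K. homogeneous_ideal A K --> I \<subset> K --> N K)"
proof -
 let ?F = "{I. homogeneous_ideal A I & \<not> N I}"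
 have "EX M:?F. ALL X:?F. M \<subseteq> X --> X = M"
 proof (rule subset_Zorn_nonempty)
  show "?F ~= {}" using J by blast
  fix C assume ne: "C ~= {}" and ch: "subset.chain ?F C"
  have CF: "C \<subseteq> ?F" and lin: "!!X Y. X : C ==> Y : C ==> X \<subseteq> Y \<or> Y \<subseteq> X"
   using ch by (auto simp: subset_chain_def)
  have Ci: "ideal X A" if "X : C" for X using CF that by (auto simp: homogeneous_ideal_def)
  have "ideal (\<Union>C) A"
  proof (rule idealI)
   show "subgroup (\<Union>C) (add_monoid A)"
   proof (rule GA.add.subgroupI)
    show "\<Union>C \<subseteq> carrier A" using ideal_simps(1)[OF Ci] by blast
    show "\<Union>C ~= {}" using ne ideal_simps(2)[OF Ci] by blast
    show "\<ominus> a \<in> \<Union>C" if "a \<in> \<Union>C" for a using that ideal_simps(4)[OF Ci] by blast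
    show "a \<oplus> b \<in> \<Union>C" if ab: "a \<in> \<Union>C" "b \<in> \<Union>C" for a b
    proof -
     obtain X Y where "X : C" "Y : C" "a : X" "b : Y" using ab by blast
     then obtain Z where "Z : C" "a : Z" "b : Z" using lin by blast
     then show ?thesis using ideal_simps(3)[OF Ci] by blast
    qed
   qed
  qed (use ideal_simps(6,7)[OF Ci] ring_axioms in blast)+
  moreover have "GA.cmp x k \<in> \<Union>C" if "x \<in> \<Union>C" for x k
   using that CF by (auto simp: homogeneous_ideal_def)
  ultimately have hom: "homogeneous_ideal A (\<Union>C)" by (simp add: homogeneous_ideal_def)
  then obtain B where B: "B \<subseteq> carrier A" "finite B" "\<Union>C = genideal A B"
   using noeth unfolding graded_noetherian_def by blast
  have BC: "B \<subseteq> \<Union>C" unfolding B(3) by (rule genideal_self[OF B(1)])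
  obtain X where X: "X : C" "B \<subseteq> X" using finite_subset_Union_chain[OF B(2) BC ne ch] by blast
  have "\<Union>C \<subseteq> X" unfolding B(3) by (rule genideal_minimal[OF Ci[OF X(1)] X(2)])
  then have "\<Union>C = X" using X(1) by blast
  then show "\<Union>C \<in> ?F" using X(1) CF by blast
 qed
 then show ?thesis by blast
qed

lemma zero_dg_perf: "dg_module A zero_dg" "fg zero_dg"
proof -
 have g: "gm (zero_dg :: ('a, unit) dg_module)"
  by (rule gmI[where c = "%_ _. ()"]) simp_all
 show "dg_module A zero_dg" by (rule dgI[OF g]) (simp_all add: lmap_def)
 show "fg zero_dg" unfolding fg_def dual_basis_def by (intro exI[of _ 0]) simp
qed

end

section \<open>Functorial enlargements that detect T\<close>

context tensor_ideal
begin

text \<open>A functorial enlargement \<open>io X : X \<rightarrow> GO X\<close> through which \<open>T\<close> can be detected: by the last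
 condition, a map that factors up to homotopy through \<open>T\<close> after enlarging its target already does so before.\<close>

definition good :: "(('a, 'm) dg_module => ('a, 'm) dg_module) =>
  (('a, 'm) dg_module => ('a, 'm) dg_module => ('m => 'm) => 'm => 'm) => (('a, 'm) dg_module => 'm => 'm) => bool" where
 "good GO GM io \<longleftrightarrow>
  (ALL X:perf A. GO X : perf A & cm X (GO X) (io X)) &
  (ALL X:perf A. ALL Y:perf A. ALL k f. lmap k X Y f -->
   lmap k (GO X) (GO Y) (GM X Y f) & (ALL x:carrier X. GM X Y f (io X x) = io Y (f x)) &
   (ALL I. ideal I A -->
    ((ALL x:carrier X. eqm I Y (f (\<partial>\<^bsub>X\<^esub> x)) (\<partial>\<^bsub>Y\<^esub> (f x))) -->
     (ALL z:carrier (GO X). eqm I (GO Y) (GM X Y f (\<partial>\<^bsub>GO X\<^esub> z)) (\<partial>\<^bsub>GO Y\<^esub> (GM X Y f z)))) &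
    ((ALL x:carrier X. f x : IM I Y) --> (ALL z:carrier (GO X). GM X Y f z : IM I (GO Y))))) &
  (ALL X:perf A. ALL P:(perf A :: ('a, 'm) dg_module set). ALL g. ALL V:T. cm P X g --> fac V P (GO X) (%x. io X (g x)) --> (EX V':T. fac V' P X g))"

lemma goodD:
 fixes P :: "('a, 'm) dg_module"
 assumes "good GO GM io" and X: "X : perf A"
 shows "GO X : perf A" "cm X (GO X) (io X)"
  and "Y : perf A ==> lmap k X Y f ==> lmap k (GO X) (GO Y) (GM X Y f)"
  and "Y : perf A ==> lmap k X Y f ==> x : carrier X ==> GM X Y f (io X x) = io Y (f x)"
  and "Y : perf A ==> lmap k X Y f ==> ideal I A ==> (!!x. x : carrier X ==> eqm I Y (f (\<partial>\<^bsub>X\<^esub> x)) (\<partial>\<^bsub>Y\<^esub> (f x))) ==>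
   z : carrier (GO X) ==> eqm I (GO Y) (GM X Y f (\<partial>\<^bsub>GO X\<^esub> z)) (\<partial>\<^bsub>GO Y\<^esub> (GM X Y f z))"
  and "Y : perf A ==> lmap k X Y f ==> ideal I A ==> (!!x. x : carrier X ==> f x : IM I Y) ==>
   z : carrier (GO X) ==> GM X Y f z : IM I (GO Y)"
  and "P : perf A ==> V : T ==> cm P X g ==> fac V P (GO X) (%x. io X (g x)) ==> EX V':T. fac V' P X g"
proof -
 note g = assms(1)[unfolded good_def]
 note 1 = g[THEN conjunct1, rule_format, OF X]
 note 2 = g[THEN conjunct2, THEN conjunct1, rule_format, OF X]
 note 3 = g[THEN conjunct2, THEN conjunct2, rule_format, OF X]
 show "GO X : perf A" "cm X (GO X) (io X)" using 1 by simp_all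
 show "lmap k (GO X) (GO Y) (GM X Y f)" if "Y : perf A" "lmap k X Y f"
  by (rule 2[OF that, THEN conjunct1])
 show "GM X Y f (io X x) = io Y (f x)" if "Y : perf A" "lmap k X Y f" "x : carrier X"
  by (rule 2[OF that(1,2), THEN conjunct2, THEN conjunct1, rule_format, OF that(3)])
 show "eqm I (GO Y) (GM X Y f (\<partial>\<^bsub>GO X\<^esub> z)) (\<partial>\<^bsub>GO Y\<^esub> (GM X Y f z))"
  if "Y : perf A" "lmap k X Y f" "ideal I A" "!!x. x : carrier X ==> eqm I Y (f (\<partial>\<^bsub>X\<^esub> x)) (\<partial>\<^bsub>Y\<^esub> (f x))"
   "z : carrier (GO X)"
  by (rule 2[OF that(1,2), THEN conjunct2, THEN conjunct2, rule_format, OF that(3), THEN conjunct1, rule_format, OF that(4,5)])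
 show "GM X Y f z : IM I (GO Y)"
  if "Y : perf A" "lmap k X Y f" "ideal I A" "!!x. x : carrier X ==> f x : IM I Y" "z : carrier (GO X)"
  by (rule 2[OF that(1,2), THEN conjunct2, THEN conjunct2, rule_format, OF that(3), THEN conjunct2, rule_format, OF that(4,5)])
 show "EX V':T. fac V' P X g" if "P : perf A" "V : T" "cm P X g" "fac V P (GO X) (%x. io X (g x))"
  by (rule 3[OF that])
qed

lemma good_id: "good (%X. X) (%X Y f. f) (%X x. x)"
 unfolding good_def by (intro conjI ballI allI impI) (auto simp: cm_id)

lemma good_comp:
 assumes L: "good LO LM li" and K: "good KO KM ki"
 shows "good (%X. KO (LO X)) (%X Y f. KM (LO X) (LO Y) (LM X Y f)) (%X x. ki (LO X) (li X x))"
 unfolding good_def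
proof (intro conjI ballI allI impI)
 fix X :: "('a, 'm) dg_module" assume X: "X : perf A"
 note 1 = goodD[OF L X] and 2 = goodD[OF K goodD(1)[OF L X]]
 show "KO (LO X) : perf A" "cm X (KO (LO X)) (%x. ki (LO X) (li X x))"
  using 2(1) cm_comp[OF 1(2) 2(2)] by auto
 {
  fix Y :: "('a, 'm) dg_module" and k f assume Y: "Y : perf A" and f: "lmap k X Y f"
  note Lf = 1(3)[OF Y f] and LY = goodD(1)[OF L Y]
  show "lmap k (KO (LO X)) (KO (LO Y)) (KM (LO X) (LO Y) (LM X Y f))" by (rule 2(3)[OF LY Lf])
  show "KM (LO X) (LO Y) (LM X Y f) (ki (LO X) (li X x)) = ki (LO Y) (li Y (f x))" if x: "x : carrier X" for x
   using 2(4)[OF LY Lf lmap_closed[OF cmD(1)[OF 1(2)] x]] 1(4)[OF Y f x] by simp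
  fix I z assume I: "ideal I A" and z: "z : carrier (KO (LO X))"
  show "eqm I (KO (LO Y)) (KM (LO X) (LO Y) (LM X Y f) (\<partial>\<^bsub>KO (LO X)\<^esub> z)) (\<partial>\<^bsub>KO (LO Y)\<^esub> (KM (LO X) (LO Y) (LM X Y f) z))"
   if "ALL x:carrier X. eqm I Y (f (\<partial>\<^bsub>X\<^esub> x)) (\<partial>\<^bsub>Y\<^esub> (f x))"
   by (rule 2(5)[OF LY Lf I 1(5)[OF Y f I bspec[OF that]] z])
  show "KM (LO X) (LO Y) (LM X Y f) z : IM I (KO (LO Y))" if "ALL x:carrier X. f x : IM I Y"
   by (rule 2(6)[OF LY Lf I 1(6)[OF Y f I bspec[OF that]] z])
 }
 fix P :: "('a, 'm) dg_module" and g V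
 assume P: "P : perf A" and V: "V : T" and g: "cm P X g" and fa: "fac V P (KO (LO X)) (%x. ki (LO X) (li X (g x)))"
 obtain V' where "V' : T" "fac V' P (LO X) (%x. li X (g x))"
  using 2(7)[OF P V cm_comp[OF g 1(2)] fa] by blast
 then show "EX V':T. fac V' P X g" by (rule 1(7)[OF P _ g])
qed

text \<open>The enlargement of \<open>X\<close> by the cone of the evaluation \<open>Q \<otimes> Q\<^sup>* \<otimes> X \<rightarrow> X\<close>, for \<open>Q\<close> in \<open>T\<close>.\<close>

lemma good_evaluation_cone:
 assumes Q: "Q : T" and db: "dual_basis Q n q d \<phi>"
 shows "EX GO GM io. good GO GM io & (ALL X:perf A. ALL I x \<psi> k m. ideal I A --> x : mgrad Q k --> \<partial>\<^bsub>Q\<^esub> x : IM I Q -->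
  lmap m Q U \<psi> --> (ALL y:carrier Q. \<psi> (\<partial>\<^bsub>Q\<^esub> y) : I) --> even (k + m) -->
  (EX h. lmap (k + m + 1) X (GO X) h &
   (ALL y:carrier X. eqm I (GO X) (\<psi> x \<odot>\<^bsub>GO X\<^esub> io X y) (\<partial>\<^bsub>GO X\<^esub> (h y) \<oplus>\<^bsub>GO X\<^esub> h (\<partial>\<^bsub>X\<^esub> y)))))"
proof -
 note Qd = T_perf(1)[OF Q]
 note bd = tensor_box_data[OF Qd db] and bd' = dual_box_data[OF tensor_box_data[OF Qd db]]
 let ?e = "%i j. \<phi> i (q j)" and ?D = "%i j. \<phi> i (\<partial>\<^bsub>Q\<^esub> (q j))"
 let ?Y = "%X. dual_box {..<n} d ?D X"
 let ?W = "%X. box {..<n} d ?e ?D (?Y X)"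
 define C where "C X = cone (?W X) X (box_ev {..<n} X)" for X :: "('a, 'm) dg_module"
 \<comment> \<open>\<open>f\<close> is applied to every entry, on the shifted summand as well and
   without a sign. This is compatible with the cone differential whenever \<open>f\<close> commutes
   with the differentials in the unsigned sense, whatever its degree.\<close>
 define H where "H f v = (f (fst v), %i j. f (snd v i j))" for f :: "'m => 'm" and v :: "'m \<times> (nat => nat => 'm)"
 define GO where "GO X = cpy (C X)" for X
 define GM where "GM X Y f = (%z. cp (C Y) (H f (dc (C X) z)))" for X Y f
 define io where "io X y = cp (C X) (y, \<zero>\<^bsub>?W X\<^esub>)" for X y
 have Y: "dg_module A (?Y X)" "fg (?Y X)" if "X : perf A" for X :: "('a, 'm) dg_module"
  using that box_dg[OF bd', of X] box_fg[OF bd', of X] by (auto simp: perf_iff)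
 have W: "dg_module A (?W X)" "fg (?W X)" if "X : perf A" for X :: "('a, 'm) dg_module"
  using Y[OF that] box_dg[OF bd, of "?Y X"] box_fg[OF bd, of "?Y X"] by auto
 have C: "dg_module A (C X)" "fg (C X)" if "X : perf A" for X
  using that W[OF that] box_ev_cm[OF bd, of X] unfolding C_def perf_iff by simp_all
 have iso: "cm (C X) (GO X) (cp (C X))" "cm (GO X) (C X) (dc (C X))"
  "x : carrier (C X) ==> dc (C X) (cp (C X) x) = x" if "X : perf A" for X x
  using cpy(1)[OF C[OF that]] by (auto simp: dg_iso_def GO_def)
 have GOp: "GO X : perf A" if "X : perf A" for X unfolding GO_def by (rule cpy(4)[OF C[OF that]])
 have Xd: "dg_module A X" "gm X" if "X : perf A" for X :: "('a, 'm) dg_module" using that by (simp_all add: perf_iff)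
 have inc: "cm X (C X) (%y. (y, \<zero>\<^bsub>?W X\<^esub>))" if X: "X : perf A" for X
 proof -
  interpret W: graded_group "?W X" "mgrad (?W X)" by (rule gm_graded[OF dg_gm[OF W(1)[OF X]]])
  interpret X: abelian_group X using Xd[OF X] by simp
  show ?thesis unfolding cm_def lmap_def C_def
   using Xd[OF X] W[OF X] dgD[OF Xd(1)[OF X]] dgD(7)[OF W(1)[OF X]] lmap_zero[OF _ _ cmD(1)[OF box_ev_cm[OF bd Xd(1)[OF X]]]]
   by (auto simp: W.minus_zero)
 qed
 have inner: "lmap k (?Y X) (?Y Y) (%v j. f (v j))" if "X : perf A" "Y : perf A" "lmap k X Y f" for k f and X Y :: "('a, 'm) dg_module"
  by (rule box_map[OF bd' Xd(2)[OF that(1)] Xd(2)[OF that(2)] that(3)])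
 have outer: "lmap k (?W X) (?W Y) (%w i j. f (w i j))" if p: "X : perf A" "Y : perf A" "lmap k X Y f" for k f and X Y :: "('a, 'm) dg_module"
  by (rule box_map[OF bd dg_gm[OF Y(1)[OF p(1)]] dg_gm[OF Y(1)[OF p(2)]] inner[OF p]])
 have Wall: "w i j : carrier X" if "X : perf A" "w : carrier (?W X)" for w i j and X :: "('a, 'm) dg_module"
  by (rule box_all[OF box_all[OF that(2) dg_gm[OF Y(1)[OF that(1)]]] Xd(2)[OF that(1)]])
 have Hl: "lmap k (C X) (C Y) (H f)" if p: "X : perf A" "Y : perf A" "lmap k X Y f" for k X Y f
 proof -
  have "(%i j. f (w i j)) : mgrad (?W Y) (i + k - 1)" if "w : mgrad (?W X) (i - 1)" for w i
   using lmap_deg[OF outer[OF p] that] by (simp add: algebra_simps)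
  then show ?thesis unfolding lmap_def C_def
   using lmapD[OF p(3)] lmapD(1-3)[OF outer[OF p]] by (auto simp: H_def)
 qed
 have Hc: "eqm I (C Y) (H f (\<partial>\<^bsub>C X\<^esub> v)) (\<partial>\<^bsub>C Y\<^esub> (H f v))"
  if p: "X : perf A" "Y : perf A" "lmap k X Y f" and I: "ideal I A"
   and c: "!!x. x : carrier X ==> eqm I Y (f (\<partial>\<^bsub>X\<^esub> x)) (\<partial>\<^bsub>Y\<^esub> (f x))" and v: "v : carrier (C X)" for k X Y f I v
 proof -
  obtain x w where xw: "v = (x, w)" "x : carrier X" "w : carrier (?W X)" using v unfolding C_def by auto
  note gX = Xd(2)[OF p(1)] and gY = Xd(2)[OF p(2)]
  note gWX = dg_gm[OF W(1)[OF p(1)]] and gWY = dg_gm[OF W(1)[OF p(2)]]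
  note f = lmapD[OF p(3)] and evX = lmapD[OF cmD(1)[OF box_ev_cm[OF bd Xd(1)[OF p(1)]]]]
   and evY = lmapD[OF cmD(1)[OF box_ev_cm[OF bd Xd(1)[OF p(2)]]]]
  let ?fw = "%i j. f (w i j)" and ?fd = "%i j. f ((\<partial>\<^bsub>?W X\<^esub> w) i j)"
  have fw: "?fw : carrier (?W Y)" by (rule lmap_closed[OF outer[OF p] xw(3)])
  have dw: "\<partial>\<^bsub>?W X\<^esub> w : carrier (?W X)" by (rule dgD(1)[OF W(1)[OF p(1)] xw(3)])
  have "eqm I (?W Y) ?fd (\<partial>\<^bsub>?W Y\<^esub> ?fw)"
   by (rule box_comm_mod[OF bd Y(1)[OF p(1)] Y(1)[OF p(2)] inner[OF p] I box_comm_mod[OF bd' Xd(1)[OF p(1)] Xd(1)[OF p(2)] p(3) I c] xw(3)])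
  from eqm_minus[OF gWY I this] have 2: "eqm I (?W Y) (%i j. f ((\<ominus>\<^bsub>?W X\<^esub> \<partial>\<^bsub>?W X\<^esub> w) i j)) (\<ominus>\<^bsub>?W Y\<^esub> \<partial>\<^bsub>?W Y\<^esub> ?fw)"
   using lmap_minus[OF gWX gWY outer[OF p] dw] by simp
  have ev: "f (box_ev {..<n} X w) = box_ev {..<n} Y ?fw"
   by (rule box_ev_lmap[OF gX gY p(3) Wall[OF p(1) xw(3)], symmetric])
  have 1: "eqm I Y (f (\<partial>\<^bsub>X\<^esub> x) \<oplus>\<^bsub>Y\<^esub> f (box_ev {..<n} X w)) (\<partial>\<^bsub>Y\<^esub> (f x) \<oplus>\<^bsub>Y\<^esub> box_ev {..<n} Y ?fw)"
   using eqm_add[OF gY I c[OF xw(2)] eqm_refl[OF gY I evY(1)[OF fw]]] ev by simp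
  have e1: "H f (\<partial>\<^bsub>C X\<^esub> v) = (f (\<partial>\<^bsub>X\<^esub> x) \<oplus>\<^bsub>Y\<^esub> f (box_ev {..<n} X w), %i j. f ((\<ominus>\<^bsub>?W X\<^esub> \<partial>\<^bsub>?W X\<^esub> w) i j))"
   using f(2)[OF dgD(1)[OF Xd(1)[OF p(1)] xw(2)] evX(1)[OF xw(3)]] unfolding C_def xw(1) H_def by simp
  have e2: "\<partial>\<^bsub>C Y\<^esub> (H f v) = (\<partial>\<^bsub>Y\<^esub> (f x) \<oplus>\<^bsub>Y\<^esub> box_ev {..<n} Y ?fw, \<ominus>\<^bsub>?W Y\<^esub> \<partial>\<^bsub>?W Y\<^esub> ?fw)"
   unfolding C_def xw(1) H_def by simp
  show ?thesis
   unfolding e1 e2 unfolding eqm_def C_def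
   using IM_pair[OF gY gWY I eqmD(3)[OF 1] eqmD(3)[OF 2]] eqmD(1,2)[OF 1] eqmD(1,2)[OF 2]
    cone_diff[OF gWY gY eqmD(1)[OF 1] eqmD(1)[OF 2] eqmD(2)[OF 1] eqmD(2)[OF 2]]
   by (simp only: cone_simps mem_Times_iff fst_conv snd_conv simp_thms)
 qed
 have HI: "H f v : IM I (C Y)" if p: "X : perf A" "Y : perf A" "lmap k X Y f" and I: "ideal I A"
   and c: "!!x. x : carrier X ==> f x : IM I Y" and v: "v : carrier (C X)" for k X Y f I v
 proof -
  obtain x w where xw: "v = (x, w)" "x : carrier X" "w : carrier (?W X)" using v unfolding C_def by auto
  note gY = Xd(2)[OF p(2)] and wi = box_all[OF xw(3) dg_gm[OF Y(1)[OF p(1)]]]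
  have "(%i j. f (w i j)) : IM I (?W Y)"
  proof (rule box_IM[OF bd dg_gm[OF Y(1)[OF p(2)]] I lmap_closed[OF outer[OF p] xw(3)]])
   show "(%j. f (w i j)) : IM I (?Y Y)" for i
    by (rule box_IM[OF bd' gY I lmap_closed[OF inner[OF p] wi] c[OF Wall[OF p(1) xw(3)]]])
  qed
  then show ?thesis unfolding C_def xw(1) H_def fst_conv snd_conv
   by (rule IM_pair[OF gY dg_gm[OF W(1)[OF p(2)]] I c[OF xw(2)]])
 qed
 have GMl: "lmap k (GO X) (GO Y) (GM X Y f)" if p: "X : perf A" "Y : perf A" "lmap k X Y f" for k X Y f
  using lmap_comp[OF lmap_comp[OF cmD(1)[OF iso(2)[OF p(1)]] Hl[OF p]] cmD(1)[OF iso(1)[OF p(2)]]] by (simp add: GM_def)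
 have "good GO GM io"
  unfolding good_def
 proof (intro conjI ballI allI impI)
  fix X :: "('a, 'm) dg_module" assume X: "X : perf A"
  show "GO X : perf A" by (rule GOp[OF X])
  show "cm X (GO X) (io X)" unfolding io_def[abs_def] by (rule cm_comp[OF inc[OF X] iso(1)[OF X]])
  {
   fix Y :: "('a, 'm) dg_module" and k f assume Y: "Y : perf A" and f: "lmap k X Y f"
   show "lmap k (GO X) (GO Y) (GM X Y f)" by (rule GMl[OF X Y f])
   show "GM X Y f (io X x) = io Y (f x)" if x: "x : carrier X" for x
   proof -
    have "(%i j. f (\<zero>\<^bsub>?W X\<^esub> i j)) = \<zero>\<^bsub>?W Y\<^esub>"
     by (rule lmap_zero[OF dg_gm[OF W(1)[OF X]] dg_gm[OF W(1)[OF Y]] outer[OF X Y f]])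
    then have "H f (x, \<zero>\<^bsub>?W X\<^esub>) = (f x, \<zero>\<^bsub>?W Y\<^esub>)" unfolding H_def fst_conv snd_conv by (rule arg_cong)
    then show ?thesis
     unfolding GM_def io_def iso(3)[OF X lmap_closed[OF cmD(1)[OF inc[OF X]] x]] by (rule arg_cong)
   qed
   fix I z assume I: "ideal I A" and z: "z : carrier (GO X)"
   note dz = lmap_closed[OF cmD(1)[OF iso(2)[OF X]] z]
   show "eqm I (GO Y) (GM X Y f (\<partial>\<^bsub>GO X\<^esub> z)) (\<partial>\<^bsub>GO Y\<^esub> (GM X Y f z))"
    if c: "ALL x:carrier X. eqm I Y (f (\<partial>\<^bsub>X\<^esub> x)) (\<partial>\<^bsub>Y\<^esub> (f x))"
    using eqm_lmap[OF dg_gm[OF C(1)[OF Y]] I Xd(2)[OF GOp[OF Y]] cmD(1)[OF iso(1)[OF Y]] Hc[OF X Y f I bspec[OF c] dz]]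
    unfolding GM_def cmD(2)[OF iso(2)[OF X] z] cmD(2)[OF iso(1)[OF Y] lmap_closed[OF Hl[OF X Y f] dz], symmetric] .
   show "GM X Y f z : IM I (GO Y)" if c: "ALL x:carrier X. f x : IM I Y"
    unfolding GM_def by (rule IM_lmap[OF cmD(1)[OF iso(1)[OF Y]] HI[OF X Y f I bspec[OF c] dz]])
  }
  fix P :: "('a, 'm) dg_module" and g V assume P: "P : perf A" and V: "V : T" and g: "cm P X g" and fa: "fac V P (GO X) (%x. io X (g x))"
  \<comment> \<open>The source of the evaluation is \<open>Q\<close> tensored with another object,
    so its copy belongs to \<open>T\<close>; \<open>T_descent\<close> is applied to the cone over
    this copy.\<close>
  let ?WQ = "cpy (?W X)" and ?E = "%z. box_ev {..<n} X (dc (?W X) z)"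
  have WQ: "?WQ : T" by (rule T_box[OF Q db Y[OF X]])
  have iW: "cm (?W X) ?WQ (cp (?W X))" "cm ?WQ (?W X) (dc (?W X))" "!!w. w : carrier (?W X) ==> dc (?W X) (cp (?W X) w) = w"
   using cpy(1)[OF W[OF X]] by (auto simp: dg_iso_def)
  have E: "cm ?WQ X ?E" by (rule cm_comp[OF iW(2) box_ev_cm[OF bd Xd(1)[OF X]]])
  let ?K = "%v. (fst v, cp (?W X) (snd v))"
  have K: "cm (C X) (cone ?WQ X ?E) ?K"
   unfolding cm_def lmap_def C_def
   using lmapD[OF cmD(1)[OF iW(1)]] lmap_deg[OF cmD(1)[OF iW(1)], simplified] cmD(2)[OF iW(1)] iW(3)
    lmap_minus[OF dg_gm[OF W(1)[OF X]] dg_gm[OF T_perf(1)[OF WQ]] cmD(1)[OF iW(1)] dgD(1)[OF W(1)[OF X]]]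
   by auto
  have Cn: "dg_module A (cone ?WQ X ?E)" by (rule cone_dg[OF T_perf(1)[OF WQ] Xd(1)[OF X] E])
  have "fac V P (cone ?WQ X ?E) (%x. (g x, \<zero>\<^bsub>?WQ\<^esub>))"
  proof (rule fac_comp[OF Xd(1)[OF P] Xd(1)[OF GOp[OF X]] Cn dg_gm[OF T_perf(1)[OF V]] fa cm_comp[OF iso(2)[OF X] K]])
   fix x assume "x : carrier P"
   then have "(g x, \<zero>\<^bsub>?W X\<^esub>) : carrier (C X)"
    using lmap_closed[OF cmD(1)[OF inc[OF X]] lmap_closed[OF cmD(1)[OF g]]] by simp
   then show "(g x, \<zero>\<^bsub>?WQ\<^esub>) = (fst (dc (C X) (io X (g x))), cp (?W X) (snd (dc (C X) (io X (g x)))))"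
    unfolding io_def iso(3)[OF X \<open>(g x, \<zero>\<^bsub>?W X\<^esub>) : carrier (C X)\<close>] fst_conv snd_conv
    using lmap_zero[OF dg_gm[OF W(1)[OF X]] dg_gm[OF T_perf(1)[OF WQ]] cmD(1)[OF iW(1)]] by simp
  qed
  then show "EX V':T. fac V' P X g" by (rule T_descent[OF WQ Xd(1)[OF X] E Xd(1)[OF P] V _ g])
 qed
 moreover have "EX h. lmap (k + m + 1) X (GO X) h &
   (ALL y:carrier X. eqm I (GO X) (\<psi> x \<odot>\<^bsub>GO X\<^esub> io X y) (\<partial>\<^bsub>GO X\<^esub> (h y) \<oplus>\<^bsub>GO X\<^esub> h (\<partial>\<^bsub>X\<^esub> y)))"
  if X: "X : perf A" and I: "ideal I A" and x: "x : mgrad Q k" and dx: "\<partial>\<^bsub>Q\<^esub> x : IM I Q" and \<psi>: "lmap m Q U \<psi>"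
   and d\<psi>: "ALL y:carrier Q. \<psi> (\<partial>\<^bsub>Q\<^esub> y) : I" and ev: "even (k + m)" for X :: "('a, 'm) dg_module" and I x \<psi> k m
 proof -
  let ?c = "cosection n q \<phi> x \<psi> X"
  note gX = Xd(2)[OF X] and gW = dg_gm[OF W(1)[OF X]] and cl = cosection_lmap[OF Qd db Xd(1)[OF X] x \<psi>]
  interpret X: graded_group X "mgrad X" by (rule gm_graded[OF gX])
  interpret W: abelian_group "?W X" using gW by simp
  have \<psi>x: "\<psi> x : carrier A" using lmap_closed[OF \<psi> gm_carrier[OF dg_gm[OF Qd] x]] by simp
  \<comment> \<open>The section of the evaluation, placed in the second component of the cone, is
    the homotopy. The differential of \<open>(0, c y)\<close> has first component
    \<open>\<psi> x y\<close>, and its second component cancels modulo \<open>I\<close> against the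
    section at the differential of \<open>y\<close>.\<close>
  have sl: "lmap (k + m + 1) X (C X) (%y. (\<zero>\<^bsub>X\<^esub>, ?c y))"
  proof -
   have "?c y : mgrad (?W X) (i + (k + m + 1) - 1)" if "y : mgrad X i" for y i using lmap_deg[OF cl that] by simp
   then show ?thesis unfolding lmap_def C_def using lmapD(1-3)[OF cl] gX by auto
  qed
  have "lmap (k + m + 1) X (GO X) (%y. cp (C X) (\<zero>\<^bsub>X\<^esub>, ?c y))"
   using lmap_comp[OF sl cmD(1)[OF iso(1)[OF X]]] by simp
  moreover have "eqm I (GO X) (\<psi> x \<odot>\<^bsub>GO X\<^esub> io X y)
    (\<partial>\<^bsub>GO X\<^esub> (cp (C X) (\<zero>\<^bsub>X\<^esub>, ?c y)) \<oplus>\<^bsub>GO X\<^esub> cp (C X) (\<zero>\<^bsub>X\<^esub>, ?c (\<partial>\<^bsub>X\<^esub> y)))" if y: "y : carrier X" for y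
  proof -
   have dy: "\<partial>\<^bsub>X\<^esub> y : carrier X" by (rule dgD(1)[OF Xd(1)[OF X] y])
   note c1 = lmap_closed[OF cl y] and c2 = lmap_closed[OF cl dy]
   note dc1 = dgD(1)[OF W(1)[OF X] c1]
   have "eqm I (?W X) (\<partial>\<^bsub>?W X\<^esub> (?c y)) (?c (\<partial>\<^bsub>X\<^esub> y))"
    by (rule cosection_diff[OF Qd db Xd(1)[OF X] x \<psi> I dx bspec[OF d\<psi>] ev y])
   then have m: "\<partial>\<^bsub>?W X\<^esub> (?c y) \<ominus>\<^bsub>?W X\<^esub> ?c (\<partial>\<^bsub>X\<^esub> y) : IM I (?W X)" by (rule eqmD(3))
   have s: "\<partial>\<^bsub>C X\<^esub> (\<zero>\<^bsub>X\<^esub>, ?c y) \<oplus>\<^bsub>C X\<^esub> (\<zero>\<^bsub>X\<^esub>, ?c (\<partial>\<^bsub>X\<^esub> y)) = (\<psi> x \<odot>\<^bsub>X\<^esub> y, (\<ominus>\<^bsub>?W X\<^esub> \<partial>\<^bsub>?W X\<^esub> (?c y)) \<oplus>\<^bsub>?W X\<^esub> ?c (\<partial>\<^bsub>X\<^esub> y))"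
    using box_ev_cosection[OF Qd db Xd(1)[OF X] x \<psi> y] dgD(7)[OF Xd(1)[OF X]] gX \<psi>x y by (simp add: C_def)
   have z: "\<psi> x \<odot>\<^bsub>C X\<^esub> (y, \<zero>\<^bsub>?W X\<^esub>) = (\<psi> x \<odot>\<^bsub>X\<^esub> y, \<zero>\<^bsub>?W X\<^esub>)"
    using gW \<psi>x by (simp add: C_def)
   have "eqm I (C X) (\<psi> x \<odot>\<^bsub>C X\<^esub> (y, \<zero>\<^bsub>?W X\<^esub>)) (\<partial>\<^bsub>C X\<^esub> (\<zero>\<^bsub>X\<^esub>, ?c y) \<oplus>\<^bsub>C X\<^esub> (\<zero>\<^bsub>X\<^esub>, ?c (\<partial>\<^bsub>X\<^esub> y)))"
   proof -
    have e: "\<zero>\<^bsub>?W X\<^esub> \<ominus>\<^bsub>?W X\<^esub> ((\<ominus>\<^bsub>?W X\<^esub> \<partial>\<^bsub>?W X\<^esub> (?c y)) \<oplus>\<^bsub>?W X\<^esub> ?c (\<partial>\<^bsub>X\<^esub> y)) = \<partial>\<^bsub>?W X\<^esub> (?c y) \<ominus>\<^bsub>?W X\<^esub> ?c (\<partial>\<^bsub>X\<^esub> y)"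
     using dc1 c2 by (simp add: W.minus_eq W.minus_add W.minus_minus)
    have "\<psi> x \<odot>\<^bsub>X\<^esub> y : carrier X" using gX \<psi>x y by simp
    then have "(\<psi> x \<odot>\<^bsub>X\<^esub> y, \<zero>\<^bsub>?W X\<^esub>) \<ominus>\<^bsub>C X\<^esub> (\<psi> x \<odot>\<^bsub>X\<^esub> y, (\<ominus>\<^bsub>?W X\<^esub> \<partial>\<^bsub>?W X\<^esub> (?c y)) \<oplus>\<^bsub>?W X\<^esub> ?c (\<partial>\<^bsub>X\<^esub> y)) =
      (\<zero>\<^bsub>X\<^esub>, \<partial>\<^bsub>?W X\<^esub> (?c y) \<ominus>\<^bsub>?W X\<^esub> ?c (\<partial>\<^bsub>X\<^esub> y))"
     using cone_diff[OF gW gX] dc1 c2 e unfolding C_def by (simp add: X.gr_diff_self)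
    then show ?thesis unfolding s z eqm_def
     using IM_pair[OF gX gW I IM_zero[OF gX I] m, of "box_ev {..<n} X"] dc1 c2 \<open>\<psi> x \<odot>\<^bsub>X\<^esub> y : carrier X\<close>
     by (simp add: C_def)
   qed
   from eqm_lmap[OF dg_gm[OF C(1)[OF X]] I Xd(2)[OF GOp[OF X]] cmD(1)[OF iso(1)[OF X]] this]
   show ?thesis unfolding io_def
    using lmapD[OF cmD(1)[OF iso(1)[OF X]]] cmD(2)[OF iso(1)[OF X]] lmap_closed[OF sl y] lmap_closed[OF sl dy]
     lmap_closed[OF cmD(1)[OF inc[OF X]] y] \<psi>x dgD(1)[OF C(1)[OF X]] by simp
  qed
  ultimately show ?thesis by blast
 qed
 ultimately show ?thesis by blast
qed

end

section \<open>The nilpotence argument modulo homogeneous ideals\<close>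

context tensor_ideal
begin

definition hz :: "'a set => ('a, 'm) dg_module => (('a, 'm) dg_module => ('a, 'm) dg_module) =>
  (('a, 'm) dg_module => 'm => 'm) => ('m => 'm) => bool" where
 "hz I P GO io h \<longleftrightarrow> lmap 1 P (GO P) h &
  (ALL x:carrier P. eqm I (GO P) (io P x) (\<partial>\<^bsub>GO P\<^esub> (h x) \<oplus>\<^bsub>GO P\<^esub> h (\<partial>\<^bsub>P\<^esub> x)))"

text \<open>Some good enlargement of \<open>P\<close> is null-homotopic modulo \<open>I\<close>.\<close>

definition negligible :: "('a, 'm) dg_module => 'a set => bool" where
 "negligible P I \<longleftrightarrow> (EX GO GM io h. good GO GM io & hz I P GO io h)"

text \<open>A chain map homotopic to \<open>g\<close>. If \<open>h\<close> contracts
  \<open>g\<close> modulo an ideal, its values lie in the corresponding submodule, so that vanishing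
  up to homotopy becomes divisibility on the nose.\<close>

definition defect :: "('a, 'm) dg_module => ('a, 'm) dg_module => ('m => 'm) => ('m => 'm) => 'm => 'm" where
 "defect P X g h x = g x \<ominus>\<^bsub>X\<^esub> (\<partial>\<^bsub>X\<^esub> (h x) \<oplus>\<^bsub>X\<^esub> h (\<partial>\<^bsub>P\<^esub> x))"

lemma defect:
 assumes P: "dg_module A P" and X: "dg_module A X" and g: "cm P X g" and h: "lmap 1 P X h"
 shows "cm P X (defect P X g h)"
  and "x : carrier P ==> g x = defect P X g h x \<oplus>\<^bsub>X\<^esub> (\<partial>\<^bsub>X\<^esub> (h x) \<oplus>\<^bsub>X\<^esub> h (\<partial>\<^bsub>P\<^esub> x))"
proof -
 note gP [simp] = dg_gm[OF P] and gX [simp] = dg_gm[OF X]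
 note D = dgD[OF P] dgD[OF X] lmapD[OF cmD(1)[OF g]] lmapD[OF h] lmapD0[OF gP gX h]
 have "lmap 0 P X (%x. \<partial>\<^bsub>X\<^esub> (h x) \<oplus>\<^bsub>X\<^esub> h (\<partial>\<^bsub>P\<^esub> x))"
  using lmap_add[OF gP gX lmap_comp[OF h dg_lmap[OF X]] lmap_cong[OF lmap_comp[OF dg_lmap[OF P] h] gP _ refl]] by simp
 then have "lmap 0 P X (defect P X g h)" unfolding defect_def[abs_def] by (rule lmap_subtract[OF gP gX cmD(1)[OF g]])
 then show "cm P X (defect P X g h)"
  unfolding cm_def by (simp add: defect_def D cmD(2)[OF g] group_arith group_closed)
 show "g x = defect P X g h x \<oplus>\<^bsub>X\<^esub> (\<partial>\<^bsub>X\<^esub> (h x) \<oplus>\<^bsub>X\<^esub> h (\<partial>\<^bsub>P\<^esub> x))" if "x : carrier P"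
  using that by (simp add: defect_def D group_arith group_closed)
qed

text \<open>The common part of the two negligibility arguments. The inclusion of \<open>P\<close>
  into the composite enlargement differs from \<open>ki\<close> applied to the defect by the exact
  homotopy coming from \<open>h\<close>. The remaining map is contracted modulo \<open>I\<close> by
  \<open>F k\<close>, so the sum of the two homotopies works. The degrees of \<open>k\<close> and
  \<open>F\<close> may vary as long as they add up to 1, which leaves room for dividing by a
  scalar.\<close>

lemma hz_comp:
 assumes L: "good LO LM li" and K: "good KO KM ki" and P: "P : perf A" and I: "ideal I A"
  and h: "lmap 1 P (LO P) h" and F: "lmap e (KO P) (KO (LO P)) F"
  and Fc: "!!z. z : carrier (KO P) ==> eqm I (KO (LO P)) (F (\<partial>\<^bsub>KO P\<^esub> z)) (\<partial>\<^bsub>KO (LO P)\<^esub> (F z))"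
  and k: "lmap j P (KO P) k" "j + e = 1"
  and main: "!!x. x : carrier P ==> eqm I (KO (LO P)) (ki (LO P) (defect P (LO P) (li P) h x)) (F (\<partial>\<^bsub>KO P\<^esub> (k x) \<oplus>\<^bsub>KO P\<^esub> k (\<partial>\<^bsub>P\<^esub> x)))"
 shows "negligible P I"
proof -
 note LP = goodD[OF L P] and KP = goodD[OF K P] and KLP = goodD[OF K goodD(1)[OF L P]]
 let ?N = "KO (LO P)" and ?f = "defect P (LO P) (li P) h"
 have d: "dg_module A P" "dg_module A (LO P)" "dg_module A (KO P)" "dg_module A ?N"
  using P LP(1) KP(1) KLP(1) by (simp_all add: perf_iff)
 note g [simp] = d[THEN dg_gm]
 note D = d[THEN dgD(1)] lmapD[OF k(1)] lmapD[OF F] lmapD[OF h] lmapD[OF cmD(1)[OF KLP(2)]]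
 let ?H = "%x. F (k x) \<oplus>\<^bsub>?N\<^esub> ki (LO P) (h x)"
 have Hl: "lmap 1 P ?N ?H"
  using lmap_comp[OF k(1) F] lmap_comp[OF h cmD(1)[OF KLP(2)]] k(2) by (intro lmap_add) simp_all
 have "eqm I ?N (ki (LO P) (li P x)) (\<partial>\<^bsub>?N\<^esub> (?H x) \<oplus>\<^bsub>?N\<^esub> ?H (\<partial>\<^bsub>P\<^esub> x))" if x: "x : carrier P" for x
 proof -
  note fx = defect(2)[OF d(1,2) LP(2) h x] and fc = lmap_closed[OF cmD(1)[OF defect(1)[OF d(1,2) LP(2) h]] x]
  let ?a = "\<partial>\<^bsub>?N\<^esub> (ki (LO P) (h x)) \<oplus>\<^bsub>?N\<^esub> ki (LO P) (h (\<partial>\<^bsub>P\<^esub> x))"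
  let ?b = "F (\<partial>\<^bsub>KO P\<^esub> (k x)) \<oplus>\<^bsub>?N\<^esub> F (k (\<partial>\<^bsub>P\<^esub> x))"
  have ac: "?a : carrier ?N" using x by (simp add: D group_closed)
  have "ki (LO P) (li P x) = ki (LO P) (?f x) \<oplus>\<^bsub>?N\<^esub> ?a"
   unfolding fx using x fc by (simp add: D cmD(2)[OF KLP(2)] group_closed)
  moreover have "eqm I ?N (ki (LO P) (?f x)) ?b" using main[OF x] x by (simp add: D)
  moreover have "eqm I ?N ?b (\<partial>\<^bsub>?N\<^esub> (F (k x)) \<oplus>\<^bsub>?N\<^esub> F (k (\<partial>\<^bsub>P\<^esub> x)))"
   using x by (intro eqm_add[OF g(4) I Fc eqm_refl[OF g(4) I]]) (simp_all add: D)
  ultimately have "eqm I ?N (ki (LO P) (li P x)) ((\<partial>\<^bsub>?N\<^esub> (F (k x)) \<oplus>\<^bsub>?N\<^esub> F (k (\<partial>\<^bsub>P\<^esub> x))) \<oplus>\<^bsub>?N\<^esub> ?a)"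
   using eqm_add[OF g(4) I eqm_trans[OF g(4) I] eqm_refl[OF g(4) I ac]] by metis
  moreover have "(\<partial>\<^bsub>?N\<^esub> (F (k x)) \<oplus>\<^bsub>?N\<^esub> F (k (\<partial>\<^bsub>P\<^esub> x))) \<oplus>\<^bsub>?N\<^esub> ?a = \<partial>\<^bsub>?N\<^esub> (?H x) \<oplus>\<^bsub>?N\<^esub> ?H (\<partial>\<^bsub>P\<^esub> x)"
   using x by (simp add: D dgD(2)[OF d(4)] abelian_group.group_rearrange[OF gm_group[OF g(4)]] group_closed)
  ultimately show ?thesis by simp
 qed
 then have "hz I P (%X. KO (LO X)) (%X x. ki (LO X) (li X x)) ?H" using Hl by (simp add: hz_def)
 then show ?thesis unfolding negligible_def using good_comp[OF L K] by blast
qed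

lemma negligible_carrier:
 assumes "P : perf A" shows "negligible P (carrier A)"
proof -
 have d: "dg_module A P" using assms by (simp add: perf_iff)
 note g = dg_gm[OF d]
 have "IM (carrier A) P = carrier P" unfolding IM_def using lmap_closed by fastforce
 then have "hz (carrier A) P (%X. X) (%X x. x) (%_. \<zero>\<^bsub>P\<^esub>)"
  using lmap_0[OF g] g dgD(7)[OF d] by (simp add: hz_def eqm_def group_closed)
 then show ?thesis unfolding negligible_def using good_id by blast
qed

text \<open>The defect of the first enlargement has values divisible by \<open>J\<close>, and so has
  the map \<open>F\<close> induced on the second enlargements. By naturality the inclusion followed
  by \<open>F\<close> is contracted up to \<open>F\<close> of an element divisible by
  \<open>K\<close>, and this is divisible by products, hence zero modulo \<open>I\<close>.\<close>

lemma negligible_product: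
 assumes P: "P : perf A" and I: "ideal I A" and J: "ideal J A" and K: "ideal K A"
  and nJ: "negligible P J" and nK: "negligible P K" and JK: "!!a b. a : K ==> b : J ==> a \<otimes> b : I"
 shows "negligible P I"
proof -
 obtain LO LM li h where L: "good LO LM li" and h: "hz J P LO li h" using nJ by (auto simp: negligible_def)
 obtain KO KM ki k where K': "good KO KM ki" and k: "hz K P KO ki k" using nK by (auto simp: negligible_def)
 note LP = goodD[OF L P] and KP = goodD[OF K' P] and KLP = goodD[OF K' goodD(1)[OF L P]]
 let ?N = "KO (LO P)" and ?f = "defect P (LO P) (li P) h"
 have d: "dg_module A P" "dg_module A (LO P)" "dg_module A (KO P)" "dg_module A ?N" and fgK: "fg (KO P)"
  using P LP(1) KP(1) KLP(1) by (simp_all add: perf_iff)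
 note g = d[THEN dg_gm]
 obtain n q dd \<phi> where db: "dual_basis (KO P) n q dd \<phi>" using fgK by (auto simp: fg_def)
 have hl: "lmap 1 P (LO P) h" and kl: "lmap 1 P (KO P) k" using h k by (simp_all add: hz_def)
 note f = defect(1)[OF d(1,2) LP(2) hl]
 let ?F = "KM P (LO P) ?f"
 note Fl = KP(3)[OF LP(1) cmD(1)[OF f]]
 have fJ: "?f x : IM J (LO P)" if x: "x : carrier P" for x
  unfolding defect_def by (rule eqmD(3)) (use h x in \<open>simp add: hz_def\<close>)
 have FJ: "?F z : IM J ?N" if "z : carrier (KO P)" for z
  by (rule KP(6)[OF LP(1) cmD(1)[OF f] J fJ that])
 show ?thesis
 proof (rule hz_comp[OF L K' P I hl Fl _ kl])
  fix z assume z: "z : carrier (KO P)"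
  show "eqm I ?N (?F (\<partial>\<^bsub>KO P\<^esub> z)) (\<partial>\<^bsub>?N\<^esub> (?F z))"
  proof (rule KP(5)[OF LP(1) cmD(1)[OF f] I _ z])
   fix x assume x: "x : carrier P"
   show "eqm I (LO P) (?f (\<partial>\<^bsub>P\<^esub> x)) (\<partial>\<^bsub>LO P\<^esub> (?f x))"
    unfolding cmD(2)[OF f x] by (rule eqm_refl[OF g(2) I dgD(1)[OF d(2) lmap_closed[OF cmD(1)[OF f] x]]])
  qed
 next
  fix x assume x: "x : carrier P"
  let ?z = "\<partial>\<^bsub>KO P\<^esub> (k x) \<oplus>\<^bsub>KO P\<^esub> k (\<partial>\<^bsub>P\<^esub> x)"
  have e: "eqm K (KO P) (ki P x) ?z" using k x by (simp add: hz_def)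
  have "?F (ki P x \<ominus>\<^bsub>KO P\<^esub> ?z) : IM I ?N"
   by (rule IM_product[OF g(3,4) I db Fl FJ eqmD(3)[OF e] JK])
  then have "eqm I ?N (?F (ki P x)) (?F ?z)"
   unfolding eqm_def lmap_diff[OF g(3,4) Fl eqmD(1,2)[OF e]] using lmap_closed[OF Fl] eqmD(1,2)[OF e] by simp
  then show "eqm I ?N (ki (LO P) (?f x)) (?F ?z)"
   unfolding KP(4)[OF LP(1) cmD(1)[OF f] x] .
 qed simp
qed

text \<open>Modulo \<open>p\<close> the defect of the first enlargement is divisible by
  \<open>t\<close>, say congruent to \<open>t u\<close>. The factor \<open>t\<close> is then spent
  on the second enlargement, where \<open>t\<close> times the inclusion is contracted by
  \<open>k\<close>: \<open>ki\<close> applied to \<open>t u\<close> is the map induced by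
  \<open>u\<close>, applied to \<open>t\<close> times the inclusion of \<open>P\<close>.\<close>

lemma negligible_prime:
 assumes P: "P : perf A" and p: "p : Spec A" and K: "good KO KM ki" and t: "t : rgrad A l" "t ~: p"
  and k: "lmap (l + 1) P (KO P) k"
  and tk: "!!x. x : carrier P ==> eqm p (KO P) (t \<odot>\<^bsub>KO P\<^esub> ki P x) (\<partial>\<^bsub>KO P\<^esub> (k x) \<oplus>\<^bsub>KO P\<^esub> k (\<partial>\<^bsub>P\<^esub> x))"
  and nJ: "negligible P (adj p t)"
 shows "negligible P p"
proof -
 note hp = SpecD(1)[OF p] and I = SpecD(2)[OF p] and tc = GA.G_carrier[OF t(1)]
 obtain LO LM li h where L: "good LO LM li" and h: "hz (adj p t) P LO li h" using nJ by (auto simp: negligible_def)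
 note LP = goodD[OF L P] and KP = goodD[OF K P] and KLP = goodD[OF K goodD(1)[OF L P]]
 let ?N = "KO (LO P)" and ?f = "defect P (LO P) (li P) h"
 have d: "dg_module A P" "dg_module A (LO P)" "dg_module A (KO P)" "dg_module A ?N" and fgL: "fg P" "fg (LO P)"
  using P LP(1) KP(1) KLP(1) by (simp_all add: perf_iff)
 note g = d[THEN dg_gm]
 obtain n q dq \<phi> where db: "dual_basis P n q dq \<phi>" using fgL by (auto simp: fg_def)
 obtain n' q' dq' \<phi>' where db': "dual_basis (LO P) n' q' dq' \<phi>'" using fgL by (auto simp: fg_def)
 have hl: "lmap 1 P (LO P) h" using h by (simp add: hz_def)
 note f = defect(1)[OF d(1,2) LP(2) hl] and c = db_closed[OF g(1) db]
 have fJ: "?f x : IM (adj p t) (LO P)" if x: "x : carrier P" for x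
  unfolding defect_def by (rule eqmD(3)) (use h x in \<open>simp add: hz_def\<close>)
 have "EX y:mgrad (LO P) (dq i - l). eqm p (LO P) (?f (q i)) (t \<odot>\<^bsub>LO P\<^esub> y)" if i: "i < n" for i
  using adj_divide[OF g(2) db' hp t(1) _ fJ[OF c(1)[OF i]]] lmap_deg[OF cmD(1)[OF f] dbD(1)[OF db i]] by simp
 then obtain y where y: "!!i. i < n ==> y i : mgrad (LO P) (dq i - l)"
  "!!i. i < n ==> eqm p (LO P) (?f (q i)) (t \<odot>\<^bsub>LO P\<^esub> y i)" by metis
 define u where "u x = finsum (LO P) (%i. \<phi> i x \<odot>\<^bsub>LO P\<^esub> y i) {..<n}" for x
 have ul: "lmap (- l) P (LO P) u" unfolding u_def[abs_def]
  by (rule db_lmap[OF g(1,2) db]) (simp add: y(1))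
 have tu: "eqm p (LO P) (?f x) (t \<odot>\<^bsub>LO P\<^esub> u x)" if x: "x : carrier P" for x
 proof -
  have yc: "y i : carrier (LO P)" if "i < n" for i using gm_carrier[OF g(2) y(1)[OF that]] .
  have "eqm p (LO P) (finsum (LO P) (%i. \<phi> i x \<odot>\<^bsub>LO P\<^esub> ?f (q i)) {..<n})
    (finsum (LO P) (%i. \<phi> i x \<odot>\<^bsub>LO P\<^esub> (t \<odot>\<^bsub>LO P\<^esub> y i)) {..<n})"
   by (rule eqm_finsum[OF g(2) I]) (use eqm_smult[OF g(2) I c(2) y(2)] x in simp_all)
  moreover have "finsum (LO P) (%i. \<phi> i x \<odot>\<^bsub>LO P\<^esub> (t \<odot>\<^bsub>LO P\<^esub> y i)) {..<n} = t \<odot>\<^bsub>LO P\<^esub> u x"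
   unfolding u_def using c x yc g(2) tc
   by (subst smult_finsum[OF g(2) tc]) (auto intro!: finsum_congr simp: smult_smult m_comm)
  ultimately show ?thesis unfolding db_expand[OF g(1,2) db cmD(1)[OF f] x, symmetric] by simp
 qed
 \<comment> \<open>The quotient \<open>u\<close> commutes with the differential only modulo
   \<open>p\<close>: this holds for \<open>t u\<close>, which is congruent to a chain map, and
   \<open>t\<close> can be cancelled modulo the prime.\<close>
 have uc: "eqm p (LO P) (u (\<partial>\<^bsub>P\<^esub> x)) (\<partial>\<^bsub>LO P\<^esub> (u x))" if x: "x : carrier P" for x
 proof -
  have dx: "\<partial>\<^bsub>P\<^esub> x : carrier P" by (rule dgD(1)[OF d(1) x])
  note uxc = lmap_closed[OF ul x] and udc = lmap_closed[OF ul dx]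
  have ducl: "\<partial>\<^bsub>LO P\<^esub> (u x) : carrier (LO P)" by (rule dgD(1)[OF d(2) uxc])
  have "eqm p (LO P) (\<partial>\<^bsub>LO P\<^esub> (?f x)) (t \<odot>\<^bsub>LO P\<^esub> \<partial>\<^bsub>LO P\<^esub> (u x))"
   using eqm_lmap[OF g(2) I g(2) dg_lmap[OF d(2)] tu[OF x]] dgD(3)[OF d(2) tc uxc] by simp
  then have "eqm p (LO P) (t \<odot>\<^bsub>LO P\<^esub> u (\<partial>\<^bsub>P\<^esub> x)) (t \<odot>\<^bsub>LO P\<^esub> \<partial>\<^bsub>LO P\<^esub> (u x))"
   by (rule eqm_trans[OF g(2) I eqm_sym[OF g(2) I tu[OF dx, unfolded cmD(2)[OF f x]]]])
  from eqmD(3)[OF this] have "t \<odot>\<^bsub>LO P\<^esub> (u (\<partial>\<^bsub>P\<^esub> x) \<ominus>\<^bsub>LO P\<^esub> \<partial>\<^bsub>LO P\<^esub> (u x)) : IM p (LO P)"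
   unfolding smult_diff_r[OF g(2) tc udc ducl] .
  from IM_prime_cancel[OF g(2) p tc t(2) group_closed(3)[OF gm_group[OF g(2)] udc ducl] this]
  show ?thesis using udc ducl by (simp add: eqm_def)
 qed
 let ?F = "KM P (LO P) u"
 note Fl = KP(3)[OF LP(1) ul]
 show ?thesis
 proof (rule hz_comp[OF L K P I hl Fl KP(5)[OF LP(1) ul I uc] k])
  fix x assume x: "x : carrier P"
  let ?z = "\<partial>\<^bsub>KO P\<^esub> (k x) \<oplus>\<^bsub>KO P\<^esub> k (\<partial>\<^bsub>P\<^esub> x)"
  note kil = cmD(1)[OF KLP(2)] and kiP = lmap_closed[OF cmD(1)[OF KP(2)] x]
  have "eqm p ?N (ki (LO P) (?f x)) (ki (LO P) (t \<odot>\<^bsub>LO P\<^esub> u x))"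
   by (rule eqm_lmap[OF g(2) I g(4) kil tu[OF x]])
  moreover have "ki (LO P) (t \<odot>\<^bsub>LO P\<^esub> u x) = ?F (t \<odot>\<^bsub>KO P\<^esub> ki P x)"
   using lmap_smult[OF kil tc lmap_closed[OF ul x]] lmap_smult[OF Fl tc kiP] KP(4)[OF LP(1) ul x] by simp
  moreover have "eqm p ?N (?F (t \<odot>\<^bsub>KO P\<^esub> ki P x)) (?F ?z)"
   by (rule eqm_lmap[OF g(3) I g(4) Fl tk[OF x]])
  ultimately show "eqm p ?N (ki (LO P) (?f x)) (?F ?z)" using eqm_trans[OF g(4) I] by simp
 qed simp_all
qed

lemma negligible_zero:
 assumes noeth: "graded_noetherian A" and P: "P : perf A" and sP: "supp A P \<subseteq> \<sigma> A T"
 shows "negligible P {\<zero>}"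
proof (rule ccontr)
 assume neg: "\<not> negligible P {\<zero>}"
 have "homogeneous_ideal A {\<zero>}" using zeroideal by (simp add: homogeneous_ideal_def)
 then obtain p where hp: "homogeneous_ideal A p" and np: "\<not> negligible P p"
  and mx: "!!K. homogeneous_ideal A K ==> p \<subset> K ==> negligible P K"
  using homogeneous_ideal_maximal[OF noeth, of "{\<zero>}" "negligible P"] neg by blast
 have I: "ideal p A" using hp by (simp add: homogeneous_ideal_def)
 have adj: "homogeneous_ideal A (adj p t)" "ideal (adj p t) A" "negligible P (adj p t)" if "t : rgrad A l" "t ~: p" for t l
 proof -
  note a = adj_homogeneous[OF hp that(1)]
  show "homogeneous_ideal A (adj p t)" by (rule a(1))
  then show "ideal (adj p t) A" by (simp add: homogeneous_ideal_def)
  show "negligible P (adj p t)" using mx[OF a(1)] a(2,3) that(2) by blast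
 qed
 have p: "p : Spec A"
 proof (rule homogeneous_prime[OF hp])
  show "p ~= carrier A" using np negligible_carrier[OF P] by blast
  fix a b i j assume a: "a : rgrad A i" and b: "b : rgrad A j" and ab: "a \<otimes> b : p"
  note ac = GA.G_carrier[OF a] and bc = GA.G_carrier[OF b] and s = ideal_simps[OF I]
  show "a : p \<or> b : p"
  proof (rule ccontr)
   assume "\<not> (a : p \<or> b : p)"
   then have n: "a ~: p" "b ~: p" by auto
   have "negligible P p"
   proof (rule negligible_product[OF P I adj(2)[OF b n(2)] adj(2)[OF a n(1)] adj(3)[OF b n(2)] adj(3)[OF a n(1)]])
    fix u v assume "u : adj p a" "v : adj p b"
    then obtain r c r' c' where *: "r : p" "c : carrier A" "u = r \<oplus> a \<otimes> c" "r' : p" "c' : carrier A" "v = r' \<oplus> b \<otimes> c'"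
     unfolding adj_iff[OF ac] adj_iff[OF bc] by blast
    have "u \<otimes> v = r \<otimes> v \<oplus> ((a \<otimes> c) \<otimes> r' \<oplus> (a \<otimes> b) \<otimes> (c \<otimes> c'))"
     using * s(1)[OF *(1)] s(1)[OF *(4)] ac bc by (simp add: l_distr r_distr m_assoc m_lcomm GA.group_rearrange)
    moreover have "v : carrier A" using *(4-6) s(1)[OF *(4)] bc by simp
    ultimately show "u \<otimes> v : p" using * ac bc ab by (simp add: s)
   qed
   then show False using np by blast
  qed
 qed
 obtain n q d \<phi> where db: "dual_basis P n q d \<phi>" and Pd: "dg_module A P" using P by (auto simp: perf_iff fg_def)
 show False
 proof (cases "p : supp A P")
  case False
  then obtain s l k where s: "s ~: p" "null P s l k" using not_in_supp_iff[OF p Pd db] by blast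
  then have st: "s : rgrad A l" "lmap (l + 1) P P k"
   and e: "!!x. x : carrier P ==> s \<odot>\<^bsub>P\<^esub> x = \<partial>\<^bsub>P\<^esub> (k x) \<oplus>\<^bsub>P\<^esub> k (\<partial>\<^bsub>P\<^esub> x)" by (auto simp: null_def)
  have "negligible P p"
  proof (rule negligible_prime[OF P p good_id st(1) s(1) st(2) _ adj(3)[OF st(1) s(1)]])
   fix x assume x: "x : carrier P"
   show "eqm p P (s \<odot>\<^bsub>P\<^esub> x) (\<partial>\<^bsub>P\<^esub> (k x) \<oplus>\<^bsub>P\<^esub> k (\<partial>\<^bsub>P\<^esub> x))"
    unfolding e[OF x, symmetric]
    by (rule eqm_refl[OF dg_gm[OF Pd] I gm_smult(1)[OF dg_gm[OF Pd] x GA.G_carrier[OF st(1)]]])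
  qed
  then show False using np by blast
 next
  case True
  then obtain Q where Q: "Q : T" "p : supp A Q" using sP unfolding \<sigma>_def by blast
  obtain n' q' d' \<phi>' where dbQ: "dual_basis Q n' q' d' \<phi>'" and Qd: "dg_module A Q"
   using T_perf[OF Q(1)] by (auto simp: fg_def)
  have "\<nexists>s l h. s ~: p & null Q s l h" using not_in_supp_iff[OF p Qd dbQ] Q(2) by blast
  from support_witness[OF Qd dbQ p this] obtain x j \<psi> m where w: "x : mgrad Q j" "\<partial>\<^bsub>Q\<^esub> x : IM p Q"
   "lmap m Q U \<psi>" "ALL y:carrier Q. \<psi> (\<partial>\<^bsub>Q\<^esub> y) : p" "\<psi> x ~: p" by blast
  have t: "\<psi> x : rgrad A (j + m)" using lmap_deg[OF w(3,1)] by simp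
  \<comment> \<open>Lying outside \<open>p\<close>, the scalar \<open>\<psi> x\<close> is nonzero,
    so its degree is even, as the section of the evaluation requires.\<close>
  have ev: "even (j + m)" using A_odd[OF t] w(5) ideal_simps(2)[OF I] by metis
  obtain GO GM io where G: "good GO GM io & (ALL X:perf A. ALL I x \<psi> k m. ideal I A --> x : mgrad Q k -->
    \<partial>\<^bsub>Q\<^esub> x : IM I Q --> lmap m Q U \<psi> --> (ALL y:carrier Q. \<psi> (\<partial>\<^bsub>Q\<^esub> y) : I) --> even (k + m) -->
    (EX h. lmap (k + m + 1) X (GO X) h &
    (ALL y:carrier X. eqm I (GO X) (\<psi> x \<odot>\<^bsub>GO X\<^esub> io X y) (\<partial>\<^bsub>GO X\<^esub> (h y) \<oplus>\<^bsub>GO X\<^esub> h (\<partial>\<^bsub>X\<^esub> y)))))"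
   using good_evaluation_cone[OF Q(1) dbQ] by (elim exE)
  note good = G[THEN conjunct1]
  have "EX h. lmap (j + m + 1) P (GO P) h & (ALL y:carrier P. eqm p (GO P) (\<psi> x \<odot>\<^bsub>GO P\<^esub> io P y) (\<partial>\<^bsub>GO P\<^esub> (h y) \<oplus>\<^bsub>GO P\<^esub> h (\<partial>\<^bsub>P\<^esub> y)))"
   by (rule G[THEN conjunct2, rule_format, OF P I w(1,2,3) _ ev]) (rule bspec[OF w(4)])
  then obtain h where h: "lmap (j + m + 1) P (GO P) h & (ALL y:carrier P. eqm p (GO P) (\<psi> x \<odot>\<^bsub>GO P\<^esub> io P y) (\<partial>\<^bsub>GO P\<^esub> (h y) \<oplus>\<^bsub>GO P\<^esub> h (\<partial>\<^bsub>P\<^esub> y)))" by (elim exE)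
  have "negligible P p"
   by (rule negligible_prime[OF P p good t w(5) h[THEN conjunct1] _ adj(3)[OF t w(5)]]) (rule bspec[OF h[THEN conjunct2]])
  then show False using np by blast
 qed
qed

lemma facI:
 assumes "cm P U' \<alpha>" "cm U' X \<beta>" "lmap 1 P X h"
  "!!x. x : carrier P ==> g x = \<beta> (\<alpha> x) \<oplus>\<^bsub>X\<^esub> (\<partial>\<^bsub>X\<^esub> (h x) \<oplus>\<^bsub>X\<^esub> h (\<partial>\<^bsub>P\<^esub> x))"
 shows "fac U' P X g"
 unfolding fac_def using assms by blast

text \<open>Congruence modulo the zero ideal is equality, so the inclusion of \<open>P\<close> into
  some enlargement is null-homotopic and factors, up to homotopy, through a zero object, which lies
  in \<open>T\<close>. The detection property then factors the identity of \<open>P\<close> through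
  an object of \<open>T\<close>, making \<open>P\<close> a retract.\<close>

lemma mem_of_supp_subset:
 assumes noeth: "graded_noetherian A" and P: "P : perf A" and sP: "supp A P \<subseteq> \<sigma> A T"
 shows "P : T"
proof -
 obtain GO GM io h where G: "good GO GM io" and h: "hz {\<zero>} P GO io h"
  using negligible_zero[OF assms] by (auto simp: negligible_def)
 note GP = goodD[OF G P]
 obtain n q d \<phi> where db: "dual_basis (GO P) n q d \<phi>" and Gd: "dg_module A (GO P)" using GP(1) by (auto simp: perf_iff fg_def)
 have Pd: "dg_module A P" using P by (simp add: perf_iff)
 note gG = dg_gm[OF Gd]
 interpret G: abelian_group "GO P" using gG by simp
 have hl: "lmap 1 P (GO P) h" using h by (simp add: hz_def)
 have e: "io P x = \<partial>\<^bsub>GO P\<^esub> (h x) \<oplus>\<^bsub>GO P\<^esub> h (\<partial>\<^bsub>P\<^esub> x)" if x: "x : carrier P" for x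
 proof -
  have e: "eqm {\<zero>} (GO P) (io P x) (\<partial>\<^bsub>GO P\<^esub> (h x) \<oplus>\<^bsub>GO P\<^esub> h (\<partial>\<^bsub>P\<^esub> x))" using h x by (simp add: hz_def)
  show ?thesis using IM_zero_ideal[OF gG db eqmD(3)[OF e]] G.gr_diff_eq[OF eqmD(1,2)[OF e] G.zero_closed] eqmD(2)[OF e] by simp
 qed
 let ?Z = "cpy zero_dg"
 have Z: "?Z : T"
  by (rule T_zero[OF cpy(4)[OF zero_dg_perf] dg_iso_ho[OF cpy(2)[OF zero_dg_perf] zero_dg_perf(1) dg_iso_sym[OF cpy(1)[OF zero_dg_perf]]]])
 have Zd: "dg_module A ?Z" by (rule cpy(2)[OF zero_dg_perf])
 have c: "cm P ?Z (%_. \<zero>\<^bsub>?Z\<^esub>)" "cm ?Z (GO P) (%_. \<zero>\<^bsub>GO P\<^esub>)"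
  using lmap_0[OF dg_gm[OF Zd]] lmap_0[OF gG] dgD(7)[OF Zd] dgD(7)[OF Gd] by (simp_all add: cm_def)
 have e0: "io P x = \<zero>\<^bsub>GO P\<^esub> \<oplus>\<^bsub>GO P\<^esub> (\<partial>\<^bsub>GO P\<^esub> (h x) \<oplus>\<^bsub>GO P\<^esub> h (\<partial>\<^bsub>P\<^esub> x))" if x: "x : carrier P" for x
  unfolding e[OF x] using x lmap_closed[OF hl] dgD(1)[OF Pd] dgD(1)[OF Gd] by simp
 have "fac ?Z P (GO P) (%x. io P x)" by (rule facI[OF c hl e0])
 then obtain V where "V : T" "fac V P P (%x. x)" using GP(7)[OF P Z cm_id] by blast
 then show ?thesis using T_retract[OF _ P] by blast
qed

end

section \<open>Null-homotopic scalars on cones, shifts and tensor products\<close>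

context even_graded_ring
begin

lemma nullD:
 assumes "null M s l h"
 shows "s : rgrad A l" "s : carrier A" "lmap (l + 1) M M h"
  "x : carrier M ==> s \<odot>\<^bsub>M\<^esub> x = \<partial>\<^bsub>M\<^esub> (h x) \<oplus>\<^bsub>M\<^esub> h (\<partial>\<^bsub>M\<^esub> x)"
 using assms by (auto simp: null_def)

lemma null_scale:
 assumes M: "dg_module A M" and n: "null M s l h" and u: "u : rgrad A m"
 shows "null M (u \<otimes> s) (m + l) (%x. u \<odot>\<^bsub>M\<^esub> h x)"
 unfolding null_def
proof (intro conjI ballI)
 note g = dg_gm[OF M] and uc = GA.G_carrier[OF u] and nD = nullD[OF n] and hD = lmapD[OF nullD(3)[OF n]]
 show "u \<otimes> s : rgrad A (m + l)" by (rule A_mult[OF u nD(1)])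
 show "lmap (m + l + 1) M M (%x. u \<odot>\<^bsub>M\<^esub> h x)"
  using lmap_smult_left[OF g g nD(3) u] by (simp add: algebra_simps)
 fix x assume x: "x : carrier M"
 show "(u \<otimes> s) \<odot>\<^bsub>M\<^esub> x = \<partial>\<^bsub>M\<^esub> (u \<odot>\<^bsub>M\<^esub> h x) \<oplus>\<^bsub>M\<^esub> u \<odot>\<^bsub>M\<^esub> h (\<partial>\<^bsub>M\<^esub> x)"
  using smult_smult[OF g uc nD(2) x] nD(4)[OF x] g uc x hD dgD[OF M] by (simp add: smult_add_r)
qed

text \<open>The identity of \<open>N\<close> is \<open>f g\<close> up to the homotopy
  \<open>K\<close>, so \<open>s\<close> is contracted by \<open>f h g - s K\<close>.\<close>

lemma null_retract:
 assumes M: "dg_module A M" and N: "dg_module A N" and f: "cm M N f" and g: "cm N M g"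
  and e: "ho_eq N N (%y. f (g y)) (%y. y)" and n: "null M s l h"
 shows "EX k. null N s l k"
proof -
 obtain K where K: "lmap 1 N N K" "!!y. y : carrier N ==> f (g y) \<ominus>\<^bsub>N\<^esub> y = \<partial>\<^bsub>N\<^esub> (K y) \<oplus>\<^bsub>N\<^esub> K (\<partial>\<^bsub>N\<^esub> y)"
  using e by (auto simp: ho_eq_def)
 note [simp] = dg_gm[OF M] dg_gm[OF N]
 note nD = nullD[OF n]
 note D = dgD[OF M] dgD[OF N] lmapD[OF cmD(1)[OF f]] lmapD[OF cmD(1)[OF g]] lmapD[OF K(1)] lmapD[OF nD(3)]
 have "null N s l (%y. f (h (g y)) \<ominus>\<^bsub>N\<^esub> s \<odot>\<^bsub>N\<^esub> K y)"
  unfolding null_def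
 proof (intro conjI ballI nD(1))
  show "lmap (l + 1) N N (%y. f (h (g y)) \<ominus>\<^bsub>N\<^esub> s \<odot>\<^bsub>N\<^esub> K y)"
   using lmap_comp[OF lmap_comp[OF cmD(1)[OF g] nD(3)] cmD(1)[OF f]] lmap_smult_left[OF _ _ K(1) nD(1)]
   by (intro lmap_subtract) (simp_all add: add.commute)
  fix y assume y: "y : carrier N"
  have "s \<odot>\<^bsub>N\<^esub> f (g y) = f (\<partial>\<^bsub>M\<^esub> (h (g y)) \<oplus>\<^bsub>M\<^esub> h (\<partial>\<^bsub>M\<^esub> (g y)))"
   using y nD(2) nD(4)[of "g y"] lmap_smult[OF cmD(1)[OF f], of s "g y"] by (simp add: D)
  moreover have "y = f (g y) \<ominus>\<^bsub>N\<^esub> (\<partial>\<^bsub>N\<^esub> (K y) \<oplus>\<^bsub>N\<^esub> K (\<partial>\<^bsub>N\<^esub> y))"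
   using y unfolding K(2)[OF y, symmetric] by (simp add: D group_arith group_closed)
  then have "s \<odot>\<^bsub>N\<^esub> y = s \<odot>\<^bsub>N\<^esub> f (g y) \<ominus>\<^bsub>N\<^esub> s \<odot>\<^bsub>N\<^esub> (\<partial>\<^bsub>N\<^esub> (K y) \<oplus>\<^bsub>N\<^esub> K (\<partial>\<^bsub>N\<^esub> y))"
   using y nD(2) smult_diff_r[of N s "f (g y)" "\<partial>\<^bsub>N\<^esub> (K y) \<oplus>\<^bsub>N\<^esub> K (\<partial>\<^bsub>N\<^esub> y)"] by (simp add: D group_closed)
  ultimately show "s \<odot>\<^bsub>N\<^esub> y = \<partial>\<^bsub>N\<^esub> (f (h (g y)) \<ominus>\<^bsub>N\<^esub> s \<odot>\<^bsub>N\<^esub> K y) \<oplus>\<^bsub>N\<^esub> (f (h (g (\<partial>\<^bsub>N\<^esub> y))) \<ominus>\<^bsub>N\<^esub> s \<odot>\<^bsub>N\<^esub> K (\<partial>\<^bsub>N\<^esub> y))"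
   using y nD(2) by (simp add: D cmD(2)[OF f] cmD(2)[OF g] smult_arith group_arith group_closed)
 qed
 then show ?thesis by blast
qed

text \<open>If \<open>N\<close> is the error by which \<open>H\<close> fails to contract
  \<open>s\<close>, then \<open>\<partial> H + H \<partial> = s - N\<close>, and
  \<open>s + N\<close> commutes with the differential. As \<open>N\<close> squares to zero,
  \<open>(s - N)(s + N)\<close> is the square of \<open>s\<close>, contracted by
  \<open>H (s + N)\<close>.\<close>

lemma null_square:
 assumes M: "dg_module A M" and s: "s : rgrad A l" and H: "lmap (l + 1) M M H"
  and NN: "!!x. x : carrier M ==> N (N x) = \<zero>\<^bsub>M\<^esub>"
  and N: "!!x. x : carrier M ==> N x = s \<odot>\<^bsub>M\<^esub> x \<ominus>\<^bsub>M\<^esub> (\<partial>\<^bsub>M\<^esub> (H x) \<oplus>\<^bsub>M\<^esub> H (\<partial>\<^bsub>M\<^esub> x))"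
 shows "null M (s \<otimes> s) (l + l) (%x. H (s \<odot>\<^bsub>M\<^esub> x \<oplus>\<^bsub>M\<^esub> N x))"
 unfolding null_def
proof (intro conjI ballI)
 note g [simp] = dg_gm[OF M] and sc [simp] = GA.G_carrier[OF s]
 interpret M: abelian_group M by simp
 note D = dgD[OF M] lmapD(1,2,3)[OF H] lmapD0[OF g g H]
 show "s \<otimes> s : rgrad A (l + l)" by (rule A_mult[OF s s])
 have sl: "lmap l M M (%x. s \<odot>\<^bsub>M\<^esub> x)" using lmap_smult_left[OF g g lmap_id s] by simp
 have "lmap l M M (%x. s \<odot>\<^bsub>M\<^esub> x \<ominus>\<^bsub>M\<^esub> (\<partial>\<^bsub>M\<^esub> (H x) \<oplus>\<^bsub>M\<^esub> H (\<partial>\<^bsub>M\<^esub> x)))"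
  using lmap_comp[OF H dg_lmap[OF M]] lmap_comp[OF dg_lmap[OF M] H]
  by (intro lmap_subtract[OF g g sl] lmap_add) simp_all
 then have Nl: "lmap l M M N" by (rule lmap_cong) (simp_all add: N)
 from lmap_comp[OF lmap_add[OF g g sl Nl] H]
 show "lmap (l + l + 1) M M (%x. H (s \<odot>\<^bsub>M\<^esub> x \<oplus>\<^bsub>M\<^esub> N x))" by (simp add: add.assoc)
 fix x assume x: "x : carrier M"
 note ND = lmapD(1,2,3)[OF Nl]
 let ?z = "s \<odot>\<^bsub>M\<^esub> x \<oplus>\<^bsub>M\<^esub> N x"
 have z: "?z : carrier M" using x by (simp add: ND group_closed)
 have "N (\<partial>\<^bsub>M\<^esub> x) = \<partial>\<^bsub>M\<^esub> (N x)" using x by (simp add: N D group_arith group_closed)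
 then have dz: "\<partial>\<^bsub>M\<^esub> ?z = s \<odot>\<^bsub>M\<^esub> \<partial>\<^bsub>M\<^esub> x \<oplus>\<^bsub>M\<^esub> N (\<partial>\<^bsub>M\<^esub> x)" using x by (simp add: D ND)
 have hz: "\<partial>\<^bsub>M\<^esub> (H ?z) \<oplus>\<^bsub>M\<^esub> H (\<partial>\<^bsub>M\<^esub> ?z) : carrier M" using z by (simp add: D group_closed)
 have "\<partial>\<^bsub>M\<^esub> (H ?z) \<oplus>\<^bsub>M\<^esub> H (\<partial>\<^bsub>M\<^esub> ?z) = s \<odot>\<^bsub>M\<^esub> ?z \<ominus>\<^bsub>M\<^esub> N ?z"
  using N[OF z] z hz ND(1)[OF z] by (simp add: M.gr_eq_diff M.gr_diff_add M.a_comm group_closed)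
 also have "\<dots> = (s \<otimes> s) \<odot>\<^bsub>M\<^esub> x" using x NN[OF x] by (simp add: ND smult_arith group_arith group_closed M.minus_zero)
 finally show "(s \<otimes> s) \<odot>\<^bsub>M\<^esub> x = \<partial>\<^bsub>M\<^esub> (H ?z) \<oplus>\<^bsub>M\<^esub> H (s \<odot>\<^bsub>M\<^esub> \<partial>\<^bsub>M\<^esub> x \<oplus>\<^bsub>M\<^esub> N (\<partial>\<^bsub>M\<^esub> x))"
  unfolding dz by simp
qed

text \<open>The diagonal homotopy given by \<open>k\<close> and \<open>- h\<close> contracts
  \<open>s\<close> up to an error that maps the shifted copy of \<open>X\<close> into
  \<open>Y\<close> and is zero on \<open>Y\<close>. Such an error squares to zero, at the cost of
  replacing \<open>s\<close> by its square.\<close>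

lemma null_cone:
 assumes X: "dg_module A X" and Y: "dg_module A Y" and f: "cm X Y f" and nX: "null X s l h" and nY: "null Y s l k"
 shows "EX H. null (cone X Y f) (s \<otimes> s) (l + l) H"
proof -
 note [simp] = dg_gm[OF X] dg_gm[OF Y]
 let ?C = "cone X Y f"
 interpret X: graded_group X "mgrad X" by (rule gm_graded) simp
 interpret Y: abelian_group Y by simp
 note n = nullD[OF nX] nullD[OF nY]
 note D = dgD[OF X] dgD[OF Y] lmapD[OF cmD(1)[OF f]] lmapD[OF n(3)] lmapD[OF n(7)]
  lmapD0[OF _ _ cmD(1)[OF f]] lmapD0[OF _ _ n(3)] lmapD0[OF _ _ n(7)]
 let ?H = "%v. (k (fst v), \<ominus>\<^bsub>X\<^esub> h (snd v))"
 let ?N = "%v. (f (h (snd v)) \<ominus>\<^bsub>Y\<^esub> k (f (snd v)), \<zero>\<^bsub>X\<^esub>)"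
 have "h x : mgrad X (i + (l + 1) - 1)" if "x : mgrad X (i - 1)" for x i
  using lmap_deg[OF n(3) that] by (simp add: algebra_simps)
 then have "lmap (l + 1) ?C ?C ?H"
  unfolding lmap_def by (auto simp: D smult_minus_r X.minus_add n)
 moreover have "?N v = s \<odot>\<^bsub>?C\<^esub> v \<ominus>\<^bsub>?C\<^esub> (\<partial>\<^bsub>?C\<^esub> (?H v) \<oplus>\<^bsub>?C\<^esub> ?H (\<partial>\<^bsub>?C\<^esub> v))" if v: "v : carrier ?C" for v
 proof -
  obtain y x where v: "v = (y, x)" "y : carrier Y" "x : carrier X" using v by auto
  then show ?thesis using n(2)
   by (simp add: n(4)[OF v(3)] n(8)[OF v(2)] D group_arith group_closed)
 qed
 moreover have "?N (?N v) = \<zero>\<^bsub>?C\<^esub>" for v by (simp add: D Y.gr_diff_self)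
 ultimately show ?thesis using null_square[OF cone_dg[OF X Y f] n(1), of ?H ?N] by blast
qed

text \<open>The differential and the homotopy receive the same sign, which disappears in their
  composites.\<close>

lemma null_shift:
 assumes M: "dg_module A M" and n: "null M s l h"
 shows "null (shift k M) s l (%x. koszul k M (h x))"
 unfolding null_def
proof (intro conjI ballI nullD(1)[OF n])
 note g = dg_gm[OF M]
 show "lmap (l + 1) (shift k M) (shift k M) (%x. koszul k M (h x))"
  by (rule shift_lmap[OF lmap_koszul[OF g g nullD(3)[OF n]]])
 fix x assume "x : carrier (shift k M)"
 then have x: "x : carrier M" by simp
 note hc = lmap_closed[OF nullD(3)[OF n]]
 show "s \<odot>\<^bsub>shift k M\<^esub> x = \<partial>\<^bsub>shift k M\<^esub> (koszul k M (h x)) \<oplus>\<^bsub>shift k M\<^esub> koszul k M (h (\<partial>\<^bsub>shift k M\<^esub> x))"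
  using nullD(4)[OF n x] koszul_lmap[OF g g dg_lmap[OF M] hc[OF x]] koszul_lmap[OF g g nullD(3)[OF n] dgD(1)[OF M x]]
   koszul_simps(2)[OF g] hc x dgD(1)[OF M] by simp
qed

text \<open>The homotopy acts on the left tensor factor, through the matrix \<open>P\<close>. Since
  \<open>s\<close> is nonzero, \<open>l\<close> is even and this action has odd degree, so it
  anticommutes with the part of the differential coming from \<open>Y\<close> and these terms
  cancel. What remains is the homotopy equation of \<open>Q\<close> in coordinates.\<close>

lemma null_box:
 assumes Q: "dg_module A Q" and db: "dual_basis Q n q d \<phi>" and Y: "dg_module A Y" and nQ: "null Q s l h" and s0: "s ~= \<zero>"
 shows "EX H. null (box {..<n} d (%i j. \<phi> i (q j)) (%i j. \<phi> i (\<partial>\<^bsub>Q\<^esub> (q j))) Y) s l H"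
proof -
 note bd = tensor_box_data[OF Q db] and gQ = dg_gm[OF Q] and gY [simp] = dg_gm[OF Y] and n = nullD[OF nQ]
 let ?B = "box {..<n} d (%i j. \<phi> i (q j)) (%i j. \<phi> i (\<partial>\<^bsub>Q\<^esub> (q j))) Y"
 note gB = box_gm[OF bd gY] and Bd = box_dg[OF bd Y] and c = db_closed[OF gQ db]
 interpret Y: graded_group Y "mgrad Y" by (rule gm_graded[OF gY])
 have l: "even l" using A_odd[OF n(1)] s0 by blast
 have hq: "h (q j) : mgrad Q (d j + (l + 1))" if "j < n" for j by (rule lmap_deg[OF n(3) dbD(1)[OF db that]])
 have hc: "h (q j) : carrier Q" "\<partial>\<^bsub>Q\<^esub> (q j) : carrier Q" "h (\<partial>\<^bsub>Q\<^esub> (q j)) : carrier Q" "\<partial>\<^bsub>Q\<^esub> (h (q j)) : carrier Q" if "j < n" for j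
  using lmap_closed[OF n(3)] dgD(1)[OF Q] c(1)[OF that] by simp_all
 define P where "P i j = \<phi> i (h (q j))" for i j
 have Pd: "P i j : rgrad A (d j + (l + 1) - d i)" if "i < n" "j < n" for i j unfolding P_def by (rule c(3)[OF that(1) hq[OF that(2)]])
 have Pc: "P i j : carrier A" if "i < n" "j < n" for i j by (rule GA.G_carrier[OF Pd[OF that]])
 let ?R = "%y i. finsum Y (%j. P i j \<odot>\<^bsub>Y\<^esub> y j) {..<n}"
 let ?H = "%y i. if i < n then ?R y i else \<zero>\<^bsub>Y\<^esub>"
 note all = box_all[OF _ gY, where J = "{..<n}" and d = d and e = "%i j. \<phi> i (q j)" and D = "%i j. \<phi> i (\<partial>\<^bsub>Q\<^esub> (q j))"]
 have rm: "finsum Y (%m. f (q m) \<odot>\<^bsub>Y\<^esub> finsum Y (%j. \<phi> m (g j) \<odot>\<^bsub>Y\<^esub> y j) {..<n}) {..<n} = finsum Y (%j. f (g j) \<odot>\<^bsub>Y\<^esub> y j) {..<n}"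
  if f: "lmap k Q U f" and g: "!!j. j < n ==> g j : carrier Q" and y: "!!j. y j : carrier Y" for f g y k
 proof -
  have "finsum Y (%m. f (q m) \<odot>\<^bsub>Y\<^esub> finsum Y (%j. \<phi> m (g j) \<odot>\<^bsub>Y\<^esub> y j) {..<n}) {..<n} =
    finsum Y (%j. finsum A (%m. f (q m) \<otimes> \<phi> m (g j)) {..<n} \<odot>\<^bsub>Y\<^esub> y j) {..<n}"
   using lmap_closed[OF f c(1)] c(2) g y by (intro row_matrix) simp_all
  also have "\<dots> = finsum Y (%j. f (g j) \<odot>\<^bsub>Y\<^esub> y j) {..<n}"
   using phi_row[OF gQ db f g] lmap_closed[OF f g] y by (intro finsum_congr) simp_all
  finally show ?thesis .
 qed
 have Rc: "?R y i : carrier Y" if "i < n" "!!j. y j : carrier Y" for y i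
  using Pc that by (intro finsum_lmap_closed) simp_all
 have Hc: "?H y : carrier ?B" if y: "y : carrier ?B" for y
 proof -
  have "finsum Y (%m. \<phi> i (q m) \<odot>\<^bsub>Y\<^esub> ?H y m) {..<n} = ?R y i" if i: "i < n" for i
  proof -
   have "finsum Y (%m. \<phi> i (q m) \<odot>\<^bsub>Y\<^esub> ?H y m) {..<n} = finsum Y (%m. \<phi> i (q m) \<odot>\<^bsub>Y\<^esub> ?R y m) {..<n}"
    using Rc all[OF y] c i by (intro finsum_congr) simp_all
   also have "\<dots> = ?R y i" unfolding P_def by (rule rm[OF dbD(2)[OF db i] hc(1) all[OF y]])
   finally show ?thesis .
  qed
  then show ?thesis using Rc all[OF y] by (simp add: box_carrier)
 qed
 have "lmap (l + 1) ?B ?B ?H"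
 proof (rule lmapI_hom[OF gB gB Hc])
  show "?H (x \<oplus>\<^bsub>?B\<^esub> y) = ?H x \<oplus>\<^bsub>?B\<^esub> ?H y" if xy: "x : carrier ?B" "y : carrier ?B" for x y
  proof
   fix i
   have "finsum Y (%j. P i j \<odot>\<^bsub>Y\<^esub> (x j \<oplus>\<^bsub>Y\<^esub> y j)) {..<n} = ?R x i \<oplus>\<^bsub>Y\<^esub> ?R y i" if i: "i < n"
   proof -
    have "finsum Y (%j. P i j \<odot>\<^bsub>Y\<^esub> (x j \<oplus>\<^bsub>Y\<^esub> y j)) {..<n} = finsum Y (%j. P i j \<odot>\<^bsub>Y\<^esub> x j \<oplus>\<^bsub>Y\<^esub> P i j \<odot>\<^bsub>Y\<^esub> y j) {..<n}"
     using Pc[OF i] all[OF xy(1)] all[OF xy(2)] by (intro finsum_congr) (simp_all add: smult_add_r)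
    also have "\<dots> = ?R x i \<oplus>\<^bsub>Y\<^esub> ?R y i" using Pc[OF i] all[OF xy(1)] all[OF xy(2)] by (intro finsum_plus) simp_all
    finally show ?thesis .
   qed
   then show "?H (x \<oplus>\<^bsub>?B\<^esub> y) i = (?H x \<oplus>\<^bsub>?B\<^esub> ?H y) i" by (simp add: box_ops)
  qed
  show "?H (a \<odot>\<^bsub>?B\<^esub> x) = a \<odot>\<^bsub>?B\<^esub> ?H x" if a: "a : carrier A" and x: "x : carrier ?B" for a x
  proof
   show "?H (a \<odot>\<^bsub>?B\<^esub> x) i = (a \<odot>\<^bsub>?B\<^esub> ?H x) i" for i
    using smult_finsum[OF gY a, of "%j. P i j \<odot>\<^bsub>Y\<^esub> x j" "{..<n}"] Pc all[OF x] a
    by (auto simp: box_ops smult_smult m_comm intro!: finsum_congr)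
  qed
  show "?H x : mgrad ?B (i + (l + 1))" if x: "x : mgrad ?B i" for i x
  proof -
   have xc: "x : carrier ?B" and xd: "!!j. j < n ==> x j : mgrad Y (i - d j)" using x by (auto simp: box_mgrad)
   have "P m j \<odot>\<^bsub>Y\<^esub> x j : mgrad Y (i + (l + 1) - d m)" if "m < n" "j < n" for m j
    using gm_smult_deg[OF gY Pd[OF that] xd[OF that(2)]] by (simp add: algebra_simps)
   then show ?thesis using Hc[OF xc] by (auto simp: box_mgrad intro!: Y.G_finsum)
  qed
 qed
 moreover have "s \<odot>\<^bsub>?B\<^esub> y = \<partial>\<^bsub>?B\<^esub> (?H y) \<oplus>\<^bsub>?B\<^esub> ?H (\<partial>\<^bsub>?B\<^esub> y)" if y: "y : carrier ?B" for y
 proof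
  fix i
  note ya [simp] = all[OF y] and dya [simp] = dgD(1)[OF Y all[OF y]]
  show "(s \<odot>\<^bsub>?B\<^esub> y) i = (\<partial>\<^bsub>?B\<^esub> (?H y) \<oplus>\<^bsub>?B\<^esub> ?H (\<partial>\<^bsub>?B\<^esub> y)) i"
  proof (cases "i < n")
   case False
   then have "y i = \<zero>\<^bsub>Y\<^esub>" using y by (simp add: box_carrier)
   then show ?thesis using False n(2) by (simp add: box_ops)
  next
   case i: True
   let ?k = "%m x. koszul m Y x"
   let ?dh = "finsum Y (%j. \<phi> i (\<partial>\<^bsub>Q\<^esub> (h (q j))) \<odot>\<^bsub>Y\<^esub> y j) {..<n}" and ?hd = "finsum Y (%j. \<phi> i (h (\<partial>\<^bsub>Q\<^esub> (q j))) \<odot>\<^bsub>Y\<^esub> y j) {..<n}"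
   let ?S = "finsum Y (%j. P i j \<odot>\<^bsub>Y\<^esub> ?k (d i) (\<partial>\<^bsub>Y\<^esub> (y j))) {..<n}"
   have Sc: "?S : carrier Y" "?dh : carrier Y" "?hd : carrier Y" using Pc i c(2) hc by (auto intro!: finsum_lmap_closed)
   have 1: "(\<partial>\<^bsub>?B\<^esub> (?H y)) i = ?dh \<oplus>\<^bsub>Y\<^esub> ?S"
   proof -
    have "finsum Y (%m. \<phi> i (\<partial>\<^bsub>Q\<^esub> (q m)) \<odot>\<^bsub>Y\<^esub> ?H y m) {..<n} = finsum Y (%m. \<phi> i (\<partial>\<^bsub>Q\<^esub> (q m)) \<odot>\<^bsub>Y\<^esub> ?R y m) {..<n}"
     using Rc c(2) i hc by (intro finsum_congr) simp_all
    also have "\<dots> = ?dh" unfolding P_def by (rule rm[OF lmap_comp[OF dg_lmap[OF Q] dbD(2)[OF db i]] hc(1) ya])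
    finally have a: "finsum Y (%m. \<phi> i (\<partial>\<^bsub>Q\<^esub> (q m)) \<odot>\<^bsub>Y\<^esub> ?H y m) {..<n} = ?dh" .
    have "lmap (- 1) Y Y (%x. ?k (d i) (\<partial>\<^bsub>Y\<^esub> x))" by (rule lmap_koszul[OF gY gY dg_lmap[OF Y]])
    from lmap_finsum[OF gY gY this, of "%j. P i j \<odot>\<^bsub>Y\<^esub> y j" "{..<n}"] lmap_smult[OF this]
    have b: "?k (d i) (\<partial>\<^bsub>Y\<^esub> (?R y i)) = ?S" using Pc i by (auto intro!: finsum_congr)
    show ?thesis using a b i by (simp add: box_ops)
   qed
   have 2: "(?H (\<partial>\<^bsub>?B\<^esub> y)) i = ?hd \<ominus>\<^bsub>Y\<^esub> ?S"
   proof -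
    have Dy: "finsum Y (%m. \<phi> j (\<partial>\<^bsub>Q\<^esub> (q m)) \<odot>\<^bsub>Y\<^esub> y m) {..<n} : carrier Y" if "j < n" for j
     using c(2) that hc by (intro finsum_lmap_closed) simp_all
    have sg: "P i j \<odot>\<^bsub>Y\<^esub> ?k (d j) (\<partial>\<^bsub>Y\<^esub> (y j)) = \<ominus>\<^bsub>Y\<^esub> (P i j \<odot>\<^bsub>Y\<^esub> ?k (d i) (\<partial>\<^bsub>Y\<^esub> (y j)))" if j: "j < n" for j
    proof -
     have "P i j \<odot>\<^bsub>Y\<^esub> ?k (d j) (\<partial>\<^bsub>Y\<^esub> (y j)) = P i j \<odot>\<^bsub>Y\<^esub> ?k (d i + 1) (\<partial>\<^bsub>Y\<^esub> (y j))"
      by (rule koszul_coeff[OF gY Pd[OF i j] _ dya]) (use l in presburger)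
     then show ?thesis using Pc[OF i j] by (simp add: koszul_def smult_minus_r Y.minus_minus)
    qed
    have "(?H (\<partial>\<^bsub>?B\<^esub> y)) i = finsum Y (%j. P i j \<odot>\<^bsub>Y\<^esub> finsum Y (%m. \<phi> j (\<partial>\<^bsub>Q\<^esub> (q m)) \<odot>\<^bsub>Y\<^esub> y m) {..<n} \<ominus>\<^bsub>Y\<^esub>
      P i j \<odot>\<^bsub>Y\<^esub> ?k (d i) (\<partial>\<^bsub>Y\<^esub> (y j))) {..<n}"
    proof -
     have "P i j \<odot>\<^bsub>Y\<^esub> (\<partial>\<^bsub>?B\<^esub> y) j = P i j \<odot>\<^bsub>Y\<^esub> finsum Y (%m. \<phi> j (\<partial>\<^bsub>Q\<^esub> (q m)) \<odot>\<^bsub>Y\<^esub> y m) {..<n} \<ominus>\<^bsub>Y\<^esub>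
       P i j \<odot>\<^bsub>Y\<^esub> ?k (d i) (\<partial>\<^bsub>Y\<^esub> (y j))" if j: "j < n" for j
      using j Dy[OF j] Pc[OF i j] sg[OF j] by (simp add: box_ops smult_add_r a_minus_def)
     note t = this
     have "finsum Y (%j. P i j \<odot>\<^bsub>Y\<^esub> (\<partial>\<^bsub>?B\<^esub> y) j) {..<n} = finsum Y (%j. P i j \<odot>\<^bsub>Y\<^esub>
       finsum Y (%m. \<phi> j (\<partial>\<^bsub>Q\<^esub> (q m)) \<odot>\<^bsub>Y\<^esub> y m) {..<n} \<ominus>\<^bsub>Y\<^esub> P i j \<odot>\<^bsub>Y\<^esub> ?k (d i) (\<partial>\<^bsub>Y\<^esub> (y j))) {..<n}"
     proof (rule finsum_congr[OF gY])
      fix j assume "j : {..<n}"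
      then have j: "j < n" by simp
      show "P i j \<odot>\<^bsub>Y\<^esub> (\<partial>\<^bsub>?B\<^esub> y) j : carrier Y"
       by (rule gm_smult(1)[OF gY all[OF dgD(1)[OF Bd y]] Pc[OF i j]])
     qed (rule t, simp)
     then show ?thesis using i by simp
    qed
    also have "\<dots> = finsum Y (%j. P i j \<odot>\<^bsub>Y\<^esub> finsum Y (%m. \<phi> j (\<partial>\<^bsub>Q\<^esub> (q m)) \<odot>\<^bsub>Y\<^esub> y m) {..<n}) {..<n} \<ominus>\<^bsub>Y\<^esub> ?S"
     using i Dy Pc by (intro finsum_diff) simp_all
    also have "finsum Y (%j. P i j \<odot>\<^bsub>Y\<^esub> finsum Y (%m. \<phi> j (\<partial>\<^bsub>Q\<^esub> (q m)) \<odot>\<^bsub>Y\<^esub> y m) {..<n}) {..<n} = ?hd"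
     unfolding P_def by (rule rm[OF lmap_comp[OF n(3) dbD(2)[OF db i]] hc(2) ya])
    finally show ?thesis .
   qed
   have "?dh \<oplus>\<^bsub>Y\<^esub> ?hd = finsum Y (%j. s \<odot>\<^bsub>Y\<^esub> (\<phi> i (q j) \<odot>\<^bsub>Y\<^esub> y j)) {..<n}"
   proof -
    have "\<phi> i (\<partial>\<^bsub>Q\<^esub> (h (q j))) \<odot>\<^bsub>Y\<^esub> y j \<oplus>\<^bsub>Y\<^esub> \<phi> i (h (\<partial>\<^bsub>Q\<^esub> (q j))) \<odot>\<^bsub>Y\<^esub> y j = s \<odot>\<^bsub>Y\<^esub> (\<phi> i (q j) \<odot>\<^bsub>Y\<^esub> y j)" if j: "j < n" for j
    proof -
     note \<phi>D = lmapD[OF dbD(2)[OF db i]]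
     have "\<phi> i (\<partial>\<^bsub>Q\<^esub> (h (q j))) \<oplus> \<phi> i (h (\<partial>\<^bsub>Q\<^esub> (q j))) = s \<otimes> \<phi> i (q j)"
      using \<phi>D(2)[OF hc(4)[OF j] hc(3)[OF j]] n(4)[OF c(1)[OF j]] \<phi>D(3)[OF n(2) c(1)[OF j]] by simp
     then show ?thesis using smult_add_l[OF gY c(2)[OF i hc(4)[OF j]] c(2)[OF i hc(3)[OF j]] ya[of j]]
      smult_smult[OF gY n(2) c(2)[OF i c(1)[OF j]] ya[of j]] by simp
    qed
    note t = this
    have cl: "\<phi> i (\<partial>\<^bsub>Q\<^esub> (h (q j))) \<odot>\<^bsub>Y\<^esub> y j : carrier Y" "\<phi> i (h (\<partial>\<^bsub>Q\<^esub> (q j))) \<odot>\<^bsub>Y\<^esub> y j : carrier Y"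
     if j: "j : {..<n}" for j
     using gm_smult(1)[OF gY ya[of j] c(2)[OF i hc(4)[of j]]] gm_smult(1)[OF gY ya[of j] c(2)[OF i hc(3)[of j]]] j by simp_all
    have "?dh \<oplus>\<^bsub>Y\<^esub> ?hd = finsum Y (%j. \<phi> i (\<partial>\<^bsub>Q\<^esub> (h (q j))) \<odot>\<^bsub>Y\<^esub> y j \<oplus>\<^bsub>Y\<^esub> \<phi> i (h (\<partial>\<^bsub>Q\<^esub> (q j))) \<odot>\<^bsub>Y\<^esub> y j) {..<n}"
     by (rule finsum_plus[OF gY cl, symmetric])
    also have "\<dots> = finsum Y (%j. s \<odot>\<^bsub>Y\<^esub> (\<phi> i (q j) \<odot>\<^bsub>Y\<^esub> y j)) {..<n}"
    proof (rule finsum_congr[OF gY])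
     show "\<phi> i (\<partial>\<^bsub>Q\<^esub> (h (q j))) \<odot>\<^bsub>Y\<^esub> y j \<oplus>\<^bsub>Y\<^esub> \<phi> i (h (\<partial>\<^bsub>Q\<^esub> (q j))) \<odot>\<^bsub>Y\<^esub> y j : carrier Y" if "j : {..<n}" for j
      by (rule group_closed(1)[OF gm_group[OF gY] cl[OF that]])
    qed (rule t, simp)
    finally show ?thesis .
   qed
   also have "\<dots> = s \<odot>\<^bsub>Y\<^esub> y i"
    using smult_finsum[OF gY n(2), of "%j. \<phi> i (q j) \<odot>\<^bsub>Y\<^esub> y j" "{..<n}"] c(2)[OF i c(1)] y i by (simp add: box_carrier)
   finally have "s \<odot>\<^bsub>Y\<^esub> y i = ?dh \<oplus>\<^bsub>Y\<^esub> ?hd" by simp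
   also have "\<dots> = (?dh \<oplus>\<^bsub>Y\<^esub> ?S) \<oplus>\<^bsub>Y\<^esub> (?hd \<ominus>\<^bsub>Y\<^esub> ?S)" using Sc by (simp add: group_arith group_closed)
   also have "\<dots> = (\<partial>\<^bsub>?B\<^esub> (?H y) \<oplus>\<^bsub>?B\<^esub> ?H (\<partial>\<^bsub>?B\<^esub> y)) i" unfolding 1[symmetric] 2[symmetric] by (simp only: box_ops(2))
   finally show ?thesis by (simp only: box_ops(3))
  qed
 qed
 ultimately show ?thesis unfolding null_def using n(1) by blast
qed

end

section \<open>Supports, and the thick ideals of objects with restricted support\<close>

context even_graded_ring
begin

lemma supp_iff:
 assumes "dg_module A P" "fg P"
 shows "p : supp A P \<longleftrightarrow> p : Spec A & (\<nexists>s l h. s ~: p & null P s l h)"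
proof (cases "p : Spec A")
 case True
 obtain n q d \<phi> where db: "dual_basis P n q d \<phi>" using assms(2) by (auto simp: fg_def)
 show ?thesis using not_in_supp_iff[OF True assms(1) db] True by blast
next
 case False
 then show ?thesis by (simp add: supp_def)
qed

lemma supp_retract:
 assumes M: "dg_module A M" "fg M" and N: "dg_module A N" "fg N" and "cm M N f" "cm N M g" "ho_eq N N (%y. f (g y)) (%y. y)"
 shows "supp A N \<subseteq> supp A M"
 unfolding subset_iff supp_iff[OF M] supp_iff[OF N] using null_retract[OF M(1) N(1) assms(5-7)] by meson

lemma supp_ho_iso:
 assumes M: "dg_module A M" "fg M" and N: "dg_module A N" "fg N" and i: "ho_iso A M N"
 shows "supp A N \<subseteq> supp A M"
proof -
 obtain f g where "cm M N f" "cm N M g" "ho_eq N N (%y. f (g y)) (%y. y)"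
  using i[unfolded ho_iso_iff[OF dg_gm[OF M(1)] dg_gm[OF N(1)]]] by (elim exE conjE)
 then show ?thesis by (rule supp_retract[OF M N])
qed

lemma supp_cone:
 assumes X: "dg_module A X" "fg X" and Y: "dg_module A Y" "fg Y" and f: "cm X Y f"
 shows "supp A (cone X Y f) \<subseteq> supp A X \<union> supp A Y"
proof
 fix p assume p: "p : supp A (cone X Y f)"
 note C = cone_dg[OF X(1) Y(1) f] cone_fg[OF dg_gm[OF X(1)] dg_gm[OF Y(1)] X(2) Y(2), of f]
 have pS: "p : Spec A" using p by (simp add: supp_def)
 show "p : supp A X \<union> supp A Y"
 proof (rule ccontr)
  assume "p ~: supp A X \<union> supp A Y"
  then obtain s l h u m k where n: "s ~: p" "null X s l h" "u ~: p" "null Y u m k"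
   using pS unfolding supp_iff[OF X] supp_iff[OF Y] Un_iff by blast
  note a = nullD(1,2)[OF n(2)] nullD(1,2)[OF n(4)]
  note t = spec_notin[OF pS a(2) n(1) a(4) n(3)]
  \<comment> \<open>The product of the two scalars is null-homotopic on both objects, so that
    \<open>null_cone\<close> can be applied with a single scalar.\<close>
  have "null X (s \<otimes> u) (l + m) (%x. u \<odot>\<^bsub>X\<^esub> h x)" using null_scale[OF X(1) n(2) a(3)] a by (simp add: m_comm add.commute)
  from null_cone[OF X(1) Y(1) f this null_scale[OF Y(1) n(4) a(1)]] spec_notin[OF pS _ t _ t] a(2,4)
  show False using p unfolding supp_iff[OF C] by (metis m_closed)
 qed
qed

lemma fg_perf: "P : perf A ==> dg_module A P" "P : perf A ==> fg P" for P :: "('a, 'm) dg_module"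
 by (simp_all add: perf_iff)

lemma supp_tensor:
 assumes X: "dg_module A X" "fg X" and Y: "dg_module A Y" "fg Y" and Z: "dg_module A Z" "fg Z" and i: "ho_iso A Z (tensor A X Y)"
 shows "supp A Z \<subseteq> supp A X"
proof
 fix p assume p: "p : supp A Z"
 then have pS: "p : Spec A" by (simp add: supp_def)
 obtain n q d \<phi> where db: "dual_basis X n q d \<phi>" using X(2) by (auto simp: fg_def)
 let ?B = "box {..<n} d (%i j. \<phi> i (q j)) (%i j. \<phi> i (\<partial>\<^bsub>X\<^esub> (q j))) Y"
 note bd = tensor_box_data[OF X(1) db]
 have B: "dg_module A ?B" "fg ?B" using box_dg[OF bd Y(1)] box_fg[OF bd dg_gm[OF Y(1)] Y(2)] by auto
 obtain G F where GF: "dg_iso ?B (tensor A X Y) G F" using tensor_box(2)[OF X(1) Y(1) db] by blast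
 have "ho_iso A ?B Z"
  by (rule ho_iso_sym[OF ho_iso_dg_trans[OF Z(1) tensor_box(1)[OF X(1) Y(1) db] B(1) i dg_iso_sym[OF GF]]])
 then have pB: "p : supp A ?B" using supp_ho_iso[OF B Z] p by blast
 show "p : supp A X"
 proof (rule ccontr)
  assume "p ~: supp A X"
  then obtain s l h where s: "s ~: p" "null X s l h" using pS unfolding supp_iff[OF X] by blast
  have "s ~= \<zero>" using s(1) ideal_simps(2)[OF SpecD(2)[OF pS]] by blast
  from null_box[OF X(1) db Y(1) s(2) this] s(1) show False using pB unfolding supp_iff[OF B] by blast
 qed
qed

lemma supp_shift:
 assumes X: "dg_module A X" "fg X" shows "supp A (shift k X) \<subseteq> supp A X"
 unfolding subset_iff supp_iff[OF X] supp_iff[OF shift_dg[OF X(1)] shift_fg[OF dg_gm[OF X(1)] X(2)]]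
 using null_shift[OF X(1)] by meson

lemma supp_zero: "supp A zero_dg = {}"
proof -
 have "null zero_dg \<one> 0 (%_. ())" by (simp add: null_def lmap_def)
 then show ?thesis using SpecD(3) unfolding set_eq_iff supp_iff[OF zero_dg_perf] by blast
qed

lemma thick_tau: "thick_tensor_ideal A (\<tau> A V :: ('a, 'm) dg_module set)"
 unfolding thick_tensor_ideal_def triangulated_subcategory_def
proof (intro conjI ballI allI impI)
 show "(\<tau> A V :: ('a, 'm) dg_module set) \<subseteq> perf A" by (auto simp: \<tau>_def)
next
 fix Z :: "('a, 'm) dg_module" assume Z: "Z : perf A" "ho_iso A Z zero_dg"
 show "Z : \<tau> A V" using supp_ho_iso[OF zero_dg_perf fg_perf[OF Z(1)] ho_iso_sym[OF Z(2)]] Z(1) by (simp add: supp_zero \<tau>_def)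
next
 fix X Y :: "('a, 'm) dg_module" assume "X : \<tau> A V" and Y: "Y : perf A" "ho_iso A X Y"
 then have X: "X : perf A" "supp A X \<subseteq> V" by (auto simp: \<tau>_def)
 show "Y : \<tau> A V" using supp_ho_iso[OF fg_perf[OF X(1)] fg_perf[OF Y(1)] Y(2)] X(2) Y(1) by (auto simp: \<tau>_def)
next
 fix X :: "('a, 'm) dg_module" and k assume "X : \<tau> A V"
 then have X: "X : perf A" "supp A X \<subseteq> V" by (auto simp: \<tau>_def)
 note d = fg_perf[OF X(1)]
 have "shift k X : perf A" using d by (simp add: perf_iff)
 then show "shift k X : \<tau> A V" using supp_shift[OF d, of k] X(2) by (auto simp: \<tau>_def)
next
 fix X Y Z :: "('a, 'm) dg_module" and f
 assume "X : \<tau> A V" "Y : \<tau> A V" and f: "chain_map A X Y f" and Z: "Z : perf A" "ho_iso A Z (cone X Y f)"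
 then have X: "X : perf A" "supp A X \<subseteq> V" and Y: "Y : perf A" "supp A Y \<subseteq> V" by (auto simp: \<tau>_def)
 note dX = fg_perf[OF X(1)] and dY = fg_perf[OF Y(1)]
 have f: "cm X Y f" using f chain_map_iff[OF dg_gm[OF dX(1)] dg_gm[OF dY(1)]] by simp
 note C = cone_dg[OF dX(1) dY(1) f] cone_fg[OF dg_gm[OF dX(1)] dg_gm[OF dY(1)] dX(2) dY(2), of f]
 show "Z : \<tau> A V" using supp_ho_iso[OF C fg_perf[OF Z(1)] ho_iso_sym[OF Z(2)]] supp_cone[OF dX dY f] X(2) Y(2) Z(1)
  by (auto simp: \<tau>_def)
next
 fix X Y Z :: "('a, 'm) dg_module" assume "X : \<tau> A V" and Y: "Y : perf A" and Z: "Z : perf A" and i: "ho_iso A X (dg_sum Y Z)"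
 then have X: "X : perf A" "supp A X \<subseteq> V" by (auto simp: \<tau>_def)
 note dX = fg_perf[OF X(1)] and dY = fg_perf[OF Y] and dZ = fg_perf[OF Z]
 note S = dg_sum_dg[OF dY(1) dZ(1)]
 obtain f g where fg: "cm X (dg_sum Y Z) f" "cm (dg_sum Y Z) X g" and h: "ho_eq (dg_sum Y Z) (dg_sum Y Z) (%y. f (g y)) (%y. y)"
  using i[unfolded ho_iso_iff[OF dg_gm[OF dX(1)] dg_gm[OF S]]] by (elim exE conjE)
 obtain K where K: "lmap 1 (dg_sum Y Z) (dg_sum Y Z) K" "!!v. v : carrier (dg_sum Y Z) ==>
   f (g v) \<ominus>\<^bsub>dg_sum Y Z\<^esub> v = \<partial>\<^bsub>dg_sum Y Z\<^esub> (K v) \<oplus>\<^bsub>dg_sum Y Z\<^esub> K (\<partial>\<^bsub>dg_sum Y Z\<^esub> v)"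
  using h by (auto simp: ho_eq_def)
 note gY = dg_gm[OF dY(1)] and gZ = dg_gm[OF dZ(1)]
 interpret Z: graded_group Z "mgrad Z" by (rule gm_graded[OF gZ])
 have i: "cm Y (dg_sum Y Z) (%y. (y, \<zero>\<^bsub>Z\<^esub>))" using gZ dgD(7)[OF dZ(1)] by (auto simp: cm_def lmap_def)
 have p: "cm (dg_sum Y Z) Y fst" using gY by (auto simp: cm_def lmap_def)
 have "ho_eq Y Y (%y. fst (f (g (y, \<zero>\<^bsub>Z\<^esub>)))) (%y. y)"
  unfolding ho_eq_def
 proof (intro exI[of _ "%y. fst (K (y, \<zero>\<^bsub>Z\<^esub>))"] conjI ballI)
  show "lmap 1 Y Y (%y. fst (K (y, \<zero>\<^bsub>Z\<^esub>)))"
   using lmap_comp[OF lmap_comp[OF cmD(1)[OF i] K(1)] cmD(1)[OF p]] by simp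
  fix y assume y: "y : carrier Y"
  note yc = lmap_closed[OF cmD(1)[OF i] y]
  obtain a b where ab0: "f (g (y, \<zero>\<^bsub>Z\<^esub>)) = (a, b)" by fastforce
  have ab: "f (g (y, \<zero>\<^bsub>Z\<^esub>)) = (a, b)" "a : carrier Y" "b : carrier Z"
   using lmap_closed[OF cmD(1)[OF fg(1)] lmap_closed[OF cmD(1)[OF fg(2)] yc]] unfolding ab0 by simp_all
  obtain c e where ce: "K (y, \<zero>\<^bsub>Z\<^esub>) = (c, e)" by fastforce
  obtain c' e' where ce': "K (\<partial>\<^bsub>Y\<^esub> y, \<zero>\<^bsub>Z\<^esub>) = (c', e')" by fastforce
  show "fst (f (g (y, \<zero>\<^bsub>Z\<^esub>))) \<ominus>\<^bsub>Y\<^esub> y = \<partial>\<^bsub>Y\<^esub> (fst (K (y, \<zero>\<^bsub>Z\<^esub>))) \<oplus>\<^bsub>Y\<^esub> fst (K (\<partial>\<^bsub>Y\<^esub> y, \<zero>\<^bsub>Z\<^esub>))"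
   using K(2)[OF yc] y ab ce ce' gY gZ dgD(7)[OF dZ(1)] by simp
 qed
 then have "supp A Y \<subseteq> supp A X" by (rule supp_retract[OF dX dY cm_comp[OF fg(1) p] cm_comp[OF i fg(2)]])
 then show "Y : \<tau> A V" using X(2) Y by (auto simp: \<tau>_def)
next
 fix X Y Z :: "('a, 'm) dg_module" assume "X : \<tau> A V" and Y: "Y : perf A" and Z: "Z : perf A" and i: "ho_iso A Z (tensor A X Y)"
 then have X: "X : perf A" "supp A X \<subseteq> V" by (auto simp: \<tau>_def)
 show "Z : \<tau> A V"
  using supp_tensor[OF fg_perf[OF X(1)] fg_perf[OF Y] fg_perf[OF Z] i] X(2) Z by (auto simp: \<tau>_def)
qed

lemma supp_upward:
 assumes P: "dg_module A P" "fg P" and p: "p : supp A P" and q: "q : Spec A" "p \<subseteq> q"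
 shows "q : supp A P"
 using p q unfolding supp_iff[OF P] by blast

text \<open>The primes containing a given homogeneous prime form a closed set, so an upward closed
  set of primes is the union of these closed sets over its members.\<close>

lemma spcl_iff: "specialization_closed A V \<longleftrightarrow> V \<subseteq> Spec A & (ALL p:V. ALL q:Spec A. p \<subseteq> q --> q : V)"
proof
 assume "specialization_closed A V"
 then obtain F where F: "!!C. C \<in> F ==> zariski_closed A C" "V = \<Union>F" by (auto simp: specialization_closed_def)
 have "C \<subseteq> Spec A & (ALL p:C. ALL q:Spec A. p \<subseteq> q --> q : C)" if C: "C : F" for C
 proof -
  obtain I where "C = {p : Spec A. I \<subseteq> p}" using F(1)[OF C] by (auto simp: zariski_closed_def)
  then show ?thesis by auto
 qed
 then show "V \<subseteq> Spec A & (ALL p:V. ALL q:Spec A. p \<subseteq> q --> q : V)" unfolding F(2) by blast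
next
 assume V: "V \<subseteq> Spec A & (ALL p:V. ALL q:Spec A. p \<subseteq> q --> q : V)"
 let ?c = "%p. {q : Spec A. p \<subseteq> q}"
 have "zariski_closed A (?c p)" if p: "p : V" for p
 proof -
  have "p : Spec A" using V p by blast
  from SpecD(1)[OF this] show ?thesis unfolding zariski_closed_def by (intro exI[of _ p]) simp
 qed
 then have "ALL C:?c ` V. zariski_closed A C" by simp
 moreover have "V = \<Union> (?c ` V)"
 proof (rule equalityI)
  show "V \<subseteq> \<Union> (?c ` V)"
  proof
   fix p assume p: "p : V"
   then have "p : ?c p" using V by auto
   then show "p \<in> \<Union> (?c ` V)" by (rule UN_I[OF p])
  qed
  show "\<Union> (?c ` V) \<subseteq> V"
  proof
   fix q assume "q \<in> \<Union> (?c ` V)"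
   then obtain p where "p : V" "q : Spec A" "p \<subseteq> q" by auto
   then show "q : V" using V by blast
  qed
 qed
 ultimately show "specialization_closed A V" unfolding specialization_closed_def by (intro exI[of _ "?c ` V"]) simp
qed

end

section \<open>Koszul objects\<close>

context tensor_ideal
begin

text \<open>One element is added at a time by the cone of multiplication by \<open>a\<close> on
  \<open>K\<close>. Moving the first component of the cone to the second contracts \<open>a\<close>,
  so the primes of the support contain \<open>a\<close>. Conversely, if \<open>a\<close> lies in
  \<open>p\<close> and some \<open>s\<close> outside \<open>p\<close> is null-homotopic on the cone,
  restricting to \<open>K\<close> contracts \<open>s\<close> modulo \<open>a K\<close>, hence modulo
  \<open>p\<close>, and by Nakayama \<open>K\<close> vanishes at \<open>p\<close>.\<close>

lemma koszul_object:
 assumes "finite X" "!!a. a : X ==> EX m. a : rgrad A m"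
 shows "EX P:(perf A :: ('a, 'm) dg_module set). supp A P = {p : Spec A. X \<subseteq> p}"
 using assms
proof (induction X)
 case empty
 note U = U_dg U_fg
 have i: "cm (cpy U) U (dc U)" "cm U (cpy U) (cp U)" "ALL x:carrier U. dc U (cp U x) = x"
  using cpy(1)[OF U] by (auto simp: dg_iso_def)
 have "ho_eq U U (%x. dc U (cp U x)) (%x. x)" by (rule ho_eq_refl[OF unit_gm U_dg]) (use i(3) in auto)
 from supp_retract[OF cpy(2,3)[OF U] U i(1,2) this] have "supp A U \<subseteq> supp A (cpy U)" .
 moreover have "Spec A \<subseteq> supp A U"
 proof
  fix p assume p: "p : Spec A"
  have "s : p" if n: "null U s l h" for s l h
  proof -
   note hc = lmap_closed[OF nullD(3)[OF n]] and h0 = lmap_zero[OF unit_gm unit_gm nullD(3)[OF n]]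
   \<comment> \<open>The unit has zero differential, so a null-homotopic scalar on it is
     zero.\<close>
   have "s = \<zero>" using nullD(4)[OF n, of \<one>] nullD(2)[OF n] h0 by simp
   then show ?thesis using ideal_simps(2)[OF SpecD(2)[OF p]] by simp
  qed
  then show "p : supp A U" using p unfolding supp_iff[OF U] by blast
 qed
 ultimately show ?case using cpy(4)[OF U] by (intro bexI[of _ "cpy U"]) (auto simp: supp_def)
next
 case (insert a X)
 obtain K :: "('a, 'm) dg_module" where K: "K : perf A" "supp A K = {p : Spec A. X \<subseteq> p}" using insert by auto
 obtain m where m: "a : rgrad A m" using insert by blast
 show ?case
 \<comment> \<open>For nonzero \<open>a\<close> the degree \<open>m\<close> is even, so the shift by
   \<open>m\<close> puts no sign on the differential and multiplication by \<open>a\<close> is a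
   chain map. For \<open>a = 0\<close> the closed set does not change and \<open>K\<close> itself
   serves.\<close>
 proof (cases "a = \<zero>")
  case True
  then have "insert a X \<subseteq> p \<longleftrightarrow> X \<subseteq> p" if "p : Spec A" for p using ideal_simps(2)[OF SpecD(2)[OF that]] by simp
  then have "{p : Spec A. insert a X \<subseteq> p} = {p : Spec A. X \<subseteq> p}" by blast
  then show ?thesis using K by (intro bexI[of _ K]) simp_all
 next
  case False
  then have ev: "even m" using A_odd[OF m] by blast
  note Kd = fg_perf[OF K(1)] and ac = GA.G_carrier[OF m]
  note gK [simp] = dg_gm[OF Kd(1)] and D = dgD[OF Kd(1)]
  interpret K: graded_group K "mgrad K" by (rule gm_graded[OF gK])
  let ?S = "shift m K" and ?f = "%x. a \<odot>\<^bsub>K\<^esub> x"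
  have S: "dg_module A ?S" "fg ?S" using Kd by simp_all
  have f: "cm ?S K ?f"
  proof -
   have "a \<odot>\<^bsub>K\<^esub> x : mgrad K i" if "x : mgrad K (i - m)" for x i using gm_smult_deg[OF gK m that] by simp
   then show ?thesis unfolding cm_def lmap_def
    using ac ev by (auto simp: D smult_add_r smult_smult m_comm koszul_def)
  qed
  let ?C = "cone ?S K ?f"
  have C: "dg_module A ?C" "fg ?C" using S Kd f by simp_all
  have na: "null ?C a m (%v. (\<zero>\<^bsub>K\<^esub>, fst v))"
   unfolding null_def
  proof (intro conjI ballI m)
   have "y : mgrad ?S (i + (m + 1) - 1)" if "y : mgrad K i" for y i using that by (simp add: algebra_simps)
   then show "lmap (m + 1) ?C ?C (%v. (\<zero>\<^bsub>K\<^esub>, fst v))" unfolding lmap_def by auto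
   fix v assume "v : carrier ?C"
   then obtain y x where v: "v = (y, x)" "y : carrier K" "x : carrier K" by auto
   then show "a \<odot>\<^bsub>?C\<^esub> v = \<partial>\<^bsub>?C\<^esub> (\<zero>\<^bsub>K\<^esub>, fst v) \<oplus>\<^bsub>?C\<^esub> (\<zero>\<^bsub>K\<^esub>, fst (\<partial>\<^bsub>?C\<^esub> v))"
    using ac ev by (simp add: D koszul_def group_arith group_closed)
  qed
  have 1: "supp A ?C \<subseteq> {p : Spec A. insert a X \<subseteq> p}"
  proof
   fix p assume p: "p : supp A ?C"
   have "p : supp A K" using p supp_cone[OF S Kd f] supp_shift[OF Kd, of m] by blast
   moreover have "a : p" using p na unfolding supp_iff[OF C] by blast
   ultimately show "p : {p : Spec A. insert a X \<subseteq> p}" using K(2) by auto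
  qed
  have 2: "{p : Spec A. insert a X \<subseteq> p} \<subseteq> supp A ?C"
  proof
   fix p assume "p : {p : Spec A. insert a X \<subseteq> p}"
   then have p: "p : Spec A" "a : p" "p : supp A K" using K(2) by auto
   note I = SpecD(2)[OF p(1)]
   obtain n q d \<phi> where db: "dual_basis K n q d \<phi>" using Kd(2) by (auto simp: fg_def)
   have "s : p" if n: "null ?C s l H" for s l H
   proof (rule ccontr)
    assume s: "s ~: p"
    note H = nullD[OF n]
    \<comment> \<open>Only the component of the contraction that stays in \<open>K\<close> is kept.
      The other one enters the homotopy equation through the cone differential as
      \<open>a w\<close>, which lies in \<open>p K\<close>.\<close>
    let ?h = "%y. fst (H (y, \<zero>\<^bsub>K\<^esub>))" and ?r = "%y. snd (H (y, \<zero>\<^bsub>K\<^esub>))"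
    have i: "lmap 0 K ?C (%y. (y, \<zero>\<^bsub>K\<^esub>))" and pr: "lmap 0 ?C K fst" by (auto simp: lmap_def)
    have hl: "lmap (l + 1) K K ?h" using lmap_comp[OF lmap_comp[OF i H(3)] pr] by simp
    have "null_mod p K s l ?h" unfolding null_mod_def
    proof (intro conjI ballI H(1) hl)
     fix y assume y: "y : carrier K"
     note yc = lmap_closed[OF H(3) lmap_closed[OF i y]] and dyc = lmap_closed[OF H(3) lmap_closed[OF i D(1)[OF y]]]
     obtain u w where uw: "H (y, \<zero>\<^bsub>K\<^esub>) = (u, w)" "u : carrier K" "w : carrier K" using yc by auto
     obtain u' w' where uw': "H (\<partial>\<^bsub>K\<^esub> y, \<zero>\<^bsub>K\<^esub>) = (u', w')" "u' : carrier K" "w' : carrier K" using dyc by auto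
     have d0: "\<partial>\<^bsub>?C\<^esub> (y, \<zero>\<^bsub>K\<^esub>) = (\<partial>\<^bsub>K\<^esub> y, \<zero>\<^bsub>K\<^esub>)" using y ac ev by (simp add: D koszul_def K.minus_zero)
     have "s \<odot>\<^bsub>K\<^esub> y = (\<partial>\<^bsub>K\<^esub> u \<oplus>\<^bsub>K\<^esub> a \<odot>\<^bsub>K\<^esub> w) \<oplus>\<^bsub>K\<^esub> u'"
      using H(4)[OF lmap_closed[OF i y]] unfolding d0 uw(1) uw'(1) by simp
     then have e: "s \<odot>\<^bsub>K\<^esub> y \<ominus>\<^bsub>K\<^esub> (\<partial>\<^bsub>K\<^esub> u \<oplus>\<^bsub>K\<^esub> u') = a \<odot>\<^bsub>K\<^esub> w"
      using uw uw' ac D(1)[OF uw(2)] by (simp add: group_arith group_closed)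
     show "eqm p K (s \<odot>\<^bsub>K\<^esub> y) (\<partial>\<^bsub>K\<^esub> (?h y) \<oplus>\<^bsub>K\<^esub> ?h (\<partial>\<^bsub>K\<^esub> y))"
      unfolding eqm_def uw(1) uw'(1) fst_conv e
      using IM_ideal_smult[OF gK I uw(3) p(2)] y uw uw' H(2) D(1)[OF uw(2)] by simp
    qed
    from nakayama_null[OF Kd(1) db p(1) this s] show False using p(3) unfolding supp_iff[OF Kd] by blast
   qed
   then show "p : supp A ?C" using p(1) unfolding supp_iff[OF C] by blast
  qed
  note dC = cpy(2,3)[OF C]
  have e: "supp A (cpy ?C) = supp A ?C"
   using supp_ho_iso[OF C dC dg_iso_ho[OF C(1) dC(1) cpy(1)[OF C]]]
    supp_ho_iso[OF dC C dg_iso_ho[OF dC(1) C(1) dg_iso_sym[OF cpy(1)[OF C]]]] by blast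
  show ?thesis
  proof (rule bexI[of _ "cpy ?C"])
   show "supp A (cpy ?C) = {p : Spec A. insert a X \<subseteq> p}" by (rule trans[OF e subset_antisym[OF 1 2]])
   show "cpy ?C : perf A" by (rule cpy(4)[OF C])
  qed
 qed
qed

lemma supp_closure_object:
 assumes noeth: "graded_noetherian A" and p: "p : Spec A"
 shows "EX P:(perf A :: ('a, 'm) dg_module set). supp A P = {q : Spec A. p \<subseteq> q}"
proof -
 note hp = SpecD(1)[OF p] and I = SpecD(2)[OF p]
 obtain B where B: "B \<subseteq> carrier A" "finite B" "p = genideal A B" using noeth hp unfolding graded_noetherian_def by blast
 have Bp: "B \<subseteq> p" unfolding B(3) by (rule genideal_self[OF B(1)])
 \<comment> \<open>The finitely many generators of \<open>p\<close> may be inhomogeneous. Their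
   components generate the same ideal, because \<open>p\<close> is homogeneous, and the Koszul
   object is built on these.\<close>
 let ?X = "\<Union>x\<in>B. GA.cmp x ` {i. GA.cmp x i ~= \<zero>}"
 have Xh: "EX m. a : rgrad A m" if a: "a : ?X" for a
 proof -
  obtain x i where x: "x : B" "a = GA.cmp x i" using a by auto
  have "x : carrier A" using x(1) B(1) by auto
  from GA.cmp_in[OF this] show ?thesis unfolding x(2) by (rule exI)
 qed
 have fX: "finite ?X"
 proof (rule finite_UN_I[OF B(2)])
  fix x assume "x : B"
  then have "x : carrier A" using B(1) by auto
  from GA.cmp_finite[OF this] show "finite (GA.cmp x ` {i. GA.cmp x i ~= \<zero>})" by (rule finite_imageI)
 qed
 have "EX P:(perf A :: ('a, 'm) dg_module set). supp A P = {q : Spec A. ?X \<subseteq> q}"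
 proof (rule koszul_object)
  show "finite ?X" by (rule fX)
  show "EX m. a : rgrad A m" if "a : ?X" for a by (rule Xh[OF that])
 qed
 then obtain P :: "('a, 'm) dg_module" where P: "P : perf A" "supp A P = {q : Spec A. ?X \<subseteq> q}"
  by (elim bexE)
 have "?X \<subseteq> q \<longleftrightarrow> p \<subseteq> q" if q: "q : Spec A" for q
 proof
  assume pq: "p \<subseteq> q"
  show "?X \<subseteq> q"
  proof
   fix a assume "a : ?X"
   then obtain x i where x: "x : B" "a = GA.cmp x i" by auto
   have "x : p" using x(1) Bp by auto
   then have "GA.cmp x i : p" using hp by (simp add: homogeneous_ideal_def)
   then show "a : q" unfolding x(2) using pq by auto
  qed
 next
  assume X: "?X \<subseteq> q"
  have "B \<subseteq> q"
  proof
   fix x assume x: "x : B"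
   then have xc: "x : carrier A" using B(1) by blast
   have "finsum A (GA.cmp x) {i. GA.cmp x i ~= \<zero>} : q"
   proof (rule ideal_finsum[OF SpecD(2)[OF q] GA.cmp_finite[OF xc]])
    fix i assume i: "i : {i. GA.cmp x i ~= \<zero>}"
    have "GA.cmp x i : ?X" by (rule UN_I[OF x]) (rule imageI[OF i])
    then show "GA.cmp x i : q" using X by (rule rev_subsetD)
   qed
   then show "x : q" unfolding GA.cmp_sum[OF xc, symmetric] .
  qed
  then show "p \<subseteq> q" unfolding B(3) by (rule genideal_minimal[OF SpecD(2)[OF q]])
 qed
 then have "supp A P = {q : Spec A. p \<subseteq> q}" unfolding P(2) by (intro Collect_cong) auto
 then show ?thesis using P(1) by (intro bexI[of _ P])
qed

end

text \<open>A union of thick ideals is in general not one, so joins cannot be read off in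
  \<open>C\<close>. Both operations are transported along the order isomorphism from
  \<open>D\<close>, which is closed under union and intersection; this also gives the formulas by
  which the two maps preserve joins and meets.\<close>

lemma inclusion_lattice:
 assumes f: "!!x. x : C ==> f x : D" and g: "!!y. y : D ==> g y : C"
  and fg: "!!y. y : D ==> f (g y) = y" and gf: "!!x. x : C ==> g (f x) = x"
  and fm: "!!x y. x : C ==> y : C ==> x \<subseteq> y ==> f x \<subseteq> f y"
  and gm: "!!x y. x : D ==> y : D ==> x \<subseteq> y ==> g x \<subseteq> g y"
  and D: "!!x y. x : D ==> y : D ==> x \<union> y : D" "!!x y. x : D ==> y : D ==> x \<inter> y : D"
 shows "lattice (inclusion_order C)"
  and "x : C ==> y : C ==> join (inclusion_order C) x y = g (f x \<union> f y)"
  and "x : C ==> y : C ==> meet (inclusion_order C) x y = g (f x \<inter> f y)"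
proof -
 let ?L = "inclusion_order C"
 interpret partial_order ?L by standard (auto simp: inclusion_order_def)
 have lub: "least ?L (g (f x \<union> f y)) (Upper ?L {x, y})" if x: "x : C" and y: "y : C" for x y
 proof -
  note fx = f[OF x] and fy = f[OF y]
  note u = D(1)[OF fx fy]
  have "x \<subseteq> g (f x \<union> f y)" "y \<subseteq> g (f x \<union> f y)" using gm[OF fx u] gm[OF fy u] gf x y by auto
  moreover have "g (f x \<union> f y) \<subseteq> z" if "z : C" "x \<subseteq> z" "y \<subseteq> z" for z
   using gm[OF u f[OF that(1)]] fm[OF x that(1,2)] fm[OF y that(1,3)] gf[OF that(1)] by auto
  ultimately show ?thesis using g[OF u] x y by (auto simp: least_def Upper_def inclusion_order_def)
 qed
 have glb: "greatest ?L (g (f x \<inter> f y)) (Lower ?L {x, y})" if x: "x : C" and y: "y : C" for x y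
 proof -
  note fx = f[OF x] and fy = f[OF y]
  note u = D(2)[OF fx fy]
  have "g (f x \<inter> f y) \<subseteq> x" "g (f x \<inter> f y) \<subseteq> y" using gm[OF u fx] gm[OF u fy] gf x y by auto
  moreover have "z \<subseteq> g (f x \<inter> f y)" if "z : C" "z \<subseteq> x" "z \<subseteq> y" for z
   using gm[OF f[OF that(1)] u] fm[OF that(1) x that(2)] fm[OF that(1) y that(3)] gf[OF that(1)] by auto
  ultimately show ?thesis using g[OF u] x y by (auto simp: greatest_def Lower_def inclusion_order_def)
 qed
 have c: "carrier ?L = C" by (simp add: inclusion_order_def)
 show "lattice ?L" by standard (use lub glb c in blast)+
 show "join ?L x y = g (f x \<union> f y)" if xy: "x : C" "y : C"
  unfolding join_def sup_def
 proof (rule some_equality)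
  show "least ?L (g (f x \<union> f y)) (Upper ?L {x, y})" by (rule lub[OF xy])
  show "z = g (f x \<union> f y)" if z: "least ?L z (Upper ?L {x, y})" for z by (rule least_unique[OF z lub[OF xy]])
 qed
 show "meet ?L x y = g (f x \<inter> f y)" if xy: "x : C" "y : C"
  unfolding meet_def inf_def
 proof (rule some_equality)
  show "greatest ?L (g (f x \<inter> f y)) (Lower ?L {x, y})" by (rule glb[OF xy])
  show "z = g (f x \<inter> f y)" if z: "greatest ?L z (Lower ?L {x, y})" for z by (rule greatest_unique[OF z glb[OF xy]])
 qed
qed

theorem corollary3p6:
  fixes A :: "'a gr_ring"
  assumes "graded_comm_ring A" and "graded_noetherian A" and "even_degrees A"
    \<comment> \<open>the carrier type \<open>'m\<close> has room for a copy of every finitely generated module\<close>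
    and "lists (carrier A) \<lesssim> (UNIV :: 'm set)"
  shows "let \<T> = (thick_ideals A :: ('a, 'm) dg_module set gorder); \<S> = spcl_subsets A in
    lattice \<T> \<and> lattice \<S> \<and>
    bij_betw (\<sigma> A) (carrier \<T>) (carrier \<S>) \<and>
    bij_betw (\<tau> A) (carrier \<S>) (carrier \<T>) \<and>
    (\<forall>T \<in> carrier \<T>. \<tau> A (\<sigma> A T) = T) \<and>
    (\<forall>V \<in> carrier \<S>. \<sigma> A (\<tau> A V :: ('a, 'm) dg_module set) = V) \<and>
    join_pres \<T> \<S> (\<sigma> A) \<and> meet_pres \<T> \<S> (\<sigma> A) \<and>
    join_pres \<S> \<T> (\<tau> A) \<and> meet_pres \<S> \<T> (\<tau> A)"
proof -
 interpret even_graded_ring A using assms(1,3) by unfold_locales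
 let ?C = "{T :: ('a, 'm) dg_module set. thick_tensor_ideal A T}" and ?D = "{V. specialization_closed A V}"
 have ti: "tensor_ideal A T" if "thick_tensor_ideal A T" for T :: "('a, 'm) dg_module set"
  using that assms(4) by unfold_locales
 have \<sigma>D: "\<sigma> A T : ?D" if T: "T : ?C" for T
 proof -
  interpret tensor_ideal A T by (rule ti) (use T in simp)
  have "q : \<sigma> A T" if "p : \<sigma> A T" "q : Spec A" "p \<subseteq> q" for p q
   using that supp_upward[OF T_perf(1,2)] unfolding \<sigma>_def by blast
  then show ?thesis unfolding mem_Collect_eq spcl_iff by (auto simp: \<sigma>_def supp_def)
 qed
 have \<tau>C: "(\<tau> A V :: ('a, 'm) dg_module set) : ?C" for V using thick_tau by simp
 have \<tau>\<sigma>: "\<tau> A (\<sigma> A T) = T" if T: "T : ?C" for T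
 proof -
  interpret tensor_ideal A T by (rule ti) (use T in simp)
  show ?thesis using mem_of_supp_subset[OF assms(2)] T_perf(3) unfolding \<tau>_def by (auto simp: \<sigma>_def)
 qed
 have \<sigma>\<tau>: "\<sigma> A (\<tau> A V :: ('a, 'm) dg_module set) = V" if V: "V : ?D" for V
 proof
  show "\<sigma> A (\<tau> A V :: ('a, 'm) dg_module set) \<subseteq> V" by (auto simp: \<sigma>_def \<tau>_def)
  interpret tensor_ideal A "\<tau> A V :: ('a, 'm) dg_module set" by (rule ti[OF thick_tau])
  show "V \<subseteq> \<sigma> A (\<tau> A V :: ('a, 'm) dg_module set)"
  proof
   fix p assume p: "p : V"
   have up: "V \<subseteq> Spec A" "!!q. q : Spec A ==> p \<subseteq> q ==> q : V" using V p unfolding mem_Collect_eq spcl_iff by auto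
   obtain P :: "('a, 'm) dg_module" where P: "P : perf A" "supp A P = {q : Spec A. p \<subseteq> q}"
    using supp_closure_object[OF assms(2), of p] p up(1) by blast
   have "P : \<tau> A V" "p : supp A P" using P up p by (auto simp: \<tau>_def)
   then show "p : \<sigma> A (\<tau> A V :: ('a, 'm) dg_module set)" unfolding \<sigma>_def by blast
  qed
 qed
 have \<sigma>m: "\<sigma> A T \<subseteq> \<sigma> A T'" if "T \<subseteq> T'" for T T' :: "('a, 'm) dg_module set" using that by (auto simp: \<sigma>_def)
 have \<tau>m: "(\<tau> A V :: ('a, 'm) dg_module set) \<subseteq> \<tau> A V'" if "V \<subseteq> V'" for V V' using that by (auto simp: \<tau>_def)
 have D: "x \<union> y : ?D" "x \<inter> y : ?D" if "x : ?D" "y : ?D" for x y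
  using that unfolding mem_Collect_eq spcl_iff by blast+
 note LC = inclusion_lattice[of ?C "\<sigma> A" ?D "\<tau> A", OF \<sigma>D \<tau>C \<sigma>\<tau> \<tau>\<sigma> \<sigma>m \<tau>m D]
 \<comment> \<open>With the identity in both directions the same lemma makes the specialization
   closed sets a lattice under union and intersection.\<close>
 note LD = inclusion_lattice[of ?D "%x. x" ?D "%x. x", OF _ _ _ _ _ _ D]
 have c: "carrier (inclusion_order X) = X" for X :: "'c set set" by (simp add: inclusion_order_def)
 have b: "bij_betw (\<sigma> A) ?C ?D" "bij_betw (\<tau> A) ?D ?C"
  using \<sigma>D \<tau>C \<sigma>\<tau> \<tau>\<sigma> by (auto intro!: bij_betw_byWitness[where f' = "\<tau> A"] bij_betw_byWitness[where f' = "\<sigma> A"])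
 show ?thesis
  unfolding Let_def thick_ideals_def spcl_subsets_def c join_pres_def meet_pres_def
  using LC LD b \<sigma>\<tau> \<tau>\<sigma> \<sigma>D \<tau>C D by simp
qed

end
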